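(* Let $\Omega_\varepsilon$ be the perforated domains described in the context. There exists an extension operator $E_\varepsilon:W^{1,2}(\Omega_\varepsilon)\to W^{1,2}(\Omega)$ such that for each $\varphi\in W^{1,2}(\Omega_\varepsilon)$ and each $1\le n\le N(\varepsilon)$, $$E_\varepsilon\varphi(x)=\varphi(x),\quad x\in\Omega_\varepsilon,$$ $$\|\nabla E_\varepsilon\varphi\|_{L^2(T_{n,\varepsilon})}\le C\|\nabla\varphi\|_{L^2(B_{2\delta_0\varepsilon^\alpha}(x_{n,\varepsilon})\setminus T_{n,\varepsilon})},$$ and hence $\|\nabla E_\varepsilon\varphi\|_{L^2(\Omega)}\le C\|\nabla\varphi\|_{L^2(\Omega_\varepsilon)}$. Moreover, for all $1\le q\le\infty$, $$\|E_\varepsilon\varphi\|_{L^q(T_{n,\varepsilon})}\le C\|\varphi\|_{L^q(B_{2\delta_0\varepsilon^\alpha}(x_{n,\varepsilon})\setminus T_{n,\varepsilon})}.$$ The constant $C$ is independent of $\varepsilon$ and $n$. Furthermore, there is an extension operator $\tilde E_\varepsilon:W^{1,2}_{\ge0}(\Omega_\varepsilon)\to W^{1,2}_{\ge0}(\Omega)$ such that for each $\varphi\in W^{1,2}_{\ge0}(\Omega_\varepsilon)$ and each $1\le n\le N(\varepsilon)$, $$\tilde E_\varepsilon\varphi(x)=\varphi(x),\quad x\in\Omega_\varepsilon,$$ $$\|\nabla\tilde E_\varepsilon\varphi\|_{L^2(T_{n,\varepsilon})}\le C\|\nabla\varphi\|_{L^2(B_{2\delta_0\varepsilon^\alpha}(x_{n,\varepsilon})\setminus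 T_{n,\varepsilon})},$$ hence $\|\nabla\tilde E_\varepsilon\varphi\|_{L^2(\Omega)}\le C\|\nabla\varphi\|_{L^2(\Omega_\varepsilon)}$, and, for all $1\le q\le\infty$, $$\|\tilde E_\varepsilon\varphi\|_{L^q(T_{n,\varepsilon})}\le C\|\varphi\|_{L^q(B_{2\delta_0\varepsilon^\alpha}(x_{n,\varepsilon})\setminus T_{n,\varepsilon})},$$ with a constant $C$ independent of $\varepsilon$ and $n$.
   Context: $\Omega\subset\mathbb R^3$ is a bounded $C^2$-domain and, for small $\varepsilon>0$ and given $\alpha\ge1$, $\Omega_\varepsilon=\Omega\setminus\bigcup_{n=1}^{N(\varepsilon)}\overline{T_{n,\varepsilon}}$, where $T_{n,\varepsilon}=x_{n,\varepsilon}+\varepsilon^\alpha T^0_{n,1}$ are $C^2$-domains and there are $\delta_0,\delta_1,\delta_2>0$ (independent of $\varepsilon,n$) such that $$T_{n,\varepsilon}\subset B_{\delta_0\varepsilon^\alpha}(x_{n,\varepsilon})\subset B_{2\delta_0\varepsilon^\alpha}(x_{n,\varepsilon})\subset B_{\delta_1\varepsilon}(x_{n,\varepsilon})\subset B_{\delta_2\varepsilon}(x_{n,\varepsilon})\subset\Omega ,$$ the balls $B_{\delta_2\varepsilon}(x_{n,\varepsilon})$, $1\le n\le N(\varepsilon)$, are pairwise disjoint, and the domains $T^0_{n,1}$ are uniformly $C^2$-domains. $W^{1,2}_{\ge0}(U)$ denotes the set of non-negative functions in $W^{1,2}(U)$. Extension operators are not required to be linear.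
   Formalization: The perforated domains Ω_ε are explicitly assumed connected; without this the gradient bound fails, e.g. for a spherical-shell hole with φ = 1 inside and φ = 0 outside. *)

theory Defs
  imports "HOL-Analysis.Analysis" "HOL-Probability.Essential_Supremum"
begin

section \<open>Domains of class \<open>C\<^sup>2\<close>\<close>

primrec Ck_on :: "nat \<Rightarrow> 'a::euclidean_space set \<Rightarrow> ('a \<Rightarrow> real) \<Rightarrow> bool" where
  "Ck_on 0 U f \<longleftrightarrow> continuous_on U f"
| "Ck_on (Suc k) U f \<longleftrightarrow>
     (\<exists>g. (\<forall>x\<in>U. GDERIV f x :> g x) \<and> (\<forall>b\<in>Basis. Ck_on k U (\<lambda>x. g x \<bullet> b)))"

text \<open>As above, with all partial derivatives of order at most \<open>k\<close> (including \<open>f\<close> itself)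
  bounded by \<open>M\<close> on \<open>U\<close>.\<close>

primrec Ck_bounded_on :: "nat \<Rightarrow> real \<Rightarrow> 'a::euclidean_space set \<Rightarrow> ('a \<Rightarrow> real) \<Rightarrow> bool" where
  "Ck_bounded_on 0 M U f \<longleftrightarrow> continuous_on U f \<and> (\<forall>x\<in>U. \<bar>f x\<bar> \<le> M)"
| "Ck_bounded_on (Suc k) M U f \<longleftrightarrow> (\<forall>x\<in>U. \<bar>f x\<bar> \<le> M) \<and>
     (\<exists>g. (\<forall>x\<in>U. GDERIV f x :> g x) \<and> (\<forall>b\<in>Basis. Ck_bounded_on k M U (\<lambda>x. g x \<bullet> b)))"

text \<open>In the orthonormal coordinates \<open>Q (x - p)\<close> centred at \<open>p\<close>, the part of \<open>S\<close> in the ball of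
  radius \<open>r\<close> about \<open>p\<close> is the part of that ball lying strictly above the graph of \<open>\<gamma>\<close>. Only the
  values of \<open>\<gamma>\<close> on the planar disc \<open>ball 0 r\<close> matter.\<close>

definition graph_chart ::
  "(real^3) set \<Rightarrow> real^3 \<Rightarrow> real \<Rightarrow> (real^3 \<Rightarrow> real^3) \<Rightarrow> (real \<times> real \<Rightarrow> real) \<Rightarrow> bool" where
  "graph_chart S p r Q \<gamma> \<longleftrightarrow> orthogonal_transformation Q \<and>
     (\<forall>x\<in>ball p r. x \<in> S \<longleftrightarrow> Q (x - p) $ 3 > \<gamma> (Q (x - p) $ 1, Q (x - p) $ 2))"

definition C2_domain :: "(real^3) set \<Rightarrow> bool" where
  "C2_domain S \<longleftrightarrow> open S \<and> connected S \<and> S \<noteq> {} \<and>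
     (\<forall>p\<in>frontier S. \<exists>r>0. \<exists>Q \<gamma>. graph_chart S p r Q \<gamma> \<and> Ck_on 2 (ball 0 r) \<gamma>)"

definition uniformly_C2_domains :: "'i set \<Rightarrow> ('i \<Rightarrow> (real^3) set) \<Rightarrow> bool" where
  "uniformly_C2_domains I S \<longleftrightarrow> (\<forall>i\<in>I. C2_domain (S i)) \<and>
     (\<exists>r>0. \<exists>M. \<forall>i\<in>I. \<forall>p\<in>frontier (S i).
        \<exists>Q \<gamma>. graph_chart (S i) p r Q \<gamma> \<and> Ck_bounded_on 2 M (ball 0 r) \<gamma>)"

section \<open>Perforated domains\<close>

definition hole ::
  "(nat \<Rightarrow> real \<Rightarrow> real^3) \<Rightarrow> real \<Rightarrow> (nat \<Rightarrow> (real^3) set) \<Rightarrow> nat \<Rightarrow> real \<Rightarrow> (real^3) set" where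
  "hole x \<alpha> T0 n \<epsilon> = (\<lambda>y. x n \<epsilon> + \<epsilon> powr \<alpha> *\<^sub>R y) ` T0 n"

definition perforated ::
  "(real^3) set \<Rightarrow> (real \<Rightarrow> nat) \<Rightarrow> (nat \<Rightarrow> real \<Rightarrow> real^3) \<Rightarrow> real \<Rightarrow> (nat \<Rightarrow> (real^3) set)
    \<Rightarrow> real \<Rightarrow> (real^3) set" where
  "perforated \<Omega> N x \<alpha> T0 \<epsilon> = \<Omega> - (\<Union>n\<in>{1..N \<epsilon>}. closure (hole x \<alpha> T0 n \<epsilon>))"

section \<open>Lebesgue norms and the Sobolev space \<open>W\<^bsup>1,2\<^esup>\<close>\<close>

text \<open>The \<open>L\<^sup>q\<close> norm over \<open>S\<close>, \<open>1 \<le> q \<le> \<infinity>\<close>, with values in \<open>[0,\<infinity>]\<close>; it is infinite when the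
  function is not \<open>q\<close>-integrable (not essentially bounded if \<open>q = \<infinity>\<close>).\<close>

definition Lq_norm ::
  "ereal \<Rightarrow> 'a::euclidean_space set \<Rightarrow> ('a \<Rightarrow> 'b::real_normed_vector) \<Rightarrow> ennreal" where
  "Lq_norm q S f =
     (if q = \<infinity> then esssup (lebesgue_on S) (\<lambda>x. ennreal (norm (f x)))
      else let p = real_of_ereal q;
               I = (\<integral>\<^sup>+x. ennreal (norm (f x) powr p) \<partial>lebesgue_on S)
           in if I = \<infinity> then \<infinity> else ennreal (enn2real I powr (1 / p)))"

definition test_functions :: "'a::euclidean_space set \<Rightarrow> ('a \<Rightarrow> real) set" where
  "test_functions U =
     {\<eta>. (\<forall>k. Ck_on k UNIV \<eta>) \<and> (\<exists>K\<subseteq>U. compact K \<and> (\<forall>x. x \<notin> K \<longrightarrow> \<eta> x = 0))}"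

definition locally_integrable_on ::
  "('a::euclidean_space \<Rightarrow> 'b::euclidean_space) \<Rightarrow> 'a set \<Rightarrow> bool" where
  "locally_integrable_on f U \<longleftrightarrow> (\<forall>K\<subseteq>U. compact K \<longrightarrow> f absolutely_integrable_on K)"

definition has_weak_gradient ::
  "'a::euclidean_space set \<Rightarrow> ('a \<Rightarrow> real) \<Rightarrow> ('a \<Rightarrow> 'a) \<Rightarrow> bool" where
  "has_weak_gradient U u g \<longleftrightarrow> locally_integrable_on u U \<and> locally_integrable_on g U \<and>
     (\<forall>\<eta>\<in>test_functions U. \<forall>D\<eta>. (\<forall>x. GDERIV \<eta> x :> D\<eta> x) \<longrightarrow>
        (LINT x|lebesgue_on U. u x *\<^sub>R D\<eta> x) = - (LINT x|lebesgue_on U. \<eta> x *\<^sub>R g x))"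

text \<open>A representative of the weak gradient, which is unique up to null sets of \<open>U\<close>.\<close>

definition wgrad ::
  "'a::euclidean_space set \<Rightarrow> ('a \<Rightarrow> real) \<Rightarrow> 'a \<Rightarrow> 'a" where
  "wgrad U u = (SOME g. has_weak_gradient U u g)"

text \<open>The elements of \<open>W\<^bsup>1,2\<^esup>(U)\<close> are represented by functions on the whole space whose values outside
  \<open>U\<close> are irrelevant; representatives are not identified.\<close>

definition W12 :: "'a::euclidean_space set \<Rightarrow> ('a \<Rightarrow> real) set" where
  "W12 U = {u. u \<in> borel_measurable (lebesgue_on U) \<and> Lq_norm 2 U u < \<infinity> \<and>
     (\<exists>g. has_weak_gradient U u g \<and> g \<in> borel_measurable (lebesgue_on U) \<and> Lq_norm 2 U g < \<infinity>)}"

definition W12_nonneg :: "'a::euclidean_space set \<Rightarrow> ('a \<Rightarrow> real) set" where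
  "W12_nonneg U = {u \<in> W12 U. AE x in lebesgue_on U. 0 \<le> u x}"

text \<open>A possibly nonlinear map from \<open>X\<close> (functions on \<open>V\<close>) to \<open>Y\<close> (functions on \<open>U\<close>) that
  extends functions from \<open>V\<close> to \<open>U\<close>. The last clause makes it well defined on classes of functions
  modulo equality almost everywhere.\<close>

definition extension_operator ::
  "'a::euclidean_space set \<Rightarrow> 'a set \<Rightarrow> ('a \<Rightarrow> real) set \<Rightarrow> ('a \<Rightarrow> real) set
    \<Rightarrow> (('a \<Rightarrow> real) \<Rightarrow> ('a \<Rightarrow> real)) \<Rightarrow> bool" where
  "extension_operator V U X Y E \<longleftrightarrow> E \<in> X \<rightarrow> Y \<and> (\<forall>\<phi>\<in>X. \<forall>x\<in>V. E \<phi> x = \<phi> x) \<and>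
     (\<forall>\<phi>\<in>X. \<forall>\<psi>\<in>X. (AE x in lebesgue_on V. \<phi> x = \<psi> x) \<longrightarrow>
        (AE x in lebesgue_on U. E \<phi> x = E \<psi> x))"

end

(*
  It suffices to extend across one rescaled hole: since x + s T0 is compactly contained in pairwise
  disjoint balls, the extensions across different holes can be glued, and the dilation by s = eps^alpha
  multiplies both sides of every estimate by the same power of s. For a single hole T inside the ball of
  radius d, reflect across the boundary in the graph charts, where the uniform C^2 bounds fix the size and
  slope of the charts, and patch finitely many reflections one after the other with cut-off functions. This
  yields an extension bounded in W^{1,2} and, as a reflection rearranges values, in every L^q. To control
  the gradient by the gradient alone, subtract the mean over the shell between T and the ball of radius 3d/2
  before extending; the Poincare inequality on the shell has a uniform constant because the shell is
  connected and every ball of fixed size centred in it meets it in at least a fixed volume, so that finitely many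
  convex or reflected pieces can be chained. Connectedness of the shell follows from that of the perforated
  domain. The operator is obtained by choosing one extension for each class modulo null sets, and replacing
  an extension by its absolute value preserves non-negativity.
*)
theory Submission
  imports Defs
begin

section \<open>Smooth functions\<close>

text \<open>The constant may depend neither on the hole nor on q, so every step must be quantitative
  in the radius \<open>d\<close>, the chart size \<open>r\<close> and the slope bound
  \<open>L\<close>. Independence of q is obtained by estimating the integral of
  \<open>\<Theta> \<bar>u\<bar>\<close> for all monotone \<open>\<Theta>\<close> at once. The
  reflection is only Lipschitz, so its chain rule is reached through C^1 functions: weak gradients
  are stable under local L^1 approximation, and each rule is proved for C^1 functions and passed to
  the limit. Since nothing is known about the function beyond the boundary, the mollifiers used
  there are shifted off centre, away from the hole. Two concentric shells occur, out to 3/2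
  \<open>d\<close> and out to 2 \<open>d\<close>: the Poincare inequality bounds the oscillation on
  the smaller by the gradient on the larger, so the outer sphere never acts as a boundary and only
  the hole needs charts. Connectedness cannot be dispensed with: in a cavity enclosed by a hole a
  function may take another constant value; its gradient vanishes, yet every extension must have a
  non-zero gradient.\<close>

lemma GDERIV_unique: "GDERIV f x :> a \<Longrightarrow> GDERIV f x :> b \<Longrightarrow> a = b"
proof -
  assume "GDERIV f x :> a" "GDERIV f x :> b"
  then have "(\<lambda>h. inner h a) = (\<lambda>h. inner h b)"
    unfolding gderiv_def using has_derivative_unique by blast
  then have "inner (a - b) a = inner (a - b) b" by metis
  then show "a = b"
    by (metis eq_iff_diff_eq_0 inner_diff_right inner_eq_zero_iff)
qed

lemma GDERIV_isCont: "GDERIV f x :> a \<Longrightarrow> isCont f x"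
  unfolding gderiv_def by (rule has_derivative_continuous)

section \<open>Functions that are flat at the origin\<close>

text \<open>The functions p(1/t) exp(-1/t), extended by 0 to t \<le> 0. A polynomial is carried
  along because exp(-1/t) alone is not closed under differentiation, whereas this family is.\<close>

definition flat_poly :: "real poly \<Rightarrow> real \<Rightarrow> real" where
  "flat_poly p t = (if t > 0 then poly p (1 / t) * exp (- (1 / t)) else 0)"

lemma poly_exp_tendsto_0: "((\<lambda>x. poly p x * exp (- x)) \<longlongrightarrow> (0::real)) at_top"
proof -
  have eq: "(\<lambda>x. poly p x * exp (- x)) = (\<lambda>x. \<Sum>i\<le>degree p. coeff p i * (x ^ i / exp x))"
    by (simp add: poly_altdef sum_distrib_right exp_minus divide_inverse mult.assoc)
  have "((\<lambda>x. \<Sum>i\<le>degree p. coeff p i * (x ^ i / exp x)) \<longlongrightarrow> (\<Sum>i\<le>degree p. coeff p i * 0)) at_top"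
    by (intro tendsto_sum tendsto_mult tendsto_const tendsto_power_div_exp_0)
  then show ?thesis by (simp add: eq)
qed

lemma flat_poly_tendsto_0: "((\<lambda>t. flat_poly p t) \<longlongrightarrow> 0) (at 0)"
proof -
  have "((\<lambda>t. poly p (inverse t) * exp (- inverse t)) \<longlongrightarrow> 0) (at_right 0)"
    using filterlim_compose[OF poly_exp_tendsto_0 filterlim_inverse_at_top_right] .
  then have R: "((\<lambda>t. flat_poly p t) \<longlongrightarrow> 0) (at_right 0)"
  proof (rule Lim_transform_eventually)
    show "\<forall>\<^sub>F t in at_right 0. poly p (inverse t) * exp (- inverse t) = flat_poly p t"
      using eventually_at_right_less[of 0] by eventually_elim (simp add: flat_poly_def inverse_eq_divide)
  qed
  have L: "((\<lambda>t. flat_poly p t) \<longlongrightarrow> 0) (at_left 0)"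
  proof (rule Lim_transform_eventually[OF tendsto_const])
    show "\<forall>\<^sub>F t in at_left 0. 0 = flat_poly p t"
      unfolding eventually_at_left_field by (rule exI[of _ "-1"]) (auto simp: flat_poly_def)
  qed
  from R L show ?thesis by (simp add: filterlim_split_at)
qed

text \<open>For t > 0 the derivative of p(1/t) exp(-1/t) is t^(-2) (p - p')(1/t) exp(-1/t), and
  \<open>[:0, 0, 1:]\<close> is the factor X^2. At 0 the difference quotient is again a member of
  the family, with polynomial X p, so it tends to 0.\<close>

lemma DERIV_flat_poly:
  "DERIV (flat_poly p) t :> flat_poly ([:0, 0, 1:] * (p - pderiv p)) t"
proof -
  consider "t > 0" | "t < 0" | "t = 0" by linarith
  then show ?thesis
  proof cases
    case 1
    have "DERIV (\<lambda>s. poly p (1 / s) * exp (- (1 / s))) t :>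
        flat_poly ([:0, 0, 1:] * (p - pderiv p)) t"
      using 1 by (auto intro!: derivative_eq_intros poly_DERIV[THEN DERIV_chain2]
          simp: flat_poly_def field_simps power2_eq_square)
    moreover have "\<forall>\<^sub>F s in nhds t. flat_poly p s = poly p (1 / s) * exp (- (1 / s))"
      using eventually_nhds_in_open[of "{0<..}" t] 1
      by (auto simp: flat_poly_def elim!: eventually_mono)
    ultimately show ?thesis by (subst DERIV_cong_ev[OF refl _ refl])
  next
    case 2
    have "DERIV (\<lambda>s. 0) t :> flat_poly ([:0, 0, 1:] * (p - pderiv p)) t"
      using 2 by (simp add: flat_poly_def)
    moreover have "\<forall>\<^sub>F s in nhds t. flat_poly p s = 0"
      using eventually_nhds_in_open[of "{..<0}" t] 2
      by (auto simp: flat_poly_def elim!: eventually_mono)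
    ultimately show ?thesis by (subst DERIV_cong_ev[OF refl _ refl])
  next
    case 3
    have "(flat_poly p (0 + h) - flat_poly p 0) / h = flat_poly ([:0, 1:] * p) h" for h
      by (simp add: flat_poly_def)
    then show ?thesis
      unfolding DERIV_def 3 using flat_poly_tendsto_0[of "[:0, 1:] * p"]
      by (simp add: flat_poly_def)
  qed
qed

lemma flat_poly_1_nonneg: "0 \<le> flat_poly 1 t"
  by (simp add: flat_poly_def)

lemma flat_poly_1_pos_iff: "0 < flat_poly 1 t \<longleftrightarrow> 0 < t"
  by (simp add: flat_poly_def)

section \<open>Closure properties of smooth functions\<close>

abbreviation smooth :: "('a::euclidean_space \<Rightarrow> real) \<Rightarrow> bool" where
  "smooth f \<equiv> \<forall>k. Ck_on k UNIV f"

text \<open>A syntactic class containing the smooth functions whose members have all partial derivatives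
  in the class again; a fortiori its members are smooth.\<close>

inductive smooth_expr :: "('a::euclidean_space \<Rightarrow> real) \<Rightarrow> bool" where
  base: "smooth f \<Longrightarrow> smooth_expr f"
| const: "smooth_expr (\<lambda>x. c)"
| coord: "smooth_expr (\<lambda>x. x \<bullet> b)"
| add: "smooth_expr f \<Longrightarrow> smooth_expr g \<Longrightarrow> smooth_expr (\<lambda>x. f x + g x)"
| mult: "smooth_expr f \<Longrightarrow> smooth_expr g \<Longrightarrow> smooth_expr (\<lambda>x. f x * g x)"
| inverse: "smooth_expr f \<Longrightarrow> (\<And>x. f x \<noteq> 0) \<Longrightarrow> smooth_expr (\<lambda>x. inverse (f x))"
| affine: "smooth_expr f \<Longrightarrow> smooth_expr (\<lambda>x. f (a + c *\<^sub>R x))"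
| flat: "smooth_expr f \<Longrightarrow> smooth_expr (\<lambda>x. flat_poly p (f x))"

text \<open>\<open>Ck_on\<close> asserts, for each order k separately, that some gradient exists.
  Uniqueness of the gradient makes one \<open>g\<close> serve all orders.\<close>

lemma smooth_gradient:
  assumes "smooth f"
  obtains g where "\<And>x. GDERIV f x :> g x" "\<And>b. b \<in> Basis \<Longrightarrow> smooth (\<lambda>x. g x \<bullet> b)"
proof -
  have "Ck_on (Suc 0) UNIV f" using assms by blast
  then obtain g where g: "\<And>x. GDERIV f x :> g x" by auto
  have "Ck_on k UNIV (\<lambda>x. g x \<bullet> b)" if b: "b \<in> Basis" for k b
  proof -
    have "Ck_on (Suc k) UNIV f" using assms by blast
    then obtain g' where g': "\<And>x. GDERIV f x :> g' x" "\<And>b. b \<in> Basis \<Longrightarrow> Ck_on k UNIV (\<lambda>x. g' x \<bullet> b)"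
      by auto
    have "g' = g" using g g'(1) GDERIV_unique by blast
    then show ?thesis using g'(2) b by simp
  qed
  then show thesis using g that by blast
qed

lemma smooth_expr_gradient:
  "smooth_expr f \<Longrightarrow> \<exists>g. (\<forall>x. GDERIV f x :> g x) \<and> (\<forall>b\<in>Basis. smooth_expr (\<lambda>x. g x \<bullet> b))"
proof (induction rule: smooth_expr.induct)
  case (base f)
  then show ?case by (metis smooth_gradient smooth_expr.base)
next
  case (const c)
  show ?case
    by (rule exI[of _ "\<lambda>x. 0"]) (auto intro: GDERIV_const smooth_expr.const)
next
  case (coord b)
  show ?case
    by (rule exI[of _ "\<lambda>x. b"])
      (auto intro!: smooth_expr.const bounded_linear_imp_has_derivative bounded_linear_inner_left simp: gderiv_def)
next
  case (add f g)
  then obtain f' g' where "\<forall>x. GDERIV f x :> f' x" "\<forall>b\<in>Basis. smooth_expr (\<lambda>x. f' x \<bullet> b)"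
    "\<forall>x. GDERIV g x :> g' x" "\<forall>b\<in>Basis. smooth_expr (\<lambda>x. g' x \<bullet> b)" by auto
  then show ?case
    by (intro exI[of _ "\<lambda>x. f' x + g' x"]) (auto intro: GDERIV_add smooth_expr.add simp: inner_add_left)
next
  case (mult f g)
  then obtain f' g' where "\<forall>x. GDERIV f x :> f' x" "\<forall>b\<in>Basis. smooth_expr (\<lambda>x. f' x \<bullet> b)"
    "\<forall>x. GDERIV g x :> g' x" "\<forall>b\<in>Basis. smooth_expr (\<lambda>x. g' x \<bullet> b)" by auto
  then show ?case using mult.hyps
    by (intro exI[of _ "\<lambda>x. f x *\<^sub>R g' x + g x *\<^sub>R f' x"])
      (auto intro!: GDERIV_mult smooth_expr.add smooth_expr.mult simp: inner_add_left)
next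
  case (inverse f)
  then obtain f' where f': "\<forall>x. GDERIV f x :> f' x" "\<forall>b\<in>Basis. smooth_expr (\<lambda>x. f' x \<bullet> b)" by auto
  have "smooth_expr (\<lambda>x. -1 * (inverse (f x) * inverse (f x)) * (f' x \<bullet> b))" if "b \<in> Basis" for b
    using inverse.hyps f'(2) that by (intro smooth_expr.mult smooth_expr.const smooth_expr.inverse) auto
  then show ?case using inverse.hyps f'
    by (intro exI[of _ "\<lambda>x. - (inverse (f x))\<^sup>2 *\<^sub>R f' x"])
      (auto intro!: GDERIV_inverse[THEN GDERIV_subst] simp: power2_eq_square)
next
  case (affine f a c)
  then obtain f' where f': "\<forall>x. GDERIV f x :> f' x" "\<forall>b\<in>Basis. smooth_expr (\<lambda>x. f' x \<bullet> b)" by auto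
  have "GDERIV (\<lambda>x. f (a + c *\<^sub>R x)) x :> c *\<^sub>R f' (a + c *\<^sub>R x)" for x
  proof -
    have "((\<lambda>x. f (a + c *\<^sub>R x)) has_derivative (\<lambda>h. (c *\<^sub>R h) \<bullet> f' (a + c *\<^sub>R x))) (at x)"
      by (rule has_derivative_compose[where f="\<lambda>x. a + c *\<^sub>R x" and g=f])
        (use f'(1) in \<open>auto simp: gderiv_def intro!: derivative_eq_intros\<close>)
    then show ?thesis by (simp add: gderiv_def)
  qed
  moreover have "smooth_expr (\<lambda>x. c * (f' (a + c *\<^sub>R x) \<bullet> b))" if "b \<in> Basis" for b
    using smooth_expr.affine[of "\<lambda>x. f' x \<bullet> b"] f'(2) that by (intro smooth_expr.mult smooth_expr.const) auto
  ultimately show ?case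
    by (intro exI[of _ "\<lambda>x. c *\<^sub>R f' (a + c *\<^sub>R x)"]) auto
next
  case (flat f p)
  then obtain f' where f': "\<forall>x. GDERIV f x :> f' x" "\<forall>b\<in>Basis. smooth_expr (\<lambda>x. f' x \<bullet> b)" by auto
  let ?q = "[:0, 0, 1:] * (p - pderiv p)"
  have "GDERIV (\<lambda>x. flat_poly p (f x)) x :> flat_poly ?q (f x) *\<^sub>R f' x" for x
    using GDERIV_DERIV_compose[OF _ DERIV_flat_poly] f'(1) by blast
  moreover have "smooth_expr (\<lambda>x. (flat_poly ?q (f x) *\<^sub>R f' x) \<bullet> b)" if "b \<in> Basis" for b
    unfolding inner_scaleR_left using f'(2) flat.hyps that
    by (intro smooth_expr.mult smooth_expr.flat) auto
  ultimately show ?case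
    by (intro exI[of _ "\<lambda>x. flat_poly ?q (f x) *\<^sub>R f' x"] conjI allI ballI)
qed

lemma smooth_expr_imp_smooth: "smooth_expr f \<Longrightarrow> smooth f"
proof
  fix k assume "smooth_expr f"
  then show "Ck_on k UNIV f"
  proof (induction k arbitrary: f)
    case 0
    then obtain g where "\<forall>x. GDERIV f x :> g x" using smooth_expr_gradient by blast
    then show ?case
      by (metis Ck_on.simps(1) GDERIV_isCont continuous_at_imp_continuous_on)
  next
    case (Suc k)
    then obtain g where "\<forall>x. GDERIV f x :> g x" "\<forall>b\<in>Basis. smooth_expr (\<lambda>x. g x \<bullet> b)"
      using smooth_expr_gradient by blast
    then show ?case using Suc.IH by auto
  qed
qed

lemma smooth_iff_smooth_expr: "smooth f \<longleftrightarrow> smooth_expr f"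
  using smooth_expr_imp_smooth smooth_expr.base by blast

lemma smooth_continuous: "smooth f \<Longrightarrow> continuous_on UNIV f"
  by (drule spec[of _ 0]) simp

lemma smooth_gradient_continuous:
  assumes "smooth f" "\<And>x. GDERIV f x :> g x"
  shows "continuous_on UNIV g"
proof -
  obtain g' where g': "\<And>x. GDERIV f x :> g' x" "\<And>b. b \<in> Basis \<Longrightarrow> smooth (\<lambda>x. g' x \<bullet> b)"
    using smooth_gradient[OF assms(1)] by blast
  have "g' = g" using assms(2) g'(1) GDERIV_unique by blast
  then show ?thesis
    using g'(2)[THEN smooth_continuous] by (subst continuous_on_componentwise) blast
qed

lemma smooth_norm_square: "smooth_expr (\<lambda>x::'a::euclidean_space. (norm x)\<^sup>2)"
proof -
  have "finite B \<Longrightarrow> smooth_expr (\<lambda>x::'a. \<Sum>b\<in>B. (x \<bullet> b) * (x \<bullet> b))" for B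
    by (induction B rule: finite_induct)
      (auto intro!: smooth_expr.const smooth_expr.add smooth_expr.mult smooth_expr.coord)
  from this[OF finite_Basis] show ?thesis
    by (simp add: power2_norm_eq_inner euclidean_inner[symmetric])
qed

lemma smooth_minus: "smooth_expr f \<Longrightarrow> smooth_expr g \<Longrightarrow> smooth_expr (\<lambda>x. f x - g x)"
  using smooth_expr.add[OF _ smooth_expr.mult[OF smooth_expr.const[of "-1"]], of f g] by simp

section \<open>Smooth bump functions\<close>

text \<open>The quotient f / (f + h), where f is positive exactly for |x| < 2 and h exactly for |x|
  > 1; the denominator never vanishes because these two regions cover the space. The squared norm is
  used since the norm itself is not smooth at 0.\<close>

lemma smooth_bump_exists:
  obtains b :: "'a::euclidean_space \<Rightarrow> real"
  where "smooth b" "\<And>x. 0 \<le> b x" "\<And>x. b x \<le> 1" "\<And>x. norm x \<le> 1 \<Longrightarrow> b x = 1"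
    "\<And>x. norm x \<ge> 2 \<Longrightarrow> b x = 0"
proof -
  define f where "f x = flat_poly 1 (4 - (norm x)\<^sup>2)" for x :: 'a
  define h where "h x = flat_poly 1 ((norm x)\<^sup>2 - 1)" for x :: 'a
  have pos: "f x + h x > 0" for x
  proof (cases "(norm x)\<^sup>2 < 4")
    case True
    then have "f x > 0" by (simp add: f_def flat_poly_1_pos_iff)
    then show ?thesis using flat_poly_1_nonneg[of "(norm x)\<^sup>2 - 1"] by (simp add: h_def)
  next
    case False
    then have "h x > 0" by (simp add: h_def flat_poly_1_pos_iff)
    then show ?thesis using flat_poly_1_nonneg[of "4 - (norm x)\<^sup>2"] by (simp add: f_def)
  qed
  have sf: "smooth_expr f" and sh: "smooth_expr h"
    unfolding f_def h_def
    by (intro smooth_expr.flat smooth_minus smooth_expr.const smooth_norm_square)+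
  have "smooth_expr (\<lambda>x. f x * inverse (f x + h x))"
    by (intro smooth_expr.mult smooth_expr.inverse smooth_expr.add sf sh) (use pos in \<open>metis less_irrefl\<close>)
  moreover have "0 \<le> f x" "0 \<le> h x" for x
    by (simp_all add: f_def h_def flat_poly_1_nonneg)
  moreover have "h x = 0" if "norm x \<le> 1" for x
    using that power_le_one[of "norm x" 2] by (simp add: h_def flat_poly_def)
  moreover have "f x = 0" if "norm x \<ge> 2" for x
    using power_mono[OF that, of 2] by (simp add: f_def flat_poly_def)
  ultimately show thesis
  proof (intro that[of "\<lambda>x. f x * inverse (f x + h x)"])
    fix x :: 'a
    show "f x * inverse (f x + h x) \<le> 1"
      using pos[of x] \<open>0 \<le> h x\<close> by (simp add: field_simps)
    show "f x * inverse (f x + h x) = 1" if "norm x \<le> 1"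
      using pos[of x] \<open>norm x \<le> 1 \<Longrightarrow> h x = 0\<close>[OF that] by simp
  qed (use smooth_expr_imp_smooth[THEN spec] in \<open>auto simp: less_imp_le[OF pos]\<close>)
qed

lemma smooth_bump_ball:
  fixes p :: "'a::euclidean_space"
  assumes "r > 0"
  obtains b where "smooth b" "\<And>x. 0 \<le> b x" "\<And>x. b x \<le> 1" "\<And>x. x \<in> cball p r \<Longrightarrow> b x = 1"
    "\<And>x. x \<notin> ball p (2 * r) \<Longrightarrow> b x = 0"
proof -
  obtain b :: "'a \<Rightarrow> real" where b: "smooth b" "\<And>x. 0 \<le> b x" "\<And>x. b x \<le> 1" "\<And>x. norm x \<le> 1 \<Longrightarrow> b x = 1"
    "\<And>x. norm x \<ge> 2 \<Longrightarrow> b x = 0" using smooth_bump_exists by metis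
  let ?b = "\<lambda>x. b ((- (1 / r)) *\<^sub>R p + (1 / r) *\<^sub>R x)"
  have "(- (1 / r)) *\<^sub>R p + (1 / r) *\<^sub>R x = (1 / r) *\<^sub>R (x - p)" for x
    by (simp add: algebra_simps)
  then have n: "norm ((- (1 / r)) *\<^sub>R p + (1 / r) *\<^sub>R x) = dist p x / r" for x
    using assms by (simp add: dist_norm norm_minus_commute)
  show thesis
  proof (rule that[of ?b])
    have "smooth_expr ?b" using b(1) unfolding smooth_iff_smooth_expr by (rule smooth_expr.affine)
    then show "smooth ?b" by (rule smooth_expr_imp_smooth)
    show "?b x = 1" if "x \<in> cball p r" for x
      by (rule b(4)) (use that assms in \<open>simp only: n mem_cball divide_le_eq_1_pos\<close>)
    show "?b x = 0" if "x \<notin> ball p (2 * r)" for x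
      by (rule b(5)) (use that assms in \<open>simp only: n mem_ball pos_le_divide_eq not_less\<close>)
  qed (use b in auto)
qed

section \<open>Integral seminorms over Borel sets\<close>

lemma ball_cball_in_borel [measurable, simp]:
  fixes x :: "'a::euclidean_space"
  shows "ball x r \<in> sets borel" "cball x r \<in> sets borel"
  by (simp_all add: borel_open borel_closed)

definition L1on :: "'a::euclidean_space set \<Rightarrow> ('a \<Rightarrow> 'b::real_normed_vector) \<Rightarrow> ennreal" where
  "L1on K f = (\<integral>\<^sup>+x. ennreal (norm (f x)) * indicator K x \<partial>lborel)"

text \<open>The square of the L^2 norm, without the root, so that it behaves like a measure in the
  set; infinity is an admissible value, which spares integrability hypotheses. Constants in the
  later gradient estimates are therefore constants for squares.\<close>

definition L2on :: "'a::euclidean_space set \<Rightarrow> ('a \<Rightarrow> 'b::real_normed_vector) \<Rightarrow> ennreal" where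
  "L2on K f = (\<integral>\<^sup>+x. ennreal ((norm (f x))\<^sup>2) * indicator K x \<partial>lborel)"

lemma L1on_mono: "(\<And>x. x \<in> K \<Longrightarrow> x \<in> K' \<and> norm (f x) \<le> norm (g x)) \<Longrightarrow> L1on K f \<le> L1on K' g"
  unfolding L1on_def
  by (intro nn_integral_mono) (auto simp: indicator_def intro: ennreal_leI)

lemma L2on_mono: "(\<And>x. x \<in> K \<Longrightarrow> x \<in> K' \<and> norm (f x) \<le> norm (g x)) \<Longrightarrow> L2on K f \<le> L2on K' g"
  unfolding L2on_def
  by (intro nn_integral_mono) (auto simp: indicator_def intro!: ennreal_leI power_mono)

lemma L1on_cong: "(\<And>x. x \<in> K \<Longrightarrow> norm (f x) = norm (g x)) \<Longrightarrow> L1on K f = L1on K g"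
  unfolding L1on_def by (intro nn_integral_cong) (auto simp: indicator_def)

lemma L2on_cong: "(\<And>x. x \<in> K \<Longrightarrow> norm (f x) = norm (g x)) \<Longrightarrow> L2on K f = L2on K g"
  unfolding L2on_def by (intro nn_integral_cong) (auto simp: indicator_def)

lemma L1on_cong_AE: "(AE x in lborel. x \<in> K \<longrightarrow> f x = g x) \<Longrightarrow> L1on K f = L1on K g"
  unfolding L1on_def by (intro nn_integral_cong_AE, elim eventually_mono) (auto simp: indicator_def)

lemma L2on_cong_AE: "(AE x in lborel. x \<in> K \<longrightarrow> f x = g x) \<Longrightarrow> L2on K f = L2on K g"
  unfolding L2on_def by (intro nn_integral_cong_AE, elim eventually_mono) (auto simp: indicator_def)

lemma L1on_cmult:
  fixes f :: "'a::euclidean_space \<Rightarrow> 'b::euclidean_space"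
  assumes [measurable]: "f \<in> borel_measurable borel" "K \<in> sets borel"
  shows "L1on K (\<lambda>x. c *\<^sub>R f x) = ennreal \<bar>c\<bar> * L1on K f"
  unfolding L1on_def by (simp add: ennreal_mult nn_integral_cmult mult.assoc)

lemma L2on_cmult:
  fixes f :: "'a::euclidean_space \<Rightarrow> 'b::euclidean_space"
  assumes [measurable]: "f \<in> borel_measurable borel" "K \<in> sets borel"
  shows "L2on K (\<lambda>x. c *\<^sub>R f x) = ennreal (c\<^sup>2) * L2on K f"
  unfolding L2on_def by (simp add: ennreal_mult nn_integral_cmult mult.assoc power_mult_distrib)

lemma L1on_triangle:
  fixes f g h :: "'a::euclidean_space \<Rightarrow> 'b::euclidean_space"
  assumes [measurable]: "g \<in> borel_measurable borel" "h \<in> borel_measurable borel" "K \<in> sets borel"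
    and le: "\<And>x. x \<in> K \<Longrightarrow> norm (f x) \<le> norm (g x) + norm (h x)"
  shows "L1on K f \<le> L1on K g + L1on K h"
proof -
  have "L1on K f \<le> (\<integral>\<^sup>+x. ennreal (norm (g x)) * indicator K x + ennreal (norm (h x)) * indicator K x \<partial>lborel)"
    unfolding L1on_def using le
    by (intro nn_integral_mono)
      (auto simp: indicator_def simp flip: ennreal_plus intro!: ennreal_leI)
  also have "\<dots> = L1on K g + L1on K h"
    unfolding L1on_def by (rule nn_integral_add) measurable
  finally show ?thesis .
qed

lemma L1on_diff_triangle:
  fixes f g h :: "'a::euclidean_space \<Rightarrow> 'b::euclidean_space"
  assumes [measurable]: "f \<in> borel_measurable borel" "g \<in> borel_measurable borel"
    "h \<in> borel_measurable borel" "K \<in> sets borel"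
  shows "L1on K (\<lambda>x. f x - h x) \<le> L1on K (\<lambda>x. f x - g x) + L1on K (\<lambda>x. g x - h x)"
proof (rule L1on_triangle)
  show "norm (f x - h x) \<le> norm (f x - g x) + norm (g x - h x)" for x
    using norm_triangle_ineq[of "f x - g x" "g x - h x"] by simp
qed measurable

text \<open>The factors 2 come from (a + b)^2 \<le> 2 a^2 + 2 b^2, as no root is taken. The three
  functions may take values in different spaces, so that a vector field can be dominated by scalar
  functions.\<close>

lemma L2on_triangle:
  fixes f :: "'a::euclidean_space \<Rightarrow> 'b::euclidean_space" and g :: "'a \<Rightarrow> 'c::euclidean_space"
    and h :: "'a \<Rightarrow> 'd::euclidean_space"
  assumes [measurable]: "g \<in> borel_measurable borel" "h \<in> borel_measurable borel" "K \<in> sets borel"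
    and le: "\<And>x. x \<in> K \<Longrightarrow> norm (f x) \<le> norm (g x) + norm (h x)"
  shows "L2on K f \<le> 2 * L2on K g + 2 * L2on K h"
proof -
  have "(norm (f x))\<^sup>2 \<le> 2 * (norm (g x))\<^sup>2 + 2 * (norm (h x))\<^sup>2" if "x \<in> K" for x
  proof -
    have "(norm (f x))\<^sup>2 \<le> (norm (g x) + norm (h x))\<^sup>2"
      using le[OF that] by (intro power_mono) auto
    also have "\<dots> \<le> 2 * (norm (g x))\<^sup>2 + 2 * (norm (h x))\<^sup>2"
      using sum_squares_bound[of "norm (g x)" "norm (h x)"] by (simp add: power2_sum)
    finally show ?thesis .
  qed
  then have "L2on K f \<le> (\<integral>\<^sup>+x. 2 * (ennreal ((norm (g x))\<^sup>2) * indicator K x) +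
      2 * (ennreal ((norm (h x))\<^sup>2) * indicator K x) \<partial>lborel)"
    unfolding L2on_def
    by (intro nn_integral_mono)
      (auto simp: indicator_def simp flip: ennreal_plus ennreal_mult ennreal_numeral intro!: ennreal_leI)
  also have "\<dots> = 2 * L2on K g + 2 * L2on K h"
    unfolding L2on_def by (subst nn_integral_add) (simp_all add: nn_integral_cmult)
  finally show ?thesis .
qed

lemma L1on_Un:
  assumes [measurable]: "f \<in> borel_measurable borel" "A \<in> sets borel" "B \<in> sets borel"
  shows "L1on (A \<union> B) f \<le> L1on A f + L1on B f"
proof -
  have "L1on (A \<union> B) f \<le> (\<integral>\<^sup>+x. ennreal (norm (f x)) * indicator A x + ennreal (norm (f x)) * indicator B x \<partial>lborel)"
    unfolding L1on_def by (intro nn_integral_mono) (auto simp: indicator_def)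
  also have "\<dots> = L1on A f + L1on B f"
    unfolding L1on_def by (rule nn_integral_add) measurable
  finally show ?thesis .
qed

lemma L2on_Un:
  assumes [measurable]: "f \<in> borel_measurable borel" "A \<in> sets borel" "B \<in> sets borel"
  shows "L2on (A \<union> B) f \<le> L2on A f + L2on B f"
proof -
  have "L2on (A \<union> B) f \<le> (\<integral>\<^sup>+x. ennreal ((norm (f x))\<^sup>2) * indicator A x + ennreal ((norm (f x))\<^sup>2) * indicator B x \<partial>lborel)"
    unfolding L2on_def by (intro nn_integral_mono) (auto simp: indicator_def)
  also have "\<dots> = L2on A f + L2on B f"
    unfolding L2on_def by (rule nn_integral_add) measurable
  finally show ?thesis .
qed

lemma L1on_finite_if_bounded:
  fixes f :: "'a::euclidean_space \<Rightarrow> 'b::real_normed_vector"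
  assumes "bounded K" "\<And>x. x \<in> K \<Longrightarrow> norm (f x) \<le> M"
  shows "L1on K f < \<infinity>"
proof -
  obtain R where R: "K \<subseteq> cball 0 R"
    using assms(1) by (auto simp: bounded_iff subset_iff)
  have "L1on K f \<le> (\<integral>\<^sup>+x. ennreal \<bar>M\<bar> * indicator (cball 0 R) (x::'a) \<partial>lborel)"
    unfolding L1on_def
  proof (intro nn_integral_mono)
    fix x
    show "ennreal (norm (f x)) * indicator K x \<le> ennreal \<bar>M\<bar> * indicator (cball 0 R) x"
      using R assms(2)[of x] by (auto simp: indicator_def intro!: ennreal_leI)
  qed
  also have "\<dots> < \<infinity>"
    using emeasure_lborel_cball_finite[of "0::'a" R] by (simp add: nn_integral_cmult_indicator ennreal_mult_less_top)
  finally show ?thesis .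
qed

lemma integral_dominated_L1on:
  fixes f :: "'a::euclidean_space \<Rightarrow> 'b::euclidean_space" and h :: "'a \<Rightarrow> 'c::euclidean_space"
  assumes [measurable]: "h \<in> borel_measurable borel" "f \<in> borel_measurable borel" "K \<in> sets borel"
    and le: "\<And>x. x \<in> K \<Longrightarrow> norm (h x) \<le> M * norm (f x)" "\<And>x. x \<notin> K \<Longrightarrow> h x = 0"
    and fin: "L1on K f < \<infinity>" and M: "0 \<le> M"
  shows "integrable lborel h" "ennreal (norm (integral\<^sup>L lborel h)) \<le> ennreal M * L1on K f"
proof -
  have "(\<integral>\<^sup>+x. ennreal (norm (h x)) \<partial>lborel) \<le> (\<integral>\<^sup>+x. ennreal M * (ennreal (norm (f x)) * indicator K x) \<partial>lborel)"
    using le M by (intro nn_integral_mono) (auto simp: indicator_def simp flip: ennreal_mult intro!: ennreal_leI)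
  also have "\<dots> = ennreal M * L1on K f"
    unfolding L1on_def by (simp add: nn_integral_cmult)
  finally have *: "(\<integral>\<^sup>+x. ennreal (norm (h x)) \<partial>lborel) \<le> ennreal M * L1on K f" .
  also have "\<dots> < \<infinity>" using fin by (simp add: ennreal_mult_less_top)
  finally show "integrable lborel h" by (intro integrableI_bounded) auto
  then have "ennreal (norm (integral\<^sup>L lborel h)) \<le> (\<integral>\<^sup>+x. ennreal (norm (h x)) \<partial>lborel)"
    by (rule integral_norm_bound_ennreal)
  with * show "ennreal (norm (integral\<^sup>L lborel h)) \<le> ennreal M * L1on K f" by simp
qed

section \<open>Invariance of integrals under translation and point reflection\<close>

lemma nn_integral_translate:
  fixes f :: "'a::euclidean_space \<Rightarrow> ennreal"
  assumes [measurable]: "f \<in> borel_measurable borel"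
  shows "(\<integral>\<^sup>+x. f (x + z) \<partial>lborel) = (\<integral>\<^sup>+x. f x \<partial>lborel)"
proof -
  have "(\<integral>\<^sup>+x. f x \<partial>lborel) = (\<integral>\<^sup>+x. f x \<partial>(distr lborel borel ((+) z)))"
    by (simp add: lborel_distr_plus)
  also have "\<dots> = (\<integral>\<^sup>+x. f (x + z) \<partial>lborel)"
    by (subst nn_integral_distr) (auto simp: add.commute)
  finally show ?thesis ..
qed

lemma nn_integral_reflect:
  fixes f :: "'a::euclidean_space \<Rightarrow> ennreal"
  assumes [measurable]: "f \<in> borel_measurable borel"
  shows "(\<integral>\<^sup>+x. f (z - x) \<partial>lborel) = (\<integral>\<^sup>+x. f x \<partial>lborel)"
proof -
  have "(\<integral>\<^sup>+x. f x \<partial>lborel) = (\<integral>\<^sup>+x. f x \<partial>(distr lborel borel ((-) z)))"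
    using lborel_affine[of "-1" z] by (simp add: density_1)
  also have "\<dots> = (\<integral>\<^sup>+x. f (z - x) \<partial>lborel)"
    by (simp add: nn_integral_distr)
  finally show ?thesis ..
qed

lemma integral_translate:
  fixes f :: "'a::euclidean_space \<Rightarrow> 'b::euclidean_space"
  assumes [measurable]: "f \<in> borel_measurable borel"
  shows "(\<integral>x. f (x + z) \<partial>lborel) = (\<integral>x. f x \<partial>lborel)"
proof -
  have "(\<integral>x. f x \<partial>lborel) = (\<integral>x. f x \<partial>(distr lborel borel ((+) z)))"
    by (simp add: lborel_distr_plus)
  also have "\<dots> = (\<integral>x. f (x + z) \<partial>lborel)"
    by (subst integral_distr) (auto simp: add.commute)
  finally show ?thesis ..
qed

lemma integral_reflect:
  fixes f :: "'a::euclidean_space \<Rightarrow> 'b::euclidean_space"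
  assumes [measurable]: "f \<in> borel_measurable borel"
  shows "(\<integral>x. f (z - x) \<partial>lborel) = (\<integral>x. f x \<partial>lborel)"
proof -
  have "(\<integral>x. f x \<partial>lborel) = (\<integral>x. f x \<partial>(distr lborel borel ((-) z)))"
    using lborel_affine[of "-1" z] by (simp add: density_1)
  also have "\<dots> = (\<integral>x. f (z - x) \<partial>lborel)"
    by (simp add: integral_distr)
  finally show ?thesis ..
qed

subsection \<open>Continuity of translations in \<open>L\<^sup>1\<close>\<close>

lemma norm_closest_point_cball_le:
  fixes x :: "'a::euclidean_space"
  assumes "r \<ge> 0" shows "norm (closest_point (cball 0 r) x) \<le> norm x"
proof -
  have "dist (closest_point (cball 0 r) x) (closest_point (cball 0 r) 0) \<le> dist x 0"
    using assms by (intro closest_point_lipschitz) auto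
  then show ?thesis using assms by (simp add: closest_point_self)
qed

text \<open>Measurability provides continuous \<open>G n\<close> converging to \<open>u\<close>
  almost everywhere, but without a majorant. The values are therefore projected to a ball of radius
  m by \<open>P m\<close> and cut off in space by \<open>\<kappa> m\<close>. Dominated convergence
  then applies first in m, with majorant |u|, and afterwards in n, with majorant m on a bounded
  ball.\<close>

lemma L1_dense_continuous:
  fixes u :: "'a::euclidean_space \<Rightarrow> 'b::euclidean_space"
  assumes [measurable]: "u \<in> borel_measurable borel" and fin: "L1on UNIV u < \<infinity>" and "e > 0"
  obtains w K where "continuous_on UNIV w" "compact K" "\<And>x. x \<notin> K \<Longrightarrow> w x = 0"
    "L1on UNIV (\<lambda>x. u x - w x) < ennreal e"
proof -
  have "u measurable_on UNIV"
    by (rule lebesgue_measurable_imp_measurable_on) (auto intro: measurable_completion)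
  then obtain N G where N: "negligible N" and G: "\<And>n. continuous_on UNIV (G n)"
    "\<And>x. x \<notin> N \<Longrightarrow> (\<lambda>n. G n x) \<longlonglongrightarrow> u x"
    by (auto simp: measurable_on_def)
  have AEG: "AE x in lborel. (\<lambda>n. G n x) \<longlonglongrightarrow> u x"
  proof -
    have "AE x in lebesgue. x \<notin> N" using N
      by (intro AE_not_in) (auto simp: negligible_iff_null_sets)
    then have "AE x in lborel. x \<notin> N" by (simp add: AE_completion_iff)
    then show ?thesis using G(2) by (auto elim: eventually_mono)
  qed
  define \<kappa> where "\<kappa> m x = max 0 (min 1 (real m + 1 - norm x))" for m and x :: 'a
  define P where "P m = closest_point (cball (0::'b) (real m))" for m
  have contP: "continuous_on UNIV (P m)" for m
    unfolding P_def by (rule continuous_on_closest_point) auto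
  have P_le: "norm (P m y) \<le> norm y" "norm (P m y) \<le> real m" for m y
    using norm_closest_point_cball_le[of "real m" y] closest_point_in_set[of "cball (0::'b) (real m)" y]
    by (auto simp: P_def)
  have cont\<kappa>: "continuous_on UNIV (\<kappa> m)" for m unfolding \<kappa>_def by (intro continuous_intros)
  have \<kappa>01: "0 \<le> \<kappa> m x" "\<kappa> m x \<le> 1" for m x by (auto simp: \<kappa>_def)
  have [measurable]: "P m \<in> borel_measurable borel" "\<kappa> m \<in> borel_measurable borel"
    "G m \<in> borel_measurable borel" for m
    using contP cont\<kappa> G(1) by (auto intro: borel_measurable_continuous_onI)
  have "(\<lambda>m. (\<integral>\<^sup>+x. norm (u x - \<kappa> m x *\<^sub>R P m (u x)) \<partial>lborel)) \<longlonglongrightarrow> 0"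
  proof (rule nn_integral_dominated_convergence_norm[where w="\<lambda>x. norm (u x)"])
    show "AE x in lborel. norm (\<kappa> j x *\<^sub>R P j (u x)) \<le> norm (u x)" for j
      using \<kappa>01 P_le(1) mult_mono[of "\<kappa> j _" 1 "norm (P j (u _))" "norm (u _)"] by auto
    show "(\<integral>\<^sup>+x. ennreal (norm (u x)) \<partial>lborel) < \<infinity>" using fin by (simp add: L1on_def)
    show "AE x in lborel. (\<lambda>m. \<kappa> m x *\<^sub>R P m (u x)) \<longlonglongrightarrow> u x"
    proof (rule AE_I2)
      fix x
      have "\<forall>\<^sub>F m in sequentially. \<kappa> m x *\<^sub>R P m (u x) = u x"
      proof (rule eventually_sequentiallyI[of "nat \<lceil>max (norm x) (norm (u x))\<rceil>"])
        fix m assume "nat \<lceil>max (norm x) (norm (u x))\<rceil> \<le> m"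
        then have "norm x \<le> m" "norm (u x) \<le> m" by linarith+
        then show "\<kappa> m x *\<^sub>R P m (u x) = u x" by (simp add: \<kappa>_def P_def closest_point_self)
      qed
      then show "(\<lambda>m. \<kappa> m x *\<^sub>R P m (u x)) \<longlonglongrightarrow> u x" by (rule tendsto_eventually)
    qed
  qed auto
  then have "\<forall>\<^sub>F m in sequentially. (\<integral>\<^sup>+x. norm (u x - \<kappa> m x *\<^sub>R P m (u x)) \<partial>lborel) < ennreal (e/2)"
    using \<open>e > 0\<close> by (intro order_tendstoD(2)) auto
  then obtain m where m: "(\<integral>\<^sup>+x. norm (u x - \<kappa> m x *\<^sub>R P m (u x)) \<partial>lborel) < ennreal (e/2)"
    by (auto simp: eventually_sequentially)
  have "(\<lambda>n. (\<integral>\<^sup>+x. norm (\<kappa> m x *\<^sub>R P m (u x) - \<kappa> m x *\<^sub>R P m (G n x)) \<partial>lborel)) \<longlonglongrightarrow> 0"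
  proof (rule nn_integral_dominated_convergence_norm[where w="\<lambda>x. real m * indicator (cball 0 (real m + 1)) x"])
    show "AE x in lborel. norm (\<kappa> m x *\<^sub>R P m (G j x)) \<le> real m * indicator (cball 0 (real m + 1)) x" for j
    proof (rule AE_I2)
      fix x
      show "norm (\<kappa> m x *\<^sub>R P m (G j x)) \<le> real m * indicator (cball 0 (real m + 1)) x"
      proof (cases "x \<in> cball 0 (real m + 1)")
        case True
        then show ?thesis
          using \<kappa>01[of m x] P_le(2)[of m "G j x"] mult_mono[of "\<kappa> m x" 1 "norm (P m (G j x))" "real m"]
          by simp
      next
        case False
        then have "\<kappa> m x = 0" by (simp add: \<kappa>_def)
        then show ?thesis using False by simp
      qed
    qed
    have "(\<integral>\<^sup>+x. ennreal (real m * indicator (cball 0 (real m + 1)) (x::'a)) \<partial>lborel) =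
      ennreal (real m) * emeasure lborel (cball (0::'a) (real m + 1))"
      by (simp add: ennreal_mult ennreal_indicator nn_integral_cmult_indicator)
    then show "(\<integral>\<^sup>+x. ennreal (real m * indicator (cball 0 (real m + 1)) (x::'a)) \<partial>lborel) < \<infinity>"
      using emeasure_lborel_cball_finite[of "0::'a"] by (simp add: ennreal_mult_less_top)
    show "AE x in lborel. (\<lambda>n. \<kappa> m x *\<^sub>R P m (G n x)) \<longlonglongrightarrow> \<kappa> m x *\<^sub>R P m (u x)"
      using AEG
    proof eventually_elim
      case (elim x)
      have "isCont (P m) (u x)" using contP by (simp add: continuous_on_eq_continuous_at)
      from isCont_tendsto_compose[OF this elim] show ?case by (intro tendsto_scaleR tendsto_const)
    qed
  qed auto
  then have "\<forall>\<^sub>F n in sequentially. (\<integral>\<^sup>+x. norm (\<kappa> m x *\<^sub>R P m (u x) - \<kappa> m x *\<^sub>R P m (G n x)) \<partial>lborel) < ennreal (e/2)"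
    using \<open>e > 0\<close> by (intro order_tendstoD(2)) auto
  then obtain n where n: "(\<integral>\<^sup>+x. norm (\<kappa> m x *\<^sub>R P m (u x) - \<kappa> m x *\<^sub>R P m (G n x)) \<partial>lborel) < ennreal (e/2)"
    by (auto simp: eventually_sequentially)
  define w where "w x = \<kappa> m x *\<^sub>R P m (G n x)" for x
  show thesis
  proof (rule that[of w "cball 0 (real m + 1)"])
    show cw: "continuous_on UNIV w"
      unfolding w_def
      by (intro continuous_intros cont\<kappa> continuous_on_compose2[OF contP G(1)]) auto
    show "w x = 0" if "x \<notin> cball 0 (real m + 1)" for x
      using that by (simp add: w_def \<kappa>_def)
    have [measurable]: "w \<in> borel_measurable borel" using cw by (rule borel_measurable_continuous_onI)
    have "L1on UNIV (\<lambda>x. u x - w x) \<le> L1on UNIV (\<lambda>x. u x - \<kappa> m x *\<^sub>R P m (u x)) +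
        L1on UNIV (\<lambda>x. \<kappa> m x *\<^sub>R P m (u x) - w x)"
      by (rule L1on_diff_triangle) measurable
    also have "\<dots> < ennreal (e/2) + ennreal (e/2)"
      using m n by (intro add_strict_mono) (auto simp: L1on_def w_def)
    also have "\<dots> = ennreal e" using \<open>e > 0\<close> by (simp flip: ennreal_plus)
    finally show "L1on UNIV (\<lambda>x. u x - w x) < ennreal e" .
  qed simp
qed

text \<open>Three-epsilon argument with a continuous \<open>w\<close> of compact support. Moving
  \<open>w\<close> by less than 1 changes it only inside \<open>cball 0 (R + 1)\<close>, and there
  by little, by uniform continuity.\<close>

lemma L1_translation_continuous:
  fixes u :: "'a::euclidean_space \<Rightarrow> 'b::euclidean_space"
  assumes [measurable]: "u \<in> borel_measurable borel" and fin: "L1on UNIV u < \<infinity>" and "e > 0"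
  obtains \<tau> where "\<tau> > 0" "\<And>z. norm z < \<tau> \<Longrightarrow> L1on UNIV (\<lambda>x. u (x - z) - u x) < ennreal e"
proof -
  obtain w K where w: "continuous_on UNIV w" "compact K" "\<And>x. x \<notin> K \<Longrightarrow> w x = 0"
    "L1on UNIV (\<lambda>x. u x - w x) < ennreal (e/3)"
    using L1_dense_continuous[OF assms(1,2), of "e/3"] \<open>e > 0\<close> by (auto simp: )
  have [measurable]: "w \<in> borel_measurable borel" using w(1) by (rule borel_measurable_continuous_onI)
  obtain R where R: "K \<subseteq> cball 0 R"
    using compact_imp_bounded[OF w(2)] by (auto simp: bounded_iff subset_iff)
  define \<mu> where "\<mu> = measure lborel (cball (0::'a) (R + 1))"
  have em: "emeasure lborel (cball (0::'a) (R + 1)) = ennreal \<mu>"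
    unfolding \<mu>_def by (rule emeasure_eq_ennreal_measure) (use emeasure_lborel_cball_finite[of 0 "R+1"] in \<open>auto simp: less_top\<close>)
  have \<mu>: "\<mu> \<ge> 0" by (simp add: \<mu>_def)
  have "uniformly_continuous_on (cball 0 (R + 2)) w"
    by (rule compact_uniformly_continuous) (auto intro: continuous_on_subset[OF w(1)])
  \<comment> \<open>Multiplied by the volume \<open>\<mu>\<close> of that ball this stays below e/3;
    the added 1 spares a proof that the volume is positive.\<close>
  moreover have "e / (6 * (\<mu> + 1)) > 0" using \<open>e > 0\<close> \<mu> by simp
  ultimately obtain d where d: "d > 0" "\<And>x y. x \<in> cball 0 (R + 2) \<Longrightarrow> y \<in> cball 0 (R + 2) \<Longrightarrow> dist y x < d
     \<Longrightarrow> dist (w y) (w x) < e / (6 * (\<mu> + 1))"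
    unfolding uniformly_continuous_on_def by metis
  show thesis
  proof (rule that[of "min d 1"])
    show "min d 1 > 0" using d by simp
    fix z :: 'a assume z: "norm z < min d 1"
    have pt: "norm (w (x - z) - w x) \<le> e / (6 * (\<mu> + 1)) * indicator (cball 0 (R + 1)) x" for x
    proof (cases "x \<in> cball 0 (R + 1)")
      case True
      have "norm (x - z) \<le> norm x + norm z" by (rule norm_triangle_ineq4)
      then have "dist (w (x - z)) (w x) < e / (6 * (\<mu> + 1))"
        using True z by (intro d(2)) (auto simp: dist_norm norm_minus_commute)
      then show ?thesis using True by (simp add: dist_norm)
    next
      case False
      have "norm x - norm z \<le> norm (x - z)" by (rule norm_triangle_ineq2)
      then have "x - z \<notin> K" "x \<notin> K" using False z R by (auto simp: subset_iff)
      then show ?thesis using w(3) False by simp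
    qed
    have 2: "L1on UNIV (\<lambda>x. w (x - z) - w x) < ennreal (e/3)"
    proof -
      have "L1on UNIV (\<lambda>x. w (x - z) - w x) \<le> (\<integral>\<^sup>+x. ennreal (e / (6 * (\<mu> + 1))) * indicator (cball 0 (R + 1)) (x::'a) \<partial>lborel)"
        unfolding L1on_def
      proof (intro nn_integral_mono)
        fix x :: 'a
        show "ennreal (norm (w (x - z) - w x)) * indicator UNIV x \<le>
            ennreal (e / (6 * (\<mu> + 1))) * indicator (cball 0 (R + 1)) x"
          using pt[of x] by (cases "x \<in> cball 0 (R + 1)") (auto intro!: ennreal_leI)
      qed
      also have "\<dots> = ennreal (e / (6 * (\<mu> + 1))) * ennreal \<mu>"
        by (simp add: nn_integral_cmult_indicator em)
      also have "\<dots> = ennreal (e * \<mu> / (6 * (\<mu> + 1)))"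
        using \<mu> \<open>e > 0\<close> by (simp flip: ennreal_mult)
      also have "\<dots> < ennreal (e/3)"
      proof (rule ennreal_lessI)
        have "e * \<mu> < 2 * e * (\<mu> + 1)" using \<mu> \<open>e > 0\<close> by (simp add: algebra_simps add_strict_increasing)
        then show "e * \<mu> / (6 * (\<mu> + 1)) < e/3" using \<mu> by (simp add: field_simps)
      qed (use \<open>e > 0\<close> in simp)
      finally show ?thesis .
    qed
    have 1: "L1on UNIV (\<lambda>x. u (x - z) - w (x - z)) = L1on UNIV (\<lambda>x. u x - w x)"
      unfolding L1on_def using nn_integral_translate[of "\<lambda>x. ennreal (norm (u x - w x))" "-z"] by simp
    have "L1on UNIV (\<lambda>x. u (x - z) - u x) \<le> L1on UNIV (\<lambda>x. u (x - z) - w (x - z)) + L1on UNIV (\<lambda>x. w (x - z) - u x)"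
      by (rule L1on_diff_triangle) measurable
    also have "L1on UNIV (\<lambda>x. w (x - z) - u x) \<le> L1on UNIV (\<lambda>x. w (x - z) - w x) + L1on UNIV (\<lambda>x. w x - u x)"
      by (rule L1on_diff_triangle) measurable
    also have "L1on UNIV (\<lambda>x. w x - u x) = L1on UNIV (\<lambda>x. u x - w x)"
      by (rule L1on_cong) (rule norm_minus_commute)
    also have "L1on UNIV (\<lambda>x. u (x - z) - w (x - z)) + (L1on UNIV (\<lambda>x. w (x - z) - w x) + L1on UNIV (\<lambda>x. u x - w x))
      < ennreal (e/3) + (ennreal (e/3) + ennreal (e/3))"
      using 1 2 w(4) by (intro add_strict_mono) auto
    also have "\<dots> = ennreal e" using \<open>e > 0\<close> by (simp flip: ennreal_plus)
    finally show "L1on UNIV (\<lambda>x. u (x - z) - u x) < ennreal e" by (simp add: add_left_mono)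
  qed
qed

section \<open>Weak gradients of Borel functions\<close>

definition C1_on :: "'a::euclidean_space set \<Rightarrow> ('a \<Rightarrow> real) \<Rightarrow> ('a \<Rightarrow> 'a) \<Rightarrow> bool" where
  "C1_on N v v' \<longleftrightarrow> open N \<and> (\<forall>x\<in>N. GDERIV v x :> v' x) \<and> continuous_on N v'"

lemma C1_onD:
  assumes "C1_on N v v'"
  shows "open N" "x \<in> N \<Longrightarrow> GDERIV v x :> v' x" "continuous_on N v'" "continuous_on N v"
  using assms GDERIV_isCont unfolding C1_on_def by (auto intro!: continuous_at_imp_continuous_on)

lemma C1_on_subset: "C1_on N v v' \<Longrightarrow> open M \<Longrightarrow> M \<subseteq> N \<Longrightarrow> C1_on M v v'"
  unfolding C1_on_def by (auto intro: continuous_on_subset)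

lemma C1_on_mult:
  assumes "C1_on N v v'" "C1_on N w w'"
  shows "C1_on N (\<lambda>x. v x * w x) (\<lambda>x. v x *\<^sub>R w' x + w x *\<^sub>R v' x)"
  using C1_onD[OF assms(1)] C1_onD[OF assms(2)]
  by (auto simp: C1_on_def intro!: GDERIV_mult continuous_intros)

lemma GDERIV_cong_open:
  assumes "open N" "x \<in> N" "\<And>y. y \<in> N \<Longrightarrow> f y = g y"
  shows "GDERIV f x :> D \<longleftrightarrow> GDERIV g x :> D"
  unfolding gderiv_def
  using assms has_derivative_transform_within_open[of f _ x UNIV N g]
    has_derivative_transform_within_open[of g _ x UNIV N f] by auto

lemma C1_on_zero_extension:
  assumes f: "C1_on N f f'" and K: "compact K" "K \<subseteq> N" and z: "\<And>x. x \<in> N \<Longrightarrow> x \<notin> K \<Longrightarrow> f x = 0"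
  shows "C1_on UNIV (\<lambda>x. if x \<in> N then f x else 0) (\<lambda>x. if x \<in> N then f' x else 0)"
    "\<And>x. x \<in> N \<Longrightarrow> x \<notin> K \<Longrightarrow> f' x = 0"
proof -
  have op: "open N" "open (- K)" using C1_onD(1)[OF f] K by (auto simp: compact_imp_closed open_Compl)
  show z': "f' x = 0" if "x \<in> N" "x \<notin> K" for x
  proof -
    have "GDERIV f x :> f' x" using C1_onD(2)[OF f] that by auto
    moreover have "GDERIV f x :> 0"
      by (subst GDERIV_cong_open[of "N \<inter> - K" _ _ "\<lambda>_. 0"]) (use op that z in \<open>auto intro: GDERIV_const\<close>)
    ultimately show ?thesis by (rule GDERIV_unique)
  qed
  have "GDERIV (\<lambda>x. if x \<in> N then f x else 0) x :> (if x \<in> N then f' x else 0)" for x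
  proof (cases "x \<in> N")
    case True
    then show ?thesis
      by (subst GDERIV_cong_open[of N _ _ f]) (use op f in \<open>auto intro: C1_onD\<close>)
  next
    case False
    then have "x \<in> - K" using K by auto
    then show ?thesis
      by (subst GDERIV_cong_open[of "- K" _ _ "\<lambda>_. 0"]) (use op z False in \<open>auto intro: GDERIV_const\<close>)
  qed
  moreover have "continuous_on (N \<union> - K) (\<lambda>x. if x \<in> N then f' x else 0)"
  proof (rule continuous_on_open_Un)
    show "continuous_on N (\<lambda>x. if x \<in> N then f' x else 0)"
      using C1_onD(3)[OF f] by (simp cong: continuous_on_cong)
    have "continuous_on (- K) (\<lambda>x. 0 :: 'a)" by simp
    then show "continuous_on (- K) (\<lambda>x. if x \<in> N then f' x else 0)"
      by (rule continuous_on_eq) (use z' in auto)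
  qed (use op in auto)
  moreover have "N \<union> - K = UNIV" using K by auto
  ultimately show "C1_on UNIV (\<lambda>x. if x \<in> N then f x else 0) (\<lambda>x. if x \<in> N then f' x else 0)"
    by (auto simp: C1_on_def)
qed

lemma C1_mean_value:
  assumes "C1_on N v v'" "closed_segment x y \<subseteq> N" "\<And>z. z \<in> closed_segment x y \<Longrightarrow> norm (v' z) \<le> M"
  shows "\<bar>v x - v y\<bar> \<le> M * norm (x - y)"
proof -
  have "norm (v x - v y) \<le> M * norm (x - y)"
  proof (rule differentiable_bound[of "closed_segment x y" v "\<lambda>z h. h \<bullet> v' z"])
    show "(v has_derivative (\<lambda>h. h \<bullet> v' z)) (at z within closed_segment x y)" if "z \<in> closed_segment x y" for z
      using C1_onD(2)[OF assms(1), of z] assms(2) that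
      by (auto simp: gderiv_def intro: has_derivative_at_withinI)
    show "onorm (\<lambda>h. h \<bullet> v' z) \<le> M" if "z \<in> closed_segment x y" for z
    proof (rule onorm_bound)
      show "0 \<le> M" using assms(3)[OF that] norm_ge_zero[of "v' z"] by linarith
      show "norm (h \<bullet> v' z) \<le> M * norm h" for h
        using Cauchy_Schwarz_ineq2[of h "v' z"] mult_left_mono[OF assms(3)[OF that], of "norm h"]
        by (simp add: mult.commute)
    qed
  qed auto
  then show ?thesis by simp
qed

text \<open>The integral of \<open>(f (x + t b) - f x) / t\<close> vanishes by translation invariance; let \<open>t\<close> tend to 0.\<close>

lemma integral_gradient_eq_0:
  fixes f :: "'a::euclidean_space \<Rightarrow> real"
  assumes f: "C1_on UNIV f f'" and K: "compact K" and z: "\<And>x. x \<notin> K \<Longrightarrow> f x = 0"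
  shows "(\<integral>x. f' x \<partial>lborel) = 0"
proof -
  have cf: "continuous_on UNIV f" and cf': "continuous_on UNIV f'" using C1_onD[OF f] by auto
  have [measurable]: "f \<in> borel_measurable borel" "f' \<in> borel_measurable borel"
    using cf cf' by (auto intro: borel_measurable_continuous_onI)
  have z': "f' x = 0" if "x \<notin> K" for x
    using C1_on_zero_extension(2)[OF f K _ z] that by auto
  obtain R where R: "\<And>x. x \<in> K \<Longrightarrow> norm x \<le> R"
    using compact_imp_bounded[OF K] by (auto simp: bounded_iff)
  have "compact (f' ` K)" by (rule compact_continuous_image[OF continuous_on_subset[OF cf'] K]) auto
  then obtain M0 where "\<forall>x\<in>K. norm (f' x) \<le> M0"
    by (auto dest!: compact_imp_bounded simp: bounded_iff)
  then have M0: "\<And>x. x \<in> K \<Longrightarrow> norm (f' x) \<le> M0" by blast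
  define M where "M = max M0 0"
  have M: "norm (f' x) \<le> M" "0 \<le> M" for x using M0[of x] z'[of x] by (auto simp: M_def le_max_iff_disj)
  have int: "integrable lborel h" if "continuous_on UNIV h" "\<And>x. x \<notin> K \<Longrightarrow> h x = 0"
    for h :: "'a \<Rightarrow> 'c::euclidean_space"
  proof -
    have "integrable lborel (\<lambda>x. indicator K x *\<^sub>R h x)"
      by (rule borel_integrable_compact[OF K continuous_on_subset[OF that(1)]]) auto
    also have "(\<lambda>x. indicator K x *\<^sub>R h x) = h" using that(2) by (auto simp: indicator_def)
    finally show ?thesis .
  qed
  have intf: "integrable lborel f" and intf': "integrable lborel f'"
    using int cf cf' z z' by auto
  show ?thesis
  proof (rule euclidean_eqI, unfold inner_zero_left)
    fix b :: 'a assume b: "b \<in> Basis"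
    define t where "t n = 1 / real (Suc n)" for n
    have t: "t n > 0" "t n \<le> 1" for n by (auto simp: t_def)
    have t0: "t \<longlonglongrightarrow> 0" unfolding t_def by (rule LIMSEQ_Suc[OF lim_1_over_n])
    define s where "s n x = (f (x + t n *\<^sub>R b) - f x) / t n" for n x
    have "(\<lambda>n. integral\<^sup>L lborel (s n)) \<longlonglongrightarrow> (\<integral>x. f' x \<bullet> b \<partial>lborel)"
    proof (rule integral_dominated_convergence[where w="\<lambda>x. M * indicator (cball 0 (R + 1)) x"])
      show "(\<lambda>x. f' x \<bullet> b) \<in> borel_measurable lborel" "s n \<in> borel_measurable lborel" for n
        unfolding s_def by measurable
      show "integrable lborel (\<lambda>x. M * indicator (cball 0 (R + 1)) (x::'a))"
        using borel_integrable_compact[of "cball (0::'a) (R + 1)" "\<lambda>_. M"] by (simp add: mult.commute)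
      show "AE x in lborel. (\<lambda>n. s n x) \<longlonglongrightarrow> f' x \<bullet> b"
      proof (rule AE_I2)
        fix x
        have "((\<lambda>u. f (x + u *\<^sub>R b)) has_derivative (\<lambda>h. (h *\<^sub>R b) \<bullet> f' x)) (at 0)"
          by (rule has_derivative_compose[where f="\<lambda>u. x + u *\<^sub>R b" and g=f, simplified])
            (use C1_onD(2)[OF f] in \<open>auto simp: gderiv_def intro!: derivative_eq_intros\<close>)
        then have "DERIV (\<lambda>u. f (x + u *\<^sub>R b)) 0 :> f' x \<bullet> b"
          by (simp add: has_field_derivative_def inner_commute mult_commute_abs)
        then have "((\<lambda>h. (f (x + h *\<^sub>R b) - f x) / h) \<longlongrightarrow> f' x \<bullet> b) (at 0)"
          by (simp add: DERIV_def)
        then show "(\<lambda>n. s n x) \<longlonglongrightarrow> f' x \<bullet> b"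
          unfolding s_def
          by (rule filterlim_compose) (use t t0 in \<open>auto simp: filterlim_at intro!: always_eventually less_imp_neq[THEN not_sym]\<close>)
      qed
      show "AE x in lborel. norm (s n x) \<le> M * indicator (cball 0 (R + 1)) x" for n
      proof (rule AE_I2)
        fix x
        show "norm (s n x) \<le> M * indicator (cball 0 (R + 1)) x"
        proof (cases "x \<in> cball 0 (R + 1)")
          case True
          have "\<bar>f (x + t n *\<^sub>R b) - f x\<bar> \<le> M * norm (x + t n *\<^sub>R b - x)"
            by (rule C1_mean_value[OF f]) (use M in auto)
          also have "\<dots> = M * t n" using b t(1)[of n] by simp
          finally show ?thesis using True t(1)[of n] by (simp add: s_def divide_simps)
        next
          case False
          have "norm x \<le> norm (x + t n *\<^sub>R b) + norm (t n *\<^sub>R b)" by (metis add_diff_cancel_right' norm_triangle_ineq4)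
          then have "x + t n *\<^sub>R b \<notin> K" "x \<notin> K" using False R[of x] R[of "x + t n *\<^sub>R b"] b t[of n] by auto
          then show ?thesis using False z by (simp add: s_def)
        qed
      qed
    qed
    moreover have "integral\<^sup>L lborel (s n) = 0" for n
    proof -
      have int2: "integrable lborel (\<lambda>x. f (x + t n *\<^sub>R b))"
      proof -
        have "integrable (distr lborel borel ((+) (t n *\<^sub>R b))) f" using intf by (simp add: lborel_distr_plus)
        then show ?thesis by (subst (asm) integrable_distr_eq) (auto simp: add.commute)
      qed
      have "integral\<^sup>L lborel (s n) = ((\<integral>x. f (x + t n *\<^sub>R b) \<partial>lborel) - (\<integral>x. f x \<partial>lborel)) / t n"
        unfolding s_def using int2 intf by simp
      also have "\<dots> = 0" by (simp add: integral_translate)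
      finally show ?thesis .
    qed
    ultimately have "(\<integral>x. f' x \<bullet> b \<partial>lborel) = 0" by (simp add: LIMSEQ_const_iff)
    then show "(\<integral>x. f' x \<partial>lborel) \<bullet> b = 0"
      by (subst integral_inner_left[OF intf', symmetric])
  qed
qed

section \<open>Weak gradients: definition, limits, locality\<close>

text \<open>The working version of \<open>has_weak_gradient\<close>: Borel representatives on the
  whole space and integrals against \<open>lborel\<close>. Integrating over the whole space is
  harmless because test functions and their gradients vanish off a compact subset of
  \<open>U\<close>; the values outside \<open>U\<close> stay arbitrary.\<close>

definition weak_grad :: "'a::euclidean_space set \<Rightarrow> ('a \<Rightarrow> real) \<Rightarrow> ('a \<Rightarrow> 'a) \<Rightarrow> bool" where
  "weak_grad U u g \<longleftrightarrow> open U \<and> u \<in> borel_measurable borel \<and> g \<in> borel_measurable borel \<and>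
     (\<forall>K\<subseteq>U. compact K \<longrightarrow> L1on K u < \<infinity> \<and> L1on K g < \<infinity>) \<and>
     (\<forall>\<eta>\<in>test_functions U. \<forall>D. (\<forall>x. GDERIV \<eta> x :> D x) \<longrightarrow>
        (\<integral>x. u x *\<^sub>R D x \<partial>lborel) = - (\<integral>x. \<eta> x *\<^sub>R g x \<partial>lborel))"

lemma weak_gradD:
  assumes "weak_grad U u g"
  shows "open U" "u \<in> borel_measurable borel" "g \<in> borel_measurable borel"
    "\<And>K. compact K \<Longrightarrow> K \<subseteq> U \<Longrightarrow> L1on K u < \<infinity>" "\<And>K. compact K \<Longrightarrow> K \<subseteq> U \<Longrightarrow> L1on K g < \<infinity>"
    "\<And>\<eta> D. \<eta> \<in> test_functions U \<Longrightarrow> (\<And>x. GDERIV \<eta> x :> D x) \<Longrightarrow>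
        (\<integral>x. u x *\<^sub>R D x \<partial>lborel) = - (\<integral>x. \<eta> x *\<^sub>R g x \<partial>lborel)"
  using assms unfolding weak_grad_def by blast+

lemma test_functionE:
  assumes "\<eta> \<in> test_functions U" "\<And>x. GDERIV \<eta> x :> D x"
  obtains K M where "compact K" "K \<subseteq> U" "\<And>x. x \<notin> K \<Longrightarrow> \<eta> x = 0" "\<And>x. x \<notin> K \<Longrightarrow> D x = 0"
    "C1_on UNIV \<eta> D" "0 \<le> M" "\<And>x. \<bar>\<eta> x\<bar> \<le> M" "\<And>x. norm (D x) \<le> M" "smooth \<eta>"
    "\<eta> \<in> borel_measurable borel" "D \<in> borel_measurable borel"
proof -
  obtain K where K: "compact K" "K \<subseteq> U" "\<And>x. x \<notin> K \<Longrightarrow> \<eta> x = 0" and s: "smooth \<eta>"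
    using assms(1) unfolding test_functions_def by blast
  have cD: "continuous_on UNIV D" using smooth_gradient_continuous[OF s assms(2)] .
  have c\<eta>: "continuous_on UNIV \<eta>" using smooth_continuous[OF s] .
  have C: "C1_on UNIV \<eta> D" using cD assms(2) by (simp add: C1_on_def)
  have z: "D x = 0" if "x \<notin> K" for x using C1_on_zero_extension(2)[OF C K(1) _ K(3)] that by auto
  have "compact (D ` K)" "compact (\<eta> ` K)"
    using compact_continuous_image[OF continuous_on_subset[OF cD] K(1)]
      compact_continuous_image[OF continuous_on_subset[OF c\<eta>] K(1)] by auto
  then obtain M1 M2 where "\<forall>x\<in>K. norm (D x) \<le> M1" "\<forall>x\<in>K. \<bar>\<eta> x\<bar> \<le> M2"
    by (auto dest!: compact_imp_bounded simp: bounded_iff)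
  then have M: "norm (D x) \<le> max 0 (max M1 M2)" "\<bar>\<eta> x\<bar> \<le> max 0 (max M1 M2)" for x
    using z[of x] K(3)[of x] by (cases "x \<in> K"; force simp: le_max_iff_disj)+
  have bm: "\<eta> \<in> borel_measurable borel" "D \<in> borel_measurable borel"
    using cD c\<eta> by (auto intro: borel_measurable_continuous_onI)
  have M0: "0 \<le> max 0 (max M1 M2)" by simp
  show thesis
    by (rule that[OF K z C M0 M(2,1) s bm])
qed

lemma test_functions_mono: "V \<subseteq> U \<Longrightarrow> test_functions V \<subseteq> test_functions U"
  unfolding test_functions_def by (auto intro: subset_trans)

lemma weak_grad_subset:
  assumes w: "weak_grad U u g" and V: "open V" "V \<subseteq> U"
  shows "weak_grad V u g"
  unfolding weak_grad_def
proof (intro conjI allI impI ballI)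
  fix \<eta> D assume t: "\<eta> \<in> test_functions V" "\<forall>x. GDERIV \<eta> x :> D x"
  have t2: "\<And>x. GDERIV \<eta> x :> D x" using t(2) by blast
  show "(\<integral>x. u x *\<^sub>R D x \<partial>lborel) = - (\<integral>x. \<eta> x *\<^sub>R g x \<partial>lborel)"
    using weak_gradD(6)[OF w _ t2] t(1) test_functions_mono[OF V(2)] by blast
next
  fix K assume K: "K \<subseteq> V" "compact K"
  then have "K \<subseteq> U" using V by auto
  then show "L1on K u < \<infinity>" "L1on K g < \<infinity>" using weak_gradD(4,5)[OF w K(2)] by auto
qed (use V weak_gradD(2,3)[OF w] in auto)

lemma C1_weak_grad:
  assumes v: "C1_on N v v'"
  shows "weak_grad N (\<lambda>x. if x \<in> N then v x else 0) (\<lambda>x. if x \<in> N then v' x else 0)"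
proof -
  have op: "open N" and cv: "continuous_on N v" "continuous_on N v'" using C1_onD[OF v] by auto
  then have N: "N \<in> sets borel" by simp
  have m: "(\<lambda>x. if x \<in> N then v x else 0) \<in> borel_measurable borel"
       "(\<lambda>x. if x \<in> N then v' x else 0) \<in> borel_measurable borel"
    using borel_measurable_continuous_on_indicator[OF N cv(1)] borel_measurable_continuous_on_indicator[OF N cv(2)]
    by (auto simp: indicator_scaleR_eq_if simp del: real_scaleR_def)
  show ?thesis
    unfolding weak_grad_def
  proof (intro conjI op m allI impI ballI)
    fix K assume K: "K \<subseteq> N" "compact K"
    have "bounded (v ` K)" "bounded (v' ` K)"
      using compact_continuous_image[OF continuous_on_subset[OF cv(1) K(1)] K(2)]
       compact_continuous_image[OF continuous_on_subset[OF cv(2) K(1)] K(2)] compact_imp_bounded by auto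
    then obtain M1 M2 where "\<forall>x\<in>K. norm (v x) \<le> M1" "\<forall>x\<in>K. norm (v' x) \<le> M2"
      by (auto simp: bounded_iff)
    then show "L1on K (\<lambda>x. if x \<in> N then v x else 0) < \<infinity>" "L1on K (\<lambda>x. if x \<in> N then v' x else 0) < \<infinity>"
      using K L1on_finite_if_bounded[of K "\<lambda>x. if x \<in> N then v x else 0" M1]
        L1on_finite_if_bounded[of K "\<lambda>x. if x \<in> N then v' x else 0" M2]
      by (auto simp: compact_imp_bounded subset_iff)
  next
    fix \<eta> D assume "\<eta> \<in> test_functions N" "\<forall>x. GDERIV \<eta> x :> D x"
    then obtain K M where K: "compact K" "K \<subseteq> N" "\<And>x. x \<notin> K \<Longrightarrow> \<eta> x = 0" "\<And>x. x \<notin> K \<Longrightarrow> D x = 0"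
      and C: "C1_on UNIV \<eta> D" using test_functionE by metis
    have CN: "C1_on N \<eta> D" using C op by (rule C1_on_subset) auto
    have P: "C1_on N (\<lambda>x. v x * \<eta> x) (\<lambda>x. v x *\<^sub>R D x + \<eta> x *\<^sub>R v' x)"
      using C1_on_mult[OF v CN] .
    have int: "integrable lborel h" if "continuous_on N h" "\<And>x. x \<notin> K \<Longrightarrow> h x = 0"
      for h :: "'a \<Rightarrow> 'a"
    proof -
      have "integrable lborel (\<lambda>x. indicator K x *\<^sub>R h x)"
        by (rule borel_integrable_compact[OF K(1) continuous_on_subset[OF that(1) K(2)]])
      also have "(\<lambda>x. indicator K x *\<^sub>R h x) = h" using that(2) by (auto simp: indicator_def)
      finally show ?thesis .
    qed
    have cN: "continuous_on N D" "continuous_on N \<eta>" using C1_onD[OF CN] by auto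
    have i1: "integrable lborel (\<lambda>x. (if x \<in> N then v x else 0) *\<^sub>R D x)"
      by (rule int) (use K cv cN in \<open>auto cong: continuous_on_cong intro!: continuous_intros\<close>)
    have i2: "integrable lborel (\<lambda>x. \<eta> x *\<^sub>R (if x \<in> N then v' x else 0))"
      by (rule int) (use K cv cN in \<open>auto cong: continuous_on_cong intro!: continuous_intros\<close>)
    have "0 = (\<integral>x. (if x \<in> N then v x *\<^sub>R D x + \<eta> x *\<^sub>R v' x else 0) \<partial>lborel)"
      by (rule integral_gradient_eq_0[OF C1_on_zero_extension(1)[OF P K(1,2)] K(1), symmetric])
        (use K in auto)
    also have "\<dots> = (\<integral>x. (if x \<in> N then v x else 0) *\<^sub>R D x + \<eta> x *\<^sub>R (if x \<in> N then v' x else 0) \<partial>lborel)"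
      by (intro Bochner_Integration.integral_cong) auto
    also have "\<dots> = (\<integral>x. (if x \<in> N then v x else 0) *\<^sub>R D x \<partial>lborel) + (\<integral>x. \<eta> x *\<^sub>R (if x \<in> N then v' x else 0) \<partial>lborel)"
      by (rule Bochner_Integration.integral_add[OF i1 i2])
    finally show "(\<integral>x. (if x \<in> N then v x else 0) *\<^sub>R D x \<partial>lborel) = - (\<integral>x. \<eta> x *\<^sub>R (if x \<in> N then v' x else 0) \<partial>lborel)"
      by (simp add: eq_neg_iff_add_eq_0)
  qed
qed

lemma weak_grad_integrable:
  assumes w: "weak_grad U u g" and t: "\<eta> \<in> test_functions U" "\<And>x. GDERIV \<eta> x :> D x"
  shows "integrable lborel (\<lambda>x. u x *\<^sub>R D x)" "integrable lborel (\<lambda>x. \<eta> x *\<^sub>R g x)"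
proof -
  note [measurable] = weak_gradD(2,3)[OF w]
  obtain K M where K: "compact K" "K \<subseteq> U" "\<And>x. x \<notin> K \<Longrightarrow> \<eta> x = 0" "\<And>x. x \<notin> K \<Longrightarrow> D x = 0"
    and M: "0 \<le> M" "\<And>x. \<bar>\<eta> x\<bar> \<le> M" "\<And>x. norm (D x) \<le> M"
    and [measurable]: "\<eta> \<in> borel_measurable borel" "D \<in> borel_measurable borel"
    using test_functionE[OF t] by metis
  have KB: "K \<in> sets borel" using K by (simp add: borel_compact)
  show "integrable lborel (\<lambda>x. u x *\<^sub>R D x)"
    by (rule integral_dominated_L1on(1)[where f=u and M=M and K=K])
      (use K M KB weak_gradD(4)[OF w] in \<open>auto simp: mult.commute[of M] intro!: mult_left_mono\<close>)
  show "integrable lborel (\<lambda>x. \<eta> x *\<^sub>R g x)"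
    by (rule integral_dominated_L1on(1)[where f=g and M=M and K=K])
      (use K M KB weak_gradD(5)[OF w] in \<open>auto intro!: mult_right_mono\<close>)
qed

text \<open>For a fixed test function both sides of the defining identity are continuous in L^1 of
  its support, so local L^1 limits suffice. The approximants need a weak gradient only in a
  neighbourhood \<open>V\<close> of the compact set, and \<open>V\<close> may vary with it; this
  admits mollifications, which are differentiable only away from the boundary.\<close>

lemma weak_grad_limit:
  assumes op: "open U" and [measurable]: "u \<in> borel_measurable borel" "g \<in> borel_measurable borel"
    and ap: "\<And>K e. compact K \<Longrightarrow> K \<subseteq> U \<Longrightarrow> e > 0 \<Longrightarrow> \<exists>V v v'. weak_grad V v v' \<and> K \<subseteq> V \<and>
       L1on K (\<lambda>x. u x - v x) < ennreal e \<and> L1on K (\<lambda>x. g x - v' x) < ennreal e"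
  shows "weak_grad U u g"
  unfolding weak_grad_def
proof (intro conjI op assms allI impI ballI)
  have "L1on K u < \<infinity> \<and> L1on K g < \<infinity>" if K: "K \<subseteq> U" "compact K" for K
  proof -
    obtain V v v' where w: "weak_grad V v v'" "K \<subseteq> V"
       "L1on K (\<lambda>x. u x - v x) < ennreal 1" "L1on K (\<lambda>x. g x - v' x) < ennreal 1" using ap[OF K(2,1), of 1] by auto
    note [measurable] = weak_gradD(2,3)[OF w(1)]
    have KB: "K \<in> sets borel" using K by (simp add: borel_compact)
    have "L1on K u \<le> L1on K (\<lambda>x. u x - v x) + L1on K v"
      by (rule L1on_triangle) (use KB norm_triangle_sub in \<open>auto simp: add.commute\<close>)
    moreover have "L1on K g \<le> L1on K (\<lambda>x. g x - v' x) + L1on K v'"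
      by (rule L1on_triangle) (use KB norm_triangle_sub in \<open>auto simp: add.commute\<close>)
    moreover have "L1on K (\<lambda>x. u x - v x) < \<infinity>" "L1on K (\<lambda>x. g x - v' x) < \<infinity>"
      using w(3,4) by (auto intro: less_le_trans)
    moreover have "L1on K (\<lambda>x. u x - v x) + L1on K v < \<infinity>" "L1on K (\<lambda>x. g x - v' x) + L1on K v' < \<infinity>"
      using weak_gradD(4,5)[OF w(1) K(2) w(2)] calculation(3,4) by simp_all
    ultimately show ?thesis by (blast intro: le_less_trans)
  qed
  then show fin: "L1on K u < \<infinity>" "L1on K g < \<infinity>" if "K \<subseteq> U" "compact K" for K using that by auto
  fix \<eta> D assume t: "\<eta> \<in> test_functions U" "\<forall>x. GDERIV \<eta> x :> D x"
  then have t': "\<And>x. GDERIV \<eta> x :> D x" by auto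
  obtain K M where K: "compact K" "K \<subseteq> U" "\<And>x. x \<notin> K \<Longrightarrow> \<eta> x = 0" "\<And>x. x \<notin> K \<Longrightarrow> D x = 0"
    and M: "0 \<le> M" "\<And>x. \<bar>\<eta> x\<bar> \<le> M" "\<And>x. norm (D x) \<le> M"
    and [measurable]: "\<eta> \<in> borel_measurable borel" "D \<in> borel_measurable borel" and sm: "smooth \<eta>"
    using test_functionE[OF t(1) t'] by metis
  have KB[measurable]: "K \<in> sets borel" using K by (simp add: borel_compact)
  let ?I = "\<lambda>u. (\<integral>x. u x *\<^sub>R D x \<partial>lborel)" and ?J = "\<lambda>g. (\<integral>x. \<eta> x *\<^sub>R g x \<partial>lborel)"
  have "norm (?I u + ?J g) \<le> 0 + e" if "e > 0" for e
  proof -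
    \<comment> \<open>Each of the two integrals is off by at most M d, and 2 M d \<le> e.\<close>
    define d where "d = e / (2 * M + 1)"
    have d: "d > 0" using that M by (simp add: d_def)
    obtain V v v' where w: "weak_grad V v v'" "K \<subseteq> V"
       "L1on K (\<lambda>x. u x - v x) < ennreal d" "L1on K (\<lambda>x. g x - v' x) < ennreal d" using ap[OF K(1,2) d] by auto
    note [measurable] = weak_gradD(2,3)[OF w(1)]
    have tV: "\<eta> \<in> test_functions V" using K w(2) sm unfolding test_functions_def by blast
    note iv = weak_grad_integrable[OF w(1) tV t']
    have iu: "integrable lborel (\<lambda>x. (u x - v x) *\<^sub>R D x)"
      "ennreal (norm (?I (\<lambda>x. u x - v x))) \<le> ennreal M * L1on K (\<lambda>x. u x - v x)"
      by (rule integral_dominated_L1on[where f="\<lambda>x. u x - v x" and M=M and K=K];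
        (use K M w(3) in \<open>auto simp: mult.commute[of M] intro!: mult_left_mono intro: less_le_trans\<close>))+
    have ig: "integrable lborel (\<lambda>x. \<eta> x *\<^sub>R (g x - v' x))"
      "ennreal (norm (?J (\<lambda>x. g x - v' x))) \<le> ennreal M * L1on K (\<lambda>x. g x - v' x)"
      by (rule integral_dominated_L1on[where f="\<lambda>x. g x - v' x" and M=M and K=K];
        (use K M w(4) in \<open>auto intro!: mult_right_mono intro: less_le_trans\<close>))+
    have le: "norm (?I (\<lambda>x. u x - v x)) \<le> M * d" "norm (?J (\<lambda>x. g x - v' x)) \<le> M * d"
    proof -
      have "ennreal (norm (?I (\<lambda>x. u x - v x))) \<le> ennreal M * ennreal d"
        using iu(2) w(3) by (meson less_imp_le mult_left_mono order_trans zero_le)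
      then show "norm (?I (\<lambda>x. u x - v x)) \<le> M * d" using M(1) d by (simp flip: ennreal_mult)
      have "ennreal (norm (?J (\<lambda>x. g x - v' x))) \<le> ennreal M * ennreal d"
        using ig(2) w(4) by (meson less_imp_le mult_left_mono order_trans zero_le)
      then show "norm (?J (\<lambda>x. g x - v' x)) \<le> M * d" using M(1) d by (simp flip: ennreal_mult)
    qed
    have "?I u = ?I (\<lambda>x. u x - v x) + ?I v"
      by (subst Bochner_Integration.integral_add[OF iu(1) iv(1), symmetric]) (simp flip: scaleR_add_left)
    moreover have "?J g = ?J (\<lambda>x. g x - v' x) + ?J v'"
      by (subst Bochner_Integration.integral_add[OF ig(1) iv(2), symmetric]) (simp flip: scaleR_add_right)
    moreover have "?I v = - ?J v'" using weak_gradD(6)[OF w(1) tV t'] .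
    ultimately have "?I u + ?J g = ?I (\<lambda>x. u x - v x) + ?J (\<lambda>x. g x - v' x)" by simp
    then have "norm (?I u + ?J g) \<le> M * d + M * d"
      using norm_triangle_mono[OF le] by simp
    also have "\<dots> \<le> e"
    proof -
      have "d * (2 * M + 1) = e" using M(1) by (simp add: d_def)
      then show ?thesis using d by (simp add: algebra_simps)
    qed
    finally show ?thesis by simp
  qed
  then have "norm (?I u + ?J g) \<le> 0" by (rule field_le_epsilon)
  then show "?I u = - ?J g" by (simp add: eq_neg_iff_add_eq_0)
qed

text \<open>An instance of \<open>weak_grad_limit\<close> in which the approximant is the given
  function and both errors are zero.\<close>

lemma weak_grad_cong_AE:
  assumes w: "weak_grad U u g" and [measurable]: "u' \<in> borel_measurable borel" "g' \<in> borel_measurable borel"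
    and eq: "AE x in lborel. x \<in> U \<longrightarrow> u x = u' x \<and> g x = g' x"
  shows "weak_grad U u' g'"
proof (rule weak_grad_limit)
  fix K and e :: real assume K: "compact K" "K \<subseteq> U" "e > 0"
  have "L1on K (\<lambda>x. u' x - u x) = L1on K (\<lambda>x. 0::real)" "L1on K (\<lambda>x. g' x - g x) = L1on K (\<lambda>x. 0::'a)"
    using eq K by (auto intro!: L1on_cong_AE elim!: eventually_mono)
  then show "\<exists>V v v'. weak_grad V v v' \<and> K \<subseteq> V \<and> L1on K (\<lambda>x. u' x - v x) < ennreal e \<and> L1on K (\<lambda>x. g' x - v' x) < ennreal e"
    using w K by (intro exI[of _ U] exI[of _ u] exI[of _ g]) (auto simp: L1on_def)
qed (use weak_gradD(1-3)[OF w] in auto)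

lemma weak_grad_add:
  assumes "weak_grad U u g" "weak_grad U v h"
  shows "weak_grad U (\<lambda>x. u x + v x) (\<lambda>x. g x + h x)"
proof -
  note [measurable] = weak_gradD(2,3)[OF assms(1)] weak_gradD(2,3)[OF assms(2)]
  have fin: "L1on K (\<lambda>x. a x + b x) < \<infinity>" if "L1on K a < \<infinity>" "L1on K b < \<infinity>" "K \<in> sets borel"
    and [measurable]: "a \<in> borel_measurable borel" "b \<in> borel_measurable borel"
    for K and a b :: "'a \<Rightarrow> 'b::euclidean_space"
  proof -
    have "L1on K (\<lambda>x. a x + b x) \<le> L1on K a + L1on K b"
      by (rule L1on_triangle) (use that norm_triangle_ineq in auto)
    also have "\<dots> < \<infinity>" using that by simp
    finally show ?thesis .
  qed
  show ?thesis
    unfolding weak_grad_def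
  proof (intro conjI allI impI ballI)
    fix \<eta> D assume t: "\<eta> \<in> test_functions U" "\<forall>x. GDERIV \<eta> x :> D x"
    have t2: "\<And>x. GDERIV \<eta> x :> D x" using t(2) by blast
    show "(\<integral>x. (u x + v x) *\<^sub>R D x \<partial>lborel) = - (\<integral>x. \<eta> x *\<^sub>R (g x + h x) \<partial>lborel)"
      by (simp add: scaleR_add_left scaleR_add_right weak_grad_integrable[OF assms(1) t(1) t2]
          weak_grad_integrable[OF assms(2) t(1) t2] weak_gradD(6)[OF assms(1) t(1) t2] weak_gradD(6)[OF assms(2) t(1) t2])
  qed (use weak_gradD(1-5)[OF assms(1)] weak_gradD(1-5)[OF assms(2)] in \<open>auto simp: borel_compact fin[unfolded infinity_ennreal_def]\<close>)
qed

lemma weak_grad_const: "open U \<Longrightarrow> weak_grad U (\<lambda>x. c) (\<lambda>x. 0)"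
proof (rule weak_grad_cong_AE)
  assume "open U"
  then have "C1_on U (\<lambda>x. c) (\<lambda>x. 0)" by (auto simp: C1_on_def intro: GDERIV_const)
  then show "weak_grad U (\<lambda>x. if x \<in> U then c else 0) (\<lambda>x. if x \<in> U then 0 else 0)" by (rule C1_weak_grad)
qed auto

lemma weak_grad_cmult:
  assumes "weak_grad U u g"
  shows "weak_grad U (\<lambda>x. c * u x) (\<lambda>x. c *\<^sub>R g x)"
proof -
  note [measurable] = weak_gradD(2,3)[OF assms(1)]
  have "L1on K (\<lambda>x. c * u x) = ennreal \<bar>c\<bar> * L1on K u" "L1on K (\<lambda>x. c *\<^sub>R g x) = ennreal \<bar>c\<bar> * L1on K g"
    if "compact K" for K
    using that by (auto simp: borel_compact L1on_cmult L1on_cmult[of u, simplified])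
  note L = this
  show ?thesis
    unfolding weak_grad_def
  proof (intro conjI allI impI ballI)
    fix \<eta> D assume t: "\<eta> \<in> test_functions U" "\<forall>x. GDERIV \<eta> x :> D x"
    have t2: "\<And>x. GDERIV \<eta> x :> D x" using t(2) by blast
    have "(\<integral>x. (c * u x) *\<^sub>R D x \<partial>lborel) = c *\<^sub>R (\<integral>x. u x *\<^sub>R D x \<partial>lborel)"
      by (simp flip: scaleR_scaleR)
    also have "\<dots> = - (c *\<^sub>R (\<integral>x. \<eta> x *\<^sub>R g x \<partial>lborel))" by (simp add: weak_gradD(6)[OF assms t(1) t2])
    also have "\<dots> = - (\<integral>x. c *\<^sub>R \<eta> x *\<^sub>R g x \<partial>lborel)" by (simp del: scaleR_scaleR)
    finally show "(\<integral>x. (c * u x) *\<^sub>R D x \<partial>lborel) = - (\<integral>x. \<eta> x *\<^sub>R c *\<^sub>R g x \<partial>lborel)"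
      by (simp add: mult.commute)
  qed (use weak_gradD(1-5)[OF assms] L in \<open>auto simp: ennreal_mult_less_top\<close>)
qed

lemma smooth_D: "smooth f \<Longrightarrow> smooth_expr f"
  using smooth_iff_smooth_expr by blast

text \<open>In place of a partition of unity, the support of the test function is covered by
  finitely many balls and pieces are split off one at a time: multiply by a bump belonging to one
  ball, and the remainder vanishes on that ball.\<close>

lemma weak_grad_local:
  fixes U :: "'a::euclidean_space set"
  assumes op: "open U" and [measurable]: "u \<in> borel_measurable borel" "g \<in> borel_measurable borel"
    and loc: "\<And>x. x \<in> U \<Longrightarrow> \<exists>V. x \<in> V \<and> weak_grad V u g"
  shows "weak_grad U u g"
proof -
  \<comment> \<open>The factor 3 leaves room for the bump: it is 1 on radius r and 0 off radius 2 r,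
    so its compact support lies in the open ball of radius 3 r.\<close>
  have "\<exists>r>0. weak_grad (ball x (3 * r)) u g" if x: "x \<in> U" for x
  proof -
    obtain V where V: "x \<in> V" "weak_grad V u g" using loc[OF x] by auto
    obtain s where s: "s > 0" "ball x s \<subseteq> V"
      using weak_gradD(1)[OF V(2)] V(1) open_contains_ball by blast
    then have "weak_grad (ball x (3 * (s/3))) u g" using weak_grad_subset[OF V(2)] by simp
    then show ?thesis using s(1) by (intro exI[of _ "s/3"]) auto
  qed
  then obtain r where r: "\<And>x. x \<in> U \<Longrightarrow> r x > 0" "\<And>x. x \<in> U \<Longrightarrow> weak_grad (ball x (3 * r x)) u g"
    by metis
  have cover: "\<exists>F. finite F \<and> F \<subseteq> U \<and> K \<subseteq> (\<Union>x\<in>F. ball x (r x))" if K: "compact K" "K \<subseteq> U" for K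
  proof -
    have "K \<subseteq> (\<Union>x\<in>K. ball x (r x))"
    proof
      fix x assume x: "x \<in> K"
      then have "x \<in> ball x (r x)" using r(1) K by auto
      then show "x \<in> (\<Union>x\<in>K. ball x (r x))" using x by blast
    qed
    then obtain F where "F \<subseteq> K" "finite F" "K \<subseteq> (\<Union>x\<in>F. ball x (r x))"
      using compactE_image[OF K(1), of K "\<lambda>x. ball x (r x)"] by auto
    then show ?thesis using K by (intro exI[of _ F]) auto
  qed
  have fin: "L1on (\<Union>x\<in>F. ball x (r x)) f < \<infinity>"
    if F: "finite F" "F \<subseteq> U" and [measurable]: "f \<in> borel_measurable borel"
      and f: "\<And>x. x \<in> U \<Longrightarrow> L1on (cball x (r x)) f < \<infinity>" for F and f :: "'a \<Rightarrow> 'b::euclidean_space"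
    using F
  proof (induction F rule: finite_induct)
    case empty
    then show ?case by (simp add: L1on_def)
  next
    case (insert x F)
    have "L1on (\<Union>x\<in>insert x F. ball x (r x)) f \<le> L1on (ball x (r x)) f + L1on (\<Union>x\<in>F. ball x (r x)) f"
      using L1on_Un[of f "ball x (r x)" "\<Union>x\<in>F. ball x (r x)"] by (simp add: borel_open open_UN)
    moreover have "L1on (ball x (r x)) f \<le> L1on (cball x (r x)) f" by (rule L1on_mono) auto
    moreover have "L1on (cball x (r x)) f < \<infinity>" using f insert.prems by auto
    ultimately have "L1on (\<Union>x\<in>insert x F. ball x (r x)) f \<le> L1on (cball x (r x)) f + L1on (\<Union>x\<in>F. ball x (r x)) f"
      by (meson add_right_mono order_trans)
    also have "\<dots> < \<infinity>" using \<open>L1on (cball x (r x)) f < \<infinity>\<close> insert by simp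
    finally show ?case .
  qed
  have fin_c: "L1on (cball x (r x)) u < \<infinity>" "L1on (cball x (r x)) g < \<infinity>" if "x \<in> U" for x
  proof -
    have "cball x (r x) \<subseteq> ball x (3 * r x)" using r(1)[OF that] by auto
    then show "L1on (cball x (r x)) u < \<infinity>" "L1on (cball x (r x)) g < \<infinity>"
      using weak_gradD(4,5)[OF r(2)[OF that] compact_cball] by auto
  qed
  define I where "I \<eta> D \<longleftrightarrow> integrable lborel (\<lambda>x. u x *\<^sub>R D x) \<and> integrable lborel (\<lambda>x. \<eta> x *\<^sub>R g x) \<and>
     (\<integral>x. u x *\<^sub>R D x \<partial>lborel) = - (\<integral>x. \<eta> x *\<^sub>R g x \<partial>lborel)" for \<eta> D
  have I_add: "I (\<lambda>x. \<eta> x + \<eta>' x) (\<lambda>x. D x + D' x)" if "I \<eta> D" "I \<eta>' D'" for \<eta> \<eta>' D D'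
    using that unfolding I_def by (simp add: scaleR_add_left scaleR_add_right)
  \<comment> \<open>The compact set \<open>K\<close> is kept apart from the cover \<open>F\<close>:
    it bounds the support of every remainder, while \<open>F\<close> shrinks in the
    induction.\<close>
  have main: "I \<eta> D" if K: "compact K" and F: "finite F" "F \<subseteq> U" and "smooth \<eta>" "\<forall>x. GDERIV \<eta> x :> D x"
    "\<forall>x. x \<notin> K \<longrightarrow> \<eta> x = 0" "\<forall>x. x \<notin> (\<Union>y\<in>F. ball y (r y)) \<longrightarrow> \<eta> x = 0" for F K \<eta> D
    using F that(4-)
  proof (induction F arbitrary: \<eta> D rule: finite_induct)
    case empty
    then have e: "\<eta> = (\<lambda>x. 0)" by auto
    then have "D x = 0" for x using GDERIV_unique[of \<eta> x "D x" 0] GDERIV_const[of 0 x] empty.prems(3) by auto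
    then show ?case by (simp add: I_def e)
  next
    case (insert y F)
    have y: "y \<in> U" using insert.prems by auto
    note \<eta> = insert.prems(2-5)
    obtain b where b: "smooth b" "\<And>x. 0 \<le> b x" "\<And>x. b x \<le> 1" "\<And>x. x \<in> cball y (r y) \<Longrightarrow> b x = 1"
      "\<And>x. x \<notin> ball y (2 * r y) \<Longrightarrow> b x = 0" using smooth_bump_ball[OF r(1)[OF y], of y] by metis
    obtain Db where Db: "\<And>x. GDERIV b x :> Db x" using smooth_gradient[OF b(1)] by metis
    define \<eta>1 where "\<eta>1 x = b x * \<eta> x" for x
    define D1 where "D1 x = b x *\<^sub>R D x + \<eta> x *\<^sub>R Db x" for x
    have sm: "smooth_expr b" "smooth_expr \<eta>" using b(1) \<eta>(1) smooth_D by auto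
    have s1: "smooth_expr \<eta>1" unfolding \<eta>1_def using sm by (rule smooth_expr.mult)
    have g1: "GDERIV \<eta>1 x :> D1 x" for x
      unfolding \<eta>1_def D1_def using Db \<eta>(2) by (intro GDERIV_mult) auto
    have "\<eta>1 \<in> test_functions (ball y (3 * r y))"
    proof -
      have "K \<inter> cball y (2 * r y) \<subseteq> ball y (3 * r y)" using r(1)[OF y] by auto
      moreover have "compact (K \<inter> cball y (2 * r y))" using K by (simp add: compact_Int)
      moreover have "\<eta>1 x = 0" if "x \<notin> K \<inter> cball y (2 * r y)" for x
        using that \<eta>(3) b(5)[of x] by (auto simp: \<eta>1_def)
      ultimately show ?thesis
        unfolding test_functions_def using smooth_expr_imp_smooth[OF s1] by blast
    qed
    from weak_grad_integrable[OF r(2)[OF y] this g1] weak_gradD(6)[OF r(2)[OF y] this g1]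
    have I1: "I \<eta>1 D1" unfolding I_def by auto
    have I2: "I (\<lambda>x. \<eta> x - \<eta>1 x) (\<lambda>x. D x - D1 x)"
    proof (rule insert.IH)
      show "F \<subseteq> U" using insert.prems by auto
      show "smooth (\<lambda>x. \<eta> x - \<eta>1 x)" using smooth_expr_imp_smooth[OF smooth_minus[OF sm(2) s1]] .
      show "\<forall>x. GDERIV (\<lambda>x. \<eta> x - \<eta>1 x) x :> D x - D1 x" using \<eta>(2) g1 by (auto intro: GDERIV_diff)
      show "\<forall>x. x \<notin> K \<longrightarrow> \<eta> x - \<eta>1 x = 0" using \<eta>(3) by (simp add: \<eta>1_def)
      show "\<forall>x. x \<notin> (\<Union>y\<in>F. ball y (r y)) \<longrightarrow> \<eta> x - \<eta>1 x = 0"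
      proof (intro allI impI)
        fix x assume x: "x \<notin> (\<Union>y\<in>F. ball y (r y))"
        show "\<eta> x - \<eta>1 x = 0"
        proof (cases "x \<in> ball y (r y)")
          case True
          then show ?thesis using b(4)[of x] by (simp add: \<eta>1_def)
        next
          case False
          then show ?thesis using \<eta>(4) x by (simp add: \<eta>1_def)
        qed
      qed
    qed
    show ?case using I_add[OF I1 I2] by simp
  qed
  show ?thesis
    unfolding weak_grad_def
  proof (intro conjI op assms(2,3) allI impI ballI)
    fix K assume K: "K \<subseteq> U" "compact K"
    obtain F where F: "finite F" "F \<subseteq> U" "K \<subseteq> (\<Union>x\<in>F. ball x (r x))" using cover[OF K(2,1)] by auto
    have "L1on K u \<le> L1on (\<Union>x\<in>F. ball x (r x)) u" "L1on K g \<le> L1on (\<Union>x\<in>F. ball x (r x)) g"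
      using F(3) by (auto intro!: L1on_mono)
    then show "L1on K u < \<infinity>" "L1on K g < \<infinity>"
      using fin[OF F(1,2) assms(2) fin_c(1)] fin[OF F(1,2) assms(3) fin_c(2)] by (auto intro: le_less_trans)
  next
    fix \<eta> D assume t: "\<eta> \<in> test_functions U" "\<forall>x. GDERIV \<eta> x :> D x"
    then obtain K where K: "compact K" "K \<subseteq> U" "\<forall>x. x \<notin> K \<longrightarrow> \<eta> x = 0" "smooth \<eta>"
      unfolding test_functions_def by blast
    obtain F where F: "finite F" "F \<subseteq> U" "K \<subseteq> (\<Union>x\<in>F. ball x (r x))" using cover[OF K(1,2)] by auto
    have "\<forall>x. x \<notin> (\<Union>y\<in>F. ball y (r y)) \<longrightarrow> \<eta> x = 0" using F(3) K(3) by blast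
    then have "I \<eta> D" using main[OF K(1) F(1,2) K(4) t(2) K(3)] by blast
    then show "(\<integral>x. u x *\<^sub>R D x \<partial>lborel) = - (\<integral>x. \<eta> x *\<^sub>R g x \<partial>lborel)" unfolding I_def by blast
  qed
qed

section \<open>Mollification\<close>

text \<open>The centre \<open>a\<close> is arbitrary because a kernel placed away from the origin
  averages over one side of a point only, which is needed next to a boundary.\<close>

lemma smooth_kernel_exists:
  fixes a :: "'a::euclidean_space"
  assumes "\<sigma> > 0"
  obtains \<eta> D where "smooth \<eta>" "\<And>x. GDERIV \<eta> x :> D x" "\<And>x. 0 \<le> \<eta> x" "\<And>x. x \<notin> cball a \<sigma> \<Longrightarrow> \<eta> x = 0"
    "(\<integral>\<^sup>+x. ennreal (\<eta> x) \<partial>lborel) = 1"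
proof -
  obtain b where b: "smooth b" "\<And>x. 0 \<le> b x" "\<And>x. b x \<le> 1" "\<And>x. x \<in> cball a (\<sigma>/2) \<Longrightarrow> b x = 1"
      "\<And>x. x \<notin> ball a \<sigma> \<Longrightarrow> b x = 0" using smooth_bump_ball[of "\<sigma>/2" a] assms by auto
  have [measurable]: "b \<in> borel_measurable borel" by (rule borel_measurable_continuous_onI[OF smooth_continuous[OF b(1)]])
  define J where "J = (\<integral>\<^sup>+x. ennreal (b x) \<partial>lborel)"
  have "J \<le> (\<integral>\<^sup>+x. indicator (cball a \<sigma>) x \<partial>lborel)"
    unfolding J_def using b(3,5) by (intro nn_integral_mono) (auto simp: indicator_def)
  also have "\<dots> < \<infinity>" using emeasure_lborel_cball_finite[of a \<sigma>] by simp
  finally have J1: "J < \<infinity>" .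
  have "0 < emeasure lborel (cball a (\<sigma>/2))"
  proof -
    have "emeasure lborel (cball a (\<sigma>/2)) = ennreal (measure lborel (cball a (\<sigma>/2)))"
      by (rule emeasure_eq_ennreal_measure) (use emeasure_lborel_cball_finite[of a "\<sigma>/2"] in auto)
    then show ?thesis using content_cball_pos[of "\<sigma>/2" a] assms by simp
  qed
  also have "\<dots> = (\<integral>\<^sup>+x. indicator (cball a (\<sigma>/2)) x \<partial>lborel)" by simp
  also have "\<dots> \<le> J"
    unfolding J_def using b(2,4) by (intro nn_integral_mono) (auto simp: indicator_def)
  finally have J0: "0 < J" .
  define c where "c = enn2real J"
  have c: "c > 0" "J = ennreal c" using J0 J1 by (auto simp: c_def enn2real_positive_iff)
  obtain D where D: "\<And>x. GDERIV b x :> D x" using smooth_gradient[OF b(1)] by metis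
  show thesis
  proof (rule that)
    have "smooth_expr (\<lambda>x. (1/c) * b x)" using smooth_D[OF b(1)] by (intro smooth_expr.mult smooth_expr.const)
    then show "smooth (\<lambda>x. (1/c) * b x)" by (rule smooth_expr_imp_smooth)
    show "GDERIV (\<lambda>x. (1/c) * b x) x :> (1/c) *\<^sub>R D x + b x *\<^sub>R 0" for x
      by (rule GDERIV_mult[OF GDERIV_const D])
    show "0 \<le> (1/c) * b x" for x using b(2)[of x] c by simp
    show "(1/c) * b x = 0" if "x \<notin> cball a \<sigma>" for x using b(5)[of x] that by auto
    have "(\<integral>\<^sup>+x. ennreal ((1/c) * b x) \<partial>lborel) = (\<integral>\<^sup>+x. ennreal (1/c) * ennreal (b x) \<partial>lborel)"
      using c b(2) by (simp add: ennreal_mult del: times_divide_eq_left)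
    also have "\<dots> = ennreal (1/c) * J" unfolding J_def by (simp add: nn_integral_cmult)
    also have "\<dots> = 1" using c by (simp flip: ennreal_mult)
    finally show "(\<integral>\<^sup>+x. ennreal ((1/c) * b x) \<partial>lborel) = 1" .
  qed
qed

definition conv :: "('a::euclidean_space \<Rightarrow> real) \<Rightarrow> ('a \<Rightarrow> 'b::euclidean_space) \<Rightarrow> 'a \<Rightarrow> 'b" where
  "conv \<eta> f x = (\<integral>y. \<eta> (x - y) *\<^sub>R f y \<partial>lborel)"

lemma compact_support_bounded:
  fixes h :: "'a::euclidean_space \<Rightarrow> 'b::real_normed_vector"
  assumes "continuous_on UNIV h" "compact S" "\<And>x. x \<notin> S \<Longrightarrow> h x = 0"
  obtains M where "0 \<le> M" "\<And>x. norm (h x) \<le> M"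
proof -
  have "bounded (h ` S)" by (rule compact_imp_bounded[OF compact_continuous_image[OF continuous_on_subset[OF assms(1)] assms(2)]]) auto
  then obtain M where M: "\<forall>x\<in>S. norm (h x) \<le> M" by (auto simp: bounded_iff)
  have "norm (h x) \<le> max 0 M" for x using M assms(3)[of x] by (cases "x \<in> S") (auto simp: le_max_iff_disj)
  then show thesis using that[of "max 0 M"] by auto
qed

lemma compact_support_uniformly_continuous:
  fixes h :: "'a::euclidean_space \<Rightarrow> 'b::real_normed_vector"
  assumes h: "continuous_on UNIV h" "compact S" "\<And>x. x \<notin> S \<Longrightarrow> h x = 0" and e: "e > 0"
  obtains d where "d > 0" "\<And>x y. dist y x < d \<Longrightarrow> dist (h y) (h x) < e"
proof -
  obtain R where R: "\<And>x. x \<in> S \<Longrightarrow> norm x \<le> R" using compact_imp_bounded[OF h(2)] by (auto simp: bounded_iff)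
  have "uniformly_continuous_on (cball 0 (R + 2)) h"
    by (rule compact_uniformly_continuous) (auto intro: continuous_on_subset[OF h(1)])
  then obtain d where d: "d > 0" "\<And>x y. x \<in> cball 0 (R + 2) \<Longrightarrow> y \<in> cball 0 (R + 2) \<Longrightarrow> dist y x < d
     \<Longrightarrow> dist (h y) (h x) < e"
    unfolding uniformly_continuous_on_def using e by metis
  show thesis
  proof (rule that[of "min d 1"])
    show "min d 1 > 0" using d by simp
    fix x y :: 'a assume xy: "dist y x < min d 1"
    have n: "norm y \<le> norm x + dist y x" "norm x \<le> norm y + dist y x"
      using norm_triangle_ineq2[of y x] norm_triangle_ineq2[of x y] by (auto simp: dist_norm norm_minus_commute)
    show "dist (h y) (h x) < e"
    proof (cases "x \<in> cball 0 (R + 1)")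
      case True
      then show ?thesis using d(2)[of x y] xy n by auto
    next
      case False
      then have "x \<notin> S" "y \<notin> S" using R[of x] R[of y] xy n by auto
      then show ?thesis using h(3) e by simp
    qed
  qed
qed

lemma integrable_bounded_mult:
  fixes f :: "'a::euclidean_space \<Rightarrow> 'b::euclidean_space" and h :: "'a \<Rightarrow> 'c::euclidean_space"
  assumes [measurable]: "f \<in> borel_measurable borel" "h \<in> borel_measurable borel" and fin: "L1on UNIV f < \<infinity>"
    and le: "\<And>x. norm (h x) \<le> M * norm (f x)" and M: "0 \<le> M"
  shows "integrable lborel h" "ennreal (norm (integral\<^sup>L lborel h)) \<le> ennreal M * L1on UNIV f"
  using integral_dominated_L1on[of h f UNIV M] assms by auto

lemma continuous_conv:
  fixes f :: "'a::euclidean_space \<Rightarrow> 'b::euclidean_space" and h :: "'a \<Rightarrow> real"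
  assumes h: "continuous_on UNIV h" "\<And>x. norm (h x) \<le> M" and [measurable]: "f \<in> borel_measurable borel"
    and fin: "L1on UNIV f < \<infinity>"
  shows "continuous_on UNIV (conv h f)"
proof (rule continuous_at_imp_continuous_on, rule ballI)
  fix x :: 'a
  have M: "0 \<le> M" using h(2)[of 0] norm_ge_zero order_trans by blast
  have [measurable]: "h \<in> borel_measurable borel" using h(1) by (rule borel_measurable_continuous_onI)
  have intf: "integrable lborel f" using fin by (intro integrableI_bounded) (auto simp: L1on_def)
  show "isCont (conv h f) x"
    unfolding continuous_at_sequentially comp_def
  proof (intro allI impI)
    fix X assume X: "X \<longlonglongrightarrow> x"
    show "(\<lambda>n. conv h f (X n)) \<longlonglongrightarrow> conv h f x"
      unfolding conv_def
    proof (rule integral_dominated_convergence[where w="\<lambda>y. M * norm (f y)"])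
      show "integrable lborel (\<lambda>y. M * norm (f y))" using intf by simp
      show "AE y in lborel. (\<lambda>n. h (X n - y) *\<^sub>R f y) \<longlonglongrightarrow> h (x - y) *\<^sub>R f y"
      proof (rule AE_I2)
        fix y
        have "isCont h (x - y)" using h(1) by (simp add: continuous_on_eq_continuous_at)
        then have "(\<lambda>n. h (X n - y)) \<longlonglongrightarrow> h (x - y)"
          by (rule isCont_tendsto_compose) (intro tendsto_intros X)
        then show "(\<lambda>n. h (X n - y) *\<^sub>R f y) \<longlonglongrightarrow> h (x - y) *\<^sub>R f y" by (intro tendsto_intros)
      qed
      show "AE y in lborel. norm (h (X n - y) *\<^sub>R f y) \<le> M * norm (f y)" for n
        using h(2) by (auto intro!: mult_right_mono)
    qed measurable
  qed
qed

text \<open>Uniform continuity of \<open>D\<close> makes the first-order Taylor remainder of \<eta>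
  at most e' |h| at all points at once; integrated against u it is at most e' |h| times the L^1 norm
  \<open>A\<close> of u, and e' A \<le> e.\<close>

lemma GDERIV_conv:
  fixes u :: "'a::euclidean_space \<Rightarrow> real"
  assumes \<eta>: "C1_on UNIV \<eta> D" and S: "compact S" and z: "\<And>x. x \<notin> S \<Longrightarrow> \<eta> x = 0"
    and [measurable]: "u \<in> borel_measurable borel" and fin: "L1on UNIV u < \<infinity>"
  shows "GDERIV (conv \<eta> u) x :> (\<integral>y. u y *\<^sub>R D (x - y) \<partial>lborel)"
proof -
  have cD: "continuous_on UNIV D" and c\<eta>: "continuous_on UNIV \<eta>" using C1_onD[OF \<eta>] by auto
  have [measurable]: "D \<in> borel_measurable borel" "\<eta> \<in> borel_measurable borel"
    using cD c\<eta> by (auto intro: borel_measurable_continuous_onI)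
  have zD: "D x = 0" if "x \<notin> S" for x using C1_on_zero_extension(2)[OF \<eta> S _ z] that by auto
  obtain M where M: "0 \<le> M" "\<And>x. norm (D x) \<le> M" using compact_support_bounded[OF cD S zD] by metis
  obtain M2 where M2: "0 \<le> M2" "\<And>x. norm (\<eta> x) \<le> M2" using compact_support_bounded[OF c\<eta> S z] by metis
  define A where "A = enn2real (L1on UNIV u)"
  have A: "L1on UNIV u = ennreal A" "A \<ge> 0" using fin by (auto simp: A_def less_top)
  have int\<eta>: "integrable lborel (\<lambda>y. \<eta> (x - y) * u y)" for x
    by (rule integrable_bounded_mult(1)[where f=u and M=M2])
      (use M2 fin in \<open>auto simp: abs_mult intro!: mult_right_mono\<close>)
  have intD: "integrable lborel (\<lambda>y. u y *\<^sub>R D (x - y))" for x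
    by (rule integrable_bounded_mult(1)[where f=u and M=M])
      (use M fin in \<open>auto simp: mult.commute[of M] intro!: mult_left_mono\<close>)
  let ?G = "\<integral>y. u y *\<^sub>R D (x - y) \<partial>lborel"
  have "(conv \<eta> u has_derivative (\<lambda>h. h \<bullet> ?G)) (at x)"
    unfolding has_derivative_at_alt
  proof (intro conjI allI impI)
    show "bounded_linear (\<lambda>h. h \<bullet> ?G)" by (rule bounded_linear_inner_left)
    fix e :: real assume e: "0 < e"
    define e' where "e' = e / (A + 1)"
    have e': "e' > 0" "e' * A \<le> e" using e A(2) by (auto simp: e'_def field_simps)
    obtain d where d: "d > 0" "\<And>x y. dist y x < d \<Longrightarrow> dist (D y) (D x) < e'"
      using compact_support_uniformly_continuous[OF cD S zD e'(1)] by metis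
    have pt: "\<bar>\<eta> (w + h) - \<eta> w - h \<bullet> D w\<bar> \<le> e' * norm h" if h: "norm h < d" for w h
    proof -
      have C: "C1_on UNIV (\<lambda>q. \<eta> q - q \<bullet> D w) (\<lambda>q. D q - D w)"
        unfolding C1_on_def
      proof (intro conjI ballI open_UNIV)
        show "GDERIV (\<lambda>q. \<eta> q - q \<bullet> D w) q :> D q - D w" for q
          by (intro GDERIV_diff) (use C1_onD(2)[OF \<eta>] in \<open>auto simp: gderiv_def intro!: bounded_linear_imp_has_derivative bounded_linear_inner_left\<close>)
        show "continuous_on UNIV (\<lambda>q. D q - D w)" using cD by (intro continuous_intros)
      qed
      have "\<bar>(\<eta> (w + h) - (w + h) \<bullet> D w) - (\<eta> w - w \<bullet> D w)\<bar> \<le> e' * norm ((w + h) - w)"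
      proof (rule C1_mean_value[OF C])
        fix q assume "q \<in> closed_segment (w + h) w"
        moreover have "closed_segment (w + h) w \<subseteq> ball w d"
          using h d(1) by (intro closed_segment_subset convex_ball) (auto simp: dist_norm)
        ultimately have "dist q w < d" by (auto simp: dist_commute)
        then show "norm (D q - D w) \<le> e'" using d(2)[of q w] by (simp add: dist_norm)
      qed auto
      then show ?thesis by (simp add: inner_add_left algebra_simps)
    qed
    show "\<exists>d>0. \<forall>y. norm (y - x) < d \<longrightarrow> norm (conv \<eta> u y - conv \<eta> u x - (y - x) \<bullet> ?G) \<le> e * norm (y - x)"
    proof (intro exI[of _ d] conjI d(1) allI impI)
      fix x' assume x': "norm (x' - x) < d"
      let ?h = "x' - x"
      have "conv \<eta> u x' - conv \<eta> u x - ?h \<bullet> ?G =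
        (\<integral>y. \<eta> (x' - y) * u y - \<eta> (x - y) * u y - ?h \<bullet> (u y *\<^sub>R D (x - y)) \<partial>lborel)"
        unfolding conv_def using int\<eta> intD[of x]
        by (simp add: integral_inner_right del: inner_scaleR_right)
      also have "norm \<dots> \<le> e' * norm ?h * A"
      proof -
        have "ennreal (norm (\<integral>y. \<eta> (x' - y) * u y - \<eta> (x - y) * u y - ?h \<bullet> (u y *\<^sub>R D (x - y)) \<partial>lborel))
          \<le> ennreal (e' * norm ?h) * L1on UNIV u"
        proof (rule integrable_bounded_mult(2))
          fix y
          have "\<eta> (x' - y) * u y - \<eta> (x - y) * u y - ?h \<bullet> (u y *\<^sub>R D (x - y)) =
             (\<eta> ((x - y) + ?h) - \<eta> (x - y) - ?h \<bullet> D (x - y)) * u y"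
            by (simp add: algebra_simps)
          then show "norm (\<eta> (x' - y) * u y - \<eta> (x - y) * u y - ?h \<bullet> (u y *\<^sub>R D (x - y))) \<le> e' * norm ?h * norm (u y)"
            using pt[OF x', of "x - y"] by (simp add: abs_mult mult_right_mono)
        qed (use e' fin in auto)
        then show ?thesis using e' A by (simp flip: ennreal_mult)
      qed
      also have "\<dots> \<le> e * norm ?h"
        using mult_right_mono[OF e'(2) norm_ge_zero[of ?h]] by (simp add: ac_simps)
      finally show "norm (conv \<eta> u x' - conv \<eta> u x - ?h \<bullet> ?G) \<le> e * norm ?h" .
    qed
  qed
  then show ?thesis by (simp add: gderiv_def)
qed

lemma conv_eq_reflected:
  fixes f :: "'a::euclidean_space \<Rightarrow> 'b::euclidean_space"
  assumes [measurable]: "f \<in> borel_measurable borel" "\<eta> \<in> borel_measurable borel"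
  shows "conv \<eta> f x = (\<integral>z. \<eta> z *\<^sub>R f (x - z) \<partial>lborel)"
  unfolding conv_def using integral_reflect[of "\<lambda>z. \<eta> z *\<^sub>R f (x - z)" x] by simp

text \<open>Since \<eta> has integral 1, f minus its convolution is an average of the increments
  f(x) - f(x - z) over z in the support; Fubini turns this into an average of their L^1
  norms.\<close>

lemma conv_L1_bound:
  fixes f :: "'a::euclidean_space \<Rightarrow> 'b::euclidean_space"
  assumes [measurable]: "f \<in> borel_measurable borel" "\<eta> \<in> borel_measurable borel"
    and fin: "L1on UNIV f < \<infinity>"
    and \<eta>: "\<And>x. 0 \<le> \<eta> x" "\<And>x. \<eta> x \<le> M" "(\<integral>\<^sup>+x. ennreal (\<eta> x) \<partial>lborel) = 1" "\<And>x. x \<notin> S \<Longrightarrow> \<eta> x = 0"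
    and tr: "\<And>z. z \<in> S \<Longrightarrow> L1on UNIV (\<lambda>x. f (x - z) - f x) \<le> ennreal e"
  shows "L1on UNIV (\<lambda>x. f x - conv \<eta> f x) \<le> ennreal e"
proof -
  have M: "0 \<le> M" using \<eta>(1,2) order_trans by blast
  have int\<eta>: "integrable lborel \<eta>" using \<eta>(1,3) by (intro integrableI_bounded) auto
  have int1: "(\<integral>x. \<eta> x \<partial>lborel) = 1"
    using nn_integral_eq_integral[OF int\<eta>] \<eta>(1,3) by (simp add: integral_nonneg_AE flip: ennreal_1)
  have intf: "integrable lborel (\<lambda>z. \<eta> z *\<^sub>R f (x - z))" for x
  proof (rule integrable_bounded_mult(1)[where f="\<lambda>z. f (x - z)" and M=M])
    have "L1on UNIV (\<lambda>z. f (x - z)) = L1on UNIV f"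
      unfolding L1on_def using nn_integral_reflect[of "\<lambda>z. ennreal (norm (f z))" x] by simp
    then show "L1on UNIV (\<lambda>z. f (x - z)) < \<infinity>" using fin by simp
  qed (use M \<eta> in \<open>auto intro!: mult_right_mono\<close>)
  have pt: "ennreal (norm (f x - conv \<eta> f x)) \<le> (\<integral>\<^sup>+z. ennreal (\<eta> z) * ennreal (norm (f (x - z) - f x)) \<partial>lborel)" for x
  proof -
    have i2: "integrable lborel (\<lambda>z. \<eta> z *\<^sub>R f x)" using int\<eta> by simp
    have "f x = (\<integral>z. \<eta> z *\<^sub>R f x \<partial>lborel)" using int1 int\<eta> by simp
    then have eq: "f x - conv \<eta> f x = (\<integral>z. \<eta> z *\<^sub>R f x - \<eta> z *\<^sub>R f (x - z) \<partial>lborel)"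
      using intf[of x] i2 by (simp add: conv_eq_reflected)
    have "ennreal (norm (f x - conv \<eta> f x)) \<le> (\<integral>\<^sup>+z. ennreal (norm (\<eta> z *\<^sub>R f x - \<eta> z *\<^sub>R f (x - z))) \<partial>lborel)"
      unfolding eq by (rule integral_norm_bound_ennreal) (use intf i2 in auto)
    also have "\<dots> = (\<integral>\<^sup>+z. ennreal (\<eta> z) * ennreal (norm (f (x - z) - f x)) \<partial>lborel)"
    proof (rule nn_integral_cong)
      fix z
      have "norm (\<eta> z *\<^sub>R f x - \<eta> z *\<^sub>R f (x - z)) = \<eta> z * norm (f (x - z) - f x)"
        using \<eta>(1)[of z] by (simp add: norm_minus_commute flip: scaleR_diff_right)
      then show "ennreal (norm (\<eta> z *\<^sub>R f x - \<eta> z *\<^sub>R f (x - z))) = ennreal (\<eta> z) * ennreal (norm (f (x - z) - f x))"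
        using \<eta>(1) by (simp add: ennreal_mult)
    qed
    finally show ?thesis .
  qed
  have "L1on UNIV (\<lambda>x. f x - conv \<eta> f x) \<le>
     (\<integral>\<^sup>+x. (\<integral>\<^sup>+z. ennreal (\<eta> z) * ennreal (norm (f (x - z) - f x)) \<partial>lborel) \<partial>lborel)"
    unfolding L1on_def using pt by (intro nn_integral_mono) auto
  also have "\<dots> = (\<integral>\<^sup>+z. (\<integral>\<^sup>+x. ennreal (\<eta> z) * ennreal (norm (f (x - z) - f x)) \<partial>lborel) \<partial>lborel)"
    by (rule lborel_pair.Fubini') measurable
  also have "\<dots> \<le> (\<integral>\<^sup>+z. ennreal (\<eta> z) * ennreal e \<partial>lborel)"
  proof (rule nn_integral_mono)
    fix z
    have "(\<integral>\<^sup>+x. ennreal (\<eta> z) * ennreal (norm (f (x - z) - f x)) \<partial>lborel) =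
        ennreal (\<eta> z) * L1on UNIV (\<lambda>x. f (x - z) - f x)"
      by (simp add: nn_integral_cmult L1on_def)
    also have "\<dots> \<le> ennreal (\<eta> z) * ennreal e"
      using tr[of z] \<eta>(4)[of z] by (cases "z \<in> S") (auto intro: mult_left_mono)
    finally show "(\<integral>\<^sup>+x. ennreal (\<eta> z) * ennreal (norm (f (x - z) - f x)) \<partial>lborel) \<le> ennreal (\<eta> z) * ennreal e" .
  qed
  also have "\<dots> = ennreal e" using \<eta>(3) by (simp add: nn_integral_multc)
  finally show ?thesis .
qed

text \<open>Jensen for the probability density \<eta>, in the form of Cauchy-Schwarz for the product
  of sqrt \<eta> and sqrt \<eta> |f|, followed by Fubini and translation invariance.\<close>

lemma conv_L2_bound:
  fixes f :: "'a::euclidean_space \<Rightarrow> 'b::euclidean_space"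
  assumes [measurable]: "f \<in> borel_measurable borel" "\<eta> \<in> borel_measurable borel"
    and fin: "L1on UNIV f < \<infinity>"
    and \<eta>: "\<And>x. 0 \<le> \<eta> x" "\<And>x. \<eta> x \<le> M" "(\<integral>\<^sup>+x. ennreal (\<eta> x) \<partial>lborel) = 1"
  shows "L2on UNIV (conv \<eta> f) \<le> L2on UNIV f"
proof -
  have M: "0 \<le> M" using \<eta>(1,2) order_trans by blast
  have intf: "integrable lborel (\<lambda>z. \<eta> z *\<^sub>R f (x - z))" for x
  proof (rule integrable_bounded_mult(1)[where f="\<lambda>z. f (x - z)" and M=M])
    have "L1on UNIV (\<lambda>z. f (x - z)) = L1on UNIV f"
      unfolding L1on_def using nn_integral_reflect[of "\<lambda>z. ennreal (norm (f z))" x] by simp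
    then show "L1on UNIV (\<lambda>z. f (x - z)) < \<infinity>" using fin by simp
  qed (use M \<eta> in \<open>auto intro!: mult_right_mono\<close>)
  have pt: "ennreal ((norm (conv \<eta> f x))\<^sup>2) \<le> (\<integral>\<^sup>+z. ennreal (\<eta> z) * ennreal ((norm (f (x - z)))\<^sup>2) \<partial>lborel)" for x
  proof -
    let ?p = "\<lambda>z. ennreal (sqrt (\<eta> z))" and ?q = "\<lambda>z. ennreal (sqrt (\<eta> z) * norm (f (x - z)))"
    have "ennreal (norm (conv \<eta> f x)) \<le> (\<integral>\<^sup>+z. ennreal (norm (\<eta> z *\<^sub>R f (x - z))) \<partial>lborel)"
      unfolding conv_eq_reflected[OF assms(1,2)] by (rule integral_norm_bound_ennreal[OF intf])
    also have "\<dots> = (\<integral>\<^sup>+z. ?p z * ?q z \<partial>lborel)"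
      using \<eta>(1) by (intro nn_integral_cong) (simp flip: ennreal_mult mult.assoc)
    finally have "(ennreal (norm (conv \<eta> f x)))\<^sup>2 \<le> (\<integral>\<^sup>+z. ?p z * ?q z \<partial>lborel)\<^sup>2" by (rule power_mono) simp
    also have "\<dots> \<le> (\<integral>\<^sup>+z. (?p z)\<^sup>2 \<partial>lborel) * (\<integral>\<^sup>+z. (?q z)\<^sup>2 \<partial>lborel)"
      by (rule Cauchy_Schwarz_nn_integral) measurable
    also have "(\<integral>\<^sup>+z. (?p z)\<^sup>2 \<partial>lborel) = 1"
      using \<eta>(1,3) by (simp add: ennreal_power)
    also have "(\<integral>\<^sup>+z. (?q z)\<^sup>2 \<partial>lborel) = (\<integral>\<^sup>+z. ennreal (\<eta> z) * ennreal ((norm (f (x - z)))\<^sup>2) \<partial>lborel)"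
      using \<eta>(1) by (simp add: ennreal_power power_mult_distrib ennreal_mult)
    finally show ?thesis by (simp add: ennreal_power)
  qed
  have "L2on UNIV (conv \<eta> f) \<le>
     (\<integral>\<^sup>+x. (\<integral>\<^sup>+z. ennreal (\<eta> z) * ennreal ((norm (f (x - z)))\<^sup>2) \<partial>lborel) \<partial>lborel)"
    unfolding L2on_def using pt by (intro nn_integral_mono) auto
  also have "\<dots> = (\<integral>\<^sup>+z. (\<integral>\<^sup>+x. ennreal (\<eta> z) * ennreal ((norm (f (x - z)))\<^sup>2) \<partial>lborel) \<partial>lborel)"
    by (rule lborel_pair.Fubini') measurable
  also have "\<dots> = (\<integral>\<^sup>+z. ennreal (\<eta> z) * L2on UNIV f \<partial>lborel)"
  proof (rule nn_integral_cong)
    fix z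
    show "(\<integral>\<^sup>+x. ennreal (\<eta> z) * ennreal ((norm (f (x - z)))\<^sup>2) \<partial>lborel) = ennreal (\<eta> z) * L2on UNIV f"
      using nn_integral_translate[of "\<lambda>x. ennreal ((norm (f x))\<^sup>2)" "-z"]
      by (simp add: nn_integral_cmult L2on_def)
  qed
  also have "\<dots> = L2on UNIV f" using \<eta>(3) by (simp add: nn_integral_multc)
  finally show ?thesis .
qed

text \<open>\<open>v'\<close> has to be the gradient of \<open>v\<close> only at points whose
  translated kernel support stays inside \<open>U\<close>. The final clause, that 0 is mollified to
  0, serves the uniqueness of weak gradients.\<close>

definition mollification ::
  "'a::euclidean_space set \<Rightarrow> ('a \<Rightarrow> real) \<Rightarrow> ('a \<Rightarrow> 'a) \<Rightarrow> real \<Rightarrow> 'a \<Rightarrow> real \<Rightarrow> ('a \<Rightarrow> real) \<Rightarrow> ('a \<Rightarrow> 'a) \<Rightarrow> bool" where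
  "mollification U u g e a \<sigma> v v' \<longleftrightarrow> continuous_on UNIV v \<and> continuous_on UNIV v' \<and>
     (\<forall>x. (\<forall>z\<in>cball a \<sigma>. x - z \<in> U) \<longrightarrow> GDERIV v x :> v' x) \<and>
     L1on UNIV (\<lambda>x. u x - v x) < ennreal e \<and> L1on UNIV (\<lambda>x. g x - v' x) < ennreal e \<and>
     L2on UNIV v' \<le> L2on UNIV g \<and> ((\<forall>x. u x = 0) \<longrightarrow> (\<forall>x. v x = 0))"

text \<open>As soon as x minus the kernel support lies in \<open>U\<close>, the kernel reflected at
  x is a test function for \<open>U\<close>, and testing with it identifies the gradient of the
  convolution with the convolution of g. Only the total reach |a| + \<sigma> of the kernel has to be
  small, so kernels off centre are allowed.\<close>

lemma weak_grad_mollify: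
  fixes u :: "'a::euclidean_space \<Rightarrow> real"
  assumes w: "weak_grad U u g" and fin: "L1on UNIV u < \<infinity>" "L1on UNIV g < \<infinity>" and e: "e > 0"
  obtains \<tau> where "\<tau> > 0" "\<And>a \<sigma>. \<sigma> > 0 \<Longrightarrow> norm a + \<sigma> < \<tau> \<Longrightarrow> \<exists>v v'. mollification U u g e a \<sigma> v v'"
proof -
  note [measurable] = weak_gradD(2,3)[OF w]
  have e2: "e/2 > 0" using e by simp
  obtain \<tau>1 where \<tau>1: "\<tau>1 > 0" "\<And>z. norm z < \<tau>1 \<Longrightarrow> L1on UNIV (\<lambda>x. u (x - z) - u x) < ennreal (e/2)"
    using L1_translation_continuous[OF weak_gradD(2)[OF w] fin(1) e2] by metis
  obtain \<tau>2 where \<tau>2: "\<tau>2 > 0" "\<And>z. norm z < \<tau>2 \<Longrightarrow> L1on UNIV (\<lambda>x. g (x - z) - g x) < ennreal (e/2)"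
    using L1_translation_continuous[OF weak_gradD(3)[OF w] fin(2) e2] by metis
  show thesis
  proof (rule that[of "min \<tau>1 \<tau>2"])
    show "min \<tau>1 \<tau>2 > 0" using \<tau>1 \<tau>2 by simp
    fix a :: 'a and \<sigma> :: real assume \<sigma>: "\<sigma> > 0" "norm a + \<sigma> < min \<tau>1 \<tau>2"
    obtain \<eta> D where \<eta>: "smooth \<eta>" "\<And>x. GDERIV \<eta> x :> D x" "\<And>x. 0 \<le> \<eta> x" "\<And>x. x \<notin> cball a \<sigma> \<Longrightarrow> \<eta> x = 0"
      "(\<integral>\<^sup>+x. ennreal (\<eta> x) \<partial>lborel) = 1" using smooth_kernel_exists[OF \<sigma>(1), of a] by metis
    have c\<eta>: "continuous_on UNIV \<eta>" using smooth_continuous[OF \<eta>(1)] .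
    have cD: "continuous_on UNIV D" using smooth_gradient_continuous[OF \<eta>(1,2)] .
    have C: "C1_on UNIV \<eta> D" using cD \<eta>(2) by (auto simp: C1_on_def)
    obtain M where M: "0 \<le> M" "\<And>x. norm (\<eta> x) \<le> M" using compact_support_bounded[OF c\<eta> compact_cball \<eta>(4)] by metis
    have [measurable]: "\<eta> \<in> borel_measurable borel" using c\<eta> by (rule borel_measurable_continuous_onI)
    have M': "\<eta> x \<le> M" for x using M(2)[of x] by simp
    have nz: "norm z < min \<tau>1 \<tau>2" if "z \<in> cball a \<sigma>" for z
      using that \<sigma>(2) norm_triangle_ineq2[of z a] by (simp add: dist_norm norm_minus_commute)
    have G: "GDERIV (conv \<eta> u) x :> conv \<eta> g x" if x: "\<And>z. z \<in> cball a \<sigma> \<Longrightarrow> x - z \<in> U" for x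
    proof -
      let ?\<zeta> = "\<lambda>y. \<eta> (x + (-1) *\<^sub>R y)"
      have "?\<zeta> \<in> test_functions U"
      proof -
        have "smooth_expr ?\<zeta>" by (rule smooth_expr.affine[OF smooth_D[OF \<eta>(1)]])
        then have "smooth ?\<zeta>" by (rule smooth_expr_imp_smooth)
        moreover have "compact ((\<lambda>z. x - z) ` cball a \<sigma>)"
          by (rule compact_continuous_image) (auto intro: continuous_intros)
        moreover have "(\<lambda>z. x - z) ` cball a \<sigma> \<subseteq> U" using x by auto
        moreover have "?\<zeta> y = 0" if "y \<notin> (\<lambda>z. x - z) ` cball a \<sigma>" for y
        proof -
          have "x - y \<notin> cball a \<sigma>"
          proof
            assume "x - y \<in> cball a \<sigma>"
            then have "x - (x - y) \<in> (\<lambda>z. x - z) ` cball a \<sigma>" by (rule imageI)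
            then show False using that by simp
          qed
          then show ?thesis using \<eta>(4) by simp
        qed
        ultimately show ?thesis unfolding test_functions_def by blast
      qed
      moreover have "GDERIV ?\<zeta> y :> - D (x - y)" for y
      proof -
        have "((\<lambda>y. \<eta> (x - y)) has_derivative (\<lambda>h. (- h) \<bullet> D (x - y))) (at y)"
          by (rule has_derivative_compose[where f="\<lambda>y. x - y" and g=\<eta>])
            (use \<eta>(2) in \<open>auto simp: gderiv_def intro!: derivative_eq_intros\<close>)
        then show ?thesis by (simp add: gderiv_def)
      qed
      ultimately have "(\<integral>y. u y *\<^sub>R (- D (x - y)) \<partial>lborel) = - (\<integral>y. ?\<zeta> y *\<^sub>R g y \<partial>lborel)"
        by (rule weak_gradD(6)[OF w])
      then have "(\<integral>y. u y *\<^sub>R D (x - y) \<partial>lborel) = conv \<eta> g x" by (simp add: conv_def)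
      moreover have "GDERIV (conv \<eta> u) x :> (\<integral>y. u y *\<^sub>R D (x - y) \<partial>lborel)"
        by (rule GDERIV_conv[OF C compact_cball[of a \<sigma>] \<eta>(4) weak_gradD(2)[OF w] fin(1)])
      ultimately show ?thesis by simp
    qed
    have L1: "L1on UNIV (\<lambda>x. u x - conv \<eta> u x) \<le> ennreal (e/2)"
      by (rule conv_L1_bound[where M=M and S="cball a \<sigma>"]) (use fin \<eta>(3,4,5) M' \<tau>1(2) nz in \<open>auto intro: less_imp_le\<close>)
    have L2: "L1on UNIV (\<lambda>x. g x - conv \<eta> g x) \<le> ennreal (e/2)"
      by (rule conv_L1_bound[where M=M and S="cball a \<sigma>"]) (use fin \<eta>(3,4,5) M' \<tau>2(2) nz in \<open>auto intro: less_imp_le\<close>)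
    have lt: "ennreal (e/2) < ennreal e" using e by (intro ennreal_lessI) auto
    show "\<exists>v v'. mollification U u g e a \<sigma> v v'"
      unfolding mollification_def
    proof (intro exI[of _ "conv \<eta> u"] exI[of _ "conv \<eta> g"] conjI)
      show "continuous_on UNIV (conv \<eta> u)" "continuous_on UNIV (conv \<eta> g)"
        by (rule continuous_conv[OF c\<eta> M(2)]; fact fin weak_gradD(2,3)[OF w])+
      show "\<forall>x. (\<forall>z\<in>cball a \<sigma>. x - z \<in> U) \<longrightarrow> GDERIV (conv \<eta> u) x :> conv \<eta> g x" using G by blast
      show "L1on UNIV (\<lambda>x. u x - conv \<eta> u x) < ennreal e" using L1 lt by (rule le_less_trans)
      show "L1on UNIV (\<lambda>x. g x - conv \<eta> g x) < ennreal e" using L2 lt by (rule le_less_trans)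
      show "L2on UNIV (conv \<eta> g) \<le> L2on UNIV g"
        by (rule conv_L2_bound[where M=M]) (use fin \<eta> M' in auto)
      show "(\<forall>x. u x = 0) \<longrightarrow> (\<forall>x. conv \<eta> u x = 0)" by (simp add: conv_def)
    qed
  qed
qed

lemma weak_grad_zero_outside:
  assumes w: "weak_grad U u g"
  shows "weak_grad U (\<lambda>x. if x \<in> U then u x else 0) (\<lambda>x. if x \<in> U then g x else 0)"
proof (rule weak_grad_cong_AE[OF w])
  have [measurable]: "U \<in> sets borel" using weak_gradD(1)[OF w] by simp
  note [measurable] = weak_gradD(2,3)[OF w]
  show "(\<lambda>x. if x \<in> U then u x else 0) \<in> borel_measurable borel" by measurable
  show "(\<lambda>x. if x \<in> U then g x else 0) \<in> borel_measurable borel" by measurable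
qed auto

lemma L1on_zero_outside_le: "V \<subseteq> S \<Longrightarrow> L1on UNIV (\<lambda>x. if x \<in> V then f x else 0) \<le> L1on S f"
  unfolding L1on_def by (intro nn_integral_mono) (auto simp: indicator_def dest: subsetD)

lemma L2on_zero_outside_le: "V \<subseteq> S \<Longrightarrow> L2on UNIV (\<lambda>x. if x \<in> V then f x else 0) \<le> L2on S f"
  unfolding L2on_def by (intro nn_integral_mono) (auto simp: indicator_def dest: subsetD)

text \<open>Since only local integrability is known on \<open>U\<close>, the pair is first cut off
  to the d-neighbourhood \<open>V\<close> of \<open>K\<close>. The cut destroys the gradient
  relation at the boundary of \<open>V\<close>, but a kernel of radius at most d/2 does not reach
  that boundary from \<open>N\<close>.\<close>

lemma weak_grad_C1_approximation:
  fixes u :: "'a::euclidean_space \<Rightarrow> real"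
  assumes w: "weak_grad U u g" and K: "compact K" "K \<subseteq> U" and e: "e > 0"
  obtains N v v' where "C1_on N v v'" "K \<subseteq> N" "N \<subseteq> U" "continuous_on UNIV v" "continuous_on UNIV v'"
    "L1on K (\<lambda>x. u x - v x) < ennreal e" "L1on K (\<lambda>x. g x - v' x) < ennreal e"
    "L2on K v' \<le> L2on U g" "(\<forall>x. u x = 0) \<longrightarrow> (\<forall>x. v x = 0)"
proof -
  obtain d where d: "d > 0" "(\<Union>x\<in>K. cball x d) \<subseteq> U"
    using compact_subset_open_imp_cball_epsilon_subset[OF K(1) weak_gradD(1)[OF w] K(2)] by auto
  have cmp: "compact (\<Union>x\<in>K. cball x d)"
  proof -
    have "(\<Union>x\<in>K. cball x d) = (\<Union>x\<in>K. \<Union>y\<in>cball 0 d. {x + y})"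
    proof (intro SUP_cong set_eqI refl)
      fix x z :: 'a show "z \<in> cball x d \<longleftrightarrow> z \<in> (\<Union>y\<in>cball 0 d. {x + y})"
        by (auto simp: dist_norm norm_minus_commute intro!: bexI[of _ "z - x"])
    qed
    then show ?thesis using compact_sums'[OF K(1) compact_cball[of 0 d]] by simp
  qed
  define V where "V = (\<Union>x\<in>K. ball x d)"
  have V: "open V" "V \<subseteq> U" "V \<subseteq> (\<Union>x\<in>K. cball x d)" using d(2) unfolding V_def by (auto simp: subset_iff intro: less_imp_le)
  have wV: "weak_grad V u g" using weak_grad_subset[OF w V(1,2)] .
  define u1 where "u1 x = (if x \<in> V then u x else 0)" for x
  define g1 where "g1 x = (if x \<in> V then g x else 0)" for x
  have w1: "weak_grad V u1 g1" unfolding u1_def g1_def by (rule weak_grad_zero_outside[OF wV])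
  have fin: "L1on UNIV u1 < \<infinity>" "L1on UNIV g1 < \<infinity>"
  proof -
    have "L1on UNIV u1 \<le> L1on (\<Union>x\<in>K. cball x d) u" "L1on UNIV g1 \<le> L1on (\<Union>x\<in>K. cball x d) g"
      unfolding u1_def g1_def by (intro L1on_zero_outside_le V(3))+
    then show "L1on UNIV u1 < \<infinity>" "L1on UNIV g1 < \<infinity>"
      using weak_gradD(4,5)[OF w cmp d(2)] by (auto intro: le_less_trans)
  qed
  obtain \<tau> where \<tau>: "\<tau> > 0" "\<And>a \<sigma>. \<sigma> > 0 \<Longrightarrow> norm a + \<sigma> < \<tau> \<Longrightarrow> \<exists>v v'. mollification V u1 g1 e a \<sigma> v v'"
    using weak_grad_mollify[OF w1 fin e] by metis
  define \<sigma> where "\<sigma> = min (\<tau>/2) (d/2)"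
  have \<sigma>: "\<sigma> > 0" "norm (0::'a) + \<sigma> < \<tau>" "\<sigma> \<le> d/2" using \<tau>(1) d(1) by (auto simp: \<sigma>_def)
  obtain v v' where v: "continuous_on UNIV v" "continuous_on UNIV v'"
    "\<forall>x. (\<forall>z\<in>cball 0 \<sigma>. x - z \<in> V) \<longrightarrow> GDERIV v x :> v' x"
    "L1on UNIV (\<lambda>x. u1 x - v x) < ennreal e" "L1on UNIV (\<lambda>x. g1 x - v' x) < ennreal e"
    "L2on UNIV v' \<le> L2on UNIV g1" "(\<forall>x. u1 x = 0) \<longrightarrow> (\<forall>x. v x = 0)"
    using \<tau>(2)[OF \<sigma>(1,2)] unfolding mollification_def by blast
  define N where "N = (\<Union>x\<in>K. ball x (d/2))"
  have N: "open N" "K \<subseteq> N" "N \<subseteq> V" using d(1) by (auto simp: N_def V_def)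
  have "x - z \<in> V" if xz: "x \<in> N" "z \<in> cball 0 \<sigma>" for x z
  proof -
    obtain y where y: "y \<in> K" "dist y x < d/2" using xz(1) by (auto simp: N_def)
    have "dist y (x - z) \<le> dist y x + dist x (x - z)" by (rule dist_triangle)
    also have "\<dots> < d" using y \<sigma>(3) xz(2) by (simp add: dist_norm)
    finally show ?thesis using y(1) by (auto simp: V_def)
  qed
  then have C: "C1_on N v v'" using v(2,3) N(1) by (auto simp: C1_on_def intro: continuous_on_subset)
  have KV: "K \<subseteq> V" using N by auto
  show thesis
  proof (rule that[OF C N(2) _ v(1,2)])
    show "N \<subseteq> U" using N V by auto
    have "L1on K (\<lambda>x. u x - v x) \<le> L1on UNIV (\<lambda>x. u1 x - v x)" "L1on K (\<lambda>x. g x - v' x) \<le> L1on UNIV (\<lambda>x. g1 x - v' x)"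
      using KV by (auto intro!: L1on_mono simp: u1_def g1_def)
    then show "L1on K (\<lambda>x. u x - v x) < ennreal e" "L1on K (\<lambda>x. g x - v' x) < ennreal e"
      using v(4,5) by (auto intro: le_less_trans)
    have "L2on K v' \<le> L2on UNIV v'" by (rule L2on_mono) auto
    also note v(6)
    also have "L2on UNIV g1 \<le> L2on U g"
      unfolding g1_def by (rule L2on_zero_outside_le[OF V(2)])
    finally show "L2on K v' \<le> L2on U g" .
    show "(\<forall>x. u x = 0) \<longrightarrow> (\<forall>x. v x = 0)" using v(7) by (simp add: u1_def)
  qed
qed

text \<open>The difference \<open>h\<close> is a weak gradient of 0. Its C^1 approximants have v = 0
  identically, hence v' = 0 on each compact set, while v' is also arbitrarily L^1-close to h
  there.\<close>

lemma weak_grad_unique_AE: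
  fixes u :: "'a::euclidean_space \<Rightarrow> real"
  assumes 1: "weak_grad U u g" and 2: "weak_grad U u' g'" and eq: "AE x in lborel. x \<in> U \<longrightarrow> u x = u' x"
  shows "AE x in lborel. x \<in> U \<longrightarrow> g x = g' x"
proof -
  note [measurable] = weak_gradD(2,3)[OF 1] weak_gradD(2,3)[OF 2]
  define h where "h x = g x + (-1) *\<^sub>R g' x" for x
  have [measurable]: "h \<in> borel_measurable borel" unfolding h_def by measurable
  have "weak_grad U (\<lambda>x. u x + (-1) * u' x) h"
    unfolding h_def by (intro weak_grad_add 1 weak_grad_cmult 2)
  then have w: "weak_grad U (\<lambda>x. 0) h"
    by (rule weak_grad_cong_AE) (use eq in \<open>auto elim!: eventually_mono\<close>)
  have op: "open U" using weak_gradD(1)[OF 1] .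
  obtain K :: "nat \<Rightarrow> 'a set" where K: "\<And>n. compact (K n)" "U = (\<Union>n. K n)"
    using open_Union_compact_subsets[OF op] by (metis (no_types))
  have "AE x in lborel. x \<in> K n \<longrightarrow> h x = 0" for n
  proof -
    have Kn: "compact (K n)" "K n \<subseteq> U" using K by auto
    have KB[measurable]: "K n \<in> sets borel" using Kn by (simp add: borel_compact)
    have "L1on (K n) h \<le> 0 + ennreal e" if e: "e > 0" for e
    proof -
      obtain N v v' where v: "C1_on N v v'" "K n \<subseteq> N" "continuous_on UNIV v'" "L1on (K n) (\<lambda>x. h x - v' x) < ennreal e" "\<And>x. v x = 0"
        by (rule weak_grad_C1_approximation[OF w Kn e]) blast
      have "v' x = 0" if "x \<in> K n" for x
      proof -
        have "GDERIV v x :> v' x" using C1_onD(2)[OF v(1)] v(2) that by auto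
        moreover have "v = (\<lambda>x. 0)" using v(5) by auto
        ultimately show ?thesis using GDERIV_const GDERIV_unique by metis
      qed
      then have "L1on (K n) (\<lambda>x. h x - v' x) = L1on (K n) h" by (intro L1on_cong) auto
      then show ?thesis using v(4) by (simp add: less_imp_le)
    qed
    then have "L1on (K n) h \<le> 0" by (rule ennreal_le_epsilon)
    then have "(\<integral>\<^sup>+x. ennreal (norm (h x)) * indicator (K n) x \<partial>lborel) = 0" by (simp add: L1on_def)
    then have "AE x in lborel. ennreal (norm (h x)) * indicator (K n) x = 0"
      by (subst (asm) nn_integral_0_iff_AE) measurable
    then show ?thesis by eventually_elim (auto simp: indicator_def split: if_splits)
  qed
  then have "AE x in lborel. \<forall>n. x \<in> K n \<longrightarrow> h x = 0" unfolding AE_all_countable by blast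
  then show ?thesis by eventually_elim (auto simp: K(2) h_def)
qed

section \<open>Calculus of weak gradients\<close>

lemma C1_weak_grad_borel:
  assumes v: "C1_on N v v'" and m: "v \<in> borel_measurable borel" "v' \<in> borel_measurable borel"
  shows "weak_grad N v v'"
  by (rule weak_grad_cong_AE[OF C1_weak_grad[OF v] m]) auto

lemma L1on_le_cmult:
  fixes f :: "'a::euclidean_space \<Rightarrow> 'b::euclidean_space" and h :: "'a \<Rightarrow> 'c::euclidean_space"
  assumes [measurable]: "f \<in> borel_measurable borel" "K \<in> sets borel" and "0 \<le> M"
    and le: "\<And>x. x \<in> K \<Longrightarrow> norm (h x) \<le> M * norm (f x)"
  shows "L1on K h \<le> ennreal M * L1on K f"
proof -
  have "L1on K h \<le> L1on K (\<lambda>x. M *\<^sub>R f x)"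
    using le \<open>0 \<le> M\<close> by (intro L1on_mono) auto
  also have "\<dots> = ennreal M * L1on K f" using \<open>0 \<le> M\<close> by (subst L1on_cmult) auto
  finally show ?thesis .
qed

lemma compact_bound_continuous:
  assumes "compact K" "continuous_on K f"
  obtains M where "0 \<le> M" "\<And>x. x \<in> K \<Longrightarrow> norm (f x :: 'b::real_normed_vector) \<le> M"
proof -
  have "bounded (f ` K)" by (rule compact_imp_bounded[OF compact_continuous_image[OF assms(2,1)]])
  then obtain M where M: "\<forall>x\<in>K. norm (f x) \<le> M" by (auto simp: bounded_iff)
  show thesis by (rule that[of "max 0 M"]) (use M in \<open>auto simp: le_max_iff_disj\<close>)
qed

lemma weak_grad_mult:
  fixes u :: "'a::euclidean_space \<Rightarrow> real"
  assumes w: "weak_grad U u g" and \<theta>: "C1_on UNIV \<theta> \<theta>'"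
  shows "weak_grad U (\<lambda>x. \<theta> x * u x) (\<lambda>x. \<theta> x *\<^sub>R g x + u x *\<^sub>R \<theta>' x)"
proof (rule weak_grad_limit)
  note [measurable] = weak_gradD(2,3)[OF w]
  have c: "continuous_on UNIV \<theta>" "continuous_on UNIV \<theta>'" using C1_onD[OF \<theta>] by auto
  have [measurable]: "\<theta> \<in> borel_measurable borel" "\<theta>' \<in> borel_measurable borel"
    using c by (auto intro: borel_measurable_continuous_onI)
  show "open U" using weak_gradD[OF w] by simp
  show "(\<lambda>x. \<theta> x * u x) \<in> borel_measurable borel" "(\<lambda>x. \<theta> x *\<^sub>R g x + u x *\<^sub>R \<theta>' x) \<in> borel_measurable borel"
    by measurable
  fix K and e :: real assume K: "compact K" "K \<subseteq> U" and e: "e > 0"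
  have KB[measurable]: "K \<in> sets borel" using K by (simp add: borel_compact)
  obtain M1 where M1: "0 \<le> M1" "\<And>x. x \<in> K \<Longrightarrow> norm (\<theta> x) \<le> M1"
    using compact_bound_continuous[OF K(1) continuous_on_subset[OF c(1)]] by blast
  obtain M2 where M2: "0 \<le> M2" "\<And>x. x \<in> K \<Longrightarrow> norm (\<theta>' x) \<le> M2"
    using compact_bound_continuous[OF K(1) continuous_on_subset[OF c(2)]] by blast
  define d where "d = e / (M1 + M2 + 1)"
  have d: "d > 0" "(M1 + M2 + 1) * d = e" using e M1(1) M2(1) by (auto simp: d_def)
  have dlt: "(M1 + M2) * d < e" "M1 * d < e" using d M2(1) by (auto simp: algebra_simps) (smt (verit) mult_nonneg_nonneg)
  obtain N v v' where v: "C1_on N v v'" "K \<subseteq> N" "continuous_on UNIV v" "continuous_on UNIV v'"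
    "L1on K (\<lambda>x. u x - v x) < ennreal d" "L1on K (\<lambda>x. g x - v' x) < ennreal d"
    by (rule weak_grad_C1_approximation[OF w K d(1)]) blast
  have [measurable]: "v \<in> borel_measurable borel" "v' \<in> borel_measurable borel"
    using v by (auto intro: borel_measurable_continuous_onI)
  have op: "open N" using C1_onD[OF v(1)] by simp
  have "C1_on N (\<lambda>x. \<theta> x * v x) (\<lambda>x. \<theta> x *\<^sub>R v' x + v x *\<^sub>R \<theta>' x)"
    by (rule C1_on_mult[OF C1_on_subset[OF \<theta> op] v(1)]) simp
  then have "weak_grad N (\<lambda>x. \<theta> x * v x) (\<lambda>x. \<theta> x *\<^sub>R v' x + v x *\<^sub>R \<theta>' x)"
    by (rule C1_weak_grad_borel) measurable
  moreover have "L1on K (\<lambda>x. \<theta> x * u x - \<theta> x * v x) < ennreal e"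
  proof -
    have "L1on K (\<lambda>x. \<theta> x * u x - \<theta> x * v x) \<le> ennreal M1 * L1on K (\<lambda>x. u x - v x)"
      by (rule L1on_le_cmult) (use M1 in \<open>auto simp: abs_mult mult_right_mono simp flip: right_diff_distrib\<close>)
    also have "\<dots> \<le> ennreal M1 * ennreal d" using v(5) by (intro mult_left_mono) auto
    also have "\<dots> < ennreal e" using dlt(2) M1(1) d(1) e by (simp add: ennreal_lessI flip: ennreal_mult)
    finally show ?thesis .
  qed
  moreover have "L1on K (\<lambda>x. \<theta> x *\<^sub>R g x + u x *\<^sub>R \<theta>' x - (\<theta> x *\<^sub>R v' x + v x *\<^sub>R \<theta>' x)) < ennreal e"
  proof -
    have "L1on K (\<lambda>x. \<theta> x *\<^sub>R g x + u x *\<^sub>R \<theta>' x - (\<theta> x *\<^sub>R v' x + v x *\<^sub>R \<theta>' x))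
      \<le> L1on K (\<lambda>x. \<theta> x *\<^sub>R (g x - v' x)) + L1on K (\<lambda>x. (u x - v x) *\<^sub>R \<theta>' x)"
    proof (rule L1on_triangle)
      fix x
      have "\<theta> x *\<^sub>R g x + u x *\<^sub>R \<theta>' x - (\<theta> x *\<^sub>R v' x + v x *\<^sub>R \<theta>' x) = \<theta> x *\<^sub>R (g x - v' x) + (u x - v x) *\<^sub>R \<theta>' x"
        by (simp add: algebra_simps)
      then show "norm (\<theta> x *\<^sub>R g x + u x *\<^sub>R \<theta>' x - (\<theta> x *\<^sub>R v' x + v x *\<^sub>R \<theta>' x))
        \<le> norm (\<theta> x *\<^sub>R (g x - v' x)) + norm ((u x - v x) *\<^sub>R \<theta>' x)"
        by (metis norm_triangle_ineq)
    qed measurable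
    also have "\<dots> \<le> ennreal M1 * L1on K (\<lambda>x. g x - v' x) + ennreal M2 * L1on K (\<lambda>x. u x - v x)"
      by (intro add_mono L1on_le_cmult) (use M1 M2 in \<open>auto simp: mult_right_mono mult.commute[of M2] mult_left_mono\<close>)
    also have "\<dots> \<le> ennreal M1 * ennreal d + ennreal M2 * ennreal d"
      using v(5,6) by (intro add_mono mult_left_mono) auto
    also have "\<dots> = ennreal ((M1 + M2) * d)"
      using M1(1) M2(1) d(1) by (simp add: distrib_right flip: ennreal_mult ennreal_plus)
    also have "\<dots> < ennreal e" using dlt(1) e by (simp add: ennreal_lessI)
    finally show ?thesis .
  qed
  ultimately show "\<exists>V v v'. weak_grad V v v' \<and> K \<subseteq> V \<and> L1on K (\<lambda>x. \<theta> x * u x - v x) < ennreal e \<and>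
    L1on K (\<lambda>x. \<theta> x *\<^sub>R g x + u x *\<^sub>R \<theta>' x - v' x) < ennreal e"
    using v(2) by blast
qed

lemma L1on_AE_subseq:
  fixes u :: "'a::euclidean_space \<Rightarrow> 'b::euclidean_space"
  assumes [measurable]: "u \<in> borel_measurable borel" "\<And>n. v n \<in> borel_measurable borel" "K \<in> sets borel"
    and le: "\<And>n. L1on K (\<lambda>x. u x - v n x) < ennreal (1 / real (Suc n))"
  obtains r :: "nat \<Rightarrow> nat" where "strict_mono r" "AE x in lborel. x \<in> K \<longrightarrow> (\<lambda>n. v (r n) x) \<longlonglongrightarrow> u x"
proof -
  define f where "f n x = indicator K x *\<^sub>R (u x - v n x)" for n x
  have nn: "(\<integral>\<^sup>+x. ennreal (norm (f n x)) \<partial>lborel) = L1on K (\<lambda>x. u x - v n x)" for n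
    unfolding L1on_def f_def by (intro nn_integral_cong) (auto simp: indicator_def)
  have [measurable]: "f n \<in> borel_measurable borel" for n unfolding f_def by measurable
  have int: "integrable lborel (f n)" for n
    by (rule integrableI_bounded) (use nn[of n] le[of n] in \<open>auto intro: less_trans\<close>)
  have "(\<integral>x. norm (f n x) \<partial>lborel) \<le> 1 / real (Suc n)" for n
  proof -
    have "ennreal (\<integral>x. norm (f n x) \<partial>lborel) = L1on K (\<lambda>x. u x - v n x)"
      using nn[of n] int[of n] by (subst nn_integral_eq_integral[symmetric]) auto
    then have "ennreal (\<integral>x. norm (f n x) \<partial>lborel) \<le> ennreal (1 / real (Suc n))" using le[of n] by simp
    then show ?thesis by (subst (asm) ennreal_le_iff) auto
  qed
  then have "(\<lambda>n. \<integral>x. norm (f n x) \<partial>lborel) \<longlonglongrightarrow> 0"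
    by (intro tendsto_sandwich[OF _ _ tendsto_const LIMSEQ_Suc[OF lim_1_over_n]]) auto
  from tendsto_L1_AE_subseq[OF int this] obtain r :: "nat \<Rightarrow> nat" where r: "strict_mono r" "AE x in lborel. (\<lambda>n. f (r n) x) \<longlonglongrightarrow> 0"
    by auto
  have "AE x in lborel. x \<in> K \<longrightarrow> (\<lambda>n. v (r n) x) \<longlonglongrightarrow> u x"
    using r(2)
  proof eventually_elim
    case (elim x)
    show ?case
    proof
      assume "x \<in> K"
      then have "(\<lambda>n. u x - v (r n) x) \<longlonglongrightarrow> 0" using elim by (simp add: f_def)
      from tendsto_diff[OF tendsto_const[of "u x"] this] show "(\<lambda>n. v (r n) x) \<longlonglongrightarrow> u x" by simp
    qed
  qed
  then show thesis using that r(1) by blast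
qed

lemma L1on_dominated:
  fixes s :: "nat \<Rightarrow> 'a::euclidean_space \<Rightarrow> 'b::euclidean_space"
  assumes [measurable]: "\<And>n. s n \<in> borel_measurable borel" "f \<in> borel_measurable borel" "w \<in> borel_measurable borel" "K \<in> sets borel"
    and le: "\<And>n x. x \<in> K \<Longrightarrow> norm (s n x) \<le> w x" and fin: "L1on K w < \<infinity>"
    and lim: "AE x in lborel. x \<in> K \<longrightarrow> (\<lambda>n. s n x) \<longlonglongrightarrow> f x"
  shows "(\<lambda>n. L1on K (\<lambda>x. f x - s n x)) \<longlonglongrightarrow> 0"
proof -
  have eq: "L1on K (\<lambda>x. f x - s n x) = (\<integral>\<^sup>+x. norm (indicator K x *\<^sub>R f x - indicator K x *\<^sub>R s n x) \<partial>lborel)" for n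
    unfolding L1on_def by (intro nn_integral_cong) (auto simp: indicator_def)
  show ?thesis
    unfolding eq
  proof (rule nn_integral_dominated_convergence_norm[where w="\<lambda>x. indicator K x * w x"])
    show "AE x in lborel. norm (indicator K x *\<^sub>R s j x) \<le> indicator K x * w x" for j
      using le by (auto simp: indicator_def)
    have "(\<integral>\<^sup>+x. ennreal (indicator K x * w x) \<partial>lborel) \<le> L1on K w"
      unfolding L1on_def by (intro nn_integral_mono) (auto simp: indicator_def intro!: ennreal_leI)
    then show "(\<integral>\<^sup>+x. ennreal (indicator K x * w x) \<partial>lborel) < \<infinity>" using fin by (rule le_less_trans)
    show "AE x in lborel. (\<lambda>n. indicator K x *\<^sub>R s n x) \<longlonglongrightarrow> indicator K x *\<^sub>R f x"
      using lim by eventually_elim (auto simp: indicator_def)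
  qed measurable
qed

text \<open>Chain rule for the C^1 functions sqrt(t^2 + \<delta>^2), then \<delta> to 0. At t = 0
  their derivative is 0 for every \<delta>, which matches sgn 0 = 0.\<close>

lemma weak_grad_abs:
  fixes u :: "'a::euclidean_space \<Rightarrow> real"
  assumes w: "weak_grad U u g"
  shows "weak_grad U (\<lambda>x. \<bar>u x\<bar>) (\<lambda>x. sgn (u x) *\<^sub>R g x)"
proof -
  note [measurable] = weak_gradD(2,3)[OF w]
  have op: "open U" using weak_gradD(1)[OF w] .
  define F where "F \<delta> t = sqrt (t\<^sup>2 + \<delta>\<^sup>2)" for \<delta> t :: real
  define F' where "F' \<delta> t = t / sqrt (t\<^sup>2 + \<delta>\<^sup>2)" for \<delta> t :: real
  have pos: "t\<^sup>2 + \<delta>\<^sup>2 > 0" if "\<delta> > 0" for \<delta> t :: real using that by (simp add: add_nonneg_pos)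
  have F_deriv: "DERIV (F \<delta>) t :> F' \<delta> t" if "\<delta> > 0" for \<delta> t
    unfolding F_def F'_def using pos[OF that, of t] by (auto intro!: derivative_eq_intros simp: field_simps)
  have contF': "continuous_on UNIV (F' \<delta>)" "continuous_on UNIV (F \<delta>)" if "\<delta> > 0" for \<delta>
    unfolding F'_def F_def using pos[OF that] by (auto intro!: continuous_intros less_imp_neq[THEN not_sym])
  have F'_le: "\<bar>F' \<delta> t\<bar> \<le> 1" for \<delta> t
  proof -
    have "\<bar>t\<bar> \<le> sqrt (t\<^sup>2 + \<delta>\<^sup>2)" by (rule real_le_rsqrt) simp
    moreover have "\<bar>t / q\<bar> \<le> 1" if "\<bar>t\<bar> \<le> q" for q :: real
      using that by (cases "q = 0") auto
    ultimately show ?thesis unfolding F'_def by blast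
  qed
  have Fabs: "\<bar>F \<delta> t - \<bar>t\<bar>\<bar> \<le> \<bar>\<delta>\<bar>" for \<delta> t
  proof -
    have "sqrt (t\<^sup>2 + \<delta>\<^sup>2) \<le> \<bar>t\<bar> + \<bar>\<delta>\<bar>" by (rule sqrt_sum_squares_le_sum_abs)
    moreover have "\<bar>t\<bar> \<le> sqrt (t\<^sup>2 + \<delta>\<^sup>2)" by (rule real_le_rsqrt) simp
    ultimately show ?thesis unfolding F_def by linarith
  qed
  have Fle: "\<bar>F \<delta> t\<bar> \<le> \<bar>t\<bar> + 1" if "0 < \<delta>" "\<delta> \<le> 1" for \<delta> t
    using Fabs[of \<delta> t] that by linarith
  have chain: "weak_grad U (\<lambda>x. F \<delta> (u x)) (\<lambda>x. F' \<delta> (u x) *\<^sub>R g x)" if \<delta>: "\<delta> > 0" for \<delta>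
  proof (rule weak_grad_limit[OF op])
    have [measurable]: "F' \<delta> \<in> borel_measurable borel" "F \<delta> \<in> borel_measurable borel"
      using contF'[OF \<delta>] by (auto intro: borel_measurable_continuous_onI)
    show "(\<lambda>x. F \<delta> (u x)) \<in> borel_measurable borel" "(\<lambda>x. F' \<delta> (u x) *\<^sub>R g x) \<in> borel_measurable borel" by measurable
    fix K and e :: real assume K: "compact K" "K \<subseteq> U" and e: "e > 0"
    have KB[measurable]: "K \<in> sets borel" using K by (simp add: borel_compact)
    define Q where "Q n v v' N \<longleftrightarrow> C1_on N v v' \<and> K \<subseteq> N \<and> continuous_on UNIV v \<and> continuous_on UNIV v' \<and>
      L1on K (\<lambda>x. u x - v x) < ennreal (1 / real (Suc n)) \<and> L1on K (\<lambda>x. g x - v' x) < ennreal (1 / real (Suc n))"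
      for n v v' N
    have "\<exists>v v' N. Q n v v' N" for n
      unfolding Q_def by (rule weak_grad_C1_approximation[OF w K, of "1 / real (Suc n)"]; auto)
    then obtain v v' N where Q: "\<And>n. Q n (v n) (v' n) (N n)" by metis
    then have v: "\<And>n. C1_on (N n) (v n) (v' n)" "\<And>n. K \<subseteq> N n"
      "\<And>n. continuous_on UNIV (v n)" "\<And>n. continuous_on UNIV (v' n)"
      "\<And>n. L1on K (\<lambda>x. u x - v n x) < ennreal (1 / real (Suc n))"
      "\<And>n. L1on K (\<lambda>x. g x - v' n x) < ennreal (1 / real (Suc n))" unfolding Q_def by auto
    have vm[measurable]: "v n \<in> borel_measurable borel" "v' n \<in> borel_measurable borel" for n
      using v(3,4) by (auto intro: borel_measurable_continuous_onI)
    \<comment> \<open>L^1 convergence of \<open>v\<close> does not control the product of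
      \<open>F' \<delta> (v x)\<close> with g, since g is merely integrable; an almost everywhere
      convergent subsequence permits dominated convergence with majorant |g|.\<close>
    obtain r :: "nat \<Rightarrow> nat" where r: "strict_mono r" "AE x in lborel. x \<in> K \<longrightarrow> (\<lambda>n. v (r n) x) \<longlonglongrightarrow> u x"
      by (rule L1on_AE_subseq[OF weak_gradD(2)[OF w] vm(1) KB v(5)])
    have "(\<lambda>n. L1on K (\<lambda>x. F' \<delta> (u x) *\<^sub>R g x - F' \<delta> (v (r n) x) *\<^sub>R g x)) \<longlonglongrightarrow> 0"
    proof (rule L1on_dominated[where w="\<lambda>x. norm (g x)"])
      show "norm (F' \<delta> (v (r n) x) *\<^sub>R g x) \<le> norm (g x)" for n x
        using F'_le[of \<delta> "v (r n) x"] by (simp add: mult_left_le_one_le)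
      show "L1on K (\<lambda>x. norm (g x)) < \<infinity>" using weak_gradD(5)[OF w K] by (simp add: L1on_def)
      show "AE x in lborel. x \<in> K \<longrightarrow> (\<lambda>n. F' \<delta> (v (r n) x) *\<^sub>R g x) \<longlonglongrightarrow> F' \<delta> (u x) *\<^sub>R g x"
        using r(2)
      proof eventually_elim
        case (elim x)
        have "isCont (F' \<delta>) (u x)" using contF'[OF \<delta>] by (simp add: continuous_on_eq_continuous_at)
        then show ?case using elim isCont_tendsto_compose[of "u x" "F' \<delta>"] by (auto intro!: tendsto_scaleR tendsto_const)
      qed
    qed measurable
    then have ev1: "\<forall>\<^sub>F n in sequentially. L1on K (\<lambda>x. F' \<delta> (u x) *\<^sub>R g x - F' \<delta> (v (r n) x) *\<^sub>R g x) < ennreal (e/2)"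
      by (rule order_tendstoD(2)) (use e in simp)
    have "(\<lambda>n. 1 / real (Suc n)) \<longlonglongrightarrow> 0" by (rule LIMSEQ_Suc[OF lim_1_over_n])
    then have "\<forall>\<^sub>F n in sequentially. 1 / real (Suc (r n)) < e/2"
      by (intro order_tendstoD(2)[OF LIMSEQ_subseq_LIMSEQ[OF _ r(1), unfolded comp_def]]) (use e in auto)
    from eventually_happens[OF eventually_conj[OF this ev1]]
    obtain n where n: "1 / real (Suc (r n)) < e/2"
      "L1on K (\<lambda>x. F' \<delta> (u x) *\<^sub>R g x - F' \<delta> (v (r n) x) *\<^sub>R g x) < ennreal (e/2)"
      by auto
    define m where "m = r n"
    have lt: "ennreal (1 / real (Suc m)) < ennreal (e/2)"
      by (rule ennreal_lessI) (use e n(1) in \<open>simp_all add: m_def\<close>)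
    have small: "L1on K (\<lambda>x. u x - v m x) < ennreal (e/2)" "L1on K (\<lambda>x. g x - v' m x) < ennreal (e/2)"
      by (rule less_trans[OF v(5) lt], rule less_trans[OF v(6) lt])
    have "C1_on (N m) (\<lambda>x. F \<delta> (v m x)) (\<lambda>x. F' \<delta> (v m x) *\<^sub>R v' m x)"
      unfolding C1_on_def
    proof (intro conjI ballI)
      show "open (N m)" using C1_onD[OF v(1)] by auto
      show "GDERIV (\<lambda>x. F \<delta> (v m x)) x :> F' \<delta> (v m x) *\<^sub>R v' m x" if "x \<in> N m" for x
        by (rule GDERIV_DERIV_compose[OF C1_onD(2)[OF v(1) that] F_deriv[OF \<delta>]])
      have "continuous_on UNIV (\<lambda>x. F' \<delta> (v m x) *\<^sub>R v' m x)"
        by (intro continuous_on_scaleR v(4) continuous_on_compose2[OF contF'(1)[OF \<delta>] v(3)]) auto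
      then show "continuous_on (N m) (\<lambda>x. F' \<delta> (v m x) *\<^sub>R v' m x)" by (rule continuous_on_subset) auto
    qed
    then have "weak_grad (N m) (\<lambda>x. F \<delta> (v m x)) (\<lambda>x. F' \<delta> (v m x) *\<^sub>R v' m x)"
      by (rule C1_weak_grad_borel) measurable
    moreover have "L1on K (\<lambda>x. F \<delta> (u x) - F \<delta> (v m x)) < ennreal e"
    proof -
      have "\<bar>F \<delta> s - F \<delta> t\<bar> \<le> \<bar>s - t\<bar>" for s t
      proof -
        have "norm (F \<delta> s - F \<delta> t) \<le> 1 * norm (s - t)"
          by (rule field_differentiable_bound[of UNIV "F \<delta>" "F' \<delta>"])
            (use F_deriv[OF \<delta>] F'_le in auto)
        then show ?thesis by simp
      qed
      then have "L1on K (\<lambda>x. F \<delta> (u x) - F \<delta> (v m x)) \<le> L1on K (\<lambda>x. u x - v m x)" by (intro L1on_mono) auto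
      also note small(1)
      also have "ennreal (e/2) \<le> ennreal e" using e by (intro ennreal_leI) simp
      finally show ?thesis .
    qed
    moreover have "L1on K (\<lambda>x. F' \<delta> (u x) *\<^sub>R g x - F' \<delta> (v m x) *\<^sub>R v' m x) < ennreal e"
    proof -
      have "L1on K (\<lambda>x. F' \<delta> (u x) *\<^sub>R g x - F' \<delta> (v m x) *\<^sub>R v' m x) \<le>
        L1on K (\<lambda>x. F' \<delta> (u x) *\<^sub>R g x - F' \<delta> (v m x) *\<^sub>R g x) + L1on K (\<lambda>x. F' \<delta> (v m x) *\<^sub>R g x - F' \<delta> (v m x) *\<^sub>R v' m x)"
        by (rule L1on_diff_triangle) measurable
      also have "L1on K (\<lambda>x. F' \<delta> (v m x) *\<^sub>R g x - F' \<delta> (v m x) *\<^sub>R v' m x) \<le> L1on K (\<lambda>x. g x - v' m x)"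
        by (rule L1on_mono) (use F'_le in \<open>simp add: mult_left_le_one_le flip: scaleR_diff_right\<close>)
      also have "L1on K (\<lambda>x. F' \<delta> (u x) *\<^sub>R g x - F' \<delta> (v m x) *\<^sub>R g x) + L1on K (\<lambda>x. g x - v' m x) < ennreal (e/2) + ennreal (e/2)"
        using n(2) small(2) unfolding m_def by (rule add_strict_mono)
      also have "\<dots> = ennreal e" using e by (simp flip: ennreal_plus)
      finally show ?thesis by (simp add: add_left_mono)
    qed
    ultimately show "\<exists>V w w'. weak_grad V w w' \<and> K \<subseteq> V \<and> L1on K (\<lambda>x. F \<delta> (u x) - w x) < ennreal e \<and>
       L1on K (\<lambda>x. F' \<delta> (u x) *\<^sub>R g x - w' x) < ennreal e"
      using v(2) by blast
  qed
  show ?thesis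
  proof (rule weak_grad_limit[OF op])
    show "(\<lambda>x. \<bar>u x\<bar>) \<in> borel_measurable borel" "(\<lambda>x. sgn (u x) *\<^sub>R g x) \<in> borel_measurable borel" by measurable
    fix K and e :: real assume K: "compact K" "K \<subseteq> U" and e: "e > 0"
    have KB[measurable]: "K \<in> sets borel" using K by (simp add: borel_compact)
    define d where "d n = 1 / real (Suc n)" for n
    have d: "d n > 0" "d n \<le> 1" for n by (auto simp: d_def)
    have d0: "d \<longlonglongrightarrow> 0" unfolding d_def by (rule LIMSEQ_Suc[OF lim_1_over_n])
    have [measurable]: "F' (d n) \<in> borel_measurable borel" "F (d n) \<in> borel_measurable borel" for n
      using contF'[OF d(1)[of n]] by (auto intro: borel_measurable_continuous_onI)
    have fin1: "L1on K (\<lambda>x. \<bar>u x\<bar> + 1) < \<infinity>"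
    proof -
      have "L1on K (\<lambda>x. \<bar>u x\<bar> + 1) \<le> L1on K u + L1on K (\<lambda>x. 1::real)" by (rule L1on_triangle) auto
      also have "\<dots> < \<infinity>" using weak_gradD(4)[OF w K] L1on_finite_if_bounded[of K "\<lambda>_. 1::real" 1] K
        by (simp add: compact_imp_bounded)
      finally show ?thesis .
    qed
    have "(\<lambda>n. L1on K (\<lambda>x. \<bar>u x\<bar> - F (d n) (u x))) \<longlonglongrightarrow> 0"
    proof (rule L1on_dominated[OF _ _ _ _ _ fin1])
      show "norm (F (d n) (u x)) \<le> \<bar>u x\<bar> + 1" for n x using Fle[OF d] by simp
      have "(\<lambda>n. F (d n) (u x)) \<longlonglongrightarrow> \<bar>u x\<bar>" for x
      proof -
        have "(\<lambda>n. sqrt ((u x)\<^sup>2 + (d n)\<^sup>2)) \<longlonglongrightarrow> sqrt ((u x)\<^sup>2 + 0\<^sup>2)" by (intro tendsto_intros d0)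
        then show ?thesis by (simp add: F_def)
      qed
      then show "AE x in lborel. x \<in> K \<longrightarrow> (\<lambda>n. F (d n) (u x)) \<longlonglongrightarrow> \<bar>u x\<bar>" by simp
    qed measurable
    then have ev1: "\<forall>\<^sub>F n in sequentially. L1on K (\<lambda>x. \<bar>u x\<bar> - F (d n) (u x)) < ennreal e"
      by (rule order_tendstoD(2)) (use e in simp)
    have "(\<lambda>n. L1on K (\<lambda>x. sgn (u x) *\<^sub>R g x - F' (d n) (u x) *\<^sub>R g x)) \<longlonglongrightarrow> 0"
    proof (rule L1on_dominated[where w="\<lambda>x. norm (g x)"])
      show "norm (F' (d n) (u x) *\<^sub>R g x) \<le> norm (g x)" for n x
        using F'_le[of "d n" "u x"] by (simp add: mult_left_le_one_le)
      show "L1on K (\<lambda>x. norm (g x)) < \<infinity>" using weak_gradD(5)[OF w K] by (simp add: L1on_def)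
      have "(\<lambda>n. F' (d n) (u x)) \<longlonglongrightarrow> sgn (u x)" for x
      proof (cases "u x = 0")
        case True
        then show ?thesis by (simp add: F'_def)
      next
        case False
        have "(\<lambda>n. u x / sqrt ((u x)\<^sup>2 + (d n)\<^sup>2)) \<longlonglongrightarrow> u x / sqrt ((u x)\<^sup>2 + 0\<^sup>2)"
          by (intro tendsto_intros d0) (use False in auto)
        then show ?thesis using False by (simp add: F'_def sgn_real_def abs_if split: if_splits)
      qed
      then show "AE x in lborel. x \<in> K \<longrightarrow> (\<lambda>n. F' (d n) (u x) *\<^sub>R g x) \<longlonglongrightarrow> sgn (u x) *\<^sub>R g x"
        by (auto intro!: tendsto_scaleR tendsto_const)
    qed measurable
    then have ev2: "\<forall>\<^sub>F n in sequentially. L1on K (\<lambda>x. sgn (u x) *\<^sub>R g x - F' (d n) (u x) *\<^sub>R g x) < ennreal e"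
      by (rule order_tendstoD(2)) (use e in simp)
    obtain n where "L1on K (\<lambda>x. \<bar>u x\<bar> - F (d n) (u x)) < ennreal e"
      "L1on K (\<lambda>x. sgn (u x) *\<^sub>R g x - F' (d n) (u x) *\<^sub>R g x) < ennreal e"
      using eventually_conj[OF ev1 ev2] by (auto simp: eventually_sequentially)
    then show "\<exists>V v v'. weak_grad V v v' \<and> K \<subseteq> V \<and> L1on K (\<lambda>x. \<bar>u x\<bar> - v x) < ennreal e \<and>
       L1on K (\<lambda>x. sgn (u x) *\<^sub>R g x - v' x) < ennreal e"
      using chain[OF d(1)[of n]] K(2) by blast
  qed
qed

lemma nn_integral_affine:
  fixes f :: "'a::euclidean_space \<Rightarrow> ennreal"
  assumes [measurable]: "f \<in> borel_measurable borel" and s: "s > 0"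
  shows "(\<integral>\<^sup>+x. f x \<partial>lborel) = ennreal (s ^ DIM('a)) * (\<integral>\<^sup>+y. f (a + s *\<^sub>R y) \<partial>lborel)"
proof -
  have "(\<integral>\<^sup>+x. f x \<partial>lborel) = (\<integral>\<^sup>+x. f x \<partial>(density (distr lborel borel (\<lambda>x. a + s *\<^sub>R x)) (\<lambda>_. ennreal (\<bar>s\<bar>^DIM('a)))))"
    using lborel_affine[of s a] s by simp
  also have "\<dots> = ennreal (s ^ DIM('a)) * (\<integral>\<^sup>+y. f (a + s *\<^sub>R y) \<partial>lborel)"
    using s by (simp add: nn_integral_density nn_integral_distr nn_integral_cmult)
  finally show ?thesis .
qed

lemma weak_grad_affine:
  fixes u :: "'a::euclidean_space \<Rightarrow> real"
  assumes w: "weak_grad U u g" and s: "s > 0"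
  shows "weak_grad ((\<lambda>y. a + s *\<^sub>R y) -` U) (\<lambda>y. u (a + s *\<^sub>R y)) (\<lambda>y. s *\<^sub>R g (a + s *\<^sub>R y))"
proof (rule weak_grad_limit)
  note [measurable] = weak_gradD(2,3)[OF w]
  let ?A = "\<lambda>y. a + s *\<^sub>R y"
  show "open (?A -` U)" using weak_gradD(1)[OF w] by (intro open_vimage continuous_intros)
  show "(\<lambda>y. u (?A y)) \<in> borel_measurable borel" "(\<lambda>y. s *\<^sub>R g (?A y)) \<in> borel_measurable borel"
    by measurable
  fix K and e :: real assume K: "compact K" "K \<subseteq> ?A -` U" and e: "e > 0"
  have cA: "compact (?A ` K)" "?A ` K \<subseteq> U" using K by (auto intro!: compact_continuous_image continuous_intros)
  have KB[measurable]: "K \<in> sets borel" "?A ` K \<in> sets borel" using K cA by (auto simp: borel_compact)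
  have L: "L1on (?A ` K) f = ennreal (s ^ DIM('a)) * L1on K (\<lambda>y. f (?A y))"
    if [measurable]: "f \<in> borel_measurable borel" for f :: "'a \<Rightarrow> 'b::euclidean_space"
  proof -
    have "indicator (?A ` K) (?A y) = (indicator K y :: ennreal)" for y
      using s by (auto simp: indicator_def)
    then show ?thesis
      unfolding L1on_def by (subst nn_integral_affine[OF _ s, of _ a]) auto
  qed
  \<comment> \<open>Dividing out the Jacobian, a power of s, leaves e / (s + 1). This is below e
    both as it stands and after multiplication by the factor s of the gradient.\<close>
  define d where "d = e * s ^ DIM('a) / (s + 1)"
  have d: "d > 0" using e s by (simp add: d_def)
  obtain N v v' where v: "C1_on N v v'" "?A ` K \<subseteq> N" "continuous_on UNIV v" "continuous_on UNIV v'"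
    "L1on (?A ` K) (\<lambda>x. u x - v x) < ennreal d" "L1on (?A ` K) (\<lambda>x. g x - v' x) < ennreal d"
    by (rule weak_grad_C1_approximation[OF w cA d]) blast
  have [measurable]: "v \<in> borel_measurable borel" "v' \<in> borel_measurable borel"
    using v by (auto intro: borel_measurable_continuous_onI)
  have C: "C1_on (?A -` N) (\<lambda>y. v (?A y)) (\<lambda>y. s *\<^sub>R v' (?A y))"
    unfolding C1_on_def
  proof (intro conjI ballI)
    show "open (?A -` N)" using C1_onD(1)[OF v(1)] by (intro open_vimage continuous_intros)
    show "continuous_on (?A -` N) (\<lambda>y. s *\<^sub>R v' (?A y))"
      by (intro continuous_intros continuous_on_compose2[OF v(4)]) auto
    fix y assume "y \<in> ?A -` N"
    then have "GDERIV v (?A y) :> v' (?A y)" using C1_onD(2)[OF v(1)] by auto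
    then have "((\<lambda>y. v (?A y)) has_derivative (\<lambda>h. (s *\<^sub>R h) \<bullet> v' (?A y))) (at y)"
      unfolding gderiv_def
      by (rule has_derivative_compose[where f="?A", rotated]) (auto intro!: derivative_eq_intros)
    then show "GDERIV (\<lambda>y. v (?A y)) y :> s *\<^sub>R v' (?A y)" by (simp add: gderiv_def)
  qed
  have cancel: "L1on K (\<lambda>y. f (?A y)) < ennreal (d / s ^ DIM('a))"
    if "L1on (?A ` K) f < ennreal d" and [measurable]: "f \<in> borel_measurable borel" for f :: "'a \<Rightarrow> 'b::euclidean_space"
  proof -
    have "ennreal (s ^ DIM('a)) * L1on K (\<lambda>y. f (?A y)) < ennreal (s ^ DIM('a)) * ennreal (d / s ^ DIM('a))"
      using that(1) L[of f] s d by (simp flip: ennreal_mult)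
    then show ?thesis by (meson leD leI mult_left_mono zero_le)
  qed
  have dd: "d / s ^ DIM('a) = e / (s + 1)" using s by (simp add: d_def)
  have lt: "e / (s + 1) < e" "s * (e / (s + 1)) < e" using s e by (auto simp: field_simps)
  have 1: "L1on K (\<lambda>y. u (?A y) - v (?A y)) < ennreal e"
    using less_trans[OF cancel[OF v(5)] ennreal_lessI[OF e]] lt dd by simp
  have 2: "L1on K (\<lambda>y. s *\<^sub>R g (?A y) - s *\<^sub>R v' (?A y)) < ennreal e"
  proof -
    have "L1on K (\<lambda>y. s *\<^sub>R g (?A y) - s *\<^sub>R v' (?A y)) = ennreal s * L1on K (\<lambda>y. g (?A y) - v' (?A y))"
      using s by (simp add: L1on_cmult flip: scaleR_diff_right)
    also have "\<dots> \<le> ennreal s * ennreal (e / (s + 1))"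
      using cancel[OF v(6)] dd by (intro mult_left_mono) (auto intro: less_imp_le)
    also have "\<dots> = ennreal (s * (e / (s + 1)))" using s e by (simp flip: ennreal_mult)
    also have "\<dots> < ennreal e" using lt(2) e by (simp only: ennreal_lessI)
    finally show ?thesis .
  qed
  have "weak_grad (?A -` N) (\<lambda>y. v (?A y)) (\<lambda>y. s *\<^sub>R v' (?A y))"
    by (rule C1_weak_grad_borel[OF C]) measurable
  moreover have "K \<subseteq> ?A -` N" using v(2) by auto
  ultimately show "\<exists>V w w'. weak_grad V w w' \<and> K \<subseteq> V \<and> L1on K (\<lambda>y. u (?A y) - w y) < ennreal e \<and>
    L1on K (\<lambda>y. s *\<^sub>R g (?A y) - w' y) < ennreal e" using 1 2 by blast
qed

section \<open>Poincare inequalities\<close>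

text \<open>For A = B of finite measure this is twice the measure of A times the integral of the
  squared deviation from the mean. The double integral is preferred because it is monotone in both
  sets and can be passed from one set to the next without comparing means.\<close>

definition osc2 :: "'a::euclidean_space set \<Rightarrow> 'a set \<Rightarrow> ('a \<Rightarrow> real) \<Rightarrow> ennreal" where
  "osc2 A B u = (\<integral>\<^sup>+x. (\<integral>\<^sup>+y. ennreal ((u x - u y)\<^sup>2) * (indicator A x * indicator B y) \<partial>lborel) \<partial>lborel)"

lemma osc2_mono:
  assumes "A \<subseteq> A'" "B \<subseteq> B'"
  shows "osc2 A B u \<le> osc2 A' B' u"
  unfolding osc2_def
proof (intro nn_integral_mono mult_left_mono)
  fix x y
  show "(indicator A x * indicator B y :: ennreal) \<le> indicator A' x * indicator B' y"
    using assms by (auto simp: indicator_def)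
qed simp

lemma osc2_cong:
  assumes "\<And>x. x \<in> A \<union> B \<Longrightarrow> u x = v x"
  shows "osc2 A B u = osc2 A B v"
  unfolding osc2_def by (intro nn_integral_cong) (use assms in \<open>auto simp: indicator_def\<close>)

lemma osc2_sym:
  fixes u :: "'a::euclidean_space \<Rightarrow> real"
  assumes [measurable]: "u \<in> borel_measurable borel" "A \<in> sets borel" "B \<in> sets borel"
  shows "osc2 A B u = osc2 B A u"
proof -
  have "osc2 A B u = (\<integral>\<^sup>+y. (\<integral>\<^sup>+x. ennreal ((u x - u y)\<^sup>2) * (indicator A x * indicator B y) \<partial>lborel) \<partial>lborel)"
    unfolding osc2_def by (rule lborel_pair.Fubini'[symmetric]) measurable
  also have "\<dots> = osc2 B A u"
    unfolding osc2_def by (intro nn_integral_cong) (simp add: power2_commute mult.commute)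
  finally show ?thesis .
qed

lemma osc2_UN_le:
  fixes u :: "'a::euclidean_space \<Rightarrow> real"
  assumes [measurable]: "u \<in> borel_measurable borel" "\<And>z. z \<in> Z \<Longrightarrow> P z \<in> sets borel"
    and Z: "finite Z" "G \<subseteq> (\<Union>z\<in>Z. P z)"
  shows "osc2 G G u \<le> (\<Sum>a\<in>Z. \<Sum>b\<in>Z. osc2 (P a) (P b) u)"
proof -
  have "osc2 G G u \<le> (\<integral>\<^sup>+x. (\<integral>\<^sup>+y. (\<Sum>a\<in>Z. \<Sum>b\<in>Z. ennreal ((u x - u y)\<^sup>2) * (indicator (P a) x * indicator (P b) y)) \<partial>lborel) \<partial>lborel)"
    unfolding osc2_def
  proof (intro nn_integral_mono)
    fix x y
    show "ennreal ((u x - u y)\<^sup>2) * (indicator G x * indicator G y) \<le>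
       (\<Sum>a\<in>Z. \<Sum>b\<in>Z. ennreal ((u x - u y)\<^sup>2) * (indicator (P a) x * indicator (P b) y))"
    proof (cases "x \<in> G \<and> y \<in> G")
      case True
      then obtain a b where ab: "a \<in> Z" "x \<in> P a" "b \<in> Z" "y \<in> P b" using Z(2) by blast
      have "ennreal ((u x - u y)\<^sup>2) * (indicator G x * indicator G y) = ennreal ((u x - u y)\<^sup>2) * (indicator (P a) x * indicator (P b) y)"
        using True ab by simp
      also have "\<dots> \<le> (\<Sum>b\<in>Z. ennreal ((u x - u y)\<^sup>2) * (indicator (P a) x * indicator (P b) y))"
        by (rule member_le_sum[OF ab(3)]) (use Z in auto)
      also have "\<dots> \<le> (\<Sum>a\<in>Z. \<Sum>b\<in>Z. ennreal ((u x - u y)\<^sup>2) * (indicator (P a) x * indicator (P b) y))"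
        by (rule member_le_sum[OF ab(1), where f="\<lambda>a. \<Sum>b\<in>Z. ennreal ((u x - u y)\<^sup>2) * (indicator (P a) x * indicator (P b) y)"])
          (use Z in \<open>auto intro: sum_nonneg\<close>)
      finally show ?thesis .
    next
      case False
      then have "(indicator G x * indicator G y :: ennreal) = 0" by (auto simp: indicator_def)
      then show ?thesis by (simp only: mult_zero_right zero_le)
    qed
  qed
  also have "\<dots> = (\<Sum>a\<in>Z. \<Sum>b\<in>Z. osc2 (P a) (P b) u)"
    unfolding osc2_def by (simp add: nn_integral_sum)
  finally show ?thesis .
qed

text \<open>Integrate (u x - u z)^2 \<le> 2 (u x - u y)^2 + 2 (u y - u z)^2 over all x in X, y in Y,
  z in Z. The measure of the intermediate set Y appears on the left, so each link of a chain
  requires a lower bound for a volume.\<close>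

lemma osc2_chain:
  fixes u :: "'a::euclidean_space \<Rightarrow> real"
  assumes [measurable]: "u \<in> borel_measurable borel" "X \<in> sets borel" "Y \<in> sets borel" "Z \<in> sets borel"
  shows "emeasure lborel Y * osc2 X Z u \<le> 2 * (emeasure lborel Z * osc2 X Y u + emeasure lborel X * osc2 Y Z u)"
proof -
  let ?I = "\<lambda>x y z. indicator X x * indicator Y y * indicator Z z :: ennreal"
  have "emeasure lborel Y * osc2 X Z u = (\<integral>\<^sup>+x. (\<integral>\<^sup>+z. (\<integral>\<^sup>+y. ennreal ((u x - u z)\<^sup>2) * ?I x y z \<partial>lborel) \<partial>lborel) \<partial>lborel)"
  proof -
    have "(\<integral>\<^sup>+y. ennreal ((u x - u z)\<^sup>2) * ?I x y z \<partial>lborel) =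
        emeasure lborel Y * (ennreal ((u x - u z)\<^sup>2) * (indicator X x * indicator Z z))" for x z
    proof -
      have "(\<integral>\<^sup>+y. ennreal ((u x - u z)\<^sup>2) * ?I x y z \<partial>lborel) =
        (\<integral>\<^sup>+y. (ennreal ((u x - u z)\<^sup>2) * (indicator X x * indicator Z z)) * indicator Y y \<partial>lborel)"
        by (intro nn_integral_cong) (simp add: ac_simps)
      also have "\<dots> = (ennreal ((u x - u z)\<^sup>2) * (indicator X x * indicator Z z)) * emeasure lborel Y"
        by (rule nn_integral_cmult_indicator) simp
      finally show ?thesis by (simp add: ac_simps)
    qed
    then show ?thesis unfolding osc2_def by (simp add: nn_integral_cmult)
  qed
  also have "\<dots> \<le> (\<integral>\<^sup>+x. (\<integral>\<^sup>+z. (\<integral>\<^sup>+y. 2 * (ennreal ((u x - u y)\<^sup>2) * ?I x y z) + 2 * (ennreal ((u y - u z)\<^sup>2) * ?I x y z) \<partial>lborel) \<partial>lborel) \<partial>lborel)"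
  proof (intro nn_integral_mono)
    fix x y z
    have "(u x - u z)\<^sup>2 \<le> 2 * (u x - u y)\<^sup>2 + 2 * (u y - u z)\<^sup>2"
      using sum_squares_bound[of "u x - u y" "u y - u z"] by (simp add: power2_eq_square algebra_simps)
    then have "ennreal ((u x - u z)\<^sup>2) \<le> ennreal (2 * (u x - u y)\<^sup>2 + 2 * (u y - u z)\<^sup>2)" by (rule ennreal_leI)
    also have "\<dots> = 2 * ennreal ((u x - u y)\<^sup>2) + 2 * ennreal ((u y - u z)\<^sup>2)"
      by (simp add: ennreal_plus ennreal_mult)
    finally have "ennreal ((u x - u z)\<^sup>2) * ?I x y z \<le> (2 * ennreal ((u x - u y)\<^sup>2) + 2 * ennreal ((u y - u z)\<^sup>2)) * ?I x y z"
      by (rule mult_right_mono) simp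
    then show "ennreal ((u x - u z)\<^sup>2) * ?I x y z \<le> 2 * (ennreal ((u x - u y)\<^sup>2) * ?I x y z) + 2 * (ennreal ((u y - u z)\<^sup>2) * ?I x y z)"
      by (simp add: distrib_right mult.assoc)
  qed
  also have "\<dots> = 2 * (\<integral>\<^sup>+x. (\<integral>\<^sup>+z. (\<integral>\<^sup>+y. ennreal ((u x - u y)\<^sup>2) * ?I x y z \<partial>lborel) \<partial>lborel) \<partial>lborel) +
      2 * (\<integral>\<^sup>+x. (\<integral>\<^sup>+z. (\<integral>\<^sup>+y. ennreal ((u y - u z)\<^sup>2) * ?I x y z \<partial>lborel) \<partial>lborel) \<partial>lborel)"
    by (simp add: nn_integral_add nn_integral_cmult)
  also have "(\<integral>\<^sup>+x. (\<integral>\<^sup>+z. (\<integral>\<^sup>+y. ennreal ((u x - u y)\<^sup>2) * ?I x y z \<partial>lborel) \<partial>lborel) \<partial>lborel) = emeasure lborel Z * osc2 X Y u"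
  proof -
    have "(\<integral>\<^sup>+z. (\<integral>\<^sup>+y. ennreal ((u x - u y)\<^sup>2) * ?I x y z \<partial>lborel) \<partial>lborel) =
       (\<integral>\<^sup>+y. ennreal ((u x - u y)\<^sup>2) * (indicator X x * indicator Y y) \<partial>lborel) * emeasure lborel Z" for x
    proof -
      have "(\<integral>\<^sup>+y. ennreal ((u x - u y)\<^sup>2) * ?I x y z \<partial>lborel) = (\<integral>\<^sup>+y. ennreal ((u x - u y)\<^sup>2) * (indicator X x * indicator Y y) \<partial>lborel) * indicator Z z" for z
        by (subst nn_integral_multc[symmetric]) (auto intro!: nn_integral_cong simp: ac_simps)
      then show ?thesis by (simp add: nn_integral_cmult_indicator)
    qed
    then have "(\<integral>\<^sup>+x. (\<integral>\<^sup>+z. (\<integral>\<^sup>+y. ennreal ((u x - u y)\<^sup>2) * ?I x y z \<partial>lborel) \<partial>lborel) \<partial>lborel) =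
      (\<integral>\<^sup>+x. (\<integral>\<^sup>+y. ennreal ((u x - u y)\<^sup>2) * (indicator X x * indicator Y y) \<partial>lborel) * emeasure lborel Z \<partial>lborel)"
      by (rule nn_integral_cong)
    also have "\<dots> = osc2 X Y u * emeasure lborel Z"
      unfolding osc2_def by (rule nn_integral_multc) measurable
    finally show ?thesis by (simp only: mult.commute)
  qed
  also have "(\<integral>\<^sup>+x. (\<integral>\<^sup>+z. (\<integral>\<^sup>+y. ennreal ((u y - u z)\<^sup>2) * ?I x y z \<partial>lborel) \<partial>lborel) \<partial>lborel) = emeasure lborel X * osc2 Y Z u"
  proof -
    have "(\<integral>\<^sup>+z. (\<integral>\<^sup>+y. ennreal ((u y - u z)\<^sup>2) * ?I x y z \<partial>lborel) \<partial>lborel) = osc2 Z Y u * indicator X x" for x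
    proof -
      have "(\<integral>\<^sup>+y. ennreal ((u y - u z)\<^sup>2) * ?I x y z \<partial>lborel) = (\<integral>\<^sup>+y. ennreal ((u z - u y)\<^sup>2) * (indicator Z z * indicator Y y) \<partial>lborel) * indicator X x" for z
        by (subst nn_integral_multc[symmetric]) (auto intro!: nn_integral_cong simp: ac_simps power2_commute)
      then show ?thesis by (simp add: nn_integral_multc osc2_def)
    qed
    then have "(\<integral>\<^sup>+x. (\<integral>\<^sup>+z. (\<integral>\<^sup>+y. ennreal ((u y - u z)\<^sup>2) * ?I x y z \<partial>lborel) \<partial>lborel) \<partial>lborel) =
      (\<integral>\<^sup>+x. osc2 Z Y u * indicator X x \<partial>lborel)" by (rule nn_integral_cong)
    also have "\<dots> = osc2 Z Y u * emeasure lborel X" by (rule nn_integral_cmult_indicator) simp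
    also have "osc2 Z Y u = osc2 Y Z u" by (rule osc2_sym) measurable
    finally show ?thesis by (simp only: mult.commute)
  qed
  finally show ?thesis by (simp add: distrib_left)
qed

section \<open>Poincare inequality on convex sets\<close>

text \<open>Fundamental theorem of calculus along the segment, then Cauchy-Schwarz against the
  constant 1 on the unit interval.\<close>

lemma C1_increment_square_le:
  fixes v :: "'a::euclidean_space \<Rightarrow> real"
  assumes v: "C1_on N v v'" and seg: "\<And>t. 0 \<le> t \<Longrightarrow> t \<le> 1 \<Longrightarrow> x + t *\<^sub>R h \<in> N" and c: "continuous_on UNIV v'"
  shows "ennreal ((v (x + h) - v x)\<^sup>2) \<le>
    (\<integral>\<^sup>+t. ennreal ((norm h)\<^sup>2 * (norm (v' (x + t *\<^sub>R h)))\<^sup>2) * indicator {0..1} t \<partial>lborel)"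
proof -
  define f' where "f' t = h \<bullet> v' (x + t *\<^sub>R h)" for t
  have cf': "continuous_on UNIV f'"
    unfolding f'_def by (intro continuous_intros continuous_on_compose2[OF c]) auto
  have [measurable]: "f' \<in> borel_measurable borel" using cf' by (rule borel_measurable_continuous_onI)
  have "integral\<^sup>L lborel (\<lambda>t. indicator {0..1} t *\<^sub>R f' t) = v (x + 1 *\<^sub>R h) - v (x + 0 *\<^sub>R h)"
  proof (rule integral_FTC_atLeastAtMost)
    show "continuous_on {0..1} f'" using cf' by (rule continuous_on_subset) simp
    fix t :: real assume t: "0 \<le> t" "t \<le> 1"
    have "GDERIV v (x + t *\<^sub>R h) :> v' (x + t *\<^sub>R h)" using C1_onD(2)[OF v seg[OF t]] .
    then have "((\<lambda>t. v (x + t *\<^sub>R h)) has_derivative (\<lambda>s. (s *\<^sub>R h) \<bullet> v' (x + t *\<^sub>R h))) (at t)"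
      unfolding gderiv_def
      by (rule has_derivative_compose[where f="\<lambda>t. x + t *\<^sub>R h", rotated]) (auto intro!: derivative_eq_intros)
    then show "((\<lambda>t. v (x + t *\<^sub>R h)) has_vector_derivative f' t) (at t within {0..1})"
      by (simp add: has_vector_derivative_def f'_def has_derivative_at_withinI)
  qed simp
  then have eq: "v (x + h) - v x = integral\<^sup>L lborel (\<lambda>t. indicator {0..1} t *\<^sub>R f' t)" by simp
  have int: "integrable lborel (\<lambda>t. indicator {0..1} t *\<^sub>R f' t)"
    by (rule borel_integrable_compact) (auto intro: continuous_on_subset[OF cf'])
  have "ennreal \<bar>v (x + h) - v x\<bar> \<le> (\<integral>\<^sup>+t. ennreal (norm (indicator {0..1} t *\<^sub>R f' t)) \<partial>lborel)"
    using integral_norm_bound_ennreal[OF int] by (simp add: eq)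
  also have "\<dots> = (\<integral>\<^sup>+t. (ennreal \<bar>f' t\<bar> * indicator {0..1} t) * indicator {0..1} t \<partial>lborel)"
    by (intro nn_integral_cong) (auto simp: indicator_def)
  finally have "(ennreal \<bar>v (x + h) - v x\<bar>)\<^sup>2 \<le> (\<integral>\<^sup>+t. (ennreal \<bar>f' t\<bar> * indicator {0..1} t) * indicator {0..1} t \<partial>lborel)\<^sup>2"
    by (rule power_mono) simp
  also have "\<dots> \<le> (\<integral>\<^sup>+t. (ennreal \<bar>f' t\<bar> * indicator {0..1} t)\<^sup>2 \<partial>lborel) * (\<integral>\<^sup>+t. (indicator {0..1} (t::real))\<^sup>2 \<partial>lborel)"
    by (rule Cauchy_Schwarz_nn_integral) measurable
  also have "(\<integral>\<^sup>+t. (indicator {0..1} (t::real))\<^sup>2 \<partial>lborel) = (\<integral>\<^sup>+t. indicator {0..1} (t::real) \<partial>lborel)"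
    by (intro nn_integral_cong) (auto simp: indicator_def)
  also have "\<dots> = 1" by simp
  also have "(\<integral>\<^sup>+t. (ennreal \<bar>f' t\<bar> * indicator {0..1} t)\<^sup>2 \<partial>lborel) * 1 \<le>
     (\<integral>\<^sup>+t. ennreal ((norm h)\<^sup>2 * (norm (v' (x + t *\<^sub>R h)))\<^sup>2) * indicator {0..1} t \<partial>lborel)"
    unfolding mult_1_right
  proof (rule nn_integral_mono)
    fix t :: real
    have "\<bar>f' t\<bar> \<le> norm h * norm (v' (x + t *\<^sub>R h))" unfolding f'_def by (rule Cauchy_Schwarz_ineq2)
    then have "\<bar>f' t\<bar>\<^sup>2 \<le> (norm h * norm (v' (x + t *\<^sub>R h)))\<^sup>2" by (rule power_mono) simp
    then have "(ennreal \<bar>f' t\<bar>)\<^sup>2 \<le> ennreal ((norm h)\<^sup>2 * (norm (v' (x + t *\<^sub>R h)))\<^sup>2)"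
      by (simp add: ennreal_power power_mult_distrib ennreal_leI)
    then show "(ennreal \<bar>f' t\<bar> * indicator {0..1} t)\<^sup>2 \<le> ennreal ((norm h)\<^sup>2 * (norm (v' (x + t *\<^sub>R h)))\<^sup>2) * indicator {0..1} t"
      by (auto simp: indicator_def)
  qed
  finally show ?thesis by (simp add: ennreal_power)
qed

text \<open>Put y = x + h. The squared increment is at most |h|^2 times the mean of |v'|^2 along the
  segment, which stays in K by convexity. For fixed h and t, translation by t h shows that the
  integral over x is at most the one over K; what remains is the integral over h, confined to a ball
  of radius D.\<close>

lemma poincare_C1:
  fixes v :: "'a::euclidean_space \<Rightarrow> real"
  assumes v: "C1_on N v v'" "K \<subseteq> N" and c: "continuous_on UNIV v" "continuous_on UNIV v'"
    and K: "compact K" "convex K" "\<And>x y. x \<in> K \<Longrightarrow> y \<in> K \<Longrightarrow> norm (y - x) \<le> D" and D: "0 \<le> D"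
  shows "osc2 K K v \<le> ennreal (D\<^sup>2) * emeasure lborel (cball (0::'a) D) * L2on K v'"
proof -
  have KB[measurable]: "K \<in> sets borel" using K by (simp add: borel_compact)
  have [measurable]: "v \<in> borel_measurable borel" "v' \<in> borel_measurable borel"
    using c by (auto intro: borel_measurable_continuous_onI)
  have "osc2 K K v = (\<integral>\<^sup>+x. (\<integral>\<^sup>+h. ennreal ((v x - v (h + x))\<^sup>2) * (indicator K x * indicator K (h + x)) \<partial>lborel) \<partial>lborel)"
    unfolding osc2_def
  proof (rule nn_integral_cong)
    fix x
    show "(\<integral>\<^sup>+y. ennreal ((v x - v y)\<^sup>2) * (indicator K x * indicator K y) \<partial>lborel) =
      (\<integral>\<^sup>+h. ennreal ((v x - v (h + x))\<^sup>2) * (indicator K x * indicator K (h + x)) \<partial>lborel)"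
      using nn_integral_translate[of "\<lambda>y. ennreal ((v x - v y)\<^sup>2) * (indicator K x * indicator K y)" x] by simp
  qed
  also have "\<dots> = (\<integral>\<^sup>+h. (\<integral>\<^sup>+x. ennreal ((v x - v (h + x))\<^sup>2) * (indicator K x * indicator K (h + x)) \<partial>lborel) \<partial>lborel)"
    by (rule lborel_pair.Fubini'[symmetric]) measurable
  also have "\<dots> \<le> (\<integral>\<^sup>+h. ennreal (D\<^sup>2) * L2on K v' * indicator (cball 0 D) (h::'a) \<partial>lborel)"
  proof (rule nn_integral_mono)
    fix h :: 'a
    show "(\<integral>\<^sup>+x. ennreal ((v x - v (h + x))\<^sup>2) * (indicator K x * indicator K (h + x)) \<partial>lborel)
       \<le> ennreal (D\<^sup>2) * L2on K v' * indicator (cball 0 D) h"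
    proof (cases "norm h \<le> D")
      case False
      have "(\<integral>\<^sup>+x. ennreal ((v x - v (h + x))\<^sup>2) * (indicator K x * indicator K (h + x)) \<partial>lborel) = nn_integral lborel (\<lambda>_::'a. 0)"
      proof (rule nn_integral_cong)
        fix x
        have "\<not> (x \<in> K \<and> h + x \<in> K)" using K(3)[of x "h + x"] False by auto
        then show "ennreal ((v x - v (h + x))\<^sup>2) * (indicator K x * indicator K (h + x)) = 0" by (auto simp: indicator_def)
      qed
      then show ?thesis by simp
    next
      case True
      let ?W = "\<lambda>x. ennreal ((norm (v' x))\<^sup>2) * indicator K x"
      have "(\<integral>\<^sup>+x. ennreal ((v x - v (h + x))\<^sup>2) * (indicator K x * indicator K (h + x)) \<partial>lborel)
        \<le> (\<integral>\<^sup>+x. (\<integral>\<^sup>+t. ennreal (D\<^sup>2) * ?W (x + t *\<^sub>R h) * indicator {0..1} t \<partial>lborel) \<partial>lborel)"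
      proof (rule nn_integral_mono)
        fix x
        show "ennreal ((v x - v (h + x))\<^sup>2) * (indicator K x * indicator K (h + x)) \<le>
          (\<integral>\<^sup>+t. ennreal (D\<^sup>2) * ?W (x + t *\<^sub>R h) * indicator {0..1} t \<partial>lborel)"
        proof (cases "x \<in> K \<and> h + x \<in> K")
          case False
          then show ?thesis by (auto simp: indicator_def)
        next
          case xK: True
          have seg: "x + t *\<^sub>R h \<in> K" if "0 \<le> t" "t \<le> 1" for t
          proof -
            have "(1 - t) *\<^sub>R x + t *\<^sub>R (h + x) \<in> K"
              using xK that by (intro convexD[OF K(2)]) auto
            then show ?thesis by (simp add: algebra_simps)
          qed
          have "ennreal ((v x - v (h + x))\<^sup>2) = ennreal ((v (x + h) - v x)\<^sup>2)" by (simp add: power2_commute add.commute)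
          also have "\<dots> \<le> (\<integral>\<^sup>+t. ennreal ((norm h)\<^sup>2 * (norm (v' (x + t *\<^sub>R h)))\<^sup>2) * indicator {0..1} t \<partial>lborel)"
            by (rule C1_increment_square_le[OF v(1) _ c(2)]) (use seg v(2) in auto)
          also have "\<dots> \<le> (\<integral>\<^sup>+t. ennreal (D\<^sup>2) * ?W (x + t *\<^sub>R h) * indicator {0..1} t \<partial>lborel)"
          proof (rule nn_integral_mono)
            fix t :: real
            have "(norm h)\<^sup>2 * (norm (v' (x + t *\<^sub>R h)))\<^sup>2 \<le> D\<^sup>2 * (norm (v' (x + t *\<^sub>R h)))\<^sup>2"
              using True by (intro mult_right_mono power_mono) auto
            then have "ennreal ((norm h)\<^sup>2 * (norm (v' (x + t *\<^sub>R h)))\<^sup>2) \<le> ennreal (D\<^sup>2) * ennreal ((norm (v' (x + t *\<^sub>R h)))\<^sup>2)"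
              by (simp add: ennreal_leI flip: ennreal_mult)
            then show "ennreal ((norm h)\<^sup>2 * (norm (v' (x + t *\<^sub>R h)))\<^sup>2) * indicator {0..1} t
              \<le> ennreal (D\<^sup>2) * ?W (x + t *\<^sub>R h) * indicator {0..1} t"
              using seg[of t] by (auto simp: indicator_def)
          qed
          finally show ?thesis using xK by simp
        qed
      qed
      also have "\<dots> = (\<integral>\<^sup>+t. (\<integral>\<^sup>+x. ennreal (D\<^sup>2) * ?W (x + t *\<^sub>R h) * indicator {0..1} t \<partial>lborel) \<partial>lborel)"
        by (rule lborel_pair.Fubini'[symmetric]) measurable
      also have "\<dots> = (\<integral>\<^sup>+t. ennreal (D\<^sup>2) * L2on K v' * indicator {0..1} (t::real) \<partial>lborel)"
      proof (rule nn_integral_cong)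
        fix t :: real
        have "(\<integral>\<^sup>+x. ennreal (D\<^sup>2) * ?W (x + t *\<^sub>R h) * indicator {0..1} t \<partial>lborel) =
          ennreal (D\<^sup>2) * (\<integral>\<^sup>+x. ?W (x + t *\<^sub>R h) \<partial>lborel) * indicator {0..1} t"
          by (subst nn_integral_multc; (subst nn_integral_cmult)?) measurable
        also have "(\<integral>\<^sup>+x. ?W (x + t *\<^sub>R h) \<partial>lborel) = L2on K v'"
          unfolding L2on_def using nn_integral_translate[of ?W "t *\<^sub>R h"] by simp
        finally show "(\<integral>\<^sup>+x. ennreal (D\<^sup>2) * ?W (x + t *\<^sub>R h) * indicator {0..1} t \<partial>lborel) = ennreal (D\<^sup>2) * L2on K v' * indicator {0..1} t" .
      qed
      also have "\<dots> = ennreal (D\<^sup>2) * L2on K v'" by (subst nn_integral_cmult_indicator) auto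
      finally show ?thesis using True by simp
    qed
  qed
  also have "\<dots> = ennreal (D\<^sup>2) * L2on K v' * emeasure lborel (cball (0::'a) D)"
    by (rule nn_integral_cmult_indicator) simp
  finally show ?thesis by (simp add: ac_simps)
qed

text \<open>Fatou's lemma, once in each variable.\<close>

lemma osc2_AE_limit:
  fixes u :: "'a::euclidean_space \<Rightarrow> real"
  assumes [measurable]: "u \<in> borel_measurable borel" "\<And>n. v n \<in> borel_measurable borel" "K \<in> sets borel"
    and lim: "AE x in lborel. x \<in> K \<longrightarrow> (\<lambda>n. v n x) \<longlonglongrightarrow> u x"
    and le: "\<And>n. osc2 K K (v n) \<le> A"
  shows "osc2 K K u \<le> A"
proof -
  let ?F = "\<lambda>u x y. ennreal ((u x - u y)\<^sup>2) * (indicator K x * indicator K y)"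
  have "osc2 K K u \<le> (\<integral>\<^sup>+x. liminf (\<lambda>n. \<integral>\<^sup>+y. ?F (v n) x y \<partial>lborel) \<partial>lborel)"
    unfolding osc2_def
  proof (rule nn_integral_mono_AE)
    show "AE x in lborel. (\<integral>\<^sup>+y. ?F u x y \<partial>lborel) \<le> liminf (\<lambda>n. \<integral>\<^sup>+y. ?F (v n) x y \<partial>lborel)"
      using lim
    proof eventually_elim
      case (elim x)
      have "(\<integral>\<^sup>+y. ?F u x y \<partial>lborel) \<le> (\<integral>\<^sup>+y. liminf (\<lambda>n. ?F (v n) x y) \<partial>lborel)"
      proof (rule nn_integral_mono_AE)
        show "AE y in lborel. ?F u x y \<le> liminf (\<lambda>n. ?F (v n) x y)"
          using lim
        proof eventually_elim
          case (elim y)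
          show ?case
          proof (cases "x \<in> K \<and> y \<in> K")
            case True
            then have "(\<lambda>n. ennreal ((v n x - v n y)\<^sup>2)) \<longlonglongrightarrow> ennreal ((u x - u y)\<^sup>2)"
              using elim \<open>x \<in> K \<longrightarrow> (\<lambda>n. v n x) \<longlonglongrightarrow> u x\<close> by (intro tendsto_ennrealI tendsto_intros) auto
            then have "liminf (\<lambda>n. ennreal ((v n x - v n y)\<^sup>2)) = ennreal ((u x - u y)\<^sup>2)"
              by (rule lim_imp_Liminf[OF trivial_limit_sequentially])
            then show ?thesis using True by simp
          next
            case False
            then have "(indicator K x * indicator K y :: ennreal) = 0" by (auto simp: indicator_def)
            then show ?thesis by (simp only: mult_zero_right zero_le)
          qed
        qed
      qed
      also have "\<dots> \<le> liminf (\<lambda>n. \<integral>\<^sup>+y. ?F (v n) x y \<partial>lborel)"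
        by (rule nn_integral_liminf) measurable
      finally show ?case .
    qed
  qed
  also have "\<dots> \<le> liminf (\<lambda>n. osc2 K K (v n))"
    unfolding osc2_def by (rule nn_integral_liminf) measurable
  also have "\<dots> \<le> A"
  proof -
    have "liminf (\<lambda>n. osc2 K K (v n)) \<le> liminf (\<lambda>n. A)"
      by (rule Liminf_mono) (use le in auto)
    then show ?thesis by (simp add: Liminf_const)
  qed
  finally show ?thesis .
qed

text \<open>The approximants are close to u in L^1 only, while the oscillation is quadratic; an
  almost everywhere convergent subsequence and \<open>osc2_AE_limit\<close> bridge the gap. The
  gradient is taken over the larger \<open>U\<close> because mollifying uses values outside
  K.\<close>

lemma poincare_convex_compact:
  fixes u :: "'a::euclidean_space \<Rightarrow> real"
  assumes w: "weak_grad U u g" and K: "compact K" "K \<subseteq> U" "convex K"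
    "\<And>x y. x \<in> K \<Longrightarrow> y \<in> K \<Longrightarrow> norm (y - x) \<le> D" and D: "0 \<le> D"
  shows "osc2 K K u \<le> ennreal (D\<^sup>2) * emeasure lborel (cball (0::'a) D) * L2on U g"
proof -
  note [measurable] = weak_gradD(2,3)[OF w]
  have KB[measurable]: "K \<in> sets borel" using K by (simp add: borel_compact)
  define Q where "Q n v \<longleftrightarrow> v \<in> borel_measurable borel \<and> osc2 K K v \<le> ennreal (D\<^sup>2) * emeasure lborel (cball (0::'a) D) * L2on U g \<and>
      L1on K (\<lambda>x. u x - v x) < ennreal (1 / real (Suc n))" for n v
  have "\<exists>v. Q n v" for n
  proof -
    obtain N v v' where v: "C1_on N v v'" "K \<subseteq> N" "continuous_on UNIV v" "continuous_on UNIV v'"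
      "L1on K (\<lambda>x. u x - v x) < ennreal (1 / real (Suc n))" "L2on K v' \<le> L2on U g"
      by (rule weak_grad_C1_approximation[OF w K(1,2), of "1 / real (Suc n)"]; auto)
    have "osc2 K K v \<le> ennreal (D\<^sup>2) * emeasure lborel (cball (0::'a) D) * L2on K v'"
      by (rule poincare_C1[OF v(1-4) K(1,3,4) D])
    also have "\<dots> \<le> ennreal (D\<^sup>2) * emeasure lborel (cball (0::'a) D) * L2on U g"
      using v(6) by (rule mult_left_mono) simp
    finally show ?thesis using v(3,5) unfolding Q_def by (auto intro: borel_measurable_continuous_onI)
  qed
  then obtain v where Q: "\<And>n. Q n (v n)" by metis
  then have vm: "\<And>n. v n \<in> borel_measurable borel" and vo: "\<And>n. osc2 K K (v n) \<le> ennreal (D\<^sup>2) * emeasure lborel (cball (0::'a) D) * L2on U g"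
    and v1: "\<And>n. L1on K (\<lambda>x. u x - v n x) < ennreal (1 / real (Suc n))" unfolding Q_def by auto
  obtain r :: "nat \<Rightarrow> nat" where r: "AE x in lborel. x \<in> K \<longrightarrow> (\<lambda>n. v (r n) x) \<longlonglongrightarrow> u x"
    by (rule L1on_AE_subseq[OF weak_gradD(2)[OF w] vm KB v1])
  show ?thesis by (rule osc2_AE_limit[OF weak_gradD(2)[OF w] vm KB r vo])
qed

section \<open>Poincare inequality on connected sets by chaining balls\<close>

text \<open>Otherwise the balls about the reachable net points and those about the remaining ones
  form two open sets that separate \<open>G\<close>: if two such balls met inside G, their centres
  would be closer than 2 \<rho> and hence adjacent.\<close>

lemma connected_net_chain:
  fixes G :: "'a::euclidean_space set"
  assumes G: "connected G" and Z: "Z \<subseteq> G" "G \<subseteq> (\<Union>z\<in>Z. ball z \<rho>)"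
    and ab: "a \<in> Z" "b \<in> Z"
  shows "(a, b) \<in> {(x, y). x \<in> Z \<and> y \<in> Z \<and> dist x y < 2 * \<rho>}\<^sup>*"
proof -
  let ?E = "{(x, y). x \<in> Z \<and> y \<in> Z \<and> dist x y < 2 * \<rho>}"
  define A where "A = {c \<in> Z. (a, c) \<in> ?E\<^sup>*}"
  define U1 where "U1 = (\<Union>z\<in>A. ball z \<rho>)"
  define U2 where "U2 = (\<Union>z\<in>Z - A. ball z \<rho>)"
  have op: "open U1" "open U2" by (auto simp: U1_def U2_def)
  have aA: "a \<in> A" using ab by (simp add: A_def)
  have cov: "G \<subseteq> U1 \<union> U2" using Z(2) by (auto simp: U1_def U2_def)
  have "U1 \<inter> U2 \<inter> G = {}"
  proof (rule ccontr)
    assume "U1 \<inter> U2 \<inter> G \<noteq> {}"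
    then obtain x c d where x: "c \<in> A" "dist c x < \<rho>" "d \<in> Z" "d \<notin> A" "dist d x < \<rho>"
      by (auto simp: U1_def U2_def)
    have "dist c d \<le> dist c x + dist d x" by (metis dist_commute dist_triangle)
    then have "(c, d) \<in> ?E" using x by (auto simp: A_def)
    then have "d \<in> A" using x by (auto simp: A_def intro: rtrancl_into_rtrancl)
    then show False using x by simp
  qed
  then have "U1 \<inter> G = {} \<or> U2 \<inter> G = {}" using connectedD[OF G op _ cov] by blast
  moreover have pos: "\<rho> > 0"
  proof -
    have "a \<in> (\<Union>z\<in>Z. ball z \<rho>)" using ab Z by blast
    then obtain z where "dist z a < \<rho>" by auto
    then show ?thesis using zero_le_dist[of z a] by linarith
  qed
  moreover have "a \<in> U1 \<inter> G" using aA ab Z(1) pos by (auto simp: U1_def intro!: bexI[of _ a])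
  ultimately have "U2 \<inter> G = {}" by blast
  then have "b \<in> A" using ab Z(1) pos by (force simp: U2_def)
  then show ?thesis by (simp add: A_def)
qed

lemma ennreal_mult_le_cancel:
  assumes "m > 0" "ennreal m \<le> y" "y * X \<le> ennreal c * A" "0 \<le> c"
  shows "X \<le> ennreal (c / m) * A"
proof -
  have "X = ennreal (1 / m) * (ennreal m * X)"
    using assms(1) by (simp flip: mult.assoc ennreal_mult)
  also have "\<dots> \<le> ennreal (1 / m) * (y * X)"
    using assms(2) by (intro mult_left_mono mult_right_mono) auto
  also have "\<dots> \<le> ennreal (1 / m) * (ennreal c * A)"
    using assms(3) by (rule mult_left_mono) simp
  also have "\<dots> = ennreal (c / m) * A"
    using assms by (simp flip: mult.assoc ennreal_mult)
  finally show ?thesis .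
qed

text \<open>The constant depends on \<open>G\<close> only through the number of net points, the
  upper bound \<open>V\<close> and the lower bound \<open>m\<close> for volumes. Neighbouring pieces
  are linked through the ball of radius \<rho> about one of the centres, and any two centres are
  joined by a path no longer than the number of edges, hence of length at most M^2.\<close>

lemma osc2_connected_cover:
  fixes u :: "'a::euclidean_space \<Rightarrow> real"
  assumes G: "connected G" and GB[measurable]: "G \<in> sets borel" and um[measurable]: "u \<in> borel_measurable borel"
    and Z: "finite Z" "Z \<subseteq> G" "G \<subseteq> (\<Union>z\<in>Z. ball z \<rho>)" "card Z \<le> M"
    and A: "\<And>z. z \<in> Z \<Longrightarrow> osc2 (G \<inter> ball z (3 * \<rho>)) (G \<inter> ball z (3 * \<rho>)) u \<le> A"
    and m: "m > 0" "\<And>z. z \<in> Z \<Longrightarrow> ennreal m \<le> emeasure lborel (G \<inter> ball z \<rho>)"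
    and V: "emeasure lborel G \<le> ennreal V" "0 \<le> V" and \<rho>: "\<rho> > 0"
  shows "osc2 G G u \<le> ennreal (real M ^ 2 * max 1 (4 * V / m) ^ (M ^ 2 + 1)) * A"
proof -
  \<comment> \<open>With radius 3 \<rho>, the pieces of net points closer than 2 \<rho> share the
    full ball of radius \<rho> about either of them.\<close>
  define P where "P z = G \<inter> ball z (3 * \<rho>)" for z
  have PB[measurable]: "P z \<in> sets borel" for z unfolding P_def by measurable
  \<comment> \<open>A link costs 2 V / m times a sum of two terms, hence at most 4 V / m times their
    maximum; taking at least 1 makes the powers of \<open>k\<close> increase with the
    exponent.\<close>
  define k where "k = max 1 (4 * V / m)"
  have k1: "k \<ge> 1" "4 * V / m \<le> k" by (auto simp: k_def)
  let ?E = "{(x, y). x \<in> Z \<and> y \<in> Z \<and> dist x y < 2 * \<rho>}"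
  have PV: "emeasure lborel (P z) \<le> ennreal V" for z
    using V(1) emeasure_mono[of "P z" G lborel] by (auto simp: P_def intro: order_trans)
  have Pm: "ennreal m \<le> emeasure lborel (P z)" if "z \<in> Z" for z
  proof -
    have "G \<inter> ball z \<rho> \<subseteq> P z" using \<rho> by (auto simp: P_def)
    then have "emeasure lborel (G \<inter> ball z \<rho>) \<le> emeasure lborel (P z)" by (rule emeasure_mono) simp
    with m(2)[OF that] show ?thesis by (rule order_trans)
  qed
  have A': "osc2 (P z) (P z) u \<le> A" if "z \<in> Z" for z using A[OF that] by (simp add: P_def)
  have step: "osc2 X W u \<le> ennreal (2 * V / m) * (osc2 X Y u + osc2 Y W u)"
    if X: "X \<in> sets borel" "emeasure lborel X \<le> ennreal V" and W: "W \<in> sets borel" "emeasure lborel W \<le> ennreal V"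
      and Y: "Y \<in> sets borel" "ennreal m \<le> emeasure lborel Y" for X Y W
  proof (rule ennreal_mult_le_cancel[OF m(1) Y(2)])
    have "emeasure lborel Y * osc2 X W u \<le> 2 * (emeasure lborel W * osc2 X Y u + emeasure lborel X * osc2 Y W u)"
      by (rule osc2_chain[OF um X(1) Y(1) W(1)])
    also have "\<dots> \<le> 2 * (ennreal V * osc2 X Y u + ennreal V * osc2 Y W u)"
      using X W by (intro mult_left_mono add_mono mult_right_mono) auto
    also have "\<dots> = ennreal (2 * V) * (osc2 X Y u + osc2 Y W u)"
      using V(2) by (simp add: ennreal_mult distrib_left mult.assoc)
    finally show "emeasure lborel Y * osc2 X W u \<le> ennreal (2 * V) * (osc2 X Y u + osc2 Y W u)" .
  qed (use V in simp)
  have k2: "ennreal (2 * V / m) * (ennreal a * A + ennreal b * A) \<le> ennreal (k * max a b) * A" if "0 \<le> a" "0 \<le> b" for a b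
  proof -
    have e1: "ennreal (2 * V / m) * (ennreal a * A + ennreal b * A) = ennreal ((2 * V / m) * (a + b)) * A"
    proof -
      have "ennreal a * A + ennreal b * A = ennreal (a + b) * A"
        using that by (simp add: ennreal_plus distrib_right)
      moreover have "ennreal ((2 * V / m) * (a + b)) = ennreal (2 * V / m) * ennreal (a + b)"
        using that V(2) m(1) by (intro ennreal_mult) auto
      ultimately show ?thesis by (simp only: mult.assoc)
    qed
    have b1: "(2 * V / m) * (a + b) \<le> (2 * V / m) * (2 * max a b)"
      using V(2) m(1) by (intro mult_left_mono) auto
    have b2: "(2 * V / m) * (2 * max a b) = (4 * V / m) * max a b" by simp
    have b3: "(4 * V / m) * max a b \<le> k * max a b"
      using k1(2) that by (intro mult_right_mono) auto
    have "(2 * V / m) * (a + b) \<le> k * max a b" using b1 b2 b3 by linarith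
    then have "ennreal ((2 * V / m) * (a + b)) * A \<le> ennreal (k * max a b) * A" by (intro mult_right_mono ennreal_leI) auto
    then show ?thesis unfolding e1 .
  qed
  have adj: "osc2 (P a) (P b) u \<le> ennreal k * A" if ab: "(a, b) \<in> ?E" for a b
  proof -
    let ?Y = "G \<inter> ball a \<rho>"
    have Y: "?Y \<in> sets borel" "ennreal m \<le> emeasure lborel ?Y" using m(2) ab by auto
    have "?Y \<subseteq> P a" using \<rho> by (auto simp: P_def)
    have "?Y \<subseteq> P b"
    proof
      fix x assume x: "x \<in> ?Y"
      have "dist b x \<le> dist a b + dist a x" by (metis dist_commute dist_triangle)
      then show "x \<in> P b" using x ab by (auto simp: P_def)
    qed
    have "osc2 (P a) (P b) u \<le> ennreal (2 * V / m) * (osc2 (P a) ?Y u + osc2 ?Y (P b) u)"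
      by (rule step[OF PB PV PB PV Y])
    also have "\<dots> \<le> ennreal (2 * V / m) * (ennreal 1 * A + ennreal 1 * A)"
    proof (intro mult_left_mono add_mono)
      have "osc2 (P a) ?Y u \<le> osc2 (P a) (P a) u" using \<open>?Y \<subseteq> P a\<close> by (intro osc2_mono) auto
      then show "osc2 (P a) ?Y u \<le> ennreal 1 * A" using A'[of a] ab by (auto intro: order_trans)
      have "osc2 ?Y (P b) u \<le> osc2 (P b) (P b) u" using \<open>?Y \<subseteq> P b\<close> by (intro osc2_mono) auto
      then show "osc2 ?Y (P b) u \<le> ennreal 1 * A" using A'[of b] ab by (auto intro: order_trans)
    qed simp
    also have "\<dots> \<le> ennreal k * A" using k2[of 1 1] by simp
    finally show ?thesis .
  qed
  have path: "osc2 (P a) (P b) u \<le> ennreal (k ^ (n + 1)) * A" if "(a, b) \<in> ?E ^^ n" "a \<in> Z" for n a b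
    using that
  proof (induction n arbitrary: b)
    case 0
    then have "osc2 (P a) (P b) u \<le> A" using A' by auto
    also have "A = ennreal 1 * A" by simp
    also have "\<dots> \<le> ennreal (k ^ (0 + 1)) * A" using k1 by (intro mult_right_mono ennreal_leI) auto
    finally show ?case .
  next
    case (Suc n)
    then obtain c where c: "(a, c) \<in> ?E ^^ n" "(c, b) \<in> ?E" by auto
    have cZ: "c \<in> Z" using c(2) by auto
    have "osc2 (P a) (P b) u \<le> ennreal (2 * V / m) * (osc2 (P a) (P c) u + osc2 (P c) (P b) u)"
      by (rule step[OF PB PV PB PV PB Pm[OF cZ]])
    also have "\<dots> \<le> ennreal (2 * V / m) * (ennreal (k ^ (n + 1)) * A + ennreal k * A)"
      using Suc.IH[OF c(1) Suc.prems(2)] adj[OF c(2)] by (intro mult_left_mono add_mono) auto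
    also have "\<dots> \<le> ennreal (k * max (k ^ (n + 1)) k) * A" using k1 by (intro k2) auto
    also have "max (k ^ (n + 1)) k = k ^ (n + 1)"
      using k1 self_le_power[of k "n + 1"] by (intro max_absorb1) simp
    also have "k * k ^ (n + 1) = k ^ (Suc n + 1)" by simp
    finally show ?case .
  qed
  have fE: "finite ?E" by (rule finite_subset[of _ "Z \<times> Z"]) (use Z in auto)
  have cE: "card ?E \<le> M ^ 2"
  proof -
    have "card ?E \<le> card (Z \<times> Z)" using Z by (intro card_mono) auto
    also have "\<dots> \<le> M ^ 2" using mult_mono[OF Z(4) Z(4)] by (simp add: power2_eq_square card_cartesian_product)
    finally show ?thesis .
  qed
  have all: "osc2 (P a) (P b) u \<le> ennreal (k ^ (M ^ 2 + 1)) * A" if ab: "a \<in> Z" "b \<in> Z" for a b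
  proof -
    have "(a, b) \<in> ?E\<^sup>*" by (rule connected_net_chain[OF G Z(2,3) ab])
    then obtain n where n: "n \<le> card ?E" "(a, b) \<in> ?E ^^ n" using rtrancl_finite_eq_relpow[OF fE] by auto
    have "osc2 (P a) (P b) u \<le> ennreal (k ^ (n + 1)) * A" using path[OF n(2) ab(1)] .
    also have "\<dots> \<le> ennreal (k ^ (M ^ 2 + 1)) * A"
      using n(1) cE k1 by (intro mult_right_mono ennreal_leI power_increasing) auto
    finally show ?thesis .
  qed
  have "osc2 G G u \<le> (\<Sum>a\<in>Z. \<Sum>b\<in>Z. osc2 (P a) (P b) u)"
  proof (rule osc2_UN_le[OF um PB Z(1)])
    show "G \<subseteq> (\<Union>z\<in>Z. P z)"
    proof
      fix x assume x: "x \<in> G"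
      then obtain z where "z \<in> Z" "dist z x < \<rho>" using Z(3) by auto
      then show "x \<in> (\<Union>z\<in>Z. P z)" using x \<rho> by (auto simp: P_def intro!: bexI[of _ z])
    qed
  qed
  also have "\<dots> \<le> (\<Sum>a\<in>Z. \<Sum>b\<in>Z. ennreal (k ^ (M ^ 2 + 1)) * A)" using all by (intro sum_mono) auto
  also have "\<dots> = of_nat (card Z * card Z) * (ennreal (k ^ (M ^ 2 + 1)) * A)" by (simp add: mult.assoc)
  also have "\<dots> \<le> of_nat (M ^ 2) * (ennreal (k ^ (M ^ 2 + 1)) * A)"
    using mult_mono[OF Z(4) Z(4)]
    by (intro mult_right_mono) (simp_all only: of_nat_le_iff power2_eq_square zero_le)
  also have "\<dots> = ennreal (real M ^ 2 * k ^ (M ^ 2 + 1)) * A"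
  proof -
    have "(of_nat (M ^ 2) :: ennreal) = ennreal (real M ^ 2)" by (metis ennreal_of_nat_eq_real_of_nat of_nat_power)
    then show ?thesis using k1 by (simp add: ennreal_mult mult.assoc)
  qed
  finally show ?thesis unfolding k_def .
qed

section \<open>Reflection across a graph\<close>

lemma ennreal_mult_two: "0 \<le> q \<Longrightarrow> ennreal q * (2 * X) = ennreal (2 * q) * X"
  by (simp add: ennreal_mult mult_ac)

text \<open>\<open>G\<close> is the height above a graph over the plane orthogonal to \<open>n\<close>, measured in direction \<open>n\<close>;
  in the ball about \<open>p\<close> the set \<open>T\<close> is the part above the graph.\<close>

locale graph_patch =
  fixes T :: "(real^3) set" and p :: "real^3" and r L :: real and n :: "real^3"
    and G :: "real^3 \<Rightarrow> real" and G' :: "real^3 \<Rightarrow> real^3"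
  assumes C1: "C1_on (ball p r) G G'" and G_borel [measurable]: "G \<in> borel_measurable borel"
    and G'_borel [measurable]: "G' \<in> borel_measurable borel"
    and norm_n: "norm n = 1" and G_p: "G p = 0" and r_pos: "0 < r" and L1: "1 \<le> L"
    and slope: "\<And>x. x \<in> ball p r \<Longrightarrow> n \<bullet> G' x = 1"
    and G'_le: "\<And>x. x \<in> ball p r \<Longrightarrow> norm (G' x) \<le> L"
    and T_iff: "\<And>x. x \<in> ball p r \<Longrightarrow> x \<in> T \<longleftrightarrow> 0 < G x"
begin

definition below :: "(real^3) set" where "below = {x \<in> ball p r. G x < 0}"

text \<open>Folding moves a point by at most 2 |G| \<le> 2 L |x - p|, so the image of the ball of
  radius \<rho> stays within \<rho> (1 + 2 L) = r/4 of \<open>p\<close>.\<close>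

definition \<rho> :: real where "\<rho> = r / (4 * (1 + 2 * L))"

definition mirror :: "real^3 \<Rightarrow> real^3" where "mirror x = x - (2 * G x) *\<^sub>R n"

text \<open>G + |G| is twice the positive part of G, so this is \<open>mirror\<close> above the
  graph and the identity below. Moving along the fixed direction \<open>n\<close>, not along the
  normal, makes \<open>mirror\<close> exactly involutive, with the height exactly negated.\<close>

definition fold_down :: "real^3 \<Rightarrow> real^3" where "fold_down x = x - (G x + \<bar>G x\<bar>) *\<^sub>R n"

lemma rho_pos: "0 < \<rho>" using r_pos L1 by (simp add: \<rho>_def)

lemma rho_le: "\<rho> * (1 + 2 * L) = r / 4" "\<rho> \<le> r / 12"
proof -
  show 1: "\<rho> * (1 + 2 * L) = r / 4"
  proof -
    have "r / (4 * q) * q = r / 4" if "q \<noteq> 0" for q :: real using that by simp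
    from this[of "1 + 2 * L"] show ?thesis using L1 unfolding \<rho>_def by linarith
  qed
  have "\<rho> * 3 \<le> \<rho> * (1 + 2 * L)" using rho_pos L1 by (intro mult_left_mono) auto
  then show "\<rho> \<le> r / 12" using 1 by simp
qed

lemma G_cont: "continuous_on (ball p r) G" using C1_onD(4)[OF C1] .

lemma open_below: "open below"
proof -
  have "below = ball p r \<inter> G -` {..<0}" by (auto simp: below_def)
  then show ?thesis using continuous_on_open_vimage[OF open_ball] G_cont by (metis Int_commute open_lessThan)
qed

lemma below_borel [measurable]: "below \<in> sets borel" using open_below by simp

lemma fold_down_borel [measurable]: "fold_down \<in> borel_measurable borel" unfolding fold_down_def by measurable

lemma mirror_borel [measurable]: "mirror \<in> borel_measurable borel" unfolding mirror_def by measurable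

lemma G_lipschitz:
  assumes "x \<in> ball p r" "y \<in> ball p r"
  shows "\<bar>G x - G y\<bar> \<le> L * norm (x - y)"
proof -
  have "closed_segment x y \<subseteq> ball p r" using assms by (intro closed_segment_subset convex_ball)
  then show ?thesis using G'_le by (intro C1_mean_value[OF C1]) auto
qed

text \<open>By \<open>slope\<close> the derivative of G along \<open>n\<close> is the constant 1, so
  the mean value theorem yields an exact identity.\<close>

lemma G_shift:
  assumes x: "x \<in> ball p r" "x + t *\<^sub>R n \<in> ball p r"
  shows "G (x + t *\<^sub>R n) = G x + t"
proof -
  have seg: "x + s *\<^sub>R (t *\<^sub>R n) \<in> ball p r" if "0 \<le> s" "s \<le> 1" for s
  proof -
    have "(1 - s) *\<^sub>R x + s *\<^sub>R (x + t *\<^sub>R n) \<in> ball p r" using x that by (intro convexD[OF convex_ball]) auto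
    then show ?thesis by (simp add: algebra_simps)
  qed
  define f where "f s = G (x + s *\<^sub>R (t *\<^sub>R n))" for s
  have "(f has_derivative (\<lambda>h. h * t)) (at s within {0..1})" if s: "0 \<le> s" "s \<le> 1" for s
  proof -
    have "(G has_derivative (\<lambda>h. h \<bullet> G' (x + s *\<^sub>R (t *\<^sub>R n)))) (at (x + s *\<^sub>R (t *\<^sub>R n)))"
      using C1_onD(2)[OF C1 seg[OF s]] by (simp add: gderiv_def)
    then have "((\<lambda>s. G (x + s *\<^sub>R (t *\<^sub>R n))) has_derivative (\<lambda>h. (h *\<^sub>R (t *\<^sub>R n)) \<bullet> G' (x + s *\<^sub>R (t *\<^sub>R n)))) (at s)"
      by (rule has_derivative_compose[where f="\<lambda>s. x + s *\<^sub>R (t *\<^sub>R n)", rotated]) (auto intro!: derivative_eq_intros)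
    then show ?thesis
      using slope[OF seg[OF s]] by (simp add: has_derivative_at_withinI f_def[abs_def])
  qed
  from mvt_very_simple[OF zero_le_one this] have "f 1 - f 0 = t" by auto
  then show ?thesis by (simp add: f_def)
qed

lemma G_le: "x \<in> ball p r \<Longrightarrow> \<bar>G x\<bar> \<le> L * norm (x - p)"
  using G_lipschitz[of x p] G_p r_pos by simp

lemma rho_ball: "x \<in> ball p \<rho> \<Longrightarrow> x \<in> ball p r"
  using rho_le(2) r_pos by simp

lemma fold_bound:
  assumes x: "x \<in> ball p \<rho>" and t: "\<bar>t\<bar> \<le> 2 * \<bar>G x\<bar>"
  shows "dist p (x - t *\<^sub>R n) < r / 4"
proof -
  have "norm (x - p) < \<rho>" using x by (simp add: dist_norm norm_minus_commute)
  have e: "p - (x - t *\<^sub>R n) = - ((x - p) - t *\<^sub>R n)" by simp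
  have "dist p (x - t *\<^sub>R n) = norm ((x - p) - t *\<^sub>R n)"
    unfolding dist_norm e by (rule norm_minus_cancel)
  also have "\<dots> \<le> norm (x - p) + \<bar>t\<bar>" using norm_triangle_ineq4[of "x - p" "t *\<^sub>R n"] norm_n by simp
  also have "\<dots> \<le> norm (x - p) + 2 * (L * norm (x - p))" using t G_le[OF rho_ball[OF x]] by linarith
  also have "\<dots> = norm (x - p) * (1 + 2 * L)" by (simp add: algebra_simps)
  also have "\<dots> < \<rho> * (1 + 2 * L)" using \<open>norm (x - p) < \<rho>\<close> L1 by (intro mult_strict_right_mono) auto
  finally show ?thesis using rho_le(1) by simp
qed

lemma fold_in:
  assumes x: "x \<in> ball p \<rho>"
  shows "fold_down x \<in> ball p (r / 4)" "G (fold_down x) = - \<bar>G x\<bar>"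
proof -
  show 1: "fold_down x \<in> ball p (r / 4)" unfolding fold_down_def using fold_bound[OF x, of "G x + \<bar>G x\<bar>"] by simp
  have eq: "x + (- (G x + \<bar>G x\<bar>)) *\<^sub>R n = fold_down x"
    unfolding fold_down_def by (simp only: scaleR_minus_left add_uminus_conv_diff)
  have "fold_down x \<in> ball p r" using 1 r_pos by simp
  then show "G (fold_down x) = - \<bar>G x\<bar>"
    using G_shift[OF rho_ball[OF x], of "- (G x + \<bar>G x\<bar>)"] unfolding eq by simp
qed

lemma fold_mirror: "0 < G x \<Longrightarrow> fold_down x = mirror x" "G x \<le> 0 \<Longrightarrow> fold_down x = x"
  by (auto simp: fold_down_def mirror_def)

lemma mirror_mirror:
  assumes "x \<in> ball p r" "mirror x \<in> ball p r"
  shows "mirror (mirror x) = x"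
proof -
  have "G (mirror x) = - G x"
    using G_shift[OF assms(1), of "- (2 * G x)"] assms(2) by (simp add: mirror_def)
  then show ?thesis by (simp add: mirror_def[of "mirror x"]) (simp add: mirror_def)
qed

section \<open>Reflection and Lebesgue measure\<close>

text \<open>Infinitely many translates of the zero set along \<open>n\<close> are pairwise disjoint,
  because G takes the constant value \<open>t k\<close> on the k-th, and all fit into one ball. They
  have equal measure, which must therefore be 0.\<close>

lemma graph_null: "emeasure lborel {x \<in> ball p (r/2). G x = 0} = 0"
proof -
  let ?Z = "{x \<in> ball p (r/2). G x = 0}"
  have ZB[measurable]: "?Z \<in> sets borel" by measurable
  \<comment> \<open>Distinct shifts of size at most r/4, so that points of the half ball stay in the
    ball of radius r.\<close>
  define t where "t k = r / (4 * real (Suc k))" for k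
  have t: "0 < t k" "t k \<le> r / 4" for k using r_pos by (auto simp: t_def field_simps)
  have t_inj: "t j = t k \<Longrightarrow> j = k" for j k using r_pos by (simp add: t_def)
  have in_ball: "z + t k *\<^sub>R n \<in> ball p r" if "z \<in> ball p (r/2)" for z k
  proof -
    have "dist p (z + t k *\<^sub>R n) \<le> dist p z + t k"
      using dist_triangle[of p "z + t k *\<^sub>R n" z] t(1)[of k] norm_n by (simp add: dist_norm)
    then show ?thesis using that t(2)[of k] r_pos by simp
  qed
  have key: "x \<in> ball p r \<and> G x = t k" if "x + (- t k) *\<^sub>R n \<in> ?Z" for x k
  proof -
    let ?z = "x + (- t k) *\<^sub>R n"
    have z: "?z \<in> ball p (r/2)" "G ?z = 0" using that by auto
    have "?z + t k *\<^sub>R n = x" by simp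
    then show ?thesis using in_ball[OF z(1), of k] G_shift[of ?z "t k"] z r_pos by auto
  qed
  have le: "of_nat N * emeasure lborel ?Z \<le> emeasure lborel (ball p r)" for N
  proof -
    have "(\<integral>\<^sup>+x. indicator ?Z (x + c) \<partial>lborel) = emeasure lborel ?Z" for c
    proof -
      have "indicator ?Z \<in> borel_measurable (borel :: (real^3) measure)" by (rule borel_measurable_indicator[OF ZB])
      then have "(\<integral>\<^sup>+x. indicator ?Z (x + c) \<partial>lborel) = (\<integral>\<^sup>+x. indicator ?Z x \<partial>lborel)"
        by (rule nn_integral_translate)
      also have "\<dots> = emeasure lborel ?Z" by (rule nn_integral_indicator) (use ZB in simp)
      finally show ?thesis .
    qed
    then have "of_nat N * emeasure lborel ?Z = (\<Sum>k<N. \<integral>\<^sup>+x. indicator ?Z (x + (- t k) *\<^sub>R n) \<partial>lborel)"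
      by (simp only: sum_constant card_lessThan)
    also have "\<dots> = (\<integral>\<^sup>+x. (\<Sum>k<N. indicator ?Z (x + (- t k) *\<^sub>R n)) \<partial>lborel)"
      by (rule nn_integral_sum[symmetric]) measurable
    also have "\<dots> \<le> (\<integral>\<^sup>+x. indicator (ball p r) x \<partial>lborel)"
    proof (rule nn_integral_mono)
      fix x
      show "(\<Sum>k<N. indicator ?Z (x + (- t k) *\<^sub>R n)) \<le> (indicator (ball p r) x :: ennreal)"
      proof (cases "\<exists>k<N. x + (- t k) *\<^sub>R n \<in> ?Z")
        case True
        then obtain k where k: "k < N" "x + (- t k) *\<^sub>R n \<in> ?Z" by blast
        have "(\<Sum>j<N. indicator ?Z (x + (- t j) *\<^sub>R n) :: ennreal) = (\<Sum>j<N. if j = k then 1 else 0)"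
        proof (rule sum.cong[OF HOL.refl])
          fix j
          show "(indicator ?Z (x + (- t j) *\<^sub>R n) :: ennreal) = (if j = k then 1 else 0)"
          proof (cases "j = k")
            case True
            then show ?thesis using k(2) by (simp only: indicator_simps if_True simp_thms)
          next
            case False
            have nin: "x + (- t j) *\<^sub>R n \<notin> ?Z"
            proof
              assume "x + (- t j) *\<^sub>R n \<in> ?Z"
              then have "t j = t k" using key[OF k(2)] key[of x j] by simp
              then show False using t_inj False by blast
            qed
            show ?thesis by (simp only: indicator_simps(2)[OF nin] False if_False)
          qed
        qed
        also have "\<dots> = 1" using k(1) by simp
        also have "1 \<le> (indicator (ball p r) x :: ennreal)" using key[OF k(2)] by simp
        finally show ?thesis .
      next
        case False
        have "(\<Sum>k<N. indicator ?Z (x + (- t k) *\<^sub>R n)) = (0::ennreal)"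
        proof (rule sum.neutral, rule ballI)
          fix k assume "k \<in> {..<N}"
          then have "x + (- t k) *\<^sub>R n \<notin> ?Z" using False by blast
          then show "indicator ?Z (x + (- t k) *\<^sub>R n) = (0::ennreal)" by (rule indicator_simps(2))
        qed
        then show ?thesis by (simp only: zero_le)
      qed
    qed
    finally show ?thesis by simp
  qed
  show ?thesis
  proof (rule ccontr)
    assume "emeasure lborel ?Z \<noteq> 0"
    moreover have "emeasure lborel ?Z < \<infinity>" using le[of 1] emeasure_lborel_ball_finite[of p r] by (auto intro: le_less_trans)
    ultimately obtain c where c: "c > 0" "emeasure lborel ?Z = ennreal c"
      by (cases "emeasure lborel ?Z") (auto simp: less_le)
    obtain V where V: "V \<ge> 0" "emeasure lborel (ball p r) = ennreal V"
      using emeasure_lborel_ball_finite[of p r] by (cases "emeasure lborel (ball p r)") auto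
    obtain N where "V / c < real N" using reals_Archimedean2 by blast
    moreover have "real N * c \<le> V"
    proof -
      have "ennreal (real N * c) \<le> ennreal V" using le[of N] c V by (simp add: ennreal_mult ennreal_of_nat_eq_real_of_nat)
      then show ?thesis using V(1) by simp
    qed
    ultimately show False using c(1) by (simp add: divide_simps mult.commute split: if_splits)
  qed
qed

lemma AE_off_graph: "AE x in lborel. x \<in> ball p (r/2) \<longrightarrow> G x \<noteq> 0"
  by (rule AE_I[OF _ graph_null]) auto

lemma mirror_has_derivative:
  assumes "x \<in> ball p r"
  shows "(mirror has_derivative (\<lambda>h. h - (2 * (h \<bullet> G' x)) *\<^sub>R n)) (at x)"
  unfolding mirror_def using C1_onD(2)[OF C1 assms]
  by (auto simp: gderiv_def intro!: derivative_eq_intros)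

text \<open>By \<open>slope\<close> the derivative of the reflection is its own inverse, so its
  determinant squares to 1.\<close>

lemma mirror_det:
  assumes x: "x \<in> ball p r"
  shows "\<bar>det (matrix (\<lambda>h. h - (2 * (h \<bullet> G' x)) *\<^sub>R n))\<bar> = 1"
proof -
  let ?D = "\<lambda>h. h - (2 * (h \<bullet> G' x)) *\<^sub>R n"
  have lin: "linear ?D"
    by (rule linearI) (auto simp: inner_add_left algebra_simps)
  have "?D \<circ> ?D = id"
    using slope[OF x] by (auto simp: fun_eq_iff inner_diff_left algebra_simps)
  then have "matrix ?D ** matrix ?D = mat 1"
    using matrix_compose[OF lin lin] by (simp add: matrix_id_mat_1)
  then have "det (matrix ?D ** matrix ?D) = det (mat 1 :: real^3^3)" by (rule arg_cong)
  then have "det (matrix ?D) * det (matrix ?D) = 1" unfolding det_mul det_I .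
  moreover have "\<bar>a\<bar> = 1" if "a * a = 1" for a :: real
    using that power2_eq_1_iff[of a] by (auto simp: power2_eq_square)
  ultimately show ?thesis by blast
qed

text \<open>\<open>mirror\<close> preserves volume, its determinant being 1 in absolute value, and
  it is injective here because it undoes itself; the image lies in \<open>below\<close>.\<close>

lemma mirror_emeasure_le:
  assumes [measurable]: "A \<in> sets borel"
  shows "emeasure lborel {x \<in> ball p \<rho>. 0 < G x \<and> mirror x \<in> A} \<le> emeasure lborel (below \<inter> A)"
proof -
  define X where "X = {x \<in> ball p \<rho>. 0 < G x \<and> mirror x \<in> A}"
  have [measurable]: "X \<in> sets borel" unfolding X_def by measurable
  have XL: "X \<in> sets lebesgue" by simp
  have Xm: "X \<in> lmeasurable"
    by (rule bounded_set_imp_lmeasurable) (auto simp: X_def intro: bounded_subset[OF bounded_ball, of _ p \<rho>])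
  have Xin: "x \<in> ball p r" "mirror x \<in> below \<inter> A" "mirror (mirror x) = x" if "x \<in> X" for x
  proof -
    have x: "x \<in> ball p \<rho>" "0 < G x" "mirror x \<in> A" using that by (auto simp: X_def)
    show xr: "x \<in> ball p r" using rho_ball[OF x(1)] .
    have "mirror x \<in> ball p (r/4)" "G (mirror x) = - G x" using fold_in[OF x(1)] fold_mirror(1)[OF x(2)] x(2) by auto
    then show "mirror x \<in> below \<inter> A" using x r_pos by (auto simp: below_def)
    then show "mirror (mirror x) = x" using mirror_mirror[OF xr] by (auto simp: below_def)
  qed
  have inj: "inj_on mirror X" by (rule inj_on_inverseI[where g=mirror]) (rule Xin(3))
  have der: "(mirror has_derivative (\<lambda>h. h - (2 * (h \<bullet> G' x)) *\<^sub>R n)) (at x within X)" if "x \<in> X" for x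
    using mirror_has_derivative[OF Xin(1)[OF that]] by (rule has_derivative_at_withinI)
  have "((\<lambda>x. 1::real) has_integral measure lebesgue X) X"
    using Xm lmeasure_integral[OF Xm] by (simp add: has_integral_iff lmeasurable_iff_integrable_on)
  then have "((\<lambda>x. \<bar>det (matrix (\<lambda>h. h - (2 * (h \<bullet> G' x)) *\<^sub>R n))\<bar>) has_integral measure lebesgue X) X"
    by (rule has_integral_eq[rotated]) (use mirror_det Xin(1) in auto)
  then have im: "mirror ` X \<in> lmeasurable" "measure lebesgue (mirror ` X) = measure lebesgue X"
    using has_measure_differentiable_image[OF XL der inj] by blast+
  have "emeasure lborel X = emeasure lebesgue X" by simp
  also have "\<dots> = emeasure lebesgue (mirror ` X)"
    using Xm im by (simp add: emeasure_eq_measure2)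
  also have "\<dots> \<le> emeasure lebesgue (below \<inter> A)"
    by (rule emeasure_mono) (use Xin(2) in auto)
  also have "\<dots> = emeasure lborel (below \<inter> A)" by simp
  finally show ?thesis by (simp add: X_def)
qed

text \<open>The inequality for sets says that the push-forward under \<open>mirror\<close> is
  dominated by Lebesgue measure on \<open>below\<close>; domination of measures carries over to all
  integrands.\<close>

lemma nn_integral_mirror_le:
  assumes [measurable]: "f \<in> borel_measurable borel"
  shows "(\<integral>\<^sup>+x. f (mirror x) * indicator {x \<in> ball p \<rho>. 0 < G x} x \<partial>lborel) \<le> (\<integral>\<^sup>+x. f x * indicator below x \<partial>lborel)"
proof -
  let ?S = "{x \<in> ball p \<rho>. 0 < G x}"
  have [measurable]: "?S \<in> sets borel" by measurable
  let ?M = "distr (density lborel (indicator ?S)) borel mirror" and ?N = "density lborel (indicator below)"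
  have le: "?M \<le> ?N"
  proof (subst le_measure)
    show "sets ?M = sets ?N" by simp
    show "\<forall>A\<in>sets ?M. emeasure ?M A \<le> emeasure ?N A"
    proof
      fix A assume "A \<in> sets ?M"
      then have [measurable]: "A \<in> sets borel" by simp
      have [measurable]: "mirror -` A \<in> sets borel" by (rule measurable_sets_borel[OF mirror_borel]) simp
      have "emeasure ?M A = (\<integral>\<^sup>+x. indicator ?S x * indicator (mirror -` A) x \<partial>lborel)"
        by (simp add: emeasure_distr emeasure_density)
      also have "\<dots> = (\<integral>\<^sup>+x. indicator {x \<in> ball p \<rho>. 0 < G x \<and> mirror x \<in> A} x \<partial>lborel)"
        by (intro nn_integral_cong) (auto simp: indicator_def)
      also have "\<dots> = emeasure lborel {x \<in> ball p \<rho>. 0 < G x \<and> mirror x \<in> A}" by simp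
      also have "\<dots> \<le> emeasure lborel (below \<inter> A)" by (rule mirror_emeasure_le) measurable
      also have "\<dots> = (\<integral>\<^sup>+x. indicator (below \<inter> A) x \<partial>lborel)" by simp
      also have "\<dots> = (\<integral>\<^sup>+x. indicator below x * indicator A x \<partial>lborel)"
        by (intro nn_integral_cong) (auto simp: indicator_def)
      also have "\<dots> = emeasure ?N A" by (simp add: emeasure_density)
      finally show "emeasure ?M A \<le> emeasure ?N A" .
    qed
  qed
  have "(\<integral>\<^sup>+x. f (mirror x) * indicator ?S x \<partial>lborel) = nn_integral ?M f"
    by (simp add: nn_integral_distr nn_integral_density mult.commute)
  also have "\<dots> \<le> nn_integral ?N f" by (rule nn_integral_mono_measure[OF _ le]) simp
  also have "\<dots> = (\<integral>\<^sup>+x. f x * indicator below x \<partial>lborel)" by (simp add: nn_integral_density mult.commute)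
  finally show ?thesis .
qed

text \<open>One copy of the integral accounts for the points below the graph and one for the
  mirrored points; the graph itself is a null set.\<close>

lemma nn_integral_fold_le:
  assumes [measurable]: "f \<in> borel_measurable borel"
  shows "(\<integral>\<^sup>+x. f (fold_down x) * indicator (ball p \<rho>) x \<partial>lborel) \<le> 2 * (\<integral>\<^sup>+x. f x * indicator below x \<partial>lborel)"
proof -
  let ?S = "{x \<in> ball p \<rho>. 0 < G x}"
  have [measurable]: "?S \<in> sets borel" by measurable
  have "(\<integral>\<^sup>+x. f (fold_down x) * indicator (ball p \<rho>) x \<partial>lborel) \<le>
      (\<integral>\<^sup>+x. f (mirror x) * indicator ?S x + f x * indicator below x \<partial>lborel)"
  proof (rule nn_integral_mono_AE)
    show "AE x in lborel. f (fold_down x) * indicator (ball p \<rho>) x \<le> f (mirror x) * indicator ?S x + f x * indicator below x"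
      using AE_off_graph
    proof eventually_elim
      case (elim x)
      show ?case
      proof (cases "x \<in> ball p \<rho>")
        case True
        then have "x \<in> ball p (r/2)" "x \<in> ball p r" using rho_le(2) r_pos by auto
        then consider "0 < G x" | "G x < 0" using elim by force
        then show ?thesis using True \<open>x \<in> ball p r\<close> by cases (auto simp: fold_mirror below_def)
      next
        case False
        then show ?thesis by simp
      qed
    qed
  qed
  also have "\<dots> = (\<integral>\<^sup>+x. f (mirror x) * indicator ?S x \<partial>lborel) + (\<integral>\<^sup>+x. f x * indicator below x \<partial>lborel)"
    by (rule nn_integral_add) measurable
  also have "\<dots> \<le> (\<integral>\<^sup>+x. f x * indicator below x \<partial>lborel) + (\<integral>\<^sup>+x. f x * indicator below x \<partial>lborel)"
    by (intro add_mono nn_integral_mirror_le) auto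
  also have "\<dots> = 2 * (\<integral>\<^sup>+x. f x * indicator below x \<partial>lborel)" by (simp add: mult_2)
  finally show ?thesis .
qed

section \<open>Weak differentiability of the folded function\<close>

text \<open>The chain rule for \<open>fold_down\<close>: the transposed derivative of the folding,
  applied to g at the folded point, with \<open>sgn (G x)\<close> as the derivative of the absolute
  value. The value on the graph is a mere convention, the graph being null.\<close>

definition fold_grad :: "(real^3 \<Rightarrow> real^3) \<Rightarrow> real^3 \<Rightarrow> real^3" where
  "fold_grad g x = g (fold_down x) - ((n \<bullet> g (fold_down x)) * (1 + sgn (G x))) *\<^sub>R G' x"

lemma fold_grad_borel [measurable]:
  assumes [measurable]: "g \<in> borel_measurable borel"
  shows "fold_grad g \<in> borel_measurable borel"
  unfolding fold_grad_def by measurable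

lemma fold_grad_diff: "fold_grad g x - fold_grad h x = fold_grad (\<lambda>y. g y - h y) x"
  by (simp add: fold_grad_def algebra_simps inner_diff_right)

lemma norm_fold_grad_le:
  assumes "x \<in> ball p \<rho>"
  shows "norm (fold_grad g x) \<le> (1 + 2 * L) * norm (g (fold_down x))"
proof -
  have a: "\<bar>n \<bullet> g (fold_down x)\<bar> \<le> norm (g (fold_down x))" using Cauchy_Schwarz_ineq2[of n "g (fold_down x)"] norm_n by simp
  have b: "\<bar>1 + sgn (G x)\<bar> \<le> 2" by (simp add: sgn_real_def)
  have "norm (((n \<bullet> g (fold_down x)) * (1 + sgn (G x))) *\<^sub>R G' x) \<le> norm (g (fold_down x)) * 2 * L"
    unfolding norm_scaleR abs_mult
    by (intro mult_mono a b G'_le rho_ball[OF assms]) auto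
  then show ?thesis
    using norm_triangle_ineq4[of "g (fold_down x)" "((n \<bullet> g (fold_down x)) * (1 + sgn (G x))) *\<^sub>R G' x"]
    by (simp add: fold_grad_def algebra_simps)
qed

lemma L1on_fold_le:
  assumes [measurable]: "f \<in> borel_measurable borel" "K \<in> sets borel" and K: "K \<subseteq> ball p \<rho>"
  shows "L1on K (\<lambda>x. f (fold_down x) :: real) \<le> 2 * L1on below f"
proof -
  have "L1on K (\<lambda>x. f (fold_down x)) \<le> (\<integral>\<^sup>+x. ennreal (norm (f (fold_down x))) * indicator (ball p \<rho>) x \<partial>lborel)"
    unfolding L1on_def using K by (intro nn_integral_mono) (auto simp: indicator_def)
  also have "\<dots> \<le> 2 * L1on below f"
    unfolding L1on_def by (rule nn_integral_fold_le[of "\<lambda>x. ennreal (norm (f x))"]) measurable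
  finally show ?thesis .
qed

lemma L1on_fold_grad_le:
  assumes [measurable]: "g \<in> borel_measurable borel" "K \<in> sets borel" and K: "K \<subseteq> ball p \<rho>"
  shows "L1on K (fold_grad g) \<le> ennreal (2 * (1 + 2 * L)) * L1on below g"
proof -
  have "L1on K (fold_grad g) \<le> ennreal (1 + 2 * L) * L1on K (\<lambda>x. norm (g (fold_down x)))"
    by (rule L1on_le_cmult) (use norm_fold_grad_le K L1 in auto)
  also have "L1on K (\<lambda>x. norm (g (fold_down x))) \<le> 2 * L1on below (\<lambda>x. norm (g x))"
    by (rule L1on_fold_le) (use K in auto)
  also have "L1on below (\<lambda>x. norm (g x)) = L1on below g" by (simp add: L1on_def)
  also have "ennreal (1 + 2 * L) * (2 * L1on below g) = ennreal (2 * (1 + 2 * L)) * L1on below g"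
    using L1 by (intro ennreal_mult_two) auto
  finally show ?thesis by (simp add: mult_left_mono)
qed

lemma L2on_fold_grad_le:
  assumes [measurable]: "g \<in> borel_measurable borel"
  shows "L2on (ball p \<rho>) (fold_grad g) \<le> ennreal (2 * (1 + 2 * L)\<^sup>2) * L2on below g"
proof -
  have "L2on (ball p \<rho>) (fold_grad g) \<le> L2on (ball p \<rho>) (\<lambda>x. (1 + 2 * L) *\<^sub>R norm (g (fold_down x)))"
    by (rule L2on_mono) (use norm_fold_grad_le L1 in auto)
  also have "\<dots> = ennreal ((1 + 2 * L)\<^sup>2) * L2on (ball p \<rho>) (\<lambda>x. norm (g (fold_down x)))"
    by (rule L2on_cmult) measurable
  also have "L2on (ball p \<rho>) (\<lambda>x. norm (g (fold_down x))) \<le> 2 * L2on below (\<lambda>x. norm (g x))"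
    unfolding L2on_def by (rule nn_integral_fold_le[of "\<lambda>x. ennreal ((norm (norm (g x)))\<^sup>2)"]) measurable
  also have "L2on below (\<lambda>x. norm (g x)) = L2on below g" by (simp add: L2on_def)
  also have "ennreal ((1 + 2 * L)\<^sup>2) * (2 * L2on below g) = ennreal (2 * (1 + 2 * L)\<^sup>2) * L2on below g"
    using L1 by (intro ennreal_mult_two) auto
  finally show ?thesis by (simp add: mult_left_mono)
qed

text \<open>Smoothing \<open>\<bar>G\<bar>\<close> to \<open>sqrt (G\<^sup>2 + d\<^sup>2)\<close> turns \<open>fold_down\<close> into a \<open>C\<^sup>1\<close> map.\<close>

lemma weak_grad_fold_C1:
  assumes v: "C1_on N v v'" and c: "continuous_on UNIV v" "continuous_on UNIV v'"
    and N: "{x \<in> ball p (r/2). G x \<le> 0} \<subseteq> N"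
  shows "weak_grad (ball p \<rho>) (\<lambda>x. v (fold_down x)) (fold_grad v')"
proof (rule weak_grad_limit)
  have vB[measurable]: "v \<in> borel_measurable borel" "v' \<in> borel_measurable borel"
    using c by (auto intro: borel_measurable_continuous_onI)
  show "(\<lambda>x. v (fold_down x)) \<in> borel_measurable borel" "fold_grad v' \<in> borel_measurable borel" by measurable
  fix K and e :: real assume K: "compact K" "K \<subseteq> ball p \<rho>" and e: "e > 0"
  have KB[measurable]: "K \<in> sets borel" using K by (simp add: borel_compact)
  obtain M1 where M1: "0 \<le> M1" "\<And>x. x \<in> cball p (r/2) \<Longrightarrow> norm (v x) \<le> M1"
    using compact_bound_continuous[OF compact_cball[of p "r/2"] continuous_on_subset[OF c(1) subset_UNIV]] by blast
  obtain M2 where M2: "0 \<le> M2" "\<And>x. x \<in> cball p (r/2) \<Longrightarrow> norm (v' x) \<le> M2"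
    using compact_bound_continuous[OF compact_cball[of p "r/2"] continuous_on_subset[OF c(2) subset_UNIV]] by blast
  \<comment> \<open>Smoothing parameters of size at most r/4, so that the smoothed folds, which miss
    the range of \<open>fold_bound\<close> by at most \<open>d k\<close>, stay in the half
    ball.\<close>
  define d where "d k = r / (4 * real (Suc k))" for k
  have d: "0 < d k" "d k \<le> r / 4" for k using r_pos by (auto simp: d_def field_simps)
  have d0: "d \<longlonglongrightarrow> 0"
  proof -
    have "(\<lambda>k. (r / 4) * (1 / real (Suc k))) \<longlonglongrightarrow> (r / 4) * 0"
      by (intro tendsto_mult tendsto_const LIMSEQ_Suc[OF lim_1_over_n])
    then show ?thesis by (simp add: d_def[abs_def])
  qed
  define S where "S k x = sqrt ((G x)\<^sup>2 + (d k)\<^sup>2)" for k x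
  define y where "y k x = x - (G x + S k x) *\<^sub>R n" for k x
  define w' where "w' k x = v' (y k x) - ((n \<bullet> v' (y k x)) * (1 + G x / S k x)) *\<^sub>R G' x" for k x
  have Spos: "0 < S k x" for k x
    unfolding S_def using d(1)[of k] by (simp add: add_nonneg_pos)
  have S_ge: "\<bar>G x\<bar> \<le> S k x" for k x unfolding S_def by (rule real_le_rsqrt) simp
  have S_le: "S k x \<le> \<bar>G x\<bar> + d k" for k x
    unfolding S_def using sqrt_sum_squares_le_sum_abs[of "G x" "d k"] d(1)[of k] by simp
  have y_ball: "y k x \<in> ball p (r/2)" if x: "x \<in> ball p \<rho>" for k x
  proof -
    \<comment> \<open>The displacement clamped to the range that \<open>fold_bound\<close> admits;
      the true displacement exceeds it by at most \<open>d k\<close>.\<close>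
    define t where "t = max (- (2 * \<bar>G x\<bar>)) (min (2 * \<bar>G x\<bar>) (G x + S k x))"
    have t: "\<bar>t\<bar> \<le> 2 * \<bar>G x\<bar>" "\<bar>(G x + S k x) - t\<bar> \<le> d k"
      using S_ge[of x k] S_le[of k x] d(1)[of k] by (auto simp: t_def max_def min_def)
    have "dist p (y k x) \<le> dist p (x - t *\<^sub>R n) + dist (x - t *\<^sub>R n) (y k x)" by (rule dist_triangle)
    also have "dist (x - t *\<^sub>R n) (y k x) = \<bar>(G x + S k x) - t\<bar>"
      using norm_n by (simp add: y_def dist_norm flip: scaleR_diff_left)
    also have "dist p (x - t *\<^sub>R n) + \<bar>(G x + S k x) - t\<bar> < r / 4 + r / 4"
      using fold_bound[OF x t(1)] t(2) d(2)[of k] by linarith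
    finally show ?thesis by simp
  qed
  \<comment> \<open>The smoothed fold lands strictly below the graph, at height -S < 0, so
    \<open>v\<close> is differentiable at the image even if x lies on or above the graph.\<close>
  have y_N: "y k x \<in> N" if x: "x \<in> ball p \<rho>" for k x
  proof -
    have eq: "x + (- (G x + S k x)) *\<^sub>R n = y k x"
      unfolding y_def by (simp only: scaleR_minus_left add_uminus_conv_diff)
    have "y k x \<in> ball p r" using y_ball[OF x, of k] r_pos by simp
    then have "G (y k x) = - S k x"
      using G_shift[OF rho_ball[OF x], of "- (G x + S k x)"] unfolding eq by simp
    then show ?thesis using N y_ball[OF x, of k] Spos[of k x] by auto
  qed
  have cG: "continuous_on (ball p \<rho>) G" "continuous_on (ball p \<rho>) G'"
    using G_cont C1_onD(3)[OF C1] rho_ball by (auto intro: continuous_on_subset)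
  have cS: "continuous_on (ball p \<rho>) (S k)" for k
    unfolding S_def by (intro continuous_intros cG)
  have cy: "continuous_on (ball p \<rho>) (y k)" for k
    unfolding y_def by (intro continuous_intros cG cS)
  have [measurable]: "S k \<in> borel_measurable borel" "y k \<in> borel_measurable borel" for k
    unfolding y_def S_def by measurable
  have [measurable]: "w' k \<in> borel_measurable borel" for k unfolding w'_def by measurable
  have C: "C1_on (ball p \<rho>) (\<lambda>x. v (y k x)) (w' k)" for k
    unfolding C1_on_def
  proof (intro conjI ballI open_ball)
    show "continuous_on (ball p \<rho>) (w' k)"
      unfolding w'_def
      by (intro continuous_intros cG cS continuous_on_compose2[OF c(2) cy]) (use Spos in \<open>auto simp: less_imp_neq[THEN not_sym]\<close>)
    fix x assume x: "x \<in> ball p \<rho>"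
    have dG: "(G has_derivative (\<lambda>h. h \<bullet> G' x)) (at x)"
      using C1_onD(2)[OF C1 rho_ball[OF x]] by (simp add: gderiv_def)
    have dS: "(S k has_derivative (\<lambda>h. (G x / S k x) * (h \<bullet> G' x))) (at x)"
    proof -
      have "((\<lambda>x. (G x)\<^sup>2 + (d k)\<^sup>2) has_derivative (\<lambda>h. h \<bullet> ((2 * G x) *\<^sub>R G' x))) (at x)"
        using dG by (auto intro!: derivative_eq_intros)
      then have "GDERIV (\<lambda>x. (G x)\<^sup>2 + (d k)\<^sup>2) x :> (2 * G x) *\<^sub>R G' x" by (simp add: gderiv_def)
      moreover have "(G x)\<^sup>2 + (d k)\<^sup>2 > 0" using d(1)[of k] by (simp add: add_nonneg_pos)
      ultimately have "GDERIV (S k) x :> (inverse (S k x) / 2) *\<^sub>R ((2 * G x) *\<^sub>R G' x)"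
        unfolding S_def by (rule GDERIV_DERIV_compose[OF _ DERIV_real_sqrt])
      then have "(S k has_derivative (\<lambda>h. h \<bullet> ((inverse (S k x) / 2) *\<^sub>R ((2 * G x) *\<^sub>R G' x)))) (at x)"
        by (simp only: gderiv_def)
      moreover have "(\<lambda>h. h \<bullet> ((inverse (S k x) / 2) *\<^sub>R ((2 * G x) *\<^sub>R G' x))) = (\<lambda>h. (G x / S k x) * (h \<bullet> G' x))"
      proof (rule ext)
        fix h
        have "(inverse s / 2) * ((2 * a) * b) = (a / s) * b" for s a b :: real by (simp add: field_simps)
        from this[of "S k x" "G x" "h \<bullet> G' x"]
        show "h \<bullet> ((inverse (S k x) / 2) *\<^sub>R ((2 * G x) *\<^sub>R G' x)) = (G x / S k x) * (h \<bullet> G' x)"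
          unfolding inner_scaleR_right .
      qed
      ultimately show ?thesis by (rule has_derivative_eq_rhs)
    qed
    have dy: "(y k has_derivative (\<lambda>h. h - (h \<bullet> G' x + (G x / S k x) * (h \<bullet> G' x)) *\<^sub>R n)) (at x)"
      unfolding y_def
      by (rule has_derivative_diff[OF has_derivative_ident has_derivative_scaleR_left[OF has_derivative_add[OF dG dS]]])
    have dv: "(v has_derivative (\<lambda>h. h \<bullet> v' (y k x))) (at (y k x))"
      using C1_onD(2)[OF v y_N[OF x]] by (simp add: gderiv_def)
    have "((\<lambda>x. v (y k x)) has_derivative (\<lambda>h. (h - (h \<bullet> G' x + (G x / S k x) * (h \<bullet> G' x)) *\<^sub>R n) \<bullet> v' (y k x))) (at x)"
      by (rule has_derivative_compose[OF dy dv])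
    moreover have "(\<lambda>h. (h - (h \<bullet> G' x + (G x / S k x) * (h \<bullet> G' x)) *\<^sub>R n) \<bullet> v' (y k x)) = (\<lambda>h. h \<bullet> w' k x)"
      by (auto simp: w'_def fun_eq_iff inner_diff_left inner_diff_right algebra_simps)
    ultimately show "GDERIV (\<lambda>x. v (y k x)) x :> w' k x" by (simp add: gderiv_def)
  qed
  have wg: "weak_grad (ball p \<rho>) (\<lambda>x. v (y k x)) (w' k)" for k
    by (rule C1_weak_grad_borel[OF C]) measurable
  have KAE: "AE x in lborel. x \<in> K \<longrightarrow> G x \<noteq> 0"
    using AE_off_graph by eventually_elim (use K(2) rho_le(2) r_pos in auto)
  have Slim: "(\<lambda>k. S k x) \<longlonglongrightarrow> \<bar>G x\<bar>" for x
  proof -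
    have "(\<lambda>k. sqrt ((G x)\<^sup>2 + (d k)\<^sup>2)) \<longlonglongrightarrow> sqrt ((G x)\<^sup>2 + 0\<^sup>2)" by (intro tendsto_intros d0)
    then show ?thesis by (simp add: S_def)
  qed
  have ylim: "(\<lambda>k. y k x) \<longlonglongrightarrow> fold_down x" for x
    unfolding y_def fold_down_def by (intro tendsto_intros Slim)
  have lim1: "(\<lambda>k. v (y k x)) \<longlonglongrightarrow> v (fold_down x)" and lim2: "(\<lambda>k. v' (y k x)) \<longlonglongrightarrow> v' (fold_down x)" for x
    using c by (auto intro!: isCont_tendsto_compose[OF _ ylim] simp: continuous_on_eq_continuous_at)
  have fin: "L1on K (\<lambda>x. c) < \<infinity>" for c :: real
    using K L1on_finite_if_bounded[of K "\<lambda>x. c" "\<bar>c\<bar>"] by (simp add: compact_imp_bounded)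
  have "(\<lambda>k. L1on K (\<lambda>x. v (fold_down x) - v (y k x))) \<longlonglongrightarrow> 0"
  proof (rule L1on_dominated[where w="\<lambda>x. M1"])
    show "L1on K (\<lambda>x. M1) < \<infinity>" by (rule fin)
    show "norm (v (y k x)) \<le> M1" if "x \<in> K" for k x
      using M1(2) y_ball[of x k] K(2) that by (auto simp: subset_iff less_imp_le)
    show "AE x in lborel. x \<in> K \<longrightarrow> (\<lambda>k. v (y k x)) \<longlonglongrightarrow> v (fold_down x)" using lim1 by simp
  qed measurable
  then have ev1: "\<forall>\<^sub>F k in sequentially. L1on K (\<lambda>x. v (fold_down x) - v (y k x)) < ennreal e"
    by (rule order_tendstoD(2)) (use e in simp)
  have "(\<lambda>k. L1on K (\<lambda>x. fold_grad v' x - w' k x)) \<longlonglongrightarrow> 0"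
  proof (rule L1on_dominated[where w="\<lambda>x. (1 + 2 * L) * M2"])
    show "L1on K (\<lambda>x. (1 + 2 * L) * M2) < \<infinity>" by (rule fin)
    show "norm (w' k x) \<le> (1 + 2 * L) * M2" if xK: "x \<in> K" for k x
    proof -
      have x: "x \<in> ball p \<rho>" using K xK by auto
      have m: "norm (v' (y k x)) \<le> M2" using M2(2) y_ball[OF x, of k] by (auto simp: less_imp_le)
      have a: "\<bar>n \<bullet> v' (y k x)\<bar> \<le> M2" using Cauchy_Schwarz_ineq2[of n "v' (y k x)"] norm_n m by simp
      have "\<bar>G x / S k x\<bar> \<le> 1" using S_ge[of x k] Spos[of k x] by simp
      then have b: "\<bar>1 + G x / S k x\<bar> \<le> 2" by linarith
      have "norm (((n \<bullet> v' (y k x)) * (1 + G x / S k x)) *\<^sub>R G' x) \<le> M2 * 2 * L"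
        unfolding norm_scaleR abs_mult by (intro mult_mono a b G'_le rho_ball[OF x]) (use M2 in auto)
      then show ?thesis
        using norm_triangle_ineq4[of "v' (y k x)" "((n \<bullet> v' (y k x)) * (1 + G x / S k x)) *\<^sub>R G' x"] m
        by (simp add: w'_def algebra_simps)
    qed
    show "AE x in lborel. x \<in> K \<longrightarrow> (\<lambda>k. w' k x) \<longlonglongrightarrow> fold_grad v' x"
      using KAE
    proof eventually_elim
      case (elim x)
      show ?case
      proof
        assume "x \<in> K"
        then have nz: "G x \<noteq> 0" using elim by simp
        have "(\<lambda>k. G x / S k x) \<longlonglongrightarrow> G x / \<bar>G x\<bar>" by (intro tendsto_intros Slim) (use nz in simp)
        then have "(\<lambda>k. G x / S k x) \<longlonglongrightarrow> sgn (G x)" by (simp add: real_sgn_eq)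
        then show "(\<lambda>k. w' k x) \<longlonglongrightarrow> fold_grad v' x"
          unfolding w'_def fold_grad_def by (intro tendsto_intros lim2)
      qed
    qed
  qed measurable
  then have ev2: "\<forall>\<^sub>F k in sequentially. L1on K (\<lambda>x. fold_grad v' x - w' k x) < ennreal e"
    by (rule order_tendstoD(2)) (use e in simp)
  from eventually_happens[OF eventually_conj[OF ev1 ev2]] obtain k where
    "L1on K (\<lambda>x. v (fold_down x) - v (y k x)) < ennreal e" "L1on K (\<lambda>x. fold_grad v' x - w' k x) < ennreal e" by auto
  then show "\<exists>V w w'. weak_grad V w w' \<and> K \<subseteq> V \<and> L1on K (\<lambda>x. v (fold_down x) - w x) < ennreal e \<and>
     L1on K (\<lambda>x. fold_grad v' x - w' x) < ennreal e"
    using wg[of k] K(2) by blast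
qed simp

text \<open>Mollifying with a kernel supported near \<open>\<tau> n\<close> looks only downwards, so the mollified function is
  \<open>C\<^sup>1\<close> in a neighbourhood of the closure of the part below the graph.\<close>

lemma weak_grad_fold:
  assumes w: "weak_grad below u g" and fin: "L1on below u < \<infinity>" "L1on below g < \<infinity>"
  shows "weak_grad (ball p \<rho>) (\<lambda>x. u (fold_down x)) (fold_grad g)"
proof (rule weak_grad_limit)
  note [measurable] = weak_gradD(2,3)[OF w]
  show "(\<lambda>x. u (fold_down x)) \<in> borel_measurable borel" "fold_grad g \<in> borel_measurable borel" by measurable
  fix K and e :: real assume K: "compact K" "K \<subseteq> ball p \<rho>" and e: "e > 0"
  have KB[measurable]: "K \<in> sets borel" using K by (simp add: borel_compact)
  define u1 where "u1 x = (if x \<in> below then u x else 0)" for x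
  define g1 where "g1 x = (if x \<in> below then g x else 0)" for x
  have w1: "weak_grad below u1 g1" unfolding u1_def g1_def by (rule weak_grad_zero_outside[OF w])
  have fin1: "L1on UNIV u1 < \<infinity>" "L1on UNIV g1 < \<infinity>"
    unfolding u1_def g1_def using L1on_zero_outside_le[of below below] fin by (auto intro: le_less_trans)
  \<comment> \<open>Folding costs a factor 2 for the function and 2 (1 + 2 L) for the gradient; both
    errors must end below e.\<close>
  define e' where "e' = e / (4 * (1 + 2 * L))"
  have e': "e' > 0" "2 * (1 + 2 * L) * e' = e / 2" "2 * e' < e"
  proof -
    have q: "3 \<le> 1 + 2 * L" using L1 by simp
    show e0: "e' > 0" using e q unfolding e'_def by (intro divide_pos_pos) auto
    have "2 * q * (e / (4 * q)) = e / 2" if "q \<noteq> 0" for q :: real using that by simp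
    from this[of "1 + 2 * L"] show e1: "2 * (1 + 2 * L) * e' = e / 2" using q unfolding e'_def by linarith
    have "e' * 3 \<le> e' * (1 + 2 * L)" using e0 q by (intro mult_left_mono) auto
    then show "2 * e' < e" using e1 e by (simp add: algebra_simps)
  qed
  obtain \<tau>0 where \<tau>0: "\<tau>0 > 0" "\<And>a \<sigma>. \<sigma> > 0 \<Longrightarrow> norm a + \<sigma> < \<tau>0 \<Longrightarrow> \<exists>v v'. mollification below u1 g1 e' a \<sigma> v v'"
    using weak_grad_mollify[OF w1 fin1 e'(1)] by metis
  \<comment> \<open>The bound r/8 keeps x - z in the ball of radius r for x in the half ball, since
    |z| is at most \<tau> + \<sigma>.\<close>
  define \<tau> where "\<tau> = min (\<tau>0 / 2) (r / 8)"
  have \<tau>: "\<tau> > 0" "\<tau> \<le> \<tau>0 / 2" "\<tau> \<le> r / 8" using \<tau>0(1) r_pos by (auto simp: \<tau>_def)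
  \<comment> \<open>A displacement of length \<sigma> raises G by at most L \<sigma> = \<tau>/2,
    while the shift by -\<tau> n lowers it by exactly \<tau>; starting from G < \<tau>/2 the point
    ends strictly below the graph.\<close>
  define \<sigma> where "\<sigma> = \<tau> / (2 * L)"
  have \<sigma>: "\<sigma> > 0" "L * \<sigma> = \<tau> / 2" "\<sigma> \<le> \<tau> / 2" using \<tau>(1) L1 by (auto simp: \<sigma>_def field_simps)
  have "norm (\<tau> *\<^sub>R n) + \<sigma> < \<tau>0" using \<tau> \<sigma> norm_n by simp
  from \<tau>0(2)[OF \<sigma>(1) this] obtain v v' where v: "continuous_on UNIV v" "continuous_on UNIV v'"
     "\<And>x. (\<forall>z\<in>cball (\<tau> *\<^sub>R n) \<sigma>. x - z \<in> below) \<Longrightarrow> GDERIV v x :> v' x"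
     "L1on UNIV (\<lambda>x. u1 x - v x) < ennreal e'" "L1on UNIV (\<lambda>x. g1 x - v' x) < ennreal e'"
    unfolding mollification_def by blast
  have [measurable]: "v \<in> borel_measurable borel" "v' \<in> borel_measurable borel"
    using v(1,2) by (auto intro: borel_measurable_continuous_onI)
  define N where "N = {x \<in> ball p (r/2). G x < \<tau> / 2}"
  have opN: "open N"
  proof -
    have "N = ball p (r/2) \<inter> G -` {..<\<tau>/2}" by (auto simp: N_def)
    moreover have "continuous_on (ball p (r/2)) G" using G_cont by (rule continuous_on_subset) (use r_pos in auto)
    ultimately show ?thesis using continuous_on_open_vimage[OF open_ball] by (metis Int_commute open_lessThan)
  qed
  have "x - z \<in> below" if x: "x \<in> N" and z: "z \<in> cball (\<tau> *\<^sub>R n) \<sigma>" for x z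
  proof -
    define q where "q = z - \<tau> *\<^sub>R n"
    have q: "norm q \<le> \<sigma>" using z by (simp add: q_def dist_norm norm_minus_commute)
    have xp: "dist p x < r / 2" "G x < \<tau> / 2" using x by (auto simp: N_def)
    have d1: "dist p (x - q) \<le> dist p x + norm q" using dist_triangle[of p "x - q" x] by (simp add: dist_norm)
    then have b1: "x - q \<in> ball p r" using q xp \<sigma>(3) \<tau>(1,3) by (simp add: field_simps)
    have "dist p (x - z) \<le> dist p (x - q) + dist (x - q) (x - z)" by (rule dist_triangle)
    also have "dist (x - q) (x - z) = \<tau>" using norm_n \<tau>(1) by (simp add: q_def dist_norm)
    finally have b2: "x - z \<in> ball p r" using d1 q xp \<sigma>(3) \<tau>(1,3) by (simp add: field_simps)
    have "G (x - q) \<le> G x + L * norm q"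
      using G_lipschitz[OF b1, of x] xp(1) r_pos by (simp add: norm_minus_commute)
    also have "L * norm q \<le> L * \<sigma>" using q L1 by (intro mult_left_mono) auto
    also note \<sigma>(2)
    finally have G1: "G (x - q) < \<tau>" using xp(2) by linarith
    have eq: "x - z = (x - q) + (- \<tau>) *\<^sub>R n" by (simp add: q_def)
    have "G (x - z) = G (x - q) + (- \<tau>)" unfolding eq by (rule G_shift[OF b1]) (use b2 eq in metis)
    then show ?thesis using G1 b2 by (simp add: below_def)
  qed
  then have "C1_on N v v'" using v(2,3) opN by (auto simp: C1_on_def intro: continuous_on_subset)
  moreover have "{x \<in> ball p (r/2). G x \<le> 0} \<subseteq> N" using \<tau>(1) by (auto simp: N_def)
  ultimately have wg: "weak_grad (ball p \<rho>) (\<lambda>x. v (fold_down x)) (fold_grad v')"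
    using v(1,2) by (intro weak_grad_fold_C1)
  have b1: "L1on below (\<lambda>x. u x - v x) \<le> ennreal e'" "L1on below (\<lambda>x. g x - v' x) \<le> ennreal e'"
  proof -
    have "L1on below (\<lambda>x. u x - v x) \<le> L1on UNIV (\<lambda>x. u1 x - v x)" "L1on below (\<lambda>x. g x - v' x) \<le> L1on UNIV (\<lambda>x. g1 x - v' x)"
      by (auto intro!: L1on_mono simp: u1_def g1_def)
    then show "L1on below (\<lambda>x. u x - v x) \<le> ennreal e'" "L1on below (\<lambda>x. g x - v' x) \<le> ennreal e'"
      using v(4,5) by (auto intro: order_trans less_imp_le)
  qed
  have "L1on K (\<lambda>x. u (fold_down x) - v (fold_down x)) < ennreal e"
  proof -
    have "L1on K (\<lambda>x. u (fold_down x) - v (fold_down x)) \<le> 2 * L1on below (\<lambda>x. u x - v x)"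
      by (rule L1on_fold_le) (use K(2) in auto)
    also have "\<dots> \<le> 2 * ennreal e'" using b1(1) by (rule mult_left_mono) simp
    also have "\<dots> = ennreal (2 * e')" using e'(1) by (simp add: ennreal_mult)
    also have "\<dots> < ennreal e" using e'(3) e by (intro ennreal_lessI) auto
    finally show ?thesis .
  qed
  moreover have "L1on K (\<lambda>x. fold_grad g x - fold_grad v' x) < ennreal e"
  proof -
    have "L1on K (\<lambda>x. fold_grad g x - fold_grad v' x) \<le> ennreal (2 * (1 + 2 * L)) * L1on below (\<lambda>x. g x - v' x)"
      unfolding fold_grad_diff by (rule L1on_fold_grad_le) (use K(2) in auto)
    also have "\<dots> \<le> ennreal (2 * (1 + 2 * L)) * ennreal e'" using b1(2) by (rule mult_left_mono) simp
    also have "\<dots> = ennreal (e / 2)"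
      unfolding e'(2)[symmetric] by (rule ennreal_mult[symmetric]) (use L1 e'(1) in auto)
    also have "\<dots> < ennreal e" using e by (intro ennreal_lessI) auto
    finally show ?thesis .
  qed
  ultimately show "\<exists>V w w'. weak_grad V w w' \<and> K \<subseteq> V \<and> L1on K (\<lambda>x. u (fold_down x) - w x) < ennreal e \<and>
     L1on K (\<lambda>x. fold_grad g x - w' x) < ennreal e"
    using wg K(2) by blast
qed simp

end

section \<open>Extension into a single hole\<close>

context graph_patch
begin

lemma fold_down_id: "x \<in> ball p r \<Longrightarrow> x \<notin> T \<Longrightarrow> fold_down x = x"
  using T_iff[of x] fold_mirror(2)[of x] by auto

lemma below_disjoint:
  assumes "open T" shows "below \<inter> closure T = {}"
proof -
  have "below \<inter> T = {}" using T_iff by (force simp: below_def)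
  then show ?thesis using open_below open_Int_closure_eq_empty by blast
qed

end

lemma frontier_near:
  fixes z :: "'a::euclidean_space"
  assumes "z \<notin> closure T" "y \<in> closure T" "dist z y \<le> q"
  obtains p where "p \<in> frontier T" "dist z p \<le> q"
proof -
  have "closed_segment z y \<inter> frontier (closure T) \<noteq> {}"
    by (rule connected_Int_frontier[OF convex_connected[OF convex_closed_segment]]) (use assms in auto)
  moreover have "frontier (closure T) \<subseteq> frontier T"
    using interior_mono[OF closure_subset, of T] by (auto simp: frontier_def)
  ultimately obtain p where p: "p \<in> closed_segment z y" "p \<in> frontier T" by blast
  have "closed_segment z y \<subseteq> cball z q" using assms(3) order_trans[OF zero_le_dist assms(3)] by (intro closed_segment_subset convex_cball) auto
  then show thesis using that p by auto
qed

section \<open>Patching reflections around the hole\<close>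

text \<open>One functional for all norms: t^q gives the L^q integrals, and the indicator of t > c
  gives an essential bound. The extension is built once and estimated for every admissible
  \<Theta>.\<close>

definition theta_int :: "(real \<Rightarrow> ennreal) \<Rightarrow> 'a::euclidean_space set \<Rightarrow> ('a \<Rightarrow> real) \<Rightarrow> ennreal" where
  "theta_int \<Theta> S u = (\<integral>\<^sup>+x. \<Theta> \<bar>u x\<bar> * indicator S x \<partial>lborel)"

definition admissible :: "(real \<Rightarrow> ennreal) \<Rightarrow> bool" where
  "admissible \<Theta> \<longleftrightarrow> \<Theta> \<in> borel_measurable borel \<and> \<Theta> 0 = 0 \<and> (\<forall>s t. 0 \<le> s \<longrightarrow> s \<le> t \<longrightarrow> \<Theta> s \<le> \<Theta> t)"

lemma theta_int_square: "theta_int (\<lambda>t. ennreal (t\<^sup>2)) S u = L2on S u"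
  by (simp add: theta_int_def L2on_def)

lemma admissible_square: "admissible (\<lambda>t. ennreal (t\<^sup>2))"
  unfolding admissible_def by (auto intro!: ennreal_leI power_mono)

lemma L1on_finite_if_L2on:
  fixes u :: "'a::euclidean_space \<Rightarrow> 'b::euclidean_space"
  assumes [measurable]: "u \<in> borel_measurable borel" "S \<in> sets borel" and "bounded S" "L2on S u < \<infinity>"
  shows "L1on S u < \<infinity>"
proof -
  have "L1on S u \<le> (\<integral>\<^sup>+x. ennreal ((norm (u x))\<^sup>2) * indicator S x + 1 * indicator S x \<partial>lborel)"
    unfolding L1on_def
  proof (intro nn_integral_mono)
    fix x
    have "a \<le> a\<^sup>2 + 1" if "0 \<le> a" for a :: real
      using zero_le_power2[of "a - 1"] that unfolding power2_eq_square by (simp add: algebra_simps)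
    then have "norm (u x) \<le> (norm (u x))\<^sup>2 + 1" by simp
    then have "ennreal (norm (u x)) \<le> ennreal ((norm (u x))\<^sup>2) + 1" by (metis ennreal_1 ennreal_leI ennreal_plus zero_le_one zero_le_power2)
    then show "ennreal (norm (u x)) * indicator S x \<le> ennreal ((norm (u x))\<^sup>2) * indicator S x + 1 * indicator S x"
      by (auto simp: indicator_def)
  qed
  also have "\<dots> = L2on S u + emeasure lborel S"
    unfolding L2on_def by (subst nn_integral_add) auto
  also have "\<dots> < \<infinity>"
    using assms(4) emeasure_bounded_finite[OF \<open>bounded S\<close>] by simp
  finally show ?thesis .
qed

text \<open>One step of the construction: near \<open>p\<close> the current extension \<open>\<Psi>\<close> is blended with the reflected
  function, which removes a neighbourhood of \<open>p\<close> from the singular set \<open>Z\<close>.\<close>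

lemma patch_step:
  fixes \<phi> b0 :: "real^3 \<Rightarrow> real" and Db :: "real^3 \<Rightarrow> real^3"
  assumes gp: "graph_patch T p r L n G G'" and T: "open T" "p \<in> frontier T" and B: "open B" "ball p r \<subseteq> B"
    and Z: "closed Z" and W: "W = B - closure T"
    and w: "weak_grad (B - Z) \<Psi> h" and eq: "\<And>x. x \<in> W \<Longrightarrow> \<Psi> x = \<phi> x"
    and w\<phi>: "weak_grad W \<phi> g" and fin: "L2on W \<phi> < \<infinity>" "L2on W g < \<infinity>"
    and \<rho>: "\<rho> = r / (4 * (1 + 2 * L))"
    and b0: "smooth b0" "\<And>x. GDERIV b0 x :> Db x" "\<And>x. 0 \<le> b0 x" "\<And>x. b0 x \<le> 1"
      "\<And>x. x \<in> cball 0 (\<rho>/4) \<Longrightarrow> b0 x = 1" "\<And>x. x \<notin> ball 0 (\<rho>/2) \<Longrightarrow> b0 x = 0" "\<And>x. norm (Db x) \<le> M" "0 \<le> M"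
  shows "\<exists>\<Psi>' h'. weak_grad (B - (Z - ball p (\<rho>/4))) \<Psi>' h' \<and> (\<forall>x\<in>W. \<Psi>' x = \<phi> x) \<and>
    (\<forall>\<Theta>. admissible \<Theta> \<longrightarrow> theta_int \<Theta> B \<Psi>' \<le> 2 * theta_int \<Theta> W \<phi> + theta_int \<Theta> B \<Psi>) \<and>
    L2on B h' \<le> ennreal (16 * (1 + 2 * L)\<^sup>2 * (1 + M\<^sup>2)) * (L2on W g + L2on W \<phi> + L2on B \<Psi> + L2on B h)"
proof -
  interpret graph_patch T p r L n G G' by (rule gp)
  have \<rho>': "graph_patch.\<rho> r L = \<rho>" unfolding \<rho> by (simp add: \<rho>_def)
  note rp = rho_pos[unfolded \<rho>'] and rb = rho_ball[unfolded \<rho>'] and rl = rho_le(2)[unfolded \<rho>']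
  note [measurable] = weak_gradD(2,3)[OF w] weak_gradD(2,3)[OF w\<phi>]
  have [measurable]: "B \<in> sets borel" "W \<in> sets borel" using B(1) W by auto
  have bW: "below \<subseteq> W" using below_disjoint[OF T(1)] B(2) W by (auto simp: below_def)
  have bb: "bounded below" unfolding below_def by (rule bounded_subset[OF bounded_ball[of p r]]) auto
  have finL1: "L1on below u < \<infinity>" if "u \<in> borel_measurable borel" and "L2on W u < \<infinity>"
    for u :: "real^3 \<Rightarrow> 'b::euclidean_space"
  proof (rule L1on_finite_if_L2on[OF that(1) below_borel bb])
    have "L2on below u \<le> L2on W u" using bW by (intro L2on_mono) auto
    then show "L2on below u < \<infinity>" using that(2) by (rule le_less_trans)
  qed
  define \<psi> where "\<psi> x = \<phi> (fold_down x)" for x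
  define hp where "hp = fold_grad g"
  have wb: "weak_grad below \<phi> g" using weak_grad_subset[OF w\<phi> open_below bW] .
  have wp: "weak_grad (ball p \<rho>) \<psi> hp"
    unfolding \<psi>_def hp_def \<rho>'[symmetric]
    by (rule weak_grad_fold[OF wb finL1 finL1]) (use fin weak_gradD[OF w\<phi>] in auto)
  note [measurable] = weak_gradD(2,3)[OF wp]
  define b where "b x = b0 (x - p)" for x
  define b' where "b' x = Db (x - p)" for x
  have sm: "smooth_expr b"
    using smooth_expr.affine[OF smooth_D[OF b0(1)], of "- p" 1] by (simp add: b_def[abs_def])
  have gb: "GDERIV b x :> b' x" for x
  proof -
    have "((\<lambda>x. b0 (x - p)) has_derivative (\<lambda>h. h \<bullet> Db (x - p))) (at x)"
      by (rule has_derivative_compose[where f="\<lambda>x. x - p" and g=b0])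
        (use b0(2) in \<open>auto simp: gderiv_def intro!: derivative_eq_intros\<close>)
    then show ?thesis by (simp add: gderiv_def b_def[abs_def] b'_def)
  qed
  have cb': "continuous_on UNIV b'" using smooth_gradient_continuous[OF smooth_expr_imp_smooth[OF sm] gb] .
  have cb: "continuous_on UNIV b" using smooth_continuous[OF smooth_expr_imp_smooth[OF sm]] .
  have C1b: "C1_on UNIV b b'" using gb cb' by (simp add: C1_on_def)
  have C1b': "C1_on UNIV (\<lambda>x. 1 - b x) (\<lambda>x. 0 - b' x)"
    unfolding C1_on_def
    by (intro conjI ballI open_UNIV GDERIV_diff[OF GDERIV_const gb] continuous_on_diff continuous_on_const cb')
  have [measurable]: "b \<in> borel_measurable borel" "b' \<in> borel_measurable borel"
    using cb cb' by (auto intro: borel_measurable_continuous_onI)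
  have b01: "0 \<le> b x" "b x \<le> 1" "norm (b' x) \<le> M" for x using b0 by (auto simp: b_def b'_def)
  have b1: "b x = 1" if "x \<in> ball p (\<rho>/4)" for x
    unfolding b_def by (rule b0(5)) (use that in \<open>simp add: dist_norm norm_minus_commute\<close>)
  have bz: "b x = 0" if "x \<notin> ball p (\<rho>/2)" for x
    unfolding b_def by (rule b0(6)) (use that in \<open>simp add: dist_norm norm_minus_commute\<close>)
  have b'1: "b' x = 0" if "x \<in> ball p (\<rho>/4)" for x
  proof -
    have "GDERIV b x :> 0"
      by (subst GDERIV_cong_open[OF open_ball that, of b "\<lambda>_. 1"]) (use b1 in \<open>auto intro: GDERIV_const\<close>)
    then show ?thesis using gb GDERIV_unique by blast
  qed
  have b'z: "b' x = 0" if "x \<notin> cball p (\<rho>/2)" for x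
  proof -
    have "GDERIV b x :> 0"
      by (subst GDERIV_cong_open[of "- cball p (\<rho>/2)" x b "\<lambda>_. 0"]) (use bz that in \<open>auto intro: GDERIV_const\<close>)
    then show ?thesis using gb GDERIV_unique by blast
  qed
  define \<Psi>' where "\<Psi>' x = (if x \<in> ball p \<rho> then b x * \<psi> x + (1 - b x) * \<Psi> x else \<Psi> x)" for x
  define h' where "h' x = (if x \<in> ball p \<rho> then (b x *\<^sub>R hp x + \<psi> x *\<^sub>R b' x) + ((1 - b x) *\<^sub>R h x + \<Psi> x *\<^sub>R (0 - b' x)) else h x)" for x
  have [measurable]: "\<Psi>' \<in> borel_measurable borel" "h' \<in> borel_measurable borel"
    unfolding \<Psi>'_def h'_def by measurable
  have wg: "weak_grad (B - (Z - ball p (\<rho>/4))) \<Psi>' h'"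
  proof (rule weak_grad_local)
    have e: "B - (Z - ball p (\<rho>/4)) = (B - Z) \<union> (B \<inter> ball p (\<rho>/4))" by auto
    show "open (B - (Z - ball p (\<rho>/4)))"
      unfolding e by (intro open_Un open_Diff open_Int open_ball B(1) Z)
    fix x assume x: "x \<in> B - (Z - ball p (\<rho>/4))"
    \<comment> \<open>Close to \<open>p\<close> the cut-off is 1 and only the reflected function
      counts, so points of \<open>Z\<close> do no harm. Elsewhere off \<open>Z\<close> either both
      functions have weak gradients, or the cut-off vanishes and nothing has changed.\<close>
    consider "x \<in> ball p (\<rho>/4)" | "x \<notin> Z" "x \<in> ball p \<rho>" | "x \<notin> Z" "x \<notin> cball p (\<rho>/2)"
      using x rp by force
    then show "\<exists>V. x \<in> V \<and> weak_grad V \<Psi>' h'"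
    proof cases
      case 1
      have sub: "ball p (\<rho>/4) \<subseteq> ball p \<rho>" using rp by auto
      have "weak_grad (ball p (\<rho>/4)) \<Psi>' h'"
      proof (rule weak_grad_cong_AE[OF weak_grad_subset[OF wp open_ball sub]])
        show "AE x in lborel. x \<in> ball p (\<rho>/4) \<longrightarrow> \<psi> x = \<Psi>' x \<and> hp x = h' x"
          using b1 b'1 sub by (intro AE_I2) (auto simp: \<Psi>'_def h'_def)
      qed measurable
      then show ?thesis using 1 by blast
    next
      case 2
      let ?V = "ball p \<rho> - Z"
      have V: "open ?V" "?V \<subseteq> ball p \<rho>" "?V \<subseteq> B - Z" using Z B(2) rb by (auto simp: open_Diff)
      have "weak_grad ?V (\<lambda>x. b x * \<psi> x + (1 - b x) * \<Psi> x)
         (\<lambda>x. (b x *\<^sub>R hp x + \<psi> x *\<^sub>R b' x) + ((1 - b x) *\<^sub>R h x + \<Psi> x *\<^sub>R (0 - b' x)))"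
        by (intro weak_grad_add weak_grad_mult C1b C1b' weak_grad_subset[OF wp V(1,2)] weak_grad_subset[OF w V(1,3)])
      then have "weak_grad ?V \<Psi>' h'"
        by (rule weak_grad_cong_AE) (auto simp: \<Psi>'_def h'_def)
      then show ?thesis using 2 by blast
    next
      case 3
      let ?V = "B - Z - cball p (\<rho>/2)"
      have V: "open ?V" "?V \<subseteq> B - Z" using Z B(1) by (auto simp: open_Diff)
      have bz': "b y = 0" "b' y = 0" if "y \<in> ?V" for y using bz[of y] b'z[of y] that by auto
      have "weak_grad ?V \<Psi>' h'"
      proof (rule weak_grad_cong_AE[OF weak_grad_subset[OF w V]])
        show "AE x in lborel. x \<in> ?V \<longrightarrow> \<Psi> x = \<Psi>' x \<and> h x = h' x"
          using bz' by (intro AE_I2) (simp add: \<Psi>'_def h'_def)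
      qed measurable
      moreover have "x \<in> ?V" using 3 x by auto
      ultimately show ?thesis by (intro exI[of _ ?V] conjI)
    qed
  qed measurable
  have eq': "\<Psi>' x = \<phi> x" if x: "x \<in> W" for x
  proof (cases "x \<in> ball p \<rho>")
    case True
    have "x \<notin> T" using x W closure_subset by auto
    then have "fold_down x = x" using fold_down_id rb[OF True] by blast
    then show ?thesis using eq[OF x] True by (simp add: \<Psi>'_def \<psi>_def algebra_simps)
  next
    case False
    then show ?thesis using eq[OF x] by (simp add: \<Psi>'_def)
  qed
  have th: "theta_int \<Theta> B \<Psi>' \<le> 2 * theta_int \<Theta> W \<phi> + theta_int \<Theta> B \<Psi>" if ad: "admissible \<Theta>" for \<Theta>
  proof -
    have [measurable]: "\<Theta> \<in> borel_measurable borel" and mono: "\<And>s t. 0 \<le> s \<Longrightarrow> s \<le> t \<Longrightarrow> \<Theta> s \<le> \<Theta> t"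
      using ad by (auto simp: admissible_def)
    have "theta_int \<Theta> B \<Psi>' \<le> (\<integral>\<^sup>+x. \<Theta> \<bar>\<phi> (fold_down x)\<bar> * indicator (ball p \<rho>) x + \<Theta> \<bar>\<Psi> x\<bar> * indicator B x \<partial>lborel)"
      unfolding theta_int_def
    proof (rule nn_integral_mono)
      fix x
      show "\<Theta> \<bar>\<Psi>' x\<bar> * indicator B x \<le> \<Theta> \<bar>\<phi> (fold_down x)\<bar> * indicator (ball p \<rho>) x + \<Theta> \<bar>\<Psi> x\<bar> * indicator B x"
      proof (cases "x \<in> B")
        case xB: True
        show ?thesis
        proof (cases "x \<in> ball p \<rho>")
          case True
          \<comment> \<open>A convex combination is at most the larger of the two values; the
            estimate for \<Theta> then rests on monotonicity.\<close>
          let ?m = "max \<bar>\<psi> x\<bar> \<bar>\<Psi> x\<bar>"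
          have "\<bar>\<Psi>' x\<bar> \<le> b x * \<bar>\<psi> x\<bar> + (1 - b x) * \<bar>\<Psi> x\<bar>"
            using True b01[of x] abs_triangle_ineq[of "b x * \<psi> x" "(1 - b x) * \<Psi> x"] by (simp add: \<Psi>'_def abs_mult)
          also have "\<dots> \<le> b x * ?m + (1 - b x) * ?m" using b01[of x] by (intro add_mono mult_left_mono) auto
          also have "\<dots> = ?m" by (simp add: algebra_simps)
          finally have "\<Theta> \<bar>\<Psi>' x\<bar> \<le> \<Theta> ?m" by (intro mono) auto
          also have "\<dots> \<le> \<Theta> \<bar>\<psi> x\<bar> + \<Theta> \<bar>\<Psi> x\<bar>" by (simp add: max_def add_increasing add_increasing2)
          finally show ?thesis using True xB by (simp add: \<psi>_def)
        next
          case False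
          then show ?thesis using xB by (simp add: \<Psi>'_def)
        qed
      qed simp
    qed
    also have "\<dots> = (\<integral>\<^sup>+x. \<Theta> \<bar>\<phi> (fold_down x)\<bar> * indicator (ball p \<rho>) x \<partial>lborel) + theta_int \<Theta> B \<Psi>"
      unfolding theta_int_def by (rule nn_integral_add) measurable
    also have "(\<integral>\<^sup>+x. \<Theta> \<bar>\<phi> (fold_down x)\<bar> * indicator (ball p \<rho>) x \<partial>lborel) \<le> 2 * (\<integral>\<^sup>+x. \<Theta> \<bar>\<phi> x\<bar> * indicator below x \<partial>lborel)"
      unfolding \<rho>'[symmetric] by (rule nn_integral_fold_le[of "\<lambda>x. \<Theta> \<bar>\<phi> x\<bar>"]) measurable
    also have "(\<integral>\<^sup>+x. \<Theta> \<bar>\<phi> x\<bar> * indicator below x \<partial>lborel) \<le> theta_int \<Theta> W \<phi>"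
      unfolding theta_int_def using bW by (intro nn_integral_mono) (auto simp: indicator_def)
    finally show ?thesis by (simp add: mult_left_mono add_right_mono)
  qed
  have "L2on B h' \<le> ennreal (16 * (1 + 2 * L)\<^sup>2 * (1 + M\<^sup>2)) * (L2on W g + L2on W \<phi> + L2on B \<Psi> + L2on B h)"
  proof -
    let ?Bp = "ball p \<rho>"
    have BpB: "?Bp \<subseteq> B" using B(2) rb by auto
    define f1 where "f1 x = norm (indicator ?Bp x *\<^sub>R hp x) + norm (h x)" for x
    define f2 where "f2 x = M * \<bar>indicator ?Bp x * \<psi> x\<bar> + M * \<bar>\<Psi> x\<bar>" for x
    have [measurable]: "f1 \<in> borel_measurable borel" "f2 \<in> borel_measurable borel" unfolding f1_def f2_def by measurable
    have "norm (h' x) \<le> norm (f1 x) + norm (f2 x)" for x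
    proof (cases "x \<in> ?Bp")
      case True
      have mb: "\<bar>a\<bar> * norm (b' x) \<le> M * \<bar>a\<bar>" for a
        using mult_right_mono[OF b01(3)[of x], of "\<bar>a\<bar>"] by (simp add: mult.commute)
      have "norm (h' x) \<le> norm (b x *\<^sub>R hp x) + norm (\<psi> x *\<^sub>R b' x) + (norm ((1 - b x) *\<^sub>R h x) + norm (\<Psi> x *\<^sub>R (0 - b' x)))"
        unfolding h'_def if_P[OF True]
        by (rule norm_triangle_mono[OF norm_triangle_ineq norm_triangle_ineq])
      also have "norm (b x *\<^sub>R hp x) \<le> norm (hp x)" using b01[of x] by (simp add: mult_left_le_one_le)
      also have "norm (\<psi> x *\<^sub>R b' x) \<le> M * \<bar>\<psi> x\<bar>" using mb[of "\<psi> x"] by simp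
      also have "norm ((1 - b x) *\<^sub>R h x) \<le> norm (h x)" using b01[of x] by (simp add: mult_left_le_one_le)
      also have "norm (\<Psi> x *\<^sub>R (0 - b' x)) \<le> M * \<bar>\<Psi> x\<bar>" using mb[of "\<Psi> x"] by simp
      finally have "norm (h' x) \<le> norm (hp x) + M * \<bar>\<psi> x\<bar> + (norm (h x) + M * \<bar>\<Psi> x\<bar>)" by simp
      moreover have "norm (f1 x) = norm (hp x) + norm (h x)" "norm (f2 x) = M * \<bar>\<psi> x\<bar> + M * \<bar>\<Psi> x\<bar>"
        using True b0(8) by (simp_all add: f1_def f2_def)
      ultimately show ?thesis by linarith
    next
      case False
      then show ?thesis using b0(8) by (simp add: h'_def f1_def f2_def)
    qed
    then have "L2on B h' \<le> 2 * L2on B f1 + 2 * L2on B f2" by (intro L2on_triangle) auto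
    also have "L2on B f1 \<le> 2 * L2on B (\<lambda>x. indicator ?Bp x *\<^sub>R hp x) + 2 * L2on B h"
      by (rule L2on_triangle) (auto simp: f1_def)
    also have "L2on B (\<lambda>x. indicator ?Bp x *\<^sub>R hp x) = L2on ?Bp hp"
      unfolding L2on_def using BpB by (intro nn_integral_cong) (auto simp: indicator_def)
    also have "L2on ?Bp hp \<le> ennreal (2 * (1 + 2 * L)\<^sup>2) * L2on below g"
      unfolding hp_def \<rho>'[symmetric] by (rule L2on_fold_grad_le) measurable
    also have "L2on below g \<le> L2on W g" using bW by (intro L2on_mono) auto
    also have "L2on B f2 \<le> 2 * L2on B (\<lambda>x. M *\<^sub>R (indicator ?Bp x * \<psi> x)) + 2 * L2on B (\<lambda>x. M *\<^sub>R \<Psi> x)"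
      by (rule L2on_triangle) (use b0(8) in \<open>auto simp: f2_def abs_mult\<close>)
    also have "L2on B (\<lambda>x. M *\<^sub>R (indicator ?Bp x * \<psi> x)) = ennreal (M\<^sup>2) * L2on B (\<lambda>x. indicator ?Bp x * \<psi> x)"
      by (rule L2on_cmult) measurable
    also have "L2on B (\<lambda>x. M *\<^sub>R \<Psi> x) = ennreal (M\<^sup>2) * L2on B \<Psi>"
      by (rule L2on_cmult) measurable
    also have "L2on B (\<lambda>x. indicator ?Bp x * \<psi> x) = L2on ?Bp \<psi>"
      unfolding L2on_def using BpB by (intro nn_integral_cong) (auto simp: indicator_def)
    also have "L2on ?Bp \<psi> \<le> 2 * L2on below \<phi>"
      unfolding L2on_def \<psi>_def \<rho>'[symmetric] by (rule nn_integral_fold_le[of "\<lambda>x. ennreal ((norm (\<phi> x))\<^sup>2)"]) measurable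
    also have "L2on below \<phi> \<le> L2on W \<phi>" using bW by (intro L2on_mono) auto
    finally have main: "L2on B h' \<le> 2 * (2 * (ennreal (2 * (1 + 2 * L)\<^sup>2) * L2on W g) + 2 * L2on B h) +
        2 * (2 * (ennreal (M\<^sup>2) * (2 * L2on W \<phi>)) + 2 * (ennreal (M\<^sup>2) * L2on B \<Psi>))"
      by (simp add: mult_left_mono add_mono)
    \<comment> \<open>Majorises the four coefficients 8 (1 + 2 L)^2, 4, 8 M^2 and 4 M^2 at once,
      since both factors of the product are at least 1.\<close>
    define c where "c = 16 * (1 + 2 * L)\<^sup>2 * (1 + M\<^sup>2)"
    have l1: "1 \<le> (1 + 2 * L)\<^sup>2" using L1 by (intro one_le_power) simp
    have m1: "(1::real) \<le> 1 + M\<^sup>2" by simp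
    have p1: "1 * 1 \<le> (1 + 2 * L)\<^sup>2 * (1 + M\<^sup>2)" "(1 + 2 * L)\<^sup>2 * 1 \<le> (1 + 2 * L)\<^sup>2 * (1 + M\<^sup>2)" "1 * (1 + M\<^sup>2) \<le> (1 + 2 * L)\<^sup>2 * (1 + M\<^sup>2)"
      using l1 m1 by (intro mult_mono; simp)+
    have c: "8 * (1 + 2 * L)\<^sup>2 \<le> c" "4 \<le> c" "8 * M\<^sup>2 \<le> c" "4 * M\<^sup>2 \<le> c" "0 \<le> c"
    proof -
      define Q where "Q = (1 + 2 * L)\<^sup>2 * (1 + M\<^sup>2)"
      define l where "l = (1 + 2 * L)\<^sup>2"
      define k where "k = M\<^sup>2"
      have cQ: "c = 16 * Q" unfolding c_def Q_def by simp
      have "1 \<le> Q" "l \<le> Q" "1 + k \<le> Q" using p1 unfolding Q_def l_def k_def by simp_all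
      moreover have "0 \<le> k" unfolding k_def by simp
      ultimately show "8 * (1 + 2 * L)\<^sup>2 \<le> c" "4 \<le> c" "8 * M\<^sup>2 \<le> c" "4 * M\<^sup>2 \<le> c" "0 \<le> c"
        unfolding cQ l_def[symmetric] k_def[symmetric] by linarith+
    qed
    have "2 * (2 * (ennreal (2 * (1 + 2 * L)\<^sup>2) * L2on W g) + 2 * L2on B h) +
        2 * (2 * (ennreal (M\<^sup>2) * (2 * L2on W \<phi>)) + 2 * (ennreal (M\<^sup>2) * L2on B \<Psi>)) =
      ennreal (8 * (1 + 2 * L)\<^sup>2) * L2on W g + ennreal 4 * L2on B h + ennreal (8 * M\<^sup>2) * L2on W \<phi> + ennreal (4 * M\<^sup>2) * L2on B \<Psi>"
    proof -
      have "2 * (2 * (ennreal (2 * a) * X1) + 2 * X2) + 2 * (2 * (ennreal b * (2 * X3)) + 2 * (ennreal b * X4)) =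
        ennreal (8 * a) * X1 + ennreal 4 * X2 + ennreal (8 * b) * X3 + ennreal (4 * b) * X4"
        if "0 \<le> a" "0 \<le> b" for a b X1 X2 X3 X4
      proof -
        have e: "ennreal (2 * a) = 2 * ennreal a" "ennreal (8 * a) = 8 * ennreal a" "ennreal (8 * b) = 8 * ennreal b"
          "ennreal (4 * b) = 4 * ennreal b" "ennreal 4 = 4" using that by (simp_all add: ennreal_mult)
        have l: "ennreal b * (2 * X3) = 2 * (ennreal b * X3)" by (rule mult.left_commute)
        show ?thesis unfolding e l by (simp add: distrib_left mult.assoc add.assoc)
      qed
      from this[of "(1 + 2 * L)\<^sup>2" "M\<^sup>2"] show ?thesis by simp
    qed
    also have "\<dots> \<le> ennreal c * L2on W g + ennreal c * L2on B h + ennreal c * L2on W \<phi> + ennreal c * L2on B \<Psi>"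
      using c by (intro add_mono mult_right_mono ennreal_leI) auto
    also have "\<dots> = ennreal c * (L2on W g + L2on W \<phi> + L2on B \<Psi> + L2on B h)"
      by (simp add: distrib_left ac_simps)
    finally show ?thesis using main unfolding c_def by (rule order_trans[rotated])
  qed
  then show ?thesis using wg eq' th by blast
qed

text \<open>The recursion behind \<open>patched_extension\<close>. In units of the squared W^{1,2}
  norm of \<phi>, after k patches the extension itself is bounded by 2 k + 1 and its gradient by
  \<open>step_const c k\<close>; the summand 2 covers the data.\<close>

primrec step_const :: "real \<Rightarrow> nat \<Rightarrow> real" where
  "step_const c 0 = 1"
| "step_const c (Suc k) = c * (2 + (2 * real k + 1) + step_const c k)"

lemma step_const_mono: "1 \<le> c \<Longrightarrow> j \<le> k \<Longrightarrow> 1 \<le> step_const c j \<and> step_const c j \<le> step_const c k"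
proof -
  assume c: "1 \<le> c"
  have ge1: "1 \<le> step_const c k" for k
  proof (induction k)
    case (Suc k)
    have "1 * 1 \<le> c * (2 + (2 * real k + 1) + step_const c k)" using c Suc by (intro mult_mono) auto
    then show ?case by simp
  qed simp
  have st: "step_const c k \<le> step_const c (Suc k)" for k
  proof -
    have "1 * step_const c k \<le> c * (2 + (2 * real k + 1) + step_const c k)" using c ge1[of k] by (intro mult_mono) auto
    then show ?thesis by simp
  qed
  assume "j \<le> k"
  then show ?thesis using ge1 lift_Suc_mono_le[of "step_const c", OF st] by auto
qed

text \<open>The start is extension by 0, weakly differentiable off the whole boundary; each patch
  removes one ball from this singular set. Every patch reflects the original \<phi> and not the
  extension reached so far, so the \<Theta>-integrals grow by a summand 2 per patch and not by a
  factor.\<close>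

lemma patched_extension:
  fixes \<phi> b0 :: "real^3 \<Rightarrow> real" and Db :: "real^3 \<Rightarrow> real^3"
  assumes T: "open T" and B: "open B" "closure T \<subseteq> B" and W: "W = B - closure T"
    and w\<phi>: "weak_grad W \<phi> g" and fin: "L2on W \<phi> < \<infinity>" "L2on W g < \<infinity>"
    and \<rho>: "\<rho> = r / (4 * (1 + 2 * L))" and L: "1 \<le> L"
    and b0: "smooth b0" "\<And>x. GDERIV b0 x :> Db x" "\<And>x. 0 \<le> b0 x" "\<And>x. b0 x \<le> 1"
      "\<And>x. x \<in> cball 0 (\<rho>/4) \<Longrightarrow> b0 x = 1" "\<And>x. x \<notin> ball 0 (\<rho>/2) \<Longrightarrow> b0 x = 0" "\<And>x. norm (Db x) \<le> M" "0 \<le> M"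
    and c: "c = 16 * (1 + 2 * L)\<^sup>2 * (1 + M\<^sup>2)"
    and P: "finite P" "P \<subseteq> frontier T" "\<And>p. p \<in> P \<Longrightarrow> \<exists>n G G'. graph_patch T p r L n G G'" "\<And>p. p \<in> P \<Longrightarrow> ball p r \<subseteq> B"
  shows "\<exists>\<Psi> h. weak_grad (B - (frontier T - (\<Union>p\<in>P. ball p (\<rho>/4)))) \<Psi> h \<and> (\<forall>x\<in>W. \<Psi> x = \<phi> x) \<and>
    (\<forall>\<Theta>. admissible \<Theta> \<longrightarrow> theta_int \<Theta> B \<Psi> \<le> of_nat (2 * card P + 1) * theta_int \<Theta> W \<phi>) \<and>
    L2on B h \<le> ennreal (step_const c (card P)) * (L2on W g + L2on W \<phi>)"
  using P
proof (induction P rule: finite_induct)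
  case empty
  have [measurable]: "B \<in> sets borel" "W \<in> sets borel" using B(1) W by auto
  note [measurable] = weak_gradD(2,3)[OF w\<phi>]
  define \<Psi> where "\<Psi> x = (if x \<in> W then \<phi> x else 0)" for x
  define h where "h x = (if x \<in> W then g x else 0)" for x
  have [measurable]: "\<Psi> \<in> borel_measurable borel" "h \<in> borel_measurable borel" unfolding \<Psi>_def h_def by measurable
  have "weak_grad (B - frontier T) \<Psi> h"
  proof (rule weak_grad_local)
    show "open (B - frontier T)" using B(1) by (intro open_Diff) auto
    fix x assume x: "x \<in> B - frontier T"
    show "\<exists>V. x \<in> V \<and> weak_grad V \<Psi> h"
    proof (cases "x \<in> T")
      case True
      have TW: "T \<inter> W = {}" using W closure_subset by auto
      have "weak_grad T \<Psi> h"
        by (rule weak_grad_cong_AE[OF weak_grad_const[OF T, of 0]]) (use TW in \<open>auto simp: \<Psi>_def h_def\<close>)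
      then show ?thesis using True by blast
    next
      case False
      then have "x \<notin> closure T" using x T by (auto simp: frontier_def interior_open)
      then have "x \<in> W" using x W by auto
      moreover have "weak_grad W \<Psi> h"
        by (rule weak_grad_cong_AE[OF w\<phi>]) (auto simp: \<Psi>_def h_def)
      ultimately show ?thesis by blast
    qed
  qed measurable
  moreover have "theta_int \<Theta> B \<Psi> \<le> of_nat (2 * card ({} :: (real^3) set) + 1) * theta_int \<Theta> W \<phi>" if "admissible \<Theta>" for \<Theta>
    unfolding theta_int_def using that by (auto intro!: nn_integral_mono simp: admissible_def \<Psi>_def indicator_def)
  moreover have "L2on B h \<le> ennreal (step_const c (card ({} :: (real^3) set))) * (L2on W g + L2on W \<phi>)"
  proof -
    have "L2on B h \<le> L2on W g" unfolding L2on_def h_def by (intro nn_integral_mono) (auto simp: indicator_def)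
    also have "\<dots> \<le> L2on W g + L2on W \<phi>" by simp
    finally show ?thesis by simp
  qed
  moreover have "\<forall>x\<in>W. \<Psi> x = \<phi> x" by (simp add: \<Psi>_def)
  ultimately show ?case by (intro exI[of _ \<Psi>] exI[of _ h]) simp
next
  case (insert p P)
  let ?Z = "frontier T - (\<Union>p\<in>P. ball p (\<rho>/4))"
  have "\<exists>\<Psi> h. weak_grad (B - ?Z) \<Psi> h \<and> (\<forall>x\<in>W. \<Psi> x = \<phi> x) \<and>
    (\<forall>\<Theta>. admissible \<Theta> \<longrightarrow> theta_int \<Theta> B \<Psi> \<le> of_nat (2 * card P + 1) * theta_int \<Theta> W \<phi>) \<and>
    L2on B h \<le> ennreal (step_const c (card P)) * (L2on W g + L2on W \<phi>)"
    by (rule insert.IH) (use insert.prems in auto)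
  then obtain \<Psi> h where IH: "weak_grad (B - ?Z) \<Psi> h" "\<forall>x\<in>W. \<Psi> x = \<phi> x"
    "\<And>\<Theta>. admissible \<Theta> \<Longrightarrow> theta_int \<Theta> B \<Psi> \<le> of_nat (2 * card P + 1) * theta_int \<Theta> W \<phi>"
    "L2on B h \<le> ennreal (step_const c (card P)) * (L2on W g + L2on W \<phi>)" by blast
  have "p \<in> insert p P" by simp
  from insert.prems(2)[OF this] obtain n G G' where gp: "graph_patch T p r L n G G'" by blast
  have pf: "p \<in> frontier T" and pB: "ball p r \<subseteq> B" using insert.prems by auto
  have Zc: "closed ?Z" by (intro closed_Diff) auto
  obtain \<Psi>' h' where *: "weak_grad (B - (?Z - ball p (\<rho>/4))) \<Psi>' h'" "\<forall>x\<in>W. \<Psi>' x = \<phi> x"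
    "\<And>\<Theta>. admissible \<Theta> \<Longrightarrow> theta_int \<Theta> B \<Psi>' \<le> 2 * theta_int \<Theta> W \<phi> + theta_int \<Theta> B \<Psi>"
    "L2on B h' \<le> ennreal c * (L2on W g + L2on W \<phi> + L2on B \<Psi> + L2on B h)"
    using patch_step[OF gp T pf B(1) pB Zc W IH(1) bspec[OF IH(2)] w\<phi> fin \<rho> b0] unfolding c[symmetric] by blast
  have cP: "card (insert p P) = Suc (card P)" using insert.hyps by simp
  have Zeq: "?Z - ball p (\<rho>/4) = frontier T - (\<Union>p\<in>insert p P. ball p (\<rho>/4))" by auto
  have c1: "1 \<le> c"
  proof -
    have "1 \<le> (1 + 2 * L)\<^sup>2" using L by (intro one_le_power) simp
    then have "1 * 1 \<le> (1 + 2 * L)\<^sup>2 * (1 + M\<^sup>2)" by (intro mult_mono) auto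
    then show ?thesis unfolding c by linarith
  qed
  let ?A = "L2on W g + L2on W \<phi>"
  have "theta_int \<Theta> B \<Psi>' \<le> of_nat (2 * card (insert p P) + 1) * theta_int \<Theta> W \<phi>" if ad: "admissible \<Theta>" for \<Theta>
  proof -
    have "theta_int \<Theta> B \<Psi>' \<le> 2 * theta_int \<Theta> W \<phi> + of_nat (2 * card P + 1) * theta_int \<Theta> W \<phi>"
      using *(3)[OF ad] IH(3)[OF ad] by (meson add_left_mono order_trans)
    also have "\<dots> = of_nat (2 * card (insert p P) + 1) * theta_int \<Theta> W \<phi>"
    proof -
      have "2 + of_nat (2 * card P + 1) = (of_nat (2 * Suc (card P) + 1) :: ennreal)" by simp
      then show ?thesis unfolding cP by (simp only: distrib_right[symmetric])
    qed
    finally show ?thesis .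
  qed
  moreover have "L2on B h' \<le> ennreal (step_const c (card (insert p P))) * ?A"
  proof -
    have 1: "L2on B \<Psi> \<le> ennreal (2 * real (card P) + 1) * ?A"
    proof -
      have "L2on B \<Psi> \<le> of_nat (2 * card P + 1) * L2on W \<phi>"
        using IH(3)[OF admissible_square] by (simp only: theta_int_square)
      also have "\<dots> \<le> of_nat (2 * card P + 1) * ?A" by (intro mult_left_mono) auto
      also have "(of_nat (2 * card P + 1) :: ennreal) = ennreal (2 * real (card P) + 1)"
        by (simp add: ennreal_of_nat_eq_real_of_nat ennreal_plus ennreal_mult)
      finally show ?thesis .
    qed
    have s1: "1 \<le> step_const c (card P)" using step_const_mono[OF c1, of "card P" "card P"] by simp
    have "L2on B h' \<le> ennreal c * (?A + L2on B \<Psi> + L2on B h)" using *(4) by simp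
    also have "\<dots> \<le> ennreal c * (ennreal 2 * ?A + ennreal (2 * real (card P) + 1) * ?A + ennreal (step_const c (card P)) * ?A)"
    proof (intro mult_left_mono add_mono 1 IH(4))
      have "1 * ?A \<le> ennreal 2 * ?A" by (rule mult_right_mono) (auto simp: ennreal_numeral[symmetric] simp del: ennreal_numeral)
      then show "?A \<le> ennreal 2 * ?A" by simp
    qed simp
    also have "\<dots> = ennreal (c * (2 + (2 * real (card P) + 1) + step_const c (card P))) * ?A"
    proof -
      have "ennreal c * (ennreal i * A + ennreal j * A + ennreal k * A) = ennreal (c * (i + j + k)) * A"
        if "0 \<le> i" "0 \<le> j" "0 \<le> k" for i j k A
        using that c1 by (simp add: ennreal_mult ennreal_plus distrib_right distrib_left mult.assoc)
      from this[of 2 "2 * real (card P) + 1" "step_const c (card P)" ?A] show ?thesis using s1 by simp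
    qed
    also have "\<dots> = ennreal (step_const c (card (insert p P))) * ?A" unfolding cP by simp
    finally show ?thesis .
  qed
  ultimately show ?case using *(1,2) unfolding Zeq by blast
qed

section \<open>Mean values and Jensen's inequality\<close>

text \<open>Young's inequality m^(p-1) a \<le> a^p / p + (1 - 1/p) m^p is integrated with a = |f x|,
  where m is the mean of |f|. The left side becomes m^p times the measure, and subtracting the last
  term leaves Jensen's inequality times 1/p.\<close>

lemma jensen_powr_mean:
  fixes f :: "'a::euclidean_space \<Rightarrow> real"
  assumes [measurable]: "f \<in> borel_measurable borel" "S \<in> sets borel"
    and \<mu>: "emeasure lborel S = ennreal \<mu>" "\<mu> > 0" and fin: "L1on S f < \<infinity>" and p: "1 \<le> p"
  shows "ennreal (\<bar>(\<integral>x. indicator S x * f x \<partial>lborel) / \<mu>\<bar> powr p) * ennreal \<mu> \<le>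
    (\<integral>\<^sup>+x. ennreal (\<bar>f x\<bar> powr p) * indicator S x \<partial>lborel)"
proof (cases "(\<integral>\<^sup>+x. ennreal (\<bar>f x\<bar> powr p) * indicator S x \<partial>lborel) = \<infinity>")
  case True
  then show ?thesis by simp
next
  case False
  let ?F = "\<lambda>x. indicator S x * \<bar>f x\<bar> powr p"
  have nn: "(\<integral>\<^sup>+x. ennreal (\<bar>f x\<bar> powr p) * indicator S x \<partial>lborel) = (\<integral>\<^sup>+x. ennreal (?F x) \<partial>lborel)"
    by (intro nn_integral_cong) (auto simp: indicator_def)
  have intF: "integrable lborel ?F"
    by (rule integrableI_bounded) (use False nn in \<open>auto simp: less_top abs_mult\<close>)
  have inta: "integrable lborel (\<lambda>x. indicator S x * \<bar>f x\<bar>)"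
  proof (rule integrableI_bounded)
    have "(\<integral>\<^sup>+x. ennreal (norm (indicator S x * \<bar>f x\<bar>)) \<partial>lborel) = L1on S f"
      unfolding L1on_def by (intro nn_integral_cong) (auto simp: indicator_def)
    then show "(\<integral>\<^sup>+x. ennreal (norm (indicator S x * \<bar>f x\<bar>)) \<partial>lborel) < \<infinity>" using fin by simp
  qed measurable
  have intS: "integrable lborel (indicator S :: 'a \<Rightarrow> real)" using \<mu> by (intro integrable_real_indicator) auto
  have S\<mu>: "(\<integral>x. indicator S x \<partial>lborel) = \<mu>" using \<mu> by (simp add: measure_def)
  define m where "m = (\<integral>x. indicator S x * \<bar>f x\<bar> \<partial>lborel) / \<mu>"
  define I where "I = (\<integral>x. ?F x \<partial>lborel)"
  have I: "(\<integral>\<^sup>+x. ennreal (?F x) \<partial>lborel) = ennreal I" "0 \<le> I"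
    unfolding I_def by (auto intro!: nn_integral_eq_integral intF integral_nonneg_AE)
  have m0: "0 \<le> m" unfolding m_def using \<mu>(2) by (intro divide_nonneg_pos integral_nonneg_AE) auto
  have cm: "\<bar>(\<integral>x. indicator S x * f x \<partial>lborel) / \<mu>\<bar> \<le> m"
  proof -
    have "\<bar>\<integral>x. indicator S x * f x \<partial>lborel\<bar> \<le> (\<integral>x. \<bar>indicator S x * f x\<bar> \<partial>lborel)" by (rule integral_abs_bound)
    also have "\<dots> = (\<integral>x. indicator S x * \<bar>f x\<bar> \<partial>lborel)" by (simp add: abs_mult)
    finally show ?thesis unfolding m_def using \<mu>(2) by (simp add: divide_right_mono)
  qed
  have "m powr p * \<mu> \<le> I"
  proof (cases "m = 0")
    case True
    then show ?thesis using I(2) by simp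
  next
    case False
    then have mp: "m > 0" using m0 by simp
    have young: "m powr (p - 1) * a \<le> (1/p) * a powr p + (1 - 1/p) * m powr p" if "0 \<le> a" for a
    \<comment> \<open>For p = 1 the conjugate exponent would be infinite, so this case is
      separate.\<close>
    proof (cases "p = 1")
      case True
      then show ?thesis using that mp by simp
    next
      case False
      then have p1: "p > 1" using p by simp
      define q where "q = p / (p - 1)"
      have q: "q > 1" "1 / p + 1 / q = 1" "(p - 1) * q = p" using p1 by (auto simp: q_def field_simps)
      have "a * m powr (p - 1) \<le> a powr p / p + (m powr (p - 1)) powr q / q"
        by (rule Youngs_inequality) (use p1 q that in auto)
      also have "(m powr (p - 1)) powr q = m powr p" using q(3) by (simp add: powr_powr)
      also have "m powr p / q = (1 / q) * m powr p" by simp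
      also have "1 / q = 1 - 1/p" using q(2) by linarith
      finally show ?thesis by (simp add: mult.commute)
    qed
    have "(\<integral>x. m powr (p - 1) * (indicator S x * \<bar>f x\<bar>) \<partial>lborel) \<le>
      (\<integral>x. (1/p) * ?F x + ((1 - 1/p) * m powr p) * indicator S x \<partial>lborel)"
    proof (rule integral_mono)
      fix x
      show "m powr (p - 1) * (indicator S x * \<bar>f x\<bar>) \<le> (1/p) * ?F x + ((1 - 1/p) * m powr p) * indicator S x"
        using young[of "\<bar>f x\<bar>"] by (simp add: indicator_def)
    qed (use intF inta intS in auto)
    also have "\<dots> = (1/p) * I + ((1 - 1/p) * m powr p) * \<mu>"
      unfolding I_def using intF intS S\<mu> by simp
    also have "(\<integral>x. m powr (p - 1) * (indicator S x * \<bar>f x\<bar>) \<partial>lborel) = m powr (p - 1) * (m * \<mu>)"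
      using \<mu>(2) by (simp add: m_def)
    also have "\<dots> = m powr p * \<mu>" using mp by (simp add: powr_diff)
    finally have "(1/p) * (m powr p * \<mu>) \<le> (1/p) * I" by (simp add: algebra_simps)
    then show ?thesis using p by (simp add: divide_le_cancel)
  qed
  moreover have "\<bar>(\<integral>x. indicator S x * f x \<partial>lborel) / \<mu>\<bar> powr p \<le> m powr p"
    using cm p by (intro powr_mono2) auto
  ultimately have "\<bar>(\<integral>x. indicator S x * f x \<partial>lborel) / \<mu>\<bar> powr p * \<mu> \<le> I"
    using \<mu>(2) mult_right_mono[of _ "m powr p" \<mu>] by (meson less_imp_le order_trans)
  then show ?thesis using \<mu>(2) unfolding nn I(1) by (simp add: ennreal_leI flip: ennreal_mult)
qed

text \<open>For each x, f x minus the mean is the mean over y of f x - f y. Jensen with exponent 2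
  bounds its square, and integration over x gives the double integral.\<close>

lemma L2on_minus_mean_le:
  fixes f :: "'a::euclidean_space \<Rightarrow> real"
  assumes [measurable]: "f \<in> borel_measurable borel" "S \<in> sets borel"
    and \<mu>: "emeasure lborel S = ennreal \<mu>" "\<mu> > 0" and fin: "L1on S f < \<infinity>"
  shows "ennreal \<mu> * L2on S (\<lambda>x. f x - (\<integral>x. indicator S x * f x \<partial>lborel) / \<mu>) \<le> osc2 S S f"
proof -
  let ?c = "(\<integral>x. indicator S x * f x \<partial>lborel) / \<mu>"
  have intf: "integrable lborel (\<lambda>x. indicator S x * f x)"
  proof (rule integrableI_bounded)
    have "(\<integral>\<^sup>+x. ennreal (norm (indicator S x * f x)) \<partial>lborel) = L1on S f"
      unfolding L1on_def by (intro nn_integral_cong) (auto simp: indicator_def)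
    then show "(\<integral>\<^sup>+x. ennreal (norm (indicator S x * f x)) \<partial>lborel) < \<infinity>" using fin by simp
  qed measurable
  have intS: "integrable lborel (indicator S :: 'a \<Rightarrow> real)" using \<mu> by (intro integrable_real_indicator) auto
  have S\<mu>: "(\<integral>x. indicator S x \<partial>lborel) = \<mu>" using \<mu> by (simp add: measure_def)
  have finc: "L1on S (\<lambda>y. f x - f y) < \<infinity>" for x
  proof -
    have "L1on S (\<lambda>y. f x - f y) \<le> L1on S (\<lambda>y. f x) + L1on S f" by (rule L1on_triangle) (auto intro: norm_triangle_ineq4)
    also have "L1on S (\<lambda>y. f x) = ennreal \<bar>f x\<bar> * ennreal \<mu>"
      unfolding L1on_def using \<mu> by (simp add: nn_integral_cmult_indicator)
    also have "ennreal \<bar>f x\<bar> * ennreal \<mu> + L1on S f < \<infinity>" using fin by (simp add: ennreal_mult_less_top)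
    finally show ?thesis .
  qed
  have pt: "ennreal ((f x - ?c)\<^sup>2) * ennreal \<mu> \<le> (\<integral>\<^sup>+y. ennreal ((f x - f y)\<^sup>2) * indicator S y \<partial>lborel)" for x
  proof -
    have "(\<integral>y. indicator S y * (f x - f y) \<partial>lborel) = (\<integral>y. f x * indicator S y - indicator S y * f y \<partial>lborel)"
      by (intro Bochner_Integration.integral_cong) (auto simp: algebra_simps)
    also have "\<dots> = f x * \<mu> - (\<integral>y. indicator S y * f y \<partial>lborel)"
      using intf intS S\<mu> by simp
    finally have "(\<integral>y. indicator S y * (f x - f y) \<partial>lborel) / \<mu> = f x - ?c"
      using \<mu>(2) by (simp add: diff_divide_distrib)
    then have "ennreal (\<bar>f x - ?c\<bar> powr 2) * ennreal \<mu> \<le> (\<integral>\<^sup>+y. ennreal (\<bar>f x - f y\<bar> powr 2) * indicator S y \<partial>lborel)"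
      using jensen_powr_mean[OF _ assms(2) \<mu> finc, of x 2] by simp
    then show ?thesis by simp
  qed
  have "ennreal \<mu> * L2on S (\<lambda>x. f x - ?c) = (\<integral>\<^sup>+x. (ennreal ((f x - ?c)\<^sup>2) * ennreal \<mu>) * indicator S x \<partial>lborel)"
    unfolding L2on_def by (subst nn_integral_cmult[symmetric]) (auto intro!: nn_integral_cong simp: ac_simps)
  also have "\<dots> \<le> (\<integral>\<^sup>+x. (\<integral>\<^sup>+y. ennreal ((f x - f y)\<^sup>2) * indicator S y \<partial>lborel) * indicator S x \<partial>lborel)"
    by (intro nn_integral_mono mult_right_mono pt) simp
  also have "\<dots> = osc2 S S f"
    unfolding osc2_def
    by (intro nn_integral_cong, subst nn_integral_multc[symmetric]) (auto intro!: nn_integral_cong simp: ac_simps)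
  finally show ?thesis .
qed

definition vol3 :: "real \<Rightarrow> real" where "vol3 s = measure lborel (ball (0::real^3) s)"

lemma emeasure_ball_vol3: "emeasure lborel (ball (c::real^3) s) = ennreal (vol3 s)"
proof -
  have "emeasure lborel (ball c s) = (\<integral>\<^sup>+x. indicator (ball c s) x \<partial>lborel)" by simp
  also have "\<dots> = (\<integral>\<^sup>+x. indicator (ball c s) (x + c) \<partial>lborel)" by (rule nn_integral_translate[symmetric]) measurable
  also have "\<dots> = (\<integral>\<^sup>+x. indicator (ball (0::real^3) s) x \<partial>lborel)"
    by (intro nn_integral_cong) (simp add: indicator_def dist_norm)
  also have "\<dots> = emeasure lborel (ball (0::real^3) s)" by simp
  also have "\<dots> = ennreal (vol3 s)"
    unfolding vol3_def by (rule emeasure_eq_ennreal_measure) (use emeasure_lborel_ball_finite[of "0::real^3" s] in auto)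
  finally show ?thesis .
qed

lemma vol3_pos: "0 < s \<Longrightarrow> 0 < vol3 s"
  unfolding vol3_def using content_ball_pos[of s "0::real^3"] by simp

section \<open>Uniform Poincare inequality on the shell around a hole\<close>

context graph_patch
begin

text \<open>At the centre G = -t, and with Lipschitz constant L it rises by at most t/2 within the
  given radius. This is the source of the uniform lower volume bound for the shell near the
  hole.\<close>

lemma ball_in_below:
  assumes t: "0 < t" "t \<le> r / 4"
  shows "ball (p - t *\<^sub>R n) (t / (2 * L)) \<subseteq> below \<inter> ball p (2 * t)"
proof
  fix x assume x: "x \<in> ball (p - t *\<^sub>R n) (t / (2 * L))"
  let ?c = "p - t *\<^sub>R n"
  have tl: "t / (2 * L) \<le> t / 2" using t L1 by (intro divide_left_mono) auto
  have pc: "dist p ?c = t" using norm_n t by (simp add: dist_norm)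
  have "dist p x \<le> dist p ?c + dist ?c x" by (rule dist_triangle)
  then have px: "dist p x < 2 * t" using pc x tl t by simp
  have cr: "?c \<in> ball p r" "x \<in> ball p r" using pc px t by auto
  have e: "p + (- t) *\<^sub>R n = ?c" by simp
  have "G ?c = - t" using G_shift[of p "- t"] cr(1) r_pos G_p unfolding e by simp
  moreover have "G x - G ?c \<le> L * norm (x - ?c)" using G_lipschitz[OF cr(2,1)] by simp
  moreover have "L * norm (x - ?c) \<le> L * (t / (2 * L))"
    using x L1 by (intro mult_left_mono) (auto simp: dist_norm norm_minus_commute)
  moreover have "L * (t / (2 * L)) = t / 2" using L1 by simp
  ultimately have "G x < 0" using t by linarith
  then show "x \<in> below \<inter> ball p (2 * t)" using cr px by (simp add: below_def)
qed

text \<open>The part of a ball outside T need not be convex, but there \<phi> coincides with its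
  composition with \<open>fold_down\<close>, which has a weak gradient on a full ball about p. The
  convex Poincare inequality on a smaller ball, restricted to S, gives the estimate.\<close>

lemma patch_osc2_le:
  assumes w: "weak_grad W2 \<phi> g" and sub: "below \<subseteq> W2" and fin: "L2on W2 \<phi> < \<infinity>" "L2on W2 g < \<infinity>"
    and q: "0 < q" "2 * q < \<rho>" "dist z p \<le> q" and S: "S \<subseteq> cball z q" "S \<inter> T = {}"
  shows "osc2 S S \<phi> \<le> ennreal ((4 * q)\<^sup>2) * emeasure lborel (cball (0::real^3) (4 * q)) * (ennreal (2 * (1 + 2 * L)\<^sup>2) * L2on W2 g)"
proof -
  have bb: "bounded below" unfolding below_def by (rule bounded_subset[OF bounded_ball[of p r]]) auto
  have w2: "L2on below \<phi> \<le> L2on W2 \<phi>" "L2on below g \<le> L2on W2 g" using sub by (auto intro!: L2on_mono)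
  have "weak_grad (ball p \<rho>) (\<lambda>x. \<phi> (fold_down x)) (fold_grad g)"
  proof (rule weak_grad_fold[OF weak_grad_subset[OF w open_below sub]])
    show "L1on below \<phi> < \<infinity>"
      by (rule L1on_finite_if_L2on[OF weak_gradD(2)[OF w] below_borel bb]) (use w2 fin in \<open>auto intro: le_less_trans\<close>)
    show "L1on below g < \<infinity>"
      by (rule L1on_finite_if_L2on[OF weak_gradD(3)[OF w] below_borel bb]) (use w2 fin in \<open>auto intro: le_less_trans\<close>)
  qed
  then have "osc2 (cball p (2 * q)) (cball p (2 * q)) (\<lambda>x. \<phi> (fold_down x)) \<le>
    ennreal ((4 * q)\<^sup>2) * emeasure lborel (cball (0::real^3) (4 * q)) * L2on (ball p \<rho>) (fold_grad g)"
  proof (rule poincare_convex_compact)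
    show "norm (y - x) \<le> 4 * q" if "x \<in> cball p (2 * q)" "y \<in> cball p (2 * q)" for x y
      using that dist_triangle[of y x p] by (simp add: dist_norm norm_minus_commute)
  qed (use q in auto)
  moreover have "osc2 S S \<phi> \<le> osc2 (cball p (2 * q)) (cball p (2 * q)) (\<lambda>x. \<phi> (fold_down x))"
  proof -
    have Sp: "S \<subseteq> cball p (2 * q)"
    proof
      fix x assume "x \<in> S"
      then have "dist z x \<le> q" using S by auto
      then show "x \<in> cball p (2 * q)" using q(3) dist_triangle[of p x z] by (simp add: dist_commute)
    qed
    have "osc2 S S \<phi> = osc2 S S (\<lambda>x. \<phi> (fold_down x))"
    proof (rule osc2_cong)
      fix x assume "x \<in> S \<union> S"
      then have "x \<in> cball p (2 * q)" "x \<notin> T" using Sp S by auto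
      moreover from this have "x \<in> ball p \<rho>" using q by auto
      ultimately show "\<phi> x = \<phi> (fold_down x)" using fold_down_id[OF rho_ball] by simp
    qed
    also have "\<dots> \<le> osc2 (cball p (2 * q)) (cball p (2 * q)) (\<lambda>x. \<phi> (fold_down x))" by (rule osc2_mono[OF Sp Sp])
    finally show ?thesis .
  qed
  moreover have "L2on (ball p \<rho>) (fold_grad g) \<le> ennreal (2 * (1 + 2 * L)\<^sup>2) * L2on W2 g"
    using L2on_fold_grad_le[OF weak_gradD(3)[OF w]] w2(2) by (meson mult_left_mono order_trans zero_le)
  ultimately show ?thesis by (meson mult_left_mono order_trans zero_le)
qed

end

text \<open>Pieces near the hole are handled by \<open>patch_osc2_le\<close>, all others by the
  convex case on balls that may cross radius 3/2 d but not 2 d; hence the gradient is taken over the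
  larger shell. Net size, volume bounds and local constants depend on d, r and L alone, which gives
  uniformity in T.\<close>

lemma hole_poincare:
  fixes d r L :: real
  assumes d: "0 < d" and r: "0 < r" "r \<le> d / 2" and L: "1 \<le> L"
  obtains C :: real where "0 < C" "\<And>T \<phi> g. open T \<Longrightarrow> T \<subseteq> ball 0 d \<Longrightarrow>
    (\<And>p. p \<in> frontier T \<Longrightarrow> \<exists>n G G'. graph_patch T p r L n G G') \<Longrightarrow>
    connected (ball 0 (3/2 * d) - closure T) \<Longrightarrow> weak_grad (ball 0 (2 * d) - closure T) \<phi> g \<Longrightarrow>
    L2on (ball 0 (2 * d) - closure T) \<phi> < \<infinity> \<Longrightarrow> L2on (ball 0 (2 * d) - closure T) g < \<infinity> \<Longrightarrow>
    osc2 (ball 0 (3/2 * d) - closure T) (ball 0 (3/2 * d) - closure T) \<phi>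
      \<le> ennreal C * L2on (ball 0 (2 * d) - closure T) g"
proof -
  define \<rho> where "\<rho> = r / (4 * (1 + 2 * L))"
  note rho_eq = \<rho>_def
  have \<rho>: "0 < \<rho>" "\<rho> \<le> r / 12"
  proof -
    show "0 < \<rho>" using r L by (simp add: \<rho>_def)
    show "\<rho> \<le> r / 12" unfolding \<rho>_def using r L by (intro divide_left_mono) auto
  qed
  \<comment> \<open>\<open>s\<close> is the mesh of the net. The pieces of the chain have radius q =
    3 s, and 2 q = 6 s stays below \<rho> = 8 s, as \<open>patch_osc2_le\<close> demands.\<close>
  define s where "s = \<rho> / 8"
  define q where "q = 3 * s"
  have s: "0 < s" "s \<le> d / 100" "2 * q < \<rho>" "q < d / 2" "0 < q" using \<rho> r d by (auto simp: s_def q_def)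
  \<comment> \<open>The radius that \<open>ball_in_below\<close> delivers for t = s/4.\<close>
  define \<tau> where "\<tau> = s / (8 * L)"
  have \<tau>: "0 < \<tau>" "\<tau> \<le> s / 8" using s L by (auto simp: \<tau>_def field_simps)
  define m where "m = vol3 \<tau>"
  have m: "0 < m" unfolding m_def using vol3_pos \<tau> by simp
  define V where "V = vol3 (3/2 * d)"
  have V: "0 < V" unfolding V_def using vol3_pos d by simp
  \<comment> \<open>The net is taken in the full ball before T is known, so its cardinality is an
    admissible constant. Its radius is s/2 because the points are later moved into the
    shell.\<close>
  obtain Z0 :: "(real^3) set" where Z0: "finite Z0" "cball 0 (3/2 * d) \<subseteq> (\<Union>z\<in>Z0. ball z (s/2))"
  proof -
    have "compact (cball (0::real^3) (3/2 * d))" by simp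
    then obtain K where "finite K" "cball (0::real^3) (3/2 * d) \<subseteq> (\<Union>x\<in>K. ball x (s/2))"
      using s(1) unfolding compact_eq_totally_bounded by (meson half_gt_zero)
    then show thesis using that by blast
  qed
  define M where "M = card Z0"
  define W4 where "W4 = measure lborel (cball (0::real^3) (4 * q))"
  have W4: "emeasure lborel (cball (0::real^3) (4 * q)) = ennreal W4" "0 \<le> W4"
    unfolding W4_def by (rule emeasure_eq_ennreal_measure) (use emeasure_lborel_cball_finite[of "0::real^3" "4 * q"] in auto)
  define A0 where "A0 = (4 * q)\<^sup>2 * W4 * (2 * (1 + 2 * L)\<^sup>2)"
  have A0: "0 \<le> A0" unfolding A0_def using W4 by simp
  define C where "C = real M ^ 2 * max 1 (4 * V / m) ^ (M ^ 2 + 1) * A0 + 1"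
  show thesis
  proof (rule that[of C])
    show "0 < C" unfolding C_def using A0 by (intro add_nonneg_pos mult_nonneg_nonneg) auto
    fix T :: "(real^3) set" and \<phi> :: "real^3 \<Rightarrow> real" and g :: "real^3 \<Rightarrow> real^3"
    assume T: "open T" "T \<subseteq> ball 0 d" and gp: "\<And>p. p \<in> frontier T \<Longrightarrow> \<exists>n G G'. graph_patch T p r L n G G'"
      and con: "connected (ball 0 (3/2 * d) - closure T)" and w: "weak_grad (ball 0 (2 * d) - closure T) \<phi> g"
      and fin: "L2on (ball 0 (2 * d) - closure T) \<phi> < \<infinity>" "L2on (ball 0 (2 * d) - closure T) g < \<infinity>"
    define W where "W = ball 0 (3/2 * d) - closure T"
    define W2 where "W2 = ball 0 (2 * d) - closure T"
    have clT: "closure T \<subseteq> cball 0 d" using T(2) by (metis closure_mono closure_ball d)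
    have WB[measurable]: "W \<in> sets borel" unfolding W_def by (intro borel_open open_Diff) auto
    note [measurable] = weak_gradD(2,3)[OF w]
    have below_W: "graph_patch.below p r G \<subseteq> W" "graph_patch.below p r G \<subseteq> W2"
      if p: "p \<in> frontier T" and g: "graph_patch T p r L n G G'" for p n G G'
    proof -
      interpret graph_patch T p r L n G G' by (rule g)
      have "norm p \<le> d" using p clT by (auto simp: frontier_def)
      then have "dist 0 x < 3/2 * d" if "x \<in> ball p r" for x
        using that dist_triangle[of 0 x p] r by simp
      then have "ball p r \<subseteq> ball 0 (3/2 * d)" by auto
      moreover have "below \<subseteq> ball p r" by (auto simp: below_def)
      ultimately show "below \<subseteq> W" using below_disjoint[OF T(1)] by (auto simp: W_def)
      moreover have "W \<subseteq> W2" using d by (auto simp: W_def W2_def)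
      ultimately show "below \<subseteq> W2" by blast
    qed
    define A where "A = ennreal A0 * L2on W2 g"
    have osc: "osc2 (W \<inter> ball z q) (W \<inter> ball z q) \<phi> \<le> A" if z: "z \<in> W" for z
    proof (cases "cball z q \<inter> closure T = {}")
      case True
      have "cball z q \<subseteq> W2"
      proof
        fix x assume x: "x \<in> cball z q"
        then have "dist 0 x \<le> dist 0 z + q" using dist_triangle[of 0 x z] by simp
        then have "dist 0 x < 2 * d" using z s(4) by (simp add: W_def)
        then show "x \<in> W2" using x True by (auto simp: W2_def)
      qed
      then have "osc2 (cball z q) (cball z q) \<phi> \<le> ennreal ((4 * q)\<^sup>2) * emeasure lborel (cball (0::real^3) (4 * q)) * L2on W2 g"
      proof (intro poincare_convex_compact w[folded W2_def])
        show "norm (y - x) \<le> 4 * q" if "x \<in> cball z q" "y \<in> cball z q" for x y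
          using that dist_triangle[of y x z] s(5) by (simp add: dist_norm norm_minus_commute)
      qed (use s in auto)
      also have "\<dots> \<le> A"
      proof -
        have "1 * 1 \<le> 2 * (1 + 2 * L)\<^sup>2" using L by (intro mult_mono one_le_power) auto
        then have "((4 * q)\<^sup>2 * W4) * 1 \<le> A0" unfolding A0_def using W4 by (intro mult_left_mono) auto
        then show ?thesis unfolding A_def W4(1) using W4(2)
          by (intro mult_right_mono) (auto simp: ennreal_leI simp flip: ennreal_mult)
      qed
      finally show ?thesis
        using osc2_mono[of "W \<inter> ball z q" "cball z q" "W \<inter> ball z q" "cball z q" \<phi>] by (auto simp: subset_iff intro: order_trans)
    next
      case False
      then obtain y where y: "y \<in> closure T" "dist z y \<le> q" by auto
      have "z \<notin> closure T" using z by (simp add: W_def)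
      from frontier_near[OF this y] obtain p where p: "p \<in> frontier T" "dist z p \<le> q" .
      obtain n G G' where g: "graph_patch T p r L n G G'" using gp[OF p(1)] by blast
      interpret graph_patch T p r L n G G' by (rule g)
      have \<rho>': "graph_patch.\<rho> r L = \<rho>" unfolding rho_eq graph_patch.\<rho>_def[OF g] ..
      have "osc2 (W \<inter> ball z q) (W \<inter> ball z q) \<phi> \<le>
         ennreal ((4 * q)\<^sup>2) * emeasure lborel (cball (0::real^3) (4 * q)) * (ennreal (2 * (1 + 2 * L)\<^sup>2) * L2on W2 g)"
      proof (rule patch_osc2_le[OF w[folded W2_def] below_W(2)[OF p(1) g] fin[folded W2_def] s(5) _ p(2)])
        show "2 * q < graph_patch.\<rho> r L" using s(3) \<rho>' by simp
        show "W \<inter> ball z q \<subseteq> cball z q" by auto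
        show "W \<inter> ball z q \<inter> T = {}" using closure_subset by (auto simp: W_def)
      qed
      also have "\<dots> = A"
      proof -
        have "ennreal a * ennreal b * (ennreal c * X) = ennreal (a * b * c) * X" if "0 \<le> a" "0 \<le> b" "0 \<le> c" for a b c X
          using that by (simp add: ennreal_mult mult.assoc)
        then show ?thesis unfolding A_def A0_def W4(1) using W4(2) by simp
      qed
      finally show ?thesis .
    qed
    have meas: "ennreal m \<le> emeasure lborel (W \<inter> ball z s)" if z: "z \<in> W" for z
    proof -
      have "\<exists>c. ball c \<tau> \<subseteq> W \<inter> ball z s"
      proof (cases "cball z (s/2) \<inter> closure T = {}")
        case True
        have nz: "norm z < 3/2 * d" using z by (simp add: W_def)
        \<comment> \<open>\<open>c\<close> is \<open>z\<close> pulled towards the origin by s/4, or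
          the origin itself if z is nearer than that, so that the ball of radius \<tau> about c
          stays clear of the outer sphere. For z = 0 the quotient is 0 by convention, and c = 0
          either way.\<close>
        define t where "t = min 1 (s / (4 * norm z))"
        define c where "c = (1 - t) *\<^sub>R z"
        have c: "norm (c - z) \<le> s / 4" "norm c + s / 8 \<le> max (s / 8) (norm z - s / 8)"
        proof -
          have t: "0 \<le> t" "t \<le> 1" "t * norm z = min (norm z) (s / 4)"
            using s(1) by (auto simp: t_def min_def field_simps split: if_splits)
          have "norm (c - z) = t * norm z" using t by (simp add: c_def algebra_simps)
          then show "norm (c - z) \<le> s / 4" using t by simp
          have "norm c = (1 - t) * norm z" using t(2) by (simp add: c_def)
          then have "norm c = norm z - t * norm z" by (simp only: left_diff_distrib mult_1_left)
          then show "norm c + s / 8 \<le> max (s / 8) (norm z - s / 8)" using t by (simp add: min_def max_def split: if_splits)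
        qed
        have "x \<in> W \<inter> ball z s" if x: "x \<in> ball c \<tau>" for x
        proof -
          have xc: "dist c x < s / 8" using x \<tau> by simp
          have "dist z x \<le> dist z c + dist c x" by (rule dist_triangle)
          then have zx: "dist z x < s / 2" using xc c(1) s(1) by (simp add: dist_norm norm_minus_commute)
          have "norm x \<le> norm c + dist c x" using norm_triangle_ineq[of c "x - c"] by (simp add: dist_norm norm_minus_commute)
          then have "norm x < 3/2 * d" using xc c(2) nz s(1,2) d by (auto simp: max_def split: if_splits)
          moreover have "x \<in> cball z (s/2)" using zx by simp
          then have "x \<notin> closure T" using True by blast
          ultimately show ?thesis using zx s(1) by (simp add: W_def)
        qed
        then show ?thesis by blast
      next
        case False
        then obtain y where y: "y \<in> closure T" "dist z y \<le> s/2" by auto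
        have "z \<notin> closure T" using z by (simp add: W_def)
        from frontier_near[OF this y] obtain p where p: "p \<in> frontier T" "dist z p \<le> s/2" .
        obtain n G G' where g: "graph_patch T p r L n G G'" using gp[OF p(1)] by blast
        interpret graph_patch T p r L n G G' by (rule g)
        have t: "0 < s / 4" "s / 4 \<le> r / 4" using s \<rho> by (auto simp: s_def)
        have e: "s / 4 / (2 * L) = \<tau>" by (simp add: \<tau>_def)
        have sub: "ball (p - (s/4) *\<^sub>R n) \<tau> \<subseteq> below \<inter> ball p (2 * (s/4))"
          using ball_in_below[OF t] unfolding e .
        have "ball p (2 * (s/4)) \<subseteq> ball z s"
        proof
          fix x assume "x \<in> ball p (2 * (s/4))"
          then show "x \<in> ball z s" using p(2) dist_triangle[of z x p] by simp
        qed
        then show ?thesis using sub below_W(1)[OF p(1) g] by blast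
      qed
      then obtain c where c: "ball c \<tau> \<subseteq> W \<inter> ball z s" by blast
      have "ennreal m = emeasure lborel (ball c \<tau>)" unfolding m_def by (simp add: emeasure_ball_vol3)
      also have "\<dots> \<le> emeasure lborel (W \<inter> ball z s)" by (rule emeasure_mono[OF c]) measurable
      finally show ?thesis .
    qed
    \<comment> \<open>Balls of the fixed net that meet the shell are recentred at a point of the
      shell; this doubles the radius from s/2 to s and does not increase their number.\<close>
    define pick where "pick z = (SOME y. y \<in> W \<inter> ball z (s/2))" for z
    define Z where "Z = pick ` {z \<in> Z0. W \<inter> ball z (s/2) \<noteq> {}}"
    have pick: "pick z \<in> W \<inter> ball z (s/2)" if ne: "W \<inter> ball z (s/2) \<noteq> {}" for z
    proof -
      obtain y where y: "y \<in> W \<inter> ball z (s/2)" using ne by blast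
      show ?thesis unfolding pick_def by (rule someI[of "\<lambda>y. y \<in> W \<inter> ball z (s/2)", OF y])
    qed
    have Z: "finite Z" "Z \<subseteq> W" "card Z \<le> M"
    proof -
      show "finite Z" unfolding Z_def using Z0(1) by simp
      show "Z \<subseteq> W" unfolding Z_def using pick by blast
      have "card Z \<le> card {z \<in> Z0. W \<inter> ball z (s/2) \<noteq> {}}" unfolding Z_def by (rule card_image_le) (use Z0 in simp)
      also have "\<dots> \<le> M" unfolding M_def by (rule card_mono) (use Z0 in auto)
      finally show "card Z \<le> M" .
    qed
    have cov: "W \<subseteq> (\<Union>z\<in>Z. ball z s)"
    proof
      fix x assume x: "x \<in> W"
      then have "x \<in> cball 0 (3/2 * d)" by (simp add: W_def)
      then obtain z where z: "z \<in> Z0" "x \<in> ball z (s/2)" using Z0(2) by blast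
      then have ne: "W \<inter> ball z (s/2) \<noteq> {}" using x by blast
      then have "pick z \<in> Z" using z by (auto simp: Z_def)
      moreover have "dist (pick z) x < s" using pick[OF ne] z(2) dist_triangle[of "pick z" x z] by (simp add: dist_commute)
      ultimately show "x \<in> (\<Union>z\<in>Z. ball z s)" by auto
    qed
    have VW: "emeasure lborel W \<le> ennreal V"
    proof -
      have "emeasure lborel W \<le> emeasure lborel (ball (0::real^3) (3/2 * d))" by (rule emeasure_mono) (auto simp: W_def)
      then show ?thesis by (simp add: V_def emeasure_ball_vol3)
    qed
    have "osc2 W W \<phi> \<le> ennreal (real M ^ 2 * max 1 (4 * V / m) ^ (M ^ 2 + 1)) * A"
    proof (rule osc2_connected_cover[OF con[folded W_def] WB weak_gradD(2)[OF w] Z(1,2) cov Z(3)])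
      show "osc2 (W \<inter> ball z (3 * s)) (W \<inter> ball z (3 * s)) \<phi> \<le> A" if "z \<in> Z" for z
        using osc[of z] that Z(2) unfolding q_def by blast
      show "ennreal m \<le> emeasure lborel (W \<inter> ball z s)" if "z \<in> Z" for z using meas that Z(2) by blast
    qed (use m V VW s in auto)
    also have "\<dots> = ennreal (real M ^ 2 * max 1 (4 * V / m) ^ (M ^ 2 + 1) * A0) * L2on W2 g"
      unfolding A_def using A0 by (simp add: ennreal_mult mult.assoc)
    also have "\<dots> \<le> ennreal C * L2on W2 g" unfolding C_def by (intro mult_right_mono ennreal_leI) auto
    finally show "osc2 (ball 0 (3/2 * d) - closure T) (ball 0 (3/2 * d) - closure T) \<phi>
      \<le> ennreal C * L2on (ball 0 (2 * d) - closure T) g" unfolding W_def W2_def .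
  qed
qed

section \<open>Extension into one hole at unit scale\<close>

abbreviation powr_int :: "real \<Rightarrow> 'a::euclidean_space set \<Rightarrow> ('a \<Rightarrow> real) \<Rightarrow> ennreal" where
  "powr_int q \<equiv> theta_int (\<lambda>t. ennreal (t powr q))"

lemma admissible_powr:
  assumes "1 \<le> q" shows "admissible (\<lambda>t. ennreal (t powr q))"
  unfolding admissible_def using assms by (auto intro!: ennreal_leI powr_mono2)

lemma abs_add_powr_le:
  fixes a b q :: real
  assumes "1 \<le> q"
  shows "\<bar>a + b\<bar> powr q \<le> 2 powr q * (\<bar>a\<bar> powr q + \<bar>b\<bar> powr q)"
proof -
  have "\<bar>a + b\<bar> \<le> 2 * max \<bar>a\<bar> \<bar>b\<bar>" by linarith
  then have "\<bar>a + b\<bar> powr q \<le> (2 * max \<bar>a\<bar> \<bar>b\<bar>) powr q" using assms by (intro powr_mono2) auto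
  also have "\<dots> = 2 powr q * (max \<bar>a\<bar> \<bar>b\<bar>) powr q" by (simp add: powr_mult)
  also have "(max \<bar>a\<bar> \<bar>b\<bar>) powr q \<le> \<bar>a\<bar> powr q + \<bar>b\<bar> powr q" by (simp add: max_def)
  finally show ?thesis by (simp add: mult_left_mono)
qed

lemma theta_int_powr_add_const_le:
  fixes u :: "'a::euclidean_space \<Rightarrow> real"
  assumes [measurable]: "u \<in> borel_measurable borel" "S \<in> sets borel" and q: "1 \<le> q"
    and V: "emeasure lborel S \<le> ennreal V" "0 \<le> V"
  shows "powr_int q S (\<lambda>x. u x + c) \<le>
    ennreal (2 powr q) * (powr_int q S u + ennreal (\<bar>c\<bar> powr q * V))"
proof -
  have "powr_int q S (\<lambda>x. u x + c) \<le>
    (\<integral>\<^sup>+x. ennreal (2 powr q) * (ennreal (\<bar>u x\<bar> powr q) * indicator S x + ennreal (\<bar>c\<bar> powr q) * indicator S x) \<partial>lborel)"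
    unfolding theta_int_def
  proof (rule nn_integral_mono)
    fix x
    have "ennreal (\<bar>u x + c\<bar> powr q) \<le> ennreal (2 powr q) * (ennreal (\<bar>u x\<bar> powr q) + ennreal (\<bar>c\<bar> powr q))"
      using abs_add_powr_le[OF q, of "u x" c] by (simp add: ennreal_leI flip: ennreal_mult ennreal_plus)
    then show "ennreal (\<bar>u x + c\<bar> powr q) * indicator S x \<le>
      ennreal (2 powr q) * (ennreal (\<bar>u x\<bar> powr q) * indicator S x + ennreal (\<bar>c\<bar> powr q) * indicator S x)"
      by (auto simp: indicator_def)
  qed
  also have "\<dots> = ennreal (2 powr q) * (powr_int q S u + ennreal (\<bar>c\<bar> powr q) * emeasure lborel S)"
    unfolding theta_int_def by (subst nn_integral_cmult; (subst nn_integral_add)?) (auto simp: nn_integral_cmult_indicator)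
  also have "\<dots> \<le> ennreal (2 powr q) * (powr_int q S u + ennreal (\<bar>c\<bar> powr q) * ennreal V)"
    by (intro mult_left_mono add_left_mono V) auto
  finally show ?thesis using V(2) by (simp add: ennreal_mult)
qed

text \<open>Subtracting the mean over the shell before patching, and adding it afterwards, lets the
  Poincare inequality replace the function by its gradient. Jensen bounds the mean by every L^q
  integral, and constants of the form C^q in front of integrals make the constant for norms
  independent of q.\<close>

lemma hole_extension:
  fixes d r L :: real
  assumes d: "0 < d" and r: "0 < r" "r \<le> d / 2" and L: "1 \<le> L"
  obtains C :: real where "1 \<le> C" "\<And>T \<phi> g. open T \<Longrightarrow> T \<subseteq> ball 0 d \<Longrightarrow>
    (\<And>p. p \<in> frontier T \<Longrightarrow> \<exists>n G G'. graph_patch T p r L n G G') \<Longrightarrow>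
    connected (ball 0 (3/2 * d) - closure T) \<Longrightarrow> weak_grad (ball 0 (2 * d) - closure T) \<phi> g \<Longrightarrow>
    L2on (ball 0 (2 * d) - closure T) \<phi> < \<infinity> \<Longrightarrow> L2on (ball 0 (2 * d) - closure T) g < \<infinity> \<Longrightarrow>
    \<exists>\<psi> h. weak_grad (ball 0 (3/2 * d)) \<psi> h \<and> (\<forall>x\<in>ball 0 (3/2 * d) - closure T. \<psi> x = \<phi> x) \<and>
      L2on (ball 0 (3/2 * d)) h \<le> ennreal C * L2on (ball 0 (2 * d) - closure T) g \<and>
      (\<forall>q\<ge>1. powr_int q (ball 0 (3/2 * d)) \<psi> \<le>
         ennreal (C powr q) * powr_int q (ball 0 (3/2 * d) - closure T) \<phi>) \<and>
      (\<forall>a\<ge>0. (AE x in lborel. x \<in> ball 0 (3/2 * d) - closure T \<longrightarrow> \<bar>\<phi> x\<bar> \<le> a) \<longrightarrow>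
         (AE x in lborel. x \<in> ball 0 (3/2 * d) \<longrightarrow> \<bar>\<psi> x\<bar> \<le> C * a))"
proof -
  define \<rho> where "\<rho> = r / (4 * (1 + 2 * L))"
  have \<rho>: "0 < \<rho>" using r L by (simp add: \<rho>_def)
  then have "0 < \<rho> / 4" by simp
  \<comment> \<open>One cut-off centred at 0, whose translates serve all boundary points, so that
    the gradient bound \<open>M\<close> is the same for every patch.\<close>
  obtain b0 :: "real^3 \<Rightarrow> real" where b0: "smooth b0" "\<And>x. 0 \<le> b0 x" "\<And>x. b0 x \<le> 1"
    "\<And>x. x \<in> cball 0 (\<rho>/4) \<Longrightarrow> b0 x = 1" "\<And>x. x \<notin> ball 0 (2 * (\<rho>/4)) \<Longrightarrow> b0 x = 0"
    using smooth_bump_ball[OF \<open>0 < \<rho> / 4\<close>, of "0::real^3"] by metis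
  have b0z: "\<And>x. x \<notin> ball 0 (\<rho>/2) \<Longrightarrow> b0 x = 0" using b0(5) by simp
  obtain Db where Db: "\<And>x. GDERIV b0 x :> Db x" using smooth_gradient[OF b0(1)] by metis
  have cDb: "continuous_on UNIV Db" by (rule smooth_gradient_continuous[OF b0(1) Db])
  have C1b: "C1_on UNIV b0 Db" using Db cDb by (simp add: C1_on_def)
  have z1: "b0 x = 0" if "x \<notin> cball 0 (\<rho>/2)" for x using b0z[of x] that by auto
  have z2: "Db x = 0" if "x \<notin> cball 0 (\<rho>/2)" for x
    by (rule C1_on_zero_extension(2)[OF C1b compact_cball[of 0 "\<rho>/2"]]) (use z1 that in auto)
  obtain M where M: "0 \<le> M" "\<And>x. norm (Db x) \<le> M"
    using compact_support_bounded[OF cDb compact_cball[of 0 "\<rho>/2"] z2] by metis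
  \<comment> \<open>Once these balls are recentred at boundary points their radius doubles to
    \<rho>/4, the radius on which the cut-off equals 1.\<close>
  obtain Z0 :: "(real^3) set" where Z0: "finite Z0" "cball 0 d \<subseteq> (\<Union>z\<in>Z0. ball z (\<rho>/8))"
  proof -
    have "compact (cball (0::real^3) d)" by simp
    moreover have "0 < \<rho> / 8" using \<rho> by simp
    ultimately obtain K where "finite K" "cball (0::real^3) d \<subseteq> (\<Union>x\<in>K. ball x (\<rho>/8))"
      unfolding compact_eq_totally_bounded by meson
    then show thesis using that by blast
  qed
  define N0 where "N0 = card Z0"
  define c where "c = 16 * (1 + 2 * L)\<^sup>2 * (1 + M\<^sup>2)"
  have c1: "1 \<le> c"
  proof -
    have "1 \<le> (1 + 2 * L)\<^sup>2" using L by (intro one_le_power) simp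
    then have "1 * 1 \<le> (1 + 2 * L)\<^sup>2 * (1 + M\<^sup>2)" by (intro mult_mono) auto
    then show ?thesis unfolding c_def by linarith
  qed
  define \<kappa> where "\<kappa> = step_const c N0"
  have \<kappa>: "1 \<le> \<kappa>" unfolding \<kappa>_def using step_const_mono[OF c1, of N0 N0] by simp
  obtain CP :: real where CP: "0 < CP" "\<And>T \<phi> g. open T \<Longrightarrow> T \<subseteq> ball 0 d \<Longrightarrow>
    (\<And>p. p \<in> frontier T \<Longrightarrow> \<exists>n G G'. graph_patch T p r L n G G') \<Longrightarrow>
    connected (ball 0 (3/2 * d) - closure T) \<Longrightarrow> weak_grad (ball 0 (2 * d) - closure T) \<phi> g \<Longrightarrow>
    L2on (ball 0 (2 * d) - closure T) \<phi> < \<infinity> \<Longrightarrow> L2on (ball 0 (2 * d) - closure T) g < \<infinity> \<Longrightarrow>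
    osc2 (ball 0 (3/2 * d) - closure T) (ball 0 (3/2 * d) - closure T) \<phi>
      \<le> ennreal CP * L2on (ball 0 (2 * d) - closure T) g"
    by (rule hole_poincare[OF assms]) blast
  \<comment> \<open>The volume of a ball placed at distance 5/4 d from the origin, inside the
    annulus from d to 3/2 d. The annulus belongs to every shell, so this bounds the measure of all
    shells from below.\<close>
  define m where "m = vol3 (d / 8)"
  have m: "0 < m" unfolding m_def using vol3_pos d by simp
  define V where "V = vol3 (3/2 * d)"
  have V: "0 < V" unfolding V_def using vol3_pos d by simp
  \<comment> \<open>V / m comes from the mean and 2 (2 N0 + 1) from the patches; the summand 1
    ensures X \<ge> 1 and hence X \<le> X^q.\<close>
  define X where "X = 1 + V / m + 2 * (2 * real N0 + 1)"
  have X: "1 \<le> X" unfolding X_def using V m by simp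
  define C where "C = \<kappa> * (1 + CP / m) + 4 * X"
  have C1: "4 * X \<le> C" "\<kappa> * (1 + CP / m) \<le> C" unfolding C_def using \<kappa> CP(1) m X by auto
  show thesis
  proof (rule that[of C])
    show "1 \<le> C" using C1 X by linarith
    fix T :: "(real^3) set" and \<phi> :: "real^3 \<Rightarrow> real" and g :: "real^3 \<Rightarrow> real^3"
    assume T: "open T" "T \<subseteq> ball 0 d" and gp: "\<And>p. p \<in> frontier T \<Longrightarrow> \<exists>n G G'. graph_patch T p r L n G G'"
      and con: "connected (ball 0 (3/2 * d) - closure T)" and w: "weak_grad (ball 0 (2 * d) - closure T) \<phi> g"
      and fin: "L2on (ball 0 (2 * d) - closure T) \<phi> < \<infinity>" "L2on (ball 0 (2 * d) - closure T) g < \<infinity>"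
    define B where "B = ball (0::real^3) (3/2 * d)"
    define W where "W = B - closure T"
    define W2 where "W2 = ball 0 (2 * d) - closure T"
    have clT: "closure T \<subseteq> cball 0 d" using T(2) by (metis closure_mono closure_ball d)
    have opW: "open W" "open B" unfolding W_def B_def by (auto intro: open_Diff)
    then have [measurable]: "W \<in> sets borel" "B \<in> sets borel" by auto
    have WW2: "W \<subseteq> W2" using d by (auto simp: W_def W2_def B_def)
    note [measurable] = weak_gradD(2,3)[OF w]
    have finW: "L2on W \<phi> < \<infinity>" "L2on W g < \<infinity>" "L2on W g \<le> L2on W2 g"
    proof -
      have "L2on W \<phi> \<le> L2on W2 \<phi>" "L2on W g \<le> L2on W2 g" using WW2 by (auto intro!: L2on_mono)
      then show "L2on W \<phi> < \<infinity>" "L2on W g < \<infinity>" "L2on W g \<le> L2on W2 g" using fin unfolding W2_def by (auto intro: le_less_trans)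
    qed
    have wW: "weak_grad W \<phi> g" using weak_grad_subset[OF w opW(1)] WW2 unfolding W2_def by blast
    have bW: "bounded W" unfolding W_def B_def by (rule bounded_subset[OF bounded_ball]) auto
    have finL1: "L1on W \<phi> < \<infinity>" by (rule L1on_finite_if_L2on[OF weak_gradD(2)[OF w] _ bW finW(1)]) simp
    define \<mu> where "\<mu> = measure lborel W"
    have e\<mu>: "emeasure lborel W = ennreal \<mu>"
      unfolding \<mu>_def by (rule emeasure_eq_ennreal_measure) (use emeasure_bounded_finite[OF bW] in auto)
    have EB: "emeasure lborel B = ennreal V" unfolding B_def V_def by (rule emeasure_ball_vol3)
    have m\<mu>: "m \<le> \<mu>" "\<mu> \<le> V"
    proof -
      define z0 where "z0 = (5/4 * d) *\<^sub>R (axis 1 1 :: real^3)"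
      have nz0: "norm z0 = 5/4 * d" using d by (simp add: z0_def)
      have "ball z0 (d/8) \<subseteq> W"
      proof
        fix x assume x: "x \<in> ball z0 (d/8)"
        have "norm x \<le> norm z0 + dist z0 x" "norm z0 \<le> norm x + dist z0 x"
          using norm_triangle_ineq2[of x z0] norm_triangle_ineq2[of z0 x] by (auto simp: dist_norm norm_minus_commute)
        then have "d < norm x" "norm x < 3/2 * d" using x nz0 d by auto
        then show "x \<in> W" using clT by (auto simp: W_def B_def)
      qed
      then have "emeasure lborel (ball z0 (d/8)) \<le> emeasure lborel W" by (rule emeasure_mono) simp
      then have "ennreal m \<le> ennreal \<mu>" unfolding e\<mu> m_def emeasure_ball_vol3 .
      then show "m \<le> \<mu>" by (subst (asm) ennreal_le_iff) (auto simp: \<mu>_def)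
      have "emeasure lborel W \<le> emeasure lborel B" by (rule emeasure_mono) (auto simp: W_def)
      then show "\<mu> \<le> V" unfolding e\<mu> EB using V by (subst (asm) ennreal_le_iff) auto
    qed
    have \<mu>: "0 < \<mu>" using m m\<mu> by linarith
    define c0 where "c0 = (\<integral>x. indicator W x * \<phi> x \<partial>lborel) / \<mu>"
    define \<phi>0 where "\<phi>0 x = \<phi> x + - c0" for x
    have w0: "weak_grad W \<phi>0 g"
      using weak_grad_add[OF wW weak_grad_const[OF opW(1), of "- c0"]] by (simp add: \<phi>0_def[abs_def])
    note [measurable] = weak_gradD(2)[OF w0]
    have "ennreal \<mu> * L2on W \<phi>0 \<le> ennreal CP * L2on W2 g"
    proof -
      have "ennreal \<mu> * L2on W \<phi>0 \<le> osc2 W W \<phi>"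
        using L2on_minus_mean_le[OF weak_gradD(2)[OF w] _ e\<mu> \<mu> finL1] by (simp add: \<phi>0_def[abs_def] c0_def)
      also have "\<dots> \<le> ennreal CP * L2on W2 g"
        unfolding W_def B_def W2_def by (rule CP(2)[OF T gp con w fin])
      finally show ?thesis .
    qed
    then have L2\<phi>0: "L2on W \<phi>0 \<le> ennreal (CP / m) * L2on W2 g"
      by (rule ennreal_mult_le_cancel[OF m, rotated]) (use m\<mu> CP(1) in \<open>auto intro: ennreal_leI\<close>)
    have fin\<phi>0: "L2on W \<phi>0 < \<infinity>"
      by (rule le_less_trans[OF L2\<phi>0]) (use fin(2) in \<open>simp add: ennreal_mult_less_top W2_def\<close>)
    define pick where "pick z = (SOME y. y \<in> frontier T \<inter> ball z (\<rho>/8))" for z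
    define P where "P = pick ` {z \<in> Z0. frontier T \<inter> ball z (\<rho>/8) \<noteq> {}}"
    have pick: "pick z \<in> frontier T \<inter> ball z (\<rho>/8)" if ne: "frontier T \<inter> ball z (\<rho>/8) \<noteq> {}" for z
    proof -
      obtain y where y: "y \<in> frontier T \<inter> ball z (\<rho>/8)" using ne by blast
      show ?thesis unfolding pick_def by (rule someI[of "\<lambda>y. y \<in> frontier T \<inter> ball z (\<rho>/8)", OF y])
    qed
    have P: "finite P" "P \<subseteq> frontier T" "card P \<le> N0"
    proof -
      show "finite P" unfolding P_def using Z0(1) by simp
      show "P \<subseteq> frontier T" unfolding P_def using pick by blast
      have "card P \<le> card {z \<in> Z0. frontier T \<inter> ball z (\<rho>/8) \<noteq> {}}" unfolding P_def by (rule card_image_le) (use Z0 in simp)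
      also have "\<dots> \<le> N0" unfolding N0_def by (rule card_mono) (use Z0 in auto)
      finally show "card P \<le> N0" .
    qed
    have frT: "frontier T \<subseteq> cball 0 d" using clT by (auto simp: frontier_def)
    \<comment> \<open>With the whole boundary covered no singular set remains, and the patched
      extension has a weak gradient on all of \<open>B\<close>.\<close>
    have Pcov: "frontier T - (\<Union>p\<in>P. ball p (\<rho>/4)) = {}"
    proof -
      have "x \<in> (\<Union>p\<in>P. ball p (\<rho>/4))" if x: "x \<in> frontier T" for x
      proof -
        obtain z where z: "z \<in> Z0" "x \<in> ball z (\<rho>/8)" using Z0(2) frT x by blast
        then have ne: "frontier T \<inter> ball z (\<rho>/8) \<noteq> {}" using x by blast
        then have "pick z \<in> P" using z by (auto simp: P_def)
        moreover have "dist (pick z) x < \<rho>/4"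
          using pick[OF ne] z(2) dist_triangle[of "pick z" x z] by (simp add: dist_commute)
        ultimately show ?thesis by auto
      qed
      then show ?thesis by blast
    qed
    have PB: "ball p r \<subseteq> B" if "p \<in> P" for p
    proof
      fix x assume "x \<in> ball p r"
      moreover have "norm p \<le> d" using that P(2) frT by auto
      ultimately have "dist 0 x < 3/2 * d" using dist_triangle[of 0 x p] r by simp
      then show "x \<in> B" by (simp add: B_def)
    qed
    have clB: "closure T \<subseteq> B" using clT d by (auto simp: B_def subset_iff)
    obtain \<Psi> h where \<Psi>: "weak_grad B \<Psi> h" "\<forall>x\<in>W. \<Psi> x = \<phi>0 x"
      "\<And>\<Theta>. admissible \<Theta> \<Longrightarrow> theta_int \<Theta> B \<Psi> \<le> of_nat (2 * card P + 1) * theta_int \<Theta> W \<phi>0"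
      "L2on B h \<le> ennreal (step_const c (card P)) * (L2on W g + L2on W \<phi>0)"
      using patched_extension[OF T(1) opW(2) clB W_def w0 fin\<phi>0 finW(2) \<rho>_def L b0(1) Db b0(2,3,4) b0z M(2,1) c_def P(1,2) gp[OF subsetD[OF P(2)]] PB]
      unfolding Pcov Diff_empty by blast
    note [measurable] = weak_gradD(2,3)[OF \<Psi>(1)]
    define \<psi> where "\<psi> x = \<Psi> x + c0" for x
    have w\<psi>: "weak_grad B \<psi> h"
      using weak_grad_add[OF \<Psi>(1) weak_grad_const[OF opW(2), of c0]] by (simp add: \<psi>_def[abs_def])
    have eq: "\<forall>x\<in>W. \<psi> x = \<phi> x" using \<Psi>(2) by (simp add: \<psi>_def \<phi>0_def)
    have L2h: "L2on B h \<le> ennreal C * L2on W2 g"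
    proof -
      have "L2on B h \<le> ennreal \<kappa> * (L2on W2 g + ennreal (CP / m) * L2on W2 g)"
      proof -
        have "step_const c (card P) \<le> \<kappa>" unfolding \<kappa>_def using step_const_mono[OF c1 P(3)] by simp
        then have "ennreal (step_const c (card P)) * (L2on W g + L2on W \<phi>0) \<le> ennreal \<kappa> * (L2on W2 g + ennreal (CP / m) * L2on W2 g)"
          by (intro mult_mono add_mono ennreal_leI finW(3) L2\<phi>0) auto
        then show ?thesis using \<Psi>(4) by (rule order_trans[rotated])
      qed
      also have "\<dots> = ennreal (\<kappa> * (1 + CP / m)) * L2on W2 g"
      proof -
        have "ennreal a * (Y + ennreal b * Y) = ennreal (a * (1 + b)) * Y" if "0 \<le> a" "0 \<le> b" for a b Y
          using that by (simp add: ennreal_mult ennreal_plus distrib_left distrib_right mult.assoc)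
        then show ?thesis using \<kappa> CP(1) m by simp
      qed
      also have "\<dots> \<le> ennreal C * L2on W2 g" using C1(2) by (intro mult_right_mono ennreal_leI) auto
      finally show ?thesis .
    qed
    have card_le: "of_nat (2 * card P + 1) \<le> ennreal (2 * real N0 + 1)"
    proof -
      have "(of_nat (2 * card P + 1) :: ennreal) = ennreal (real (2 * card P + 1))" by (rule ennreal_of_nat_eq_real_of_nat)
      also have "\<dots> \<le> ennreal (2 * real N0 + 1)" using P(3) by (intro ennreal_leI) simp
      finally show ?thesis .
    qed
    have Lq: "powr_int q B \<psi> \<le> ennreal (C powr q) * powr_int q W \<phi>"
      if q: "1 \<le> q" for q
    proof -
      let ?T = "powr_int q"
      define J where "J = ?T W \<phi>"
      have jen: "ennreal (\<bar>c0\<bar> powr q * \<mu>) \<le> J"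
        using jensen_powr_mean[OF weak_gradD(2)[OF w] _ e\<mu> \<mu> finL1 q] \<mu>
        by (simp add: c0_def J_def theta_int_def ennreal_mult)
      have jV: "ennreal (\<bar>c0\<bar> powr q * V) \<le> ennreal (V / m) * J"
      proof -
        have "\<bar>c0\<bar> powr q * V = (V / m) * (\<bar>c0\<bar> powr q * m)" using m by simp
        also have "\<dots> \<le> (V / m) * (\<bar>c0\<bar> powr q * \<mu>)" using m V m\<mu>(1) by (intro mult_left_mono) auto
        finally have "ennreal (\<bar>c0\<bar> powr q * V) \<le> ennreal ((V / m) * (\<bar>c0\<bar> powr q * \<mu>))" by (rule ennreal_leI)
        also have "\<dots> = ennreal (V / m) * ennreal (\<bar>c0\<bar> powr q * \<mu>)" using V m \<mu> by (intro ennreal_mult) auto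
        also have "\<dots> \<le> ennreal (V / m) * J" using jen by (rule mult_left_mono) simp
        finally show ?thesis .
      qed
      have a1: "?T W \<phi>0 \<le> ennreal (2 powr q) * (J + J)"
      proof -
        have "?T W \<phi>0 \<le> ennreal (2 powr q) * (?T W \<phi> + ennreal (\<bar>- c0\<bar> powr q * \<mu>))"
          unfolding \<phi>0_def[abs_def] by (rule theta_int_powr_add_const_le) (use q e\<mu> \<mu> in auto)
        also have "\<dots> \<le> ennreal (2 powr q) * (J + J)"
          using jen unfolding J_def by (intro mult_left_mono add_mono) auto
        finally show ?thesis .
      qed
      have a2: "?T B \<Psi> \<le> ennreal (2 * real N0 + 1) * (ennreal (2 powr q) * (J + J))"
        using \<Psi>(3)[OF admissible_powr[OF q]] mult_mono[OF card_le a1] by (auto intro: order_trans)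
      have "?T B \<psi> \<le> ennreal (2 powr q) * (?T B \<Psi> + ennreal (\<bar>c0\<bar> powr q * V))"
        unfolding \<psi>_def[abs_def] by (rule theta_int_powr_add_const_le) (use q EB V in auto)
      also have "\<dots> \<le> ennreal (2 powr q) * (ennreal (2 * real N0 + 1) * (ennreal (2 powr q) * (J + J)) + ennreal (V / m) * J)"
        by (intro mult_left_mono add_mono a2 jV) simp
      also have "\<dots> = ennreal (2 powr q * ((2 * real N0 + 1) * (2 powr q * 2) + V / m)) * J"
      proof -
        have "ennreal a * (ennreal b * (ennreal a * (J + J)) + ennreal e * J) = ennreal (a * (b * (a * 2) + e)) * J"
          if "0 \<le> a" "0 \<le> b" "0 \<le> e" for a b e
        proof -
          have "J + J = ennreal 2 * J" by (simp add: mult_2)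
          then show ?thesis using that
            by (simp add: ennreal_mult ennreal_plus distrib_left distrib_right mult.assoc del: ennreal_numeral)
        qed
        from this[of "2 powr q" "2 * real N0 + 1" "V / m"] show ?thesis using V m by simp
      qed
      \<comment> \<open>Subtracting and adding the mean each cost a factor 2^q, together 4^q; the
        remaining factor X is at most X^q.\<close>
      also have "\<dots> \<le> ennreal (C powr q) * J"
      proof (intro mult_right_mono ennreal_leI)
        have g1: "1 \<le> (2::real) powr q" using q by (simp add: ge_one_powr_ge_zero)
        have e1: "V / m \<le> 2 powr q * (V / m)" using mult_right_mono[OF g1, of "V / m"] V m by simp
        have "2 powr q * ((2 * real N0 + 1) * (2 powr q * 2) + V / m) \<le> 2 powr q * (2 powr q * X)"
        proof -
          have "b * (t * 2) + e \<le> t * (1 + e + 2 * b)" if "e \<le> t * e" "0 \<le> t" for b t e :: real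
            using that by (simp add: algebra_simps)
          from this[OF e1, of "2 * real N0 + 1"] show ?thesis unfolding X_def by (intro mult_left_mono) auto
        qed
        also have "\<dots> = 4 powr q * X" by (simp flip: mult.assoc powr_mult)
        also have "\<dots> \<le> 4 powr q * X powr q" using X q powr_mono[of 1 q X] by (intro mult_left_mono) auto
        also have "\<dots> = (4 * X) powr q" using X by (simp add: powr_mult)
        also have "\<dots> \<le> C powr q" using C1(1) X q by (intro powr_mono2) auto
        finally show "2 powr q * ((2 * real N0 + 1) * (2 powr q * 2) + V / m) \<le> C powr q" .
      qed simp
      finally show ?thesis unfolding J_def .
    qed
    have Linf: "AE x in lborel. x \<in> B \<longrightarrow> \<bar>\<psi> x\<bar> \<le> C * a"
      if a: "0 \<le> a" "AE x in lborel. x \<in> W \<longrightarrow> \<bar>\<phi> x\<bar> \<le> a" for a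
    proof -
      have c0a: "\<bar>c0\<bar> \<le> a"
      proof -
        have "ennreal (\<bar>c0\<bar> powr 1) * ennreal \<mu> \<le> (\<integral>\<^sup>+x. ennreal (\<bar>\<phi> x\<bar> powr 1) * indicator W x \<partial>lborel)"
          unfolding c0_def by (rule jensen_powr_mean[OF weak_gradD(2)[OF w] _ e\<mu> \<mu> finL1]) auto
        also have "\<dots> \<le> (\<integral>\<^sup>+x. ennreal a * indicator W x \<partial>lborel)"
          by (rule nn_integral_mono_AE) (use a(2) in \<open>eventually_elim; auto simp: indicator_def intro: ennreal_leI\<close>)
        also have "\<dots> = ennreal a * ennreal \<mu>" by (simp add: nn_integral_cmult_indicator e\<mu>)
        finally have "ennreal (\<bar>c0\<bar> * \<mu>) \<le> ennreal (a * \<mu>)" using a(1) \<mu> by (simp add: ennreal_mult)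
        then show ?thesis using a(1) \<mu> by (simp add: mult_le_cancel_right)
      qed
      \<comment> \<open>The indicator of values above 2 a. On the shell the shifted function is at
        most a + |c0| \<le> 2 a almost everywhere, so its \<Theta>-integral vanishes, and with it
        that of the extension; adding the mean back gives 3 a.\<close>
      define \<Theta> :: "real \<Rightarrow> ennreal" where "\<Theta> t = (if 2 * a < t then 1 else 0)" for t
      have ad: "admissible \<Theta>" unfolding admissible_def \<Theta>_def using a(1) by auto
      have [measurable]: "\<Theta> \<in> borel_measurable borel" using ad by (simp add: admissible_def)
      have "theta_int \<Theta> W \<phi>0 = nn_integral lborel (\<lambda>_::real^3. 0)"
        unfolding theta_int_def
      proof (rule nn_integral_cong_AE)
        show "AE x in lborel. \<Theta> \<bar>\<phi>0 x\<bar> * indicator W x = 0"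
          using a(2)
        proof eventually_elim
          case (elim x)
          then show ?case using c0a by (auto simp: indicator_def \<Theta>_def \<phi>0_def)
        qed
      qed
      then have "theta_int \<Theta> B \<Psi> = 0" using \<Psi>(3)[OF ad] by simp
      then have "AE x in lborel. \<Theta> \<bar>\<Psi> x\<bar> * indicator B x = 0"
        unfolding theta_int_def by (subst (asm) nn_integral_0_iff_AE) auto
      then show ?thesis
      proof eventually_elim
        case (elim x)
        show ?case
        proof
          assume "x \<in> B"
          then have "\<bar>\<Psi> x\<bar> \<le> 2 * a" using elim by (auto simp: \<Theta>_def split: if_splits)
          then have "\<bar>\<psi> x\<bar> \<le> 3 * a" using c0a by (simp add: \<psi>_def)
          also have "\<dots> \<le> C * a" using C1(1) X a(1) by (intro mult_right_mono) auto
          finally show "\<bar>\<psi> x\<bar> \<le> C * a" .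
        qed
      qed
    qed
    show "\<exists>\<psi> h. weak_grad (ball 0 (3/2 * d)) \<psi> h \<and> (\<forall>x\<in>ball 0 (3/2 * d) - closure T. \<psi> x = \<phi> x) \<and>
      L2on (ball 0 (3/2 * d)) h \<le> ennreal C * L2on (ball 0 (2 * d) - closure T) g \<and>
      (\<forall>q\<ge>1. powr_int q (ball 0 (3/2 * d)) \<psi> \<le>
         ennreal (C powr q) * powr_int q (ball 0 (3/2 * d) - closure T) \<phi>) \<and>
      (\<forall>a\<ge>0. (AE x in lborel. x \<in> ball 0 (3/2 * d) - closure T \<longrightarrow> \<bar>\<phi> x\<bar> \<le> a) \<longrightarrow>
         (AE x in lborel. x \<in> ball 0 (3/2 * d) \<longrightarrow> \<bar>\<psi> x\<bar> \<le> C * a))"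
      unfolding B_def[symmetric] W_def[symmetric] W2_def[symmetric]
      using w\<psi> eq L2h Lq Linf by (intro exI[of _ \<psi>] exI[of _ h] conjI allI impI) auto
  qed
qed

section \<open>From almost-everywhere classes to Borel representatives\<close>

lemma AE_lebesgue_on:
  "S \<in> sets lebesgue \<Longrightarrow> (AE x in lebesgue_on S. P x) \<longleftrightarrow> (AE x in lborel. x \<in> S \<longrightarrow> P x)"
  by (subst AE_restrict_space_iff) (simp_all add: AE_completion_iff)

lemma nn_integral_lebesgue_on:
  "S \<in> sets lebesgue \<Longrightarrow> (\<integral>\<^sup>+x. f x \<partial>lebesgue_on S) = (\<integral>\<^sup>+x. f x * indicator S x \<partial>lborel)"
  by (simp add: nn_integral_restrict_space nn_integral_completion)

lemma measurable_lebesgue_AE: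
  fixes F :: "'a::euclidean_space \<Rightarrow> 'b::topological_space"
  assumes F': "F' \<in> borel_measurable lebesgue" and eq: "AE x in lborel. F x = F' x"
  shows "F \<in> borel_measurable lebesgue"
proof (rule measurableI)
  fix X :: "'b set" assume X: "X \<in> sets borel"
  show "F -` X \<inter> space lebesgue \<in> sets lebesgue"
  proof (rule completion.in_sets_AE)
    have "AE x in lebesgue. F x = F' x" using eq by (simp add: AE_completion_iff)
    then show "AE x in lebesgue. x \<in> F' -` X \<inter> space lebesgue \<longleftrightarrow> x \<in> F -` X \<inter> space lebesgue"
      by eventually_elim simp
    show "F' -` X \<inter> space lebesgue \<in> sets lebesgue" by (rule measurable_sets[OF F' X])
  qed auto
qed auto

lemma measurable_lebesgue_on_AE:
  fixes f :: "'a::euclidean_space \<Rightarrow> 'b::euclidean_space"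
  assumes f': "f' \<in> borel_measurable borel" and S: "S \<in> sets lebesgue" and eq: "AE x in lborel. x \<in> S \<longrightarrow> f x = f' x"
  shows "f \<in> borel_measurable (lebesgue_on S)"
proof -
  have [measurable]: "f' \<in> borel_measurable lebesgue" "S \<in> sets lebesgue"
    using f' S by (auto intro: measurable_completion)
  have "(\<lambda>x. if x \<in> S then f x else 0) \<in> borel_measurable lebesgue"
  proof (rule measurable_lebesgue_AE)
    show "(\<lambda>x. if x \<in> S then f' x else 0) \<in> borel_measurable lebesgue" by measurable
    show "AE x in lborel. (if x \<in> S then f x else 0) = (if x \<in> S then f' x else 0)"
      using eq by eventually_elim auto
  qed
  then show ?thesis by (rule borel_measurable_if_D)
qed

lemma LINT_lebesgue_on_eq:
  fixes F :: "'a::euclidean_space \<Rightarrow> 'b::euclidean_space"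
  assumes U: "U \<in> sets borel" and F': "F' \<in> borel_measurable borel"
    and eq: "AE x in lborel. indicator U x *\<^sub>R F x = F' x"
  shows "(LINT x|lebesgue_on U. F x) = (\<integral>x. F' x \<partial>lborel)"
proof -
  have F'l: "F' \<in> borel_measurable lebesgue" using F' by (simp add: measurable_completion)
  have "(LINT x|lebesgue_on U. F x) = (\<integral>x. indicator U x *\<^sub>R F x \<partial>lebesgue)"
    by (rule integral_restrict_space) (use U in simp)
  also have "\<dots> = (\<integral>x. F' x \<partial>lebesgue)"
    by (rule integral_cong_AE[OF measurable_lebesgue_AE[OF F'l eq] F'l]) (use eq in \<open>simp add: AE_completion_iff\<close>)
  also have "\<dots> = (\<integral>x. F' x \<partial>lborel)" by (rule integral_completion) (use F' in simp)
  finally show ?thesis .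
qed

lemma absolutely_integrable_imp_L1on:
  assumes "f absolutely_integrable_on K"
  shows "L1on K f < \<infinity>"
proof -
  have "(\<integral>\<^sup>+x. ennreal (norm (indicator K x *\<^sub>R f x)) \<partial>lebesgue) < \<infinity>"
    using assms unfolding set_integrable_def integrable_iff_bounded by blast
  then have "(\<integral>\<^sup>+x. ennreal (norm (indicator K x *\<^sub>R f x)) \<partial>lborel) < \<infinity>"
    by (simp only: nn_integral_completion)
  also have "(\<integral>\<^sup>+x. ennreal (norm (indicator K x *\<^sub>R f x)) \<partial>lborel) = L1on K f"
    unfolding L1on_def by (rule nn_integral_cong) (simp add: indicator_def)
  finally show ?thesis .
qed

lemma absolutely_integrable_if_L1on:
  fixes f :: "'a::euclidean_space \<Rightarrow> 'b::euclidean_space"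
  assumes f': "f' \<in> borel_measurable borel" and K: "K \<in> sets borel" and fin: "L1on K f' < \<infinity>"
    and eq: "AE x in lborel. x \<in> K \<longrightarrow> f x = f' x"
  shows "f absolutely_integrable_on K"
  unfolding set_integrable_def
proof (rule integrableI_bounded)
  have [measurable]: "f' \<in> borel_measurable lebesgue" "K \<in> sets lebesgue"
    using f' K by (auto intro: measurable_completion)
  show "(\<lambda>x. indicator K x *\<^sub>R f x) \<in> borel_measurable lebesgue"
  proof (rule measurable_lebesgue_AE)
    show "(\<lambda>x. indicator K x *\<^sub>R f' x) \<in> borel_measurable lebesgue" by measurable
    show "AE x in lborel. indicator K x *\<^sub>R f x = indicator K x *\<^sub>R f' x"
      using eq by eventually_elim (auto simp: indicator_def)
  qed
  have "(\<integral>\<^sup>+x. ennreal (norm (indicator K x *\<^sub>R f x)) \<partial>lebesgue) = L1on K f'"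
    unfolding nn_integral_completion L1on_def
    by (rule nn_integral_cong_AE) (use eq in \<open>eventually_elim; auto simp: indicator_def\<close>)
  then show "(\<integral>\<^sup>+x. ennreal (norm (indicator K x *\<^sub>R f x)) \<partial>lebesgue) < \<infinity>" using fin by simp
qed

text \<open>Along an exhaustion by compact sets the extension by zero is a pointwise limit of
  integrable functions, hence Lebesgue measurable; a Borel version is then chosen coordinate by
  coordinate.\<close>

lemma locally_integrable_borel:
  fixes f :: "'a::euclidean_space \<Rightarrow> 'b::euclidean_space"
  assumes U: "open U" and f: "locally_integrable_on f U"
  obtains f' where "f' \<in> borel_measurable borel" "AE x in lborel. x \<in> U \<longrightarrow> f x = f' x"
proof -
  define F where "F x = (if x \<in> U then f x else 0)" for x
  obtain C where C: "\<And>n. compact (C n)" "\<And>n. C n \<subseteq> U" "\<And>n. C n \<subseteq> interior (C (Suc n))" "\<Union>(range C) = U"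
    using open_Union_compact_subsets[OF U] by metis
  have Cmono: "C m \<subseteq> C n" if "m \<le> n" for m n
    using lift_Suc_mono_le[of C, OF _ that] C(3) interior_subset by blast
  have FL: "F \<in> borel_measurable lebesgue"
  proof (rule borel_measurable_LIMSEQ_metric)
    show "(\<lambda>x. indicator (C n) x *\<^sub>R f x) \<in> borel_measurable lebesgue" for n
      using f C(1,2) unfolding locally_integrable_on_def set_integrable_def by (blast intro: borel_measurable_integrable)
    show "(\<lambda>n. indicator (C n) x *\<^sub>R f x) \<longlonglongrightarrow> F x" for x
    proof (cases "x \<in> U")
      case True
      then obtain m where m: "x \<in> C m" using C(4) by blast
      have "\<forall>\<^sub>F n in sequentially. indicator (C n) x *\<^sub>R f x = F x"
        using eventually_ge_at_top[of m] by eventually_elim (use m Cmono True in \<open>auto simp: F_def indicator_def\<close>)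
      then show ?thesis by (rule tendsto_eventually)
    next
      case False
      then have "\<And>n. indicator (C n) x *\<^sub>R f x = F x" using C(2) by (auto simp: F_def indicator_def)
      then show ?thesis by simp
    qed
  qed
  have "\<exists>k. k \<in> borel_measurable borel \<and> (AE x in lborel. F x \<bullet> b = k x)" for b
  proof -
    have "(\<lambda>x. F x \<bullet> b) \<in> borel_measurable lebesgue" using FL by measurable
    from completion_ex_borel_measurable_real[OF this] show ?thesis by auto
  qed
  then obtain k where k: "\<And>b. k b \<in> borel_measurable borel" "\<And>b. AE x in lborel. F x \<bullet> b = k b x" by metis
  show thesis
  proof (rule that)
    show "(\<lambda>x. \<Sum>b\<in>Basis. k b x *\<^sub>R b) \<in> borel_measurable borel" using k(1) by measurable
    have "AE x in lborel. \<forall>b\<in>Basis. F x \<bullet> b = k b x" by (rule AE_finite_allI) (auto intro: k(2))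
    then show "AE x in lborel. x \<in> U \<longrightarrow> f x = (\<Sum>b\<in>Basis. k b x *\<^sub>R b)"
    proof eventually_elim
      case (elim x)
      then have "(\<Sum>b\<in>Basis. k b x *\<^sub>R b) = (\<Sum>b\<in>Basis. (F x \<bullet> b) *\<^sub>R b)" by (intro sum.cong) auto
      then show ?case by (simp add: F_def euclidean_representation)
    qed
  qed
qed

text \<open>Null sets are invisible to all integrals involved, so functions can be exchanged for
  Borel representatives in both directions.\<close>

lemma has_weak_gradient_transfer:
  fixes u :: "'a::euclidean_space \<Rightarrow> real"
  assumes U: "open U" and m: "u' \<in> borel_measurable borel" "g' \<in> borel_measurable borel"
    and eq: "AE x in lborel. x \<in> U \<longrightarrow> u x = u' x" "AE x in lborel. x \<in> U \<longrightarrow> g x = g' x"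
  shows "has_weak_gradient U u g \<longleftrightarrow> weak_grad U u' g'"
proof -
  have UB: "U \<in> sets borel" using U by simp
  have int: "(LINT x|lebesgue_on U. u x *\<^sub>R D x) = (\<integral>x. u' x *\<^sub>R D x \<partial>lborel)"
    "(LINT x|lebesgue_on U. \<eta> x *\<^sub>R g x) = (\<integral>x. \<eta> x *\<^sub>R g' x \<partial>lborel)"
    if t: "\<eta> \<in> test_functions U" "\<forall>x. GDERIV \<eta> x :> D x" for \<eta> D
  proof -
    obtain K where K: "K \<subseteq> U" "\<And>x. x \<notin> K \<Longrightarrow> \<eta> x = 0" "\<And>x. x \<notin> K \<Longrightarrow> D x = 0"
      and [measurable]: "\<eta> \<in> borel_measurable borel" "D \<in> borel_measurable borel"
      using test_functionE[OF t(1), of D] t(2) by metis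
    note [measurable] = m
    show "(LINT x|lebesgue_on U. u x *\<^sub>R D x) = (\<integral>x. u' x *\<^sub>R D x \<partial>lborel)"
    proof (rule LINT_lebesgue_on_eq[OF UB])
      show "AE x in lborel. indicator U x *\<^sub>R u x *\<^sub>R D x = u' x *\<^sub>R D x"
        using eq(1) by eventually_elim (use K in \<open>auto simp: indicator_def\<close>)
    qed measurable
    show "(LINT x|lebesgue_on U. \<eta> x *\<^sub>R g x) = (\<integral>x. \<eta> x *\<^sub>R g' x \<partial>lborel)"
    proof (rule LINT_lebesgue_on_eq[OF UB])
      show "AE x in lborel. indicator U x *\<^sub>R \<eta> x *\<^sub>R g x = \<eta> x *\<^sub>R g' x"
        using eq(2) by eventually_elim (use K in \<open>auto simp: indicator_def\<close>)
    qed measurable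
  qed
  have loc: "f absolutely_integrable_on K \<longleftrightarrow> L1on K f' < \<infinity>"
    if "compact K" "K \<subseteq> U" "f' \<in> borel_measurable borel" "AE x in lborel. x \<in> U \<longrightarrow> f x = f' x"
    for K and f f' :: "'a \<Rightarrow> 'b::euclidean_space"
  proof -
    have eqK: "AE x in lborel. x \<in> K \<longrightarrow> f x = f' x" using that(4) by eventually_elim (use that(2) in auto)
    have KB: "K \<in> sets borel" using that(1) by (simp add: compact_imp_closed)
    show ?thesis
      using absolutely_integrable_imp_L1on[of K f] L1on_cong_AE[OF eqK] absolutely_integrable_if_L1on[OF that(3) KB _ eqK]
      by auto
  qed
  have "locally_integrable_on u U \<and> locally_integrable_on g U \<longleftrightarrow>
      (\<forall>K\<subseteq>U. compact K \<longrightarrow> L1on K u' < \<infinity> \<and> L1on K g' < \<infinity>)"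
    using loc[OF _ _ m(1) eq(1)] loc[OF _ _ m(2) eq(2)] unfolding locally_integrable_on_def by blast
  moreover have "(\<forall>\<eta>\<in>test_functions U. \<forall>D. (\<forall>x. GDERIV \<eta> x :> D x) \<longrightarrow>
        (LINT x|lebesgue_on U. u x *\<^sub>R D x) = - (LINT x|lebesgue_on U. \<eta> x *\<^sub>R g x)) \<longleftrightarrow>
     (\<forall>\<eta>\<in>test_functions U. \<forall>D. (\<forall>x. GDERIV \<eta> x :> D x) \<longrightarrow>
        (\<integral>x. u' x *\<^sub>R D x \<partial>lborel) = - (\<integral>x. \<eta> x *\<^sub>R g' x \<partial>lborel))"
    using int by (intro ball_cong refl all_cong1 imp_cong) simp_all
  ultimately show ?thesis unfolding has_weak_gradient_def weak_grad_def using U m by blast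
qed

lemma has_weak_gradient_borel:
  fixes u :: "'a::euclidean_space \<Rightarrow> real"
  assumes U: "open U" and w: "has_weak_gradient U u g"
  obtains u' g' where "weak_grad U u' g'" "AE x in lborel. x \<in> U \<longrightarrow> u x = u' x" "AE x in lborel. x \<in> U \<longrightarrow> g x = g' x"
proof -
  obtain u' where u': "u' \<in> borel_measurable borel" "AE x in lborel. x \<in> U \<longrightarrow> u x = u' x"
    using locally_integrable_borel[OF U, of u] w unfolding has_weak_gradient_def by blast
  obtain g' where g': "g' \<in> borel_measurable borel" "AE x in lborel. x \<in> U \<longrightarrow> g x = g' x"
    using locally_integrable_borel[OF U, of g] w unfolding has_weak_gradient_def by blast
  show thesis using that has_weak_gradient_transfer[OF U u'(1) g'(1) u'(2) g'(2)] w u'(2) g'(2) by blast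
qed

section \<open>Norms as roots of integrals, and Sobolev functions\<close>

lemma theta_int_powr_2: "theta_int (\<lambda>t. ennreal (t powr 2)) S u = L2on S u"
  unfolding theta_int_def L2on_def by (rule nn_integral_cong) (simp add: powr_numeral)

text \<open>The passage from an integral to a norm inside \<open>Lq_norm\<close>, isolated so that
  inequalities between integrals can be transferred.\<close>

definition norm_root :: "real \<Rightarrow> ennreal \<Rightarrow> ennreal" where
  "norm_root p I = (if I = \<infinity> then \<infinity> else ennreal (enn2real I powr (1 / p)))"

text \<open>The p-th root turns C^p into C. This is why the integral estimates carry
  \<open>C powr p\<close>: the constant for the norm is free of p.\<close>

lemma norm_root_le:
  assumes "I \<le> ennreal (C powr p) * J" "0 < C" "1 \<le> p"
  shows "norm_root p I \<le> ennreal C * norm_root p J"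
proof (cases "J = \<infinity>")
  case True
  then show ?thesis using assms(2) by (simp add: norm_root_def ennreal_mult_top)
next
  case False
  then have fin: "ennreal (C powr p) * J < \<infinity>" by (simp add: ennreal_mult_less_top less_top)
  then have I: "I \<noteq> \<infinity>" using assms(1) by (auto simp: top_unique)
  have "enn2real I \<le> enn2real (ennreal (C powr p) * J)" using assms(1) fin by (intro enn2real_mono) auto
  then have "enn2real I \<le> C powr p * enn2real J" by (simp add: enn2real_mult)
  then have "enn2real I powr (1 / p) \<le> (C powr p * enn2real J) powr (1 / p)" using assms(3) by (intro powr_mono2) auto
  also have "\<dots> = C * enn2real J powr (1 / p)" using assms(2,3) by (simp add: powr_mult powr_powr)
  finally have "ennreal (enn2real I powr (1 / p)) \<le> ennreal C * ennreal (enn2real J powr (1 / p))"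
    using assms(2) by (simp add: ennreal_leI flip: ennreal_mult)
  then show ?thesis using I False by (simp add: norm_root_def)
qed

lemma Lq_norm_finite:
  assumes "S \<in> sets lebesgue"
  shows "Lq_norm (ereal p) S f = norm_root p (\<integral>\<^sup>+x. ennreal (norm (f x) powr p) * indicator S x \<partial>lborel)"
  using assms by (simp add: Lq_norm_def norm_root_def Let_def nn_integral_lebesgue_on)

lemma Lq_norm_2: "S \<in> sets lebesgue \<Longrightarrow> Lq_norm 2 S f = norm_root 2 (L2on S f)"
  using Lq_norm_finite[of S 2 f] by (simp add: L2on_def powr_numeral)

lemma Lq_norm_2_AE:
  assumes "S \<in> sets lebesgue" "AE x in lborel. x \<in> S \<longrightarrow> f x = g x"
  shows "Lq_norm 2 S f = norm_root 2 (L2on S g)"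
  using Lq_norm_2[OF assms(1), of f] L2on_cong_AE[OF assms(2)] by simp

lemma norm_root_finite: "norm_root p I < \<infinity> \<longleftrightarrow> I < \<infinity>"
  by (auto simp: norm_root_def less_top)

lemma W12_imp_weak_grad:
  fixes \<phi> :: "'a::euclidean_space \<Rightarrow> real"
  assumes U: "open U" and \<phi>: "\<phi> \<in> W12 U"
  obtains u g where "weak_grad U u g" "L2on U u < \<infinity>" "L2on U g < \<infinity>" "AE x in lborel. x \<in> U \<longrightarrow> \<phi> x = u x"
proof -
  have UL: "U \<in> sets lebesgue" using U by simp
  obtain G where G: "has_weak_gradient U \<phi> G" "Lq_norm 2 U G < \<infinity>" "Lq_norm 2 U \<phi> < \<infinity>"
    using \<phi> unfolding W12_def by blast
  obtain u g where ug: "weak_grad U u g" "AE x in lborel. x \<in> U \<longrightarrow> \<phi> x = u x" "AE x in lborel. x \<in> U \<longrightarrow> G x = g x"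
    using has_weak_gradient_borel[OF U G(1)] by blast
  have "L2on U u < \<infinity>" "L2on U g < \<infinity>"
    using G(2,3) unfolding Lq_norm_2_AE[OF UL ug(2)] Lq_norm_2_AE[OF UL ug(3)] norm_root_finite by blast+
  then show thesis using that ug(1,2) by blast
qed

lemma weak_grad_imp_W12:
  fixes \<psi> :: "'a::euclidean_space \<Rightarrow> real"
  assumes w: "weak_grad U u g" and fin: "L2on U u < \<infinity>" "L2on U g < \<infinity>"
    and eq: "AE x in lborel. x \<in> U \<longrightarrow> \<psi> x = u x"
  shows "\<psi> \<in> W12 U"
proof -
  note D = weak_gradD[OF w]
  have UL: "U \<in> sets lebesgue" using D(1) by simp
  have "has_weak_gradient U \<psi> g"
    using has_weak_gradient_transfer[OF D(1-3) eq, of g] w by simp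
  moreover have "\<psi> \<in> borel_measurable (lebesgue_on U)" by (rule measurable_lebesgue_on_AE[OF D(2) UL eq])
  moreover have "g \<in> borel_measurable (lebesgue_on U)" by (rule measurable_lebesgue_on_AE[OF D(3) UL]) simp
  moreover have "Lq_norm 2 U \<psi> < \<infinity>" "Lq_norm 2 U g < \<infinity>"
    using fin unfolding Lq_norm_2[OF UL] L2on_cong_AE[OF eq] norm_root_finite by auto
  ultimately show ?thesis unfolding W12_def by blast
qed

text \<open>\<open>wgrad\<close> is an arbitrary choice among weak gradients, so it can be
  identified only up to null sets, by their uniqueness.\<close>

lemma wgrad_AE:
  fixes \<psi> :: "'a::euclidean_space \<Rightarrow> real"
  assumes w: "weak_grad U u g" and eq: "AE x in lborel. x \<in> U \<longrightarrow> \<psi> x = u x"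
  shows "AE x in lborel. x \<in> U \<longrightarrow> wgrad U \<psi> x = g x"
proof -
  note D = weak_gradD[OF w]
  have "has_weak_gradient U \<psi> g" using has_weak_gradient_transfer[OF D(1-3) eq, of g] w by simp
  then have "has_weak_gradient U \<psi> (wgrad U \<psi>)" unfolding wgrad_def by (rule someI[of "has_weak_gradient U \<psi>"])
  then obtain u' g' where 1: "weak_grad U u' g'" "AE x in lborel. x \<in> U \<longrightarrow> \<psi> x = u' x"
    "AE x in lborel. x \<in> U \<longrightarrow> wgrad U \<psi> x = g' x"
    using has_weak_gradient_borel[OF D(1)] by blast
  have "AE x in lborel. x \<in> U \<longrightarrow> u' x = u x" using eq 1(2) by eventually_elim auto
  from weak_grad_unique_AE[OF 1(1) w this] 1(3) show ?thesis by eventually_elim auto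
qed

section \<open>From extensions of single functions to extension operators\<close>

text \<open>All that is required of a single extension v of u, in terms of Borel data and of
  integrals; when u is non-negative every clause survives the passage to the absolute value of v. As
  \<open>L2on\<close> is a square, C here bounds squares of gradient norms.\<close>

definition extension_bounds ::
  "'a::euclidean_space set \<Rightarrow> 'a set \<Rightarrow> 'i set \<Rightarrow> ('i \<Rightarrow> 'a set) \<Rightarrow> ('i \<Rightarrow> 'a set) \<Rightarrow> real
    \<Rightarrow> ('a \<Rightarrow> real) \<Rightarrow> ('a \<Rightarrow> 'a) \<Rightarrow> ('a \<Rightarrow> real) \<Rightarrow> ('a \<Rightarrow> 'a) \<Rightarrow> bool" where
  "extension_bounds V U I T A C u g v h \<longleftrightarrow>
     weak_grad V u g \<and> L2on V u < \<infinity> \<and> L2on V g < \<infinity> \<and> weak_grad U v h \<and> L2on U v < \<infinity> \<and> L2on U h < \<infinity> \<and>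
     (AE x in lborel. x \<in> V \<longrightarrow> v x = u x) \<and> L2on U h \<le> ennreal C * L2on V g \<and>
     (\<forall>n\<in>I. L2on (T n) h \<le> ennreal C * L2on (A n) g \<and>
       (\<forall>q\<ge>1. powr_int q (T n) v \<le>
          ennreal (C powr q) * powr_int q (A n) u) \<and>
       (\<forall>a\<ge>0. (AE x in lborel. x \<in> A n \<longrightarrow> \<bar>u x\<bar> \<le> a) \<longrightarrow> (AE x in lborel. x \<in> T n \<longrightarrow> \<bar>v x\<bar> \<le> C * a)))"

lemma extension_bounds_abs:
  assumes e: "extension_bounds V U I T A C u g v h" and nn: "AE x in lborel. x \<in> V \<longrightarrow> 0 \<le> u x"
  shows "extension_bounds V U I T A C u g (\<lambda>x. \<bar>v x\<bar>) (\<lambda>x. sgn (v x) *\<^sub>R h x)"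
proof -
  have eq: "AE x in lborel. x \<in> V \<longrightarrow> v x = u x" and w: "weak_grad U v h" using e unfolding extension_bounds_def by auto
  have 1: "L2on S (\<lambda>x. sgn (v x) *\<^sub>R h x) \<le> L2on S h" for S by (rule L2on_mono) (auto simp: sgn_if)
  have 2: "L2on S (\<lambda>x. \<bar>v x\<bar>) = L2on S v" for S by (rule L2on_cong) simp
  have 3: "theta_int \<Theta> S (\<lambda>x. \<bar>v x\<bar>) = theta_int \<Theta> S v" for \<Theta> S by (simp add: theta_int_def)
  have "AE x in lborel. x \<in> V \<longrightarrow> \<bar>v x\<bar> = u x" using eq nn by eventually_elim auto
  then show ?thesis
    using e weak_grad_abs[OF w] order_trans[OF 1] le_less_trans[OF 1]
    unfolding extension_bounds_def 2 3 abs_idempotent by blast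
qed

text \<open>\<open>A n\<close> will be the shell off the closed hole, where the estimates are
  available, and \<open>A' n\<close> the ball minus the open hole, which the theorem asks for;
  monotonicity of the norm in the set joins the two.\<close>

lemma extension_bounds_Lq:
  assumes e: "extension_bounds V U I T A C u g v h" and C: "1 \<le> C" and n: "n \<in> I" and q: "1 \<le> q"
    and S: "T n \<in> sets lebesgue" "T n \<subseteq> U" "A n \<in> sets lebesgue" "A n \<subseteq> V" "A n \<subseteq> A' n" "A' n \<in> sets lebesgue"
    and \<phi>: "AE x in lborel. x \<in> V \<longrightarrow> \<phi> x = u x" and \<psi>: "AE x in lborel. x \<in> U \<longrightarrow> \<psi> x = v x"
  shows "Lq_norm q (T n) \<psi> \<le> ennreal C * Lq_norm q (A' n) \<phi>"
proof -
  have v: "v \<in> borel_measurable borel" using e weak_gradD(2) unfolding extension_bounds_def by blast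
  have \<phi>A: "AE x in lborel. x \<in> A n \<longrightarrow> \<phi> x = u x" using \<phi> by eventually_elim (use S in auto)
  have \<psi>T: "AE x in lborel. x \<in> T n \<longrightarrow> \<psi> x = v x" using \<psi> by eventually_elim (use S in auto)
  show ?thesis
  proof (cases "q = \<infinity>")
    case True
    define E where "E = esssup (lebesgue_on (A' n)) (\<lambda>x. ennreal (norm (\<phi> x)))"
    have LE: "Lq_norm q (A' n) \<phi> = E" "Lq_norm q (T n) \<psi> = esssup (lebesgue_on (T n)) (\<lambda>x. ennreal (norm (\<psi> x)))"
      unfolding Lq_norm_def E_def using True by auto
    show ?thesis
    proof (cases "E = \<infinity>")
      case top: True
      then show ?thesis unfolding LE(1) using C by (simp add: ennreal_mult_top)
    next
      case False
      define a where "a = enn2real E"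
      have a: "E = ennreal a" "0 \<le> a" using False by (auto simp: a_def less_top)
      have "AE x in lebesgue_on (A' n). ennreal (norm (\<phi> x)) \<le> E" unfolding E_def by (rule esssup_AE)
      then have "AE x in lborel. x \<in> A' n \<longrightarrow> norm (\<phi> x) \<le> a"
        using a by (simp add: AE_lebesgue_on[OF S(6)])
      then have "AE x in lborel. x \<in> A n \<longrightarrow> \<bar>u x\<bar> \<le> a" using \<phi>A by eventually_elim (use S(5) in auto)
      then have "AE x in lborel. x \<in> T n \<longrightarrow> \<bar>v x\<bar> \<le> C * a"
        using e n a(2) unfolding extension_bounds_def by blast
      then have "AE x in lborel. x \<in> T n \<longrightarrow> ennreal (norm (\<psi> x)) \<le> ennreal (C * a)"
        using \<psi>T by eventually_elim (auto intro: ennreal_leI)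
      then have "AE x in lebesgue_on (T n). ennreal (norm (\<psi> x)) \<le> ennreal (C * a)"
        by (simp add: AE_lebesgue_on[OF S(1)])
      moreover have "\<psi> \<in> borel_measurable (lebesgue_on (T n))" by (rule measurable_lebesgue_on_AE[OF v S(1) \<psi>T])
      ultimately have "esssup (lebesgue_on (T n)) (\<lambda>x. ennreal (norm (\<psi> x))) \<le> ennreal (C * a)"
        by (intro esssup_I) auto
      then show ?thesis unfolding LE a(1) using C a(2) by (simp add: ennreal_mult)
    qed
  next
    case False
    then obtain p where p: "q = ereal p" "1 \<le> p" using q by (cases q) auto
    let ?T = "powr_int p"
    have "(\<integral>\<^sup>+x. ennreal (norm (\<psi> x) powr p) * indicator (T n) x \<partial>lborel) = ?T (T n) v"
      unfolding theta_int_def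
      by (rule nn_integral_cong_AE) (use \<psi>T in \<open>eventually_elim; auto simp: indicator_def\<close>)
    also have "\<dots> \<le> ennreal (C powr p) * ?T (A n) u" using e n p(2) unfolding extension_bounds_def by blast
    also have "?T (A n) u = (\<integral>\<^sup>+x. ennreal (norm (\<phi> x) powr p) * indicator (A n) x \<partial>lborel)"
      unfolding theta_int_def
      by (rule nn_integral_cong_AE) (use \<phi>A in \<open>eventually_elim; auto simp: indicator_def\<close>)
    also have "\<dots> \<le> (\<integral>\<^sup>+x. ennreal (norm (\<phi> x) powr p) * indicator (A' n) x \<partial>lborel)"
      by (rule nn_integral_mono) (use S(5) in \<open>auto simp: indicator_def\<close>)
    finally have "(\<integral>\<^sup>+x. ennreal (norm (\<psi> x) powr p) * indicator (T n) x \<partial>lborel)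
      \<le> ennreal (C powr p) * (\<integral>\<^sup>+x. ennreal (norm (\<phi> x) powr p) * indicator (A' n) x \<partial>lborel)"
      by (simp add: mult_left_mono)
    then show ?thesis
      unfolding p(1) Lq_norm_finite[OF S(1)] Lq_norm_finite[OF S(6)] by (rule norm_root_le) (use C p in auto)
  qed
qed

lemma extension_bounds_wgrad:
  assumes e: "extension_bounds V U I T A C u g v h" and C: "1 \<le> C"
    and \<phi>: "AE x in lborel. x \<in> V \<longrightarrow> \<phi> x = u x" and \<psi>: "AE x in lborel. x \<in> U \<longrightarrow> \<psi> x = v x"
  shows "Lq_norm 2 U (wgrad U \<psi>) \<le> ennreal C * Lq_norm 2 V (wgrad V \<phi>)"
    and "n \<in> I \<Longrightarrow> T n \<in> sets lebesgue \<Longrightarrow> T n \<subseteq> U \<Longrightarrow> A n \<subseteq> V \<Longrightarrow> A n \<subseteq> A' n \<Longrightarrow> A' n \<in> sets lebesgue \<Longrightarrow>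
      Lq_norm 2 (T n) (wgrad U \<psi>) \<le> ennreal C * Lq_norm 2 (A' n) (wgrad V \<phi>)"
proof -
  have w: "weak_grad V u g" "weak_grad U v h" using e unfolding extension_bounds_def by auto
  have gV: "AE x in lborel. x \<in> V \<longrightarrow> wgrad V \<phi> x = g x" by (rule wgrad_AE[OF w(1) \<phi>])
  have gU: "AE x in lborel. x \<in> U \<longrightarrow> wgrad U \<psi> x = h x" by (rule wgrad_AE[OF w(2) \<psi>])
  have L: "U \<in> sets lebesgue" "V \<in> sets lebesgue" using weak_gradD(1)[OF w(1)] weak_gradD(1)[OF w(2)] by auto
  have root: "norm_root 2 I \<le> ennreal C * norm_root 2 J" if "I \<le> ennreal C * J" for I J
  proof (rule norm_root_le)
    \<comment> \<open>A constant C for squares would give sqrt C for norms; as C \<le> C^2, it is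
      enough to keep C.\<close>
    have "C \<le> C powr 2" using C powr_mono[of 1 2 C] by simp
    then have "ennreal C * J \<le> ennreal (C powr 2) * J" by (intro mult_right_mono ennreal_leI) auto
    then show "I \<le> ennreal (C powr 2) * J" using that by (rule order_trans[rotated])
  qed (use C in auto)
  show "Lq_norm 2 U (wgrad U \<psi>) \<le> ennreal C * Lq_norm 2 V (wgrad V \<phi>)"
    unfolding Lq_norm_2_AE[OF L(1) gU] Lq_norm_2_AE[OF L(2) gV]
    by (rule root) (use e in \<open>auto simp: extension_bounds_def\<close>)
  assume n: "n \<in> I" and S: "T n \<in> sets lebesgue" "T n \<subseteq> U" "A n \<subseteq> V" "A n \<subseteq> A' n" "A' n \<in> sets lebesgue"
  have gT: "AE x in lborel. x \<in> T n \<longrightarrow> wgrad U \<psi> x = h x" using gU by eventually_elim (use S in auto)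
  have gA: "AE x in lborel. x \<in> A n \<longrightarrow> g x = wgrad V \<phi> x" using gV by eventually_elim (use S in auto)
  have "L2on (T n) h \<le> ennreal C * L2on (A n) g" using e n unfolding extension_bounds_def by blast
  also have "L2on (A n) g \<le> L2on (A' n) (wgrad V \<phi>)"
    unfolding L2on_cong_AE[OF gA] by (rule L2on_mono) (use S in auto)
  finally have "L2on (T n) h \<le> ennreal C * L2on (A' n) (wgrad V \<phi>)" by (simp add: mult_left_mono)
  then show "Lq_norm 2 (T n) (wgrad U \<psi>) \<le> ennreal C * Lq_norm 2 (A' n) (wgrad V \<phi>)"
    unfolding Lq_norm_2_AE[OF S(1) gT] Lq_norm_2[OF S(5)] by (rule root)
qed

text \<open>The chosen extension depends on \<open>\<phi>\<close> only through the predicate \<open>P \<phi>\<close>, hence only on the class of \<open>\<phi>\<close>.\<close>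

lemma operator_by_choice:
  fixes P :: "('a::euclidean_space \<Rightarrow> real) \<Rightarrow> ('a \<Rightarrow> real) \<Rightarrow> bool"
  assumes ex: "\<And>\<phi>. \<phi> \<in> X \<Longrightarrow> \<exists>\<psi>. P \<phi> \<psi>"
    and inv: "\<And>\<phi> \<phi>' \<psi>. AE x in lborel. x \<in> V \<longrightarrow> \<phi> x = \<phi>' x \<Longrightarrow> P \<phi> \<psi> \<Longrightarrow> P \<phi>' \<psi>"
      "\<And>\<phi> \<psi> \<psi>'. AE x in lborel. x \<in> U \<longrightarrow> \<psi> x = \<psi>' x \<Longrightarrow> P \<phi> \<psi> \<Longrightarrow> P \<phi> \<psi>'"
    and ext: "\<And>\<phi> \<psi>. P \<phi> \<psi> \<Longrightarrow> AE x in lborel. x \<in> V \<longrightarrow> \<psi> x = \<phi> x"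
    and PY: "\<And>\<phi> \<psi>. P \<phi> \<psi> \<Longrightarrow> \<psi> \<in> Y" and S: "U \<in> sets lebesgue" "V \<in> sets lebesgue"
  obtains E where "extension_operator V U X Y E" "\<And>\<phi>. \<phi> \<in> X \<Longrightarrow> P \<phi> (E \<phi>)"
proof -
  define R where "R \<phi> = (SOME \<psi>. P \<phi> \<psi>)" for \<phi>
  \<comment> \<open>Overwriting by \<phi> on \<open>V\<close> turns agreement almost everywhere into
    agreement at every point, as \<open>extension_operator\<close> demands.\<close>
  define E where "E \<phi> x = (if x \<in> V then \<phi> x else R \<phi> x)" for \<phi> x
  have R: "P \<phi> (R \<phi>)" if "\<phi> \<in> X" for \<phi> unfolding R_def using ex[OF that] by (rule someI_ex)
  have ER: "AE x in lborel. x \<in> U \<longrightarrow> R \<phi> x = E \<phi> x" if "\<phi> \<in> X" for \<phi>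
    using ext[OF R[OF that]] by eventually_elim (auto simp: E_def)
  have PE: "P \<phi> (E \<phi>)" if "\<phi> \<in> X" for \<phi> by (rule inv(2)[OF ER[OF that] R[OF that]])
  have "AE x in lborel. x \<in> U \<longrightarrow> E \<phi> x = E \<phi>' x"
    if X: "\<phi> \<in> X" "\<phi>' \<in> X" and eq: "AE x in lborel. x \<in> V \<longrightarrow> \<phi> x = \<phi>' x" for \<phi> \<phi>'
  proof -
    have eq': "AE x in lborel. x \<in> V \<longrightarrow> \<phi>' x = \<phi> x" using eq by eventually_elim auto
    have "P \<phi> = P \<phi>'" using inv(1)[OF eq] inv(1)[OF eq'] by blast
    then have "R \<phi> = R \<phi>'" by (simp add: R_def)
    then show ?thesis using ER[OF X(1)] ER[OF X(2)] by auto
  qed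
  then have "extension_operator V U X Y E"
    unfolding extension_operator_def AE_lebesgue_on[OF S(1)] AE_lebesgue_on[OF S(2)]
    using PY[OF PE] by (auto simp: E_def)
  then show thesis using that PE by blast
qed

section \<open>Perforated domains\<close>

text \<open>The height is the third chart coordinate minus \<gamma> of the first two. Its gradient
  is e 3 minus the partial derivatives of \<gamma> times e 1 and e 2, whence slope 1 along e 3 and
  the bound 1 + 2 |M|. A boundary point has height exactly 0: it is not in the open set S, yet S
  comes arbitrarily close to it.\<close>

lemma chart_graph_patch:
  assumes S: "open S" "p \<in> frontier S" and ch: "graph_chart S p r0 Q \<gamma>"
    and ck: "Ck_bounded_on 2 M (ball 0 r0) \<gamma>" and r: "0 < r" "r \<le> r0"
  shows "\<exists>n G G'. graph_patch S p r (1 + 2 * \<bar>M\<bar>) n G G'"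
proof -
  have Q: "orthogonal_transformation Q"
    and chart: "\<And>x. x \<in> ball p r0 \<Longrightarrow> x \<in> S \<longleftrightarrow> Q (x - p) $ 3 > \<gamma> (Q (x - p) $ 1, Q (x - p) $ 2)"
    using ch unfolding graph_chart_def by auto
  \<comment> \<open>The rows of \<open>Q\<close>: an orthonormal frame in which the chart
    coordinates become inner products.\<close>
  define e where "e i = inv Q (axis i 1)" for i :: 3
  have Qe: "Q (e i) = axis i 1" for i
    unfolding e_def using orthogonal_transformation_surj[OF Q] by (rule surj_f_inv_f)
  have comp: "Q z $ i = z \<bullet> e i" for z i
  proof -
    have "z \<bullet> e i = Q z \<bullet> Q (e i)" using Q by (simp add: orthogonal_transformation_def)
    then show ?thesis by (simp add: Qe inner_axis)
  qed
  have ee: "e i \<bullet> e j = axis i 1 $ j" for i j using comp[of "e i" j] by (simp add: Qe)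
  have ne: "norm (e i) = 1" for i by (simp add: norm_eq_sqrt_inner ee axis_def)
  have e31: "e 3 \<bullet> e 3 = 1" "e 3 \<bullet> e 1 = 0" "e 3 \<bullet> e 2 = 0" by (simp_all add: ee axis_def)
  define w where "w x = ((x - p) \<bullet> e 1, (x - p) \<bullet> e 2)" for x
  have w_le: "norm (w x) \<le> dist p x" for x
  proof (rule power2_le_imp_le)
    have "(norm (w x))\<^sup>2 = (Q (x - p) $ 1)\<^sup>2 + (Q (x - p) $ 2)\<^sup>2" by (simp add: w_def norm_Pair comp)
    also have "\<dots> \<le> Q (x - p) \<bullet> Q (x - p)" by (simp add: inner_vec_def sum_3 power2_eq_square)
    also have "\<dots> = (x - p) \<bullet> (x - p)" using Q by (simp add: orthogonal_transformation_def)
    also have "\<dots> = (norm (x - p))\<^sup>2" by (simp only: power2_norm_eq_inner)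
    also have "norm (x - p) = dist p x" by (simp add: dist_norm norm_minus_commute)
    finally show "(norm (w x))\<^sup>2 \<le> (dist p x)\<^sup>2" .
  qed simp
  have wr: "w x \<in> ball 0 r0" if "x \<in> ball p r" for x using w_le[of x] that r by auto
  obtain g where g: "\<And>z. z \<in> ball 0 r0 \<Longrightarrow> GDERIV \<gamma> z :> g z"
    and gb: "\<And>b. b \<in> Basis \<Longrightarrow> Ck_bounded_on (Suc 0) M (ball 0 r0) (\<lambda>z. g z \<bullet> b)"
    using ck unfolding numeral_2_eq_2 Ck_bounded_on.simps(2)[of "Suc 0"] by blast
  have comps: "continuous_on (ball 0 r0) (\<lambda>z. g z \<bullet> b) \<and> (\<forall>z\<in>ball 0 r0. \<bar>g z \<bullet> b\<bar> \<le> M)" if b: "b \<in> Basis" for b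
  proof -
    obtain k where k: "\<And>z. z \<in> ball 0 r0 \<Longrightarrow> GDERIV (\<lambda>z. g z \<bullet> b) z :> k z" and le: "\<forall>z\<in>ball 0 r0. \<bar>g z \<bullet> b\<bar> \<le> M"
      using gb[OF b] unfolding Ck_bounded_on.simps(2)[of 0] by blast
    have "\<forall>z\<in>ball 0 r0. isCont (\<lambda>z. g z \<bullet> b) z" using GDERIV_isCont[OF k] by blast
    then show ?thesis using le continuous_at_imp_continuous_on by blast
  qed
  have B: "(1, 0) \<in> (Basis :: (real \<times> real) set)" "(0, 1) \<in> (Basis :: (real \<times> real) set)"
    by (auto simp: Basis_prod_def)
  have c1: "continuous_on (ball 0 r0) (\<lambda>z. fst (g z))" "\<And>z. z \<in> ball 0 r0 \<Longrightarrow> \<bar>fst (g z)\<bar> \<le> \<bar>M\<bar>"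
    using comps[OF B(1)] by (auto simp: inner_prod_def) force
  have c2: "continuous_on (ball 0 r0) (\<lambda>z. snd (g z))" "\<And>z. z \<in> ball 0 r0 \<Longrightarrow> \<bar>snd (g z)\<bar> \<le> \<bar>M\<bar>"
    using comps[OF B(2)] by (auto simp: inner_prod_def) force
  define G0 where "G0 x = (x - p) \<bullet> e 3 - \<gamma> (w x)" for x
  define G0' where "G0' x = e 3 - fst (g (w x)) *\<^sub>R e 1 - snd (g (w x)) *\<^sub>R e 2" for x
  have GD: "GDERIV G0 x :> G0' x" if x: "x \<in> ball p r" for x
  proof -
    have wd: "(w has_derivative (\<lambda>h. (h \<bullet> e 1, h \<bullet> e 2))) (at x)"
      unfolding w_def by (auto intro!: derivative_eq_intros)
    have gd: "(\<gamma> has_derivative (\<lambda>h. h \<bullet> g (w x))) (at (w x))" using g[OF wr[OF x]] unfolding gderiv_def .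
    have 1: "((\<lambda>x. \<gamma> (w x)) has_derivative (\<lambda>h. (h \<bullet> e 1, h \<bullet> e 2) \<bullet> g (w x))) (at x)"
      by (rule has_derivative_compose[OF wd gd])
    have 2: "((\<lambda>x. (x - p) \<bullet> e 3) has_derivative (\<lambda>h. h \<bullet> e 3)) (at x)" by (auto intro!: derivative_eq_intros)
    have "(\<lambda>h. h \<bullet> e 3 - (h \<bullet> e 1, h \<bullet> e 2) \<bullet> g (w x)) = (\<lambda>h. h \<bullet> G0' x)"
      by (rule ext) (simp add: G0'_def inner_prod_def inner_diff_right mult.commute)
    then show ?thesis unfolding gderiv_def G0_def[abs_def] using has_derivative_diff[OF 2 1] by simp
  qed
  have wc: "continuous_on (ball p r) w" unfolding w_def by (intro continuous_intros)
  have G'c: "continuous_on (ball p r) G0'"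
    unfolding G0'_def
    by (intro continuous_intros continuous_on_compose2[OF c1(1) wc] continuous_on_compose2[OF c2(1) wc]) (use wr in auto)
  \<comment> \<open>Outside the planar disc \<gamma> is arbitrary; the value 0 off the ball yields
    Borel functions on the whole space.\<close>
  define G where "G x = (if x \<in> ball p r then G0 x else 0)" for x
  define G' where "G' x = (if x \<in> ball p r then G0' x else 0)" for x
  have C0: "C1_on (ball p r) G0 G0'" unfolding C1_on_def using GD G'c by auto
  have C1: "C1_on (ball p r) G G'"
    unfolding C1_on_def
  proof (intro conjI ballI)
    show "GDERIV G x :> G' x" if x: "x \<in> ball p r" for x
    proof -
      have "GDERIV G x :> G' x \<longleftrightarrow> GDERIV G0 x :> G' x"
        by (rule GDERIV_cong_open[OF open_ball x]) (simp add: G_def)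
      then show ?thesis using GD[OF x] x by (simp add: G'_def)
    qed
    show "continuous_on (ball p r) G'" by (rule continuous_on_eq[OF G'c]) (simp add: G'_def)
  qed auto
  have bm: "G \<in> borel_measurable borel" "G' \<in> borel_measurable borel"
    using weak_gradD(2,3)[OF C1_weak_grad[OF C0]] by (simp_all add: G_def[abs_def] G'_def[abs_def])
  have T_iff: "x \<in> S \<longleftrightarrow> 0 < G x" if x: "x \<in> ball p r" for x
  proof -
    have xr: "x \<in> ball p r0" using x r by auto
    show ?thesis using chart[OF xr] x by (simp add: G_def G0_def w_def comp)
  qed
  have pr: "p \<in> ball p r" using r by simp
  have "G p = 0"
  proof -
    have "p \<notin> S" using S by (simp add: frontier_def interior_open)
    then have "G p \<le> 0" using T_iff[OF pr] by simp
    moreover have "\<not> G p < 0"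
    proof
      assume neg: "G p < 0"
      have "open (ball p r \<inter> G -` {..<0})"
        using C1_onD(4)[OF C1] continuous_on_open_vimage[OF open_ball, of p r G] open_lessThan by (metis Int_commute)
      moreover have "p \<in> ball p r \<inter> G -` {..<0}" using pr neg by simp
      moreover have "p \<in> closure S" using S by (simp add: frontier_def)
      ultimately obtain y where "y \<in> S" "y \<in> ball p r \<inter> G -` {..<0}"
        unfolding closure_iff_nhds_not_empty by blast
      then show False using T_iff[of y] by auto
    qed
    ultimately show ?thesis by simp
  qed
  have nG: "norm (G' x) \<le> 1 + 2 * \<bar>M\<bar>" if x: "x \<in> ball p r" for x
  proof -
    have "norm (G0' x) \<le> norm (e 3) + norm (fst (g (w x)) *\<^sub>R e 1) + norm (snd (g (w x)) *\<^sub>R e 2)"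
      unfolding G0'_def by (intro order_trans[OF norm_triangle_ineq4] add_mono norm_triangle_ineq4 order_refl)
    also have "\<dots> \<le> 1 + \<bar>M\<bar> + \<bar>M\<bar>" using c1(2)[OF wr[OF x]] c2(2)[OF wr[OF x]] by (simp add: ne)
    finally show ?thesis using x by (simp add: G'_def)
  qed
  have sl: "e 3 \<bullet> G' x = 1" if x: "x \<in> ball p r" for x
    using x by (simp add: G'_def G0'_def inner_diff_right e31)
  have "graph_patch S p r (1 + 2 * \<bar>M\<bar>) (e 3) G G'"
    by (rule graph_patch.intro) (use C1 bm ne \<open>G p = 0\<close> r(1) sl nG T_iff in auto)
  then show ?thesis by blast
qed

text \<open>If the ball minus K split in two, the annulus beyond radius R1, connected in dimension
  at least 2, would lie in one part. The other part would then be confined to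
  \<open>cball a R1\<close>, and together with the rest of V it would separate V.\<close>

lemma connected_ball_Diff:
  fixes a :: "'a::euclidean_space"
  assumes dim: "2 \<le> DIM('a)" and con: "connected V" and op: "open V" and K: "closed K" "K \<subseteq> cball a R1"
    and R: "R1 < R2" and V: "V \<inter> ball a R2 = ball a R2 - K"
  shows "connected (ball a R2 - K)"
proof (rule ccontr)
  let ?W = "ball a R2 - K"
  assume "\<not> connected ?W"
  then obtain U1 U2 where U: "open U1" "open U2" "?W \<subseteq> U1 \<union> U2" "U1 \<inter> U2 \<inter> ?W = {}" "U1 \<inter> ?W \<noteq> {}" "U2 \<inter> ?W \<noteq> {}"
    unfolding connected_def by blast
  define A where "A = {x. R1 < norm (x - a) \<and> norm (x - a) < R2}"
  have Amem: "x \<in> A \<longleftrightarrow> x \<in> ball a R2 \<and> x \<notin> cball a R1" for x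
    by (auto simp: A_def dist_norm norm_minus_commute)
  have AW: "A \<subseteq> ?W" using K(2) Amem by blast
  have cA: "connected A" unfolding A_def by (rule connected_annulus(1)[OF dim])
  have opW: "open ?W" using K(1) by (intro open_Diff) auto
  \<comment> \<open>Stated for arbitrary labels, because the annulus may lie in either part.\<close>
  have key: False
    if U: "open U1" "open U2" "?W \<subseteq> U1 \<union> U2" "U1 \<inter> U2 \<inter> ?W = {}" "U1 \<inter> ?W \<noteq> {}" "U2 \<inter> ?W \<noteq> {}" and A: "A \<inter> U2 = {}" for U1 U2
  proof -
    let ?X = "(U1 \<inter> ?W) \<union> (V - cball a R1)" and ?Y = "U2 \<inter> ?W"
    have Y: "?Y \<subseteq> cball a R1" using A Amem by blast
    have "open ?X" "open ?Y" using U(1,2) opW op by (auto intro!: open_Un open_Int open_Diff)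
    moreover have "V \<subseteq> ?X \<union> ?Y"
    proof
      fix x assume x: "x \<in> V"
      show "x \<in> ?X \<union> ?Y"
      proof (cases "x \<in> cball a R1")
        case True
        then have "x \<in> ball a R2" using R by auto
        then have "x \<in> ?W" using x V by blast
        then show ?thesis using U(3) by blast
      qed (use x in blast)
    qed
    moreover have "?X \<inter> ?Y \<inter> V = {}" using U(4) Y by blast
    moreover have "?X \<inter> V \<noteq> {}" "?Y \<inter> V \<noteq> {}" using U(5,6) V by blast+
    ultimately show False using con connectedD[of V ?X ?Y] by blast
  qed
  have "U1 \<inter> A = {} \<or> U2 \<inter> A = {}"
    using connectedD[OF cA U(1,2)] U(3,4) AW by blast
  then show False
  proof
    assume "U1 \<inter> A = {}"
    then show False using key[OF U(2,1)] U(3-6) by (auto simp: Un_commute Int_ac)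
  next
    assume "U2 \<inter> A = {}"
    then show False using key[OF U] by (auto simp: Int_ac)
  qed
qed

section \<open>Dilation to the scale of a hole\<close>

lemma AE_affine:
  fixes a :: "'a::euclidean_space"
  assumes s: "0 < s" and P: "AE x in lborel. P x"
  shows "AE y in lborel. P (a + s *\<^sub>R y)"
proof -
  obtain Z where Z: "{x. \<not> P x} \<subseteq> Z" "emeasure lborel Z = 0" "Z \<in> sets borel"
    using P by (auto elim!: AE_E)
  note [measurable] = Z(3)
  have "ennreal (s ^ DIM('a)) * (\<integral>\<^sup>+y. indicator Z (a + s *\<^sub>R y) \<partial>lborel) = (\<integral>\<^sup>+x. indicator Z x \<partial>lborel)"
    by (rule nn_integral_affine[symmetric]) (use s in auto)
  also have "\<dots> = 0" using Z by simp
  finally have "(\<integral>\<^sup>+y. indicator Z (a + s *\<^sub>R y) \<partial>(lborel :: 'a measure)) = 0" using s by simp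
  then have "AE y in lborel. indicator Z (a + s *\<^sub>R y) = (0::ennreal)"
    by (subst (asm) nn_integral_0_iff_AE) auto
  then show ?thesis by eventually_elim (use Z(1) in \<open>auto simp: indicator_def split: if_splits\<close>)
qed

lemma L2on_affine:
  fixes u :: "'a::euclidean_space \<Rightarrow> 'b::euclidean_space"
  assumes [measurable]: "u \<in> borel_measurable borel" "S \<in> sets borel" and s: "0 < s"
  shows "L2on S u = ennreal (s ^ DIM('a)) * L2on ((\<lambda>y. a + s *\<^sub>R y) -` S) (\<lambda>y. u (a + s *\<^sub>R y))"
  unfolding L2on_def by (subst nn_integral_affine[OF _ s, of _ a]) (auto simp: indicator_def)

lemma theta_int_affine:
  fixes u :: "'a::euclidean_space \<Rightarrow> real"
  assumes [measurable]: "u \<in> borel_measurable borel" "S \<in> sets borel" "\<Theta> \<in> borel_measurable borel" and s: "0 < s"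
  shows "theta_int \<Theta> S u = ennreal (s ^ DIM('a)) * theta_int \<Theta> ((\<lambda>y. a + s *\<^sub>R y) -` S) (\<lambda>y. u (a + s *\<^sub>R y))"
  unfolding theta_int_def by (subst nn_integral_affine[OF _ s, of _ a]) (auto simp: indicator_def)

definition hole_bounds ::
  "real \<Rightarrow> 'a::euclidean_space set \<Rightarrow> 'a set \<Rightarrow> 'a set \<Rightarrow> ('a \<Rightarrow> real) \<Rightarrow> ('a \<Rightarrow> 'a) \<Rightarrow> ('a \<Rightarrow> real) \<Rightarrow> ('a \<Rightarrow> 'a) \<Rightarrow> bool" where
  "hole_bounds C B D K \<phi> g \<psi> h \<longleftrightarrow> weak_grad B \<psi> h \<and> (\<forall>x\<in>B - K. \<psi> x = \<phi> x) \<and>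
     L2on B h \<le> ennreal C * L2on (D - K) g \<and>
     (\<forall>q\<ge>1. powr_int q B \<psi> \<le>
        ennreal (C powr q) * powr_int q (B - K) \<phi>) \<and>
     (\<forall>a\<ge>0. (AE x in lborel. x \<in> B - K \<longrightarrow> \<bar>\<phi> x\<bar> \<le> a) \<longrightarrow> (AE x in lborel. x \<in> B \<longrightarrow> \<bar>\<psi> x\<bar> \<le> C * a))"

lemma scaled_hole_extension:
  fixes d r L :: real
  assumes d: "0 < d" and r: "0 < r" "r \<le> d / 2" and L: "1 \<le> L"
  obtains C :: real where "1 \<le> C" "\<And>T \<phi> g a s. 0 < s \<Longrightarrow> open T \<Longrightarrow> T \<subseteq> ball 0 d \<Longrightarrow>
    (\<And>p. p \<in> frontier T \<Longrightarrow> \<exists>n G G'. graph_patch T p r L n G G') \<Longrightarrow>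
    connected (ball a (3/2 * d * s) - closure ((\<lambda>y. a + s *\<^sub>R y) ` T)) \<Longrightarrow>
    weak_grad (ball a (2 * d * s) - closure ((\<lambda>y. a + s *\<^sub>R y) ` T)) \<phi> g \<Longrightarrow>
    L2on (ball a (2 * d * s) - closure ((\<lambda>y. a + s *\<^sub>R y) ` T)) \<phi> < \<infinity> \<Longrightarrow>
    L2on (ball a (2 * d * s) - closure ((\<lambda>y. a + s *\<^sub>R y) ` T)) g < \<infinity> \<Longrightarrow>
    \<exists>\<psi> h. hole_bounds C (ball a (3/2 * d * s)) (ball a (2 * d * s)) (closure ((\<lambda>y. a + s *\<^sub>R y) ` T)) \<phi> g \<psi> h"
proof -
  obtain C :: real where C1: "1 \<le> C" and C: "\<And>T \<phi> g. open T \<Longrightarrow> T \<subseteq> ball 0 d \<Longrightarrow>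
    (\<And>p. p \<in> frontier T \<Longrightarrow> \<exists>n G G'. graph_patch T p r L n G G') \<Longrightarrow>
    connected (ball 0 (3/2 * d) - closure T) \<Longrightarrow> weak_grad (ball 0 (2 * d) - closure T) \<phi> g \<Longrightarrow>
    L2on (ball 0 (2 * d) - closure T) \<phi> < \<infinity> \<Longrightarrow> L2on (ball 0 (2 * d) - closure T) g < \<infinity> \<Longrightarrow>
    \<exists>\<psi> h. hole_bounds C (ball 0 (3/2 * d)) (ball 0 (2 * d)) (closure T) \<phi> g \<psi> h"
    using hole_extension[OF assms] unfolding hole_bounds_def by blast
  show thesis
  proof (rule that[OF C1])
    fix T :: "(real^3) set" and \<phi> :: "real^3 \<Rightarrow> real" and g :: "real^3 \<Rightarrow> real^3" and a :: "real^3" and s :: real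
    assume s: "0 < s" and T: "open T" "T \<subseteq> ball 0 d"
      and gp: "\<And>p. p \<in> frontier T \<Longrightarrow> \<exists>n G G'. graph_patch T p r L n G G'"
    define f where "f y = a + s *\<^sub>R y" for y :: "real^3"
    \<comment> \<open>\<open>k\<close> is the inverse of the dilation \<open>f\<close>, written in
      the same affine form with other parameters, so that the same scaling lemmas serve both
      directions.\<close>
    define b where "b = - (1 / s) *\<^sub>R a"
    define k where "k x = b + (1 / s) *\<^sub>R x" for x :: "real^3"
    define K where "K = closure (f ` T)"
    let ?B = "ball a (3/2 * d * s)" and ?D = "ball a (2 * d * s)"
    let ?Bu = "ball (0::real^3) (3/2 * d)" and ?Du = "ball (0::real^3) (2 * d)"
    assume "connected (?B - closure ((\<lambda>y. a + s *\<^sub>R y) ` T))"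
      "weak_grad (?D - closure ((\<lambda>y. a + s *\<^sub>R y) ` T)) \<phi> g"
      "L2on (?D - closure ((\<lambda>y. a + s *\<^sub>R y) ` T)) \<phi> < \<infinity>"
      "L2on (?D - closure ((\<lambda>y. a + s *\<^sub>R y) ` T)) g < \<infinity>"
    then have con: "connected (?B - K)" and w: "weak_grad (?D - K) \<phi> g"
      and fin: "L2on (?D - K) \<phi> < \<infinity>" "L2on (?D - K) g < \<infinity>"
      by (simp_all add: K_def f_def[abs_def])
    note [measurable] = weak_gradD(2,3)[OF w]
    have KB[measurable]: "K \<in> sets borel" by (simp add: K_def)
    have fk: "f (k x) = x" and kf: "k (f x) = x" for x
      using s by (simp_all add: f_def k_def b_def scaleR_add_right scaleR_diff_right)
    have fball: "f -` ball a (\<rho> * s) = ball 0 \<rho>" for \<rho>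
    proof (rule set_eqI)
      fix y
      have "dist a (f y) = s * norm y" using s by (simp add: f_def dist_norm)
      then show "y \<in> f -` ball a (\<rho> * s) \<longleftrightarrow> y \<in> ball 0 \<rho>" using s by (simp add: mult.commute)
    qed
    have fK: "f -` K = closure T"
    proof -
      have fim: "f ` S = (+) a ` ((*\<^sub>R) s ` S)" for S by (simp add: f_def[abs_def] image_image)
      have "K = f ` closure T" unfolding K_def fim by (simp only: closure_translation closure_scaleR)
      moreover have "inj f" using kf by (metis injI)
      ultimately show ?thesis by (simp add: inj_vimage_image_eq)
    qed
    have vB: "f -` (?B - K) = ?Bu - closure T" and vD: "f -` (?D - K) = ?Du - closure T"
      by (simp_all only: vimage_Diff fball fK)
    have kball: "k -` ?Bu = ?B" unfolding fball[of "3/2 * d", symmetric] by (auto simp: fk)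
    have "?Bu - closure T = k ` (?B - K)" unfolding vB[symmetric] by (force simp: fk kf image_iff)
    moreover have "connected (k ` (?B - K))"
      by (rule connected_continuous_image[OF _ con]) (auto simp: k_def intro!: continuous_intros)
    ultimately have con0: "connected (?Bu - closure T)" by simp
    have w0: "weak_grad (?Du - closure T) (\<lambda>y. \<phi> (f y)) (\<lambda>y. s *\<^sub>R g (f y))"
      using weak_grad_affine[OF w s, of a] vD by (simp add: f_def[abs_def])
    have fm[measurable]: "f \<in> borel_measurable borel" "k \<in> borel_measurable borel" unfolding f_def k_def by auto
    have s3: "0 < s ^ 3" using s by simp
    have L2f: "L2on S u = ennreal (s ^ 3) * L2on (f -` S) (\<lambda>y. u (f y))"
      if "u \<in> borel_measurable borel" "S \<in> sets borel" for S and u :: "real^3 \<Rightarrow> 'c::euclidean_space"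
      using L2on_affine[OF that s, of a] by (simp add: f_def[abs_def])
    have thf: "powr_int q S u = ennreal (s ^ 3) * powr_int q (f -` S) (\<lambda>y. u (f y))"
      if "u \<in> borel_measurable borel" "S \<in> sets borel" for S and u :: "real^3 \<Rightarrow> real" and q
      using theta_int_affine[OF that _ s, of "\<lambda>t. ennreal (t powr q)" a] by (simp add: f_def[abs_def])
    have L2v: "L2on (f -` S) (\<lambda>y. u (f y)) < \<infinity>"
      if "L2on S u < \<infinity>" "u \<in> borel_measurable borel" "S \<in> sets borel" for S and u :: "real^3 \<Rightarrow> 'c::euclidean_space"
      using that(1) s3 unfolding L2f[OF that(2,3)] by (auto simp: ennreal_mult_less_top)
    have fin0: "L2on (?Du - closure T) (\<lambda>y. \<phi> (f y)) < \<infinity>" using L2v[OF fin(1)] unfolding vD by simp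
    have gs: "L2on (?Du - closure T) (\<lambda>y. s *\<^sub>R g (f y)) = ennreal (s\<^sup>2) * L2on (?Du - closure T) (\<lambda>y. g (f y))"
      by (rule L2on_cmult) auto
    have "L2on (?Du - closure T) (\<lambda>y. s *\<^sub>R g (f y)) < \<infinity>"
      using L2v[OF fin(2)] unfolding vD gs by (simp add: ennreal_mult_less_top)
    then obtain \<psi> h where \<psi>h: "hole_bounds C ?Bu ?Du (closure T) (\<lambda>y. \<phi> (f y)) (\<lambda>y. s *\<^sub>R g (f y)) \<psi> h"
      using C[OF T gp con0 w0 fin0] by blast
    then have wh: "weak_grad ?Bu \<psi> h" unfolding hole_bounds_def by blast
    note [measurable] = weak_gradD(2,3)[OF wh]
    have "weak_grad ?B (\<lambda>x. \<psi> (k x)) (\<lambda>x. (1 / s) *\<^sub>R h (k x))"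
      using weak_grad_affine[OF wh, of "1 / s" b] s kball by (simp add: k_def[abs_def])
    moreover have "\<psi> (k x) = \<phi> x" if "x \<in> ?B - K" for x
    proof -
      have "k x \<in> f -` (?B - K)" using that by (simp add: fk)
      then show ?thesis using \<psi>h unfolding vB hole_bounds_def by (simp add: fk)
    qed
    moreover have "L2on ?B (\<lambda>x. (1 / s) *\<^sub>R h (k x)) \<le> ennreal C * L2on (?D - K) g"
    proof -
      have "L2on ?B (\<lambda>x. (1 / s) *\<^sub>R h (k x)) = ennreal (s ^ 3) * L2on ?Bu (\<lambda>y. (1 / s) *\<^sub>R h y)"
      proof -
        have "(\<lambda>x. (1 / s) *\<^sub>R h (k x)) \<in> borel_measurable borel" "?B \<in> sets borel" by measurable
        from L2f[OF this] show ?thesis unfolding fball kf .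
      qed
      also have "\<dots> = ennreal (s ^ 3) * (ennreal ((1 / s)\<^sup>2) * L2on ?Bu h)" by (subst L2on_cmult) auto
      also have "\<dots> \<le> ennreal (s ^ 3) * (ennreal ((1 / s)\<^sup>2) * (ennreal C * (ennreal (s\<^sup>2) * L2on (?Du - closure T) (\<lambda>y. g (f y)))))"
        using \<psi>h unfolding hole_bounds_def gs by (intro mult_left_mono) auto
      also have "\<dots> = (ennreal ((1 / s)\<^sup>2) * ennreal (s\<^sup>2)) * (ennreal C * (ennreal (s ^ 3) * L2on (?Du - closure T) (\<lambda>y. g (f y))))"
        by (simp only: mult_ac)
      also have "ennreal ((1 / s)\<^sup>2) * ennreal (s\<^sup>2) = 1"
        using s by (simp add: power_divide flip: ennreal_mult)
      also have "ennreal (s ^ 3) * L2on (?Du - closure T) (\<lambda>y. g (f y)) = L2on (?D - K) g"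
        by (subst (2) L2f) (auto simp: vD)
      finally show ?thesis by simp
    qed
    moreover have "powr_int q ?B (\<lambda>x. \<psi> (k x)) \<le>
        ennreal (C powr q) * powr_int q (?B - K) \<phi>" if q: "1 \<le> q" for q
    proof -
      let ?\<Theta> = "powr_int q"
      have "?\<Theta> ?B (\<lambda>x. \<psi> (k x)) = ennreal (s ^ 3) * ?\<Theta> ?Bu \<psi>"
      proof -
        have "(\<lambda>x. \<psi> (k x)) \<in> borel_measurable borel" "?B \<in> sets borel" by measurable
        from thf[OF this] show ?thesis unfolding fball kf .
      qed
      also have "\<dots> \<le> ennreal (s ^ 3) * (ennreal (C powr q) * ?\<Theta> (?Bu - closure T) (\<lambda>y. \<phi> (f y)))"
        using \<psi>h q unfolding hole_bounds_def by (intro mult_left_mono) auto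
      also have "\<dots> = ennreal (C powr q) * (ennreal (s ^ 3) * ?\<Theta> (?Bu - closure T) (\<lambda>y. \<phi> (f y)))" by (simp only: mult_ac)
      also have "ennreal (s ^ 3) * ?\<Theta> (?Bu - closure T) (\<lambda>y. \<phi> (f y)) = ?\<Theta> (?B - K) \<phi>"
      proof -
        have "?B - K \<in> sets borel" by measurable
        from thf[OF weak_gradD(2)[OF w] this] show ?thesis unfolding vB by (rule sym)
      qed
      finally show ?thesis .
    qed
    moreover have "AE x in lborel. x \<in> ?B \<longrightarrow> \<bar>\<psi> (k x)\<bar> \<le> C * t"
      if t: "0 \<le> t" "AE x in lborel. x \<in> ?B - K \<longrightarrow> \<bar>\<phi> x\<bar> \<le> t" for t
    proof -
      have "AE y in lborel. f y \<in> ?B - K \<longrightarrow> \<bar>\<phi> (f y)\<bar> \<le> t" using AE_affine[OF s t(2), of a] by (simp add: f_def)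
      then have "AE y in lborel. y \<in> ?Bu - closure T \<longrightarrow> \<bar>\<phi> (f y)\<bar> \<le> t"
        by eventually_elim (use vB in blast)
      then have "AE y in lborel. y \<in> ?Bu \<longrightarrow> \<bar>\<psi> y\<bar> \<le> C * t" using \<psi>h t(1) unfolding hole_bounds_def by blast
      then have "AE x in lborel. k x \<in> ?Bu \<longrightarrow> \<bar>\<psi> (k x)\<bar> \<le> C * t"
        using AE_affine[of "1 / s" _ b] s unfolding k_def by simp
      then show ?thesis by eventually_elim (use kball in blast)
    qed
    ultimately show "\<exists>\<psi> h. hole_bounds C ?B ?D (closure ((\<lambda>y. a + s *\<^sub>R y) ` T)) \<phi> g \<psi> h"
      unfolding hole_bounds_def K_def f_def[abs_def] by blast
  qed
qed

section \<open>Gluing the extensions over all holes\<close>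

lemma L2on_UN_le:
  assumes "finite I" and [measurable]: "F \<in> borel_measurable borel" and "\<And>n. n \<in> I \<Longrightarrow> K n \<in> sets borel"
  shows "L2on (\<Union>n\<in>I. K n) F \<le> (\<Sum>n\<in>I. L2on (K n) F)"
  using assms(1,3)
proof (induction I)
  case empty
  then show ?case by (simp add: L2on_def)
next
  case (insert i I)
  have "L2on (\<Union>n\<in>insert i I. K n) F \<le> L2on (K i) F + L2on (\<Union>n\<in>I. K n) F"
    unfolding UN_insert by (rule L2on_Un) (use insert in auto)
  also have "\<dots> \<le> L2on (K i) F + (\<Sum>n\<in>I. L2on (K n) F)" using insert by (intro add_left_mono) auto
  finally show ?case using insert by simp
qed

lemma L2on_disjoint_sum_le:
  fixes A :: "'i \<Rightarrow> 'a::euclidean_space set"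
  assumes I: "finite I" and [measurable]: "F \<in> borel_measurable borel" and A: "\<And>n. n \<in> I \<Longrightarrow> A n \<in> sets borel"
    and dis: "disjoint_family_on A I" and sub: "\<And>n. n \<in> I \<Longrightarrow> A n \<subseteq> V"
  shows "(\<Sum>n\<in>I. L2on (A n) F) \<le> L2on V F"
proof -
  have "(\<Sum>n\<in>I. L2on (A n) F) = (\<integral>\<^sup>+x. (\<Sum>n\<in>I. ennreal ((norm (F x))\<^sup>2) * indicator (A n) x) \<partial>lborel)"
    unfolding L2on_def by (subst nn_integral_sum) (use A in auto)
  also have "\<dots> \<le> L2on V F"
    unfolding L2on_def
  proof (rule nn_integral_mono)
    fix x
    show "(\<Sum>n\<in>I. ennreal ((norm (F x))\<^sup>2) * indicator (A n) x) \<le> ennreal ((norm (F x))\<^sup>2) * indicator V x"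
    proof (cases "\<exists>m\<in>I. x \<in> A m")
      case True
      then obtain m where m: "m \<in> I" "x \<in> A m" by blast
      have "(\<Sum>n\<in>I. ennreal ((norm (F x))\<^sup>2) * indicator (A n) x) = (\<Sum>n\<in>I. if n = m then ennreal ((norm (F x))\<^sup>2) else 0)"
        using m dis by (intro sum.cong) (auto simp: indicator_def disjoint_family_on_def)
      also have "\<dots> = ennreal ((norm (F x))\<^sup>2)" using I m by simp
      finally show ?thesis using sub m by (auto simp: indicator_def)
    next
      case False
      then have "(\<Sum>n\<in>I. ennreal ((norm (F x))\<^sup>2) * indicator (A n) x) = (0::ennreal)"
        by (intro sum.neutral) (auto simp: indicator_def)
      then show ?thesis by simp
    qed
  qed
  finally show ?thesis .
qed

text \<open>The glued gradient \<open>H\<close> agrees with the local one on the shell only almost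
  everywhere, by uniqueness of weak gradients; weak differentiability of the glued function is then
  a local matter. In the global estimate V contributes 1 and the disjoint shells together at most C,
  hence the constant 1 + C.\<close>

lemma perforated_extension:
  fixes V U :: "'a::euclidean_space set" and C :: real
  assumes I: "finite I" and U: "open U" and V: "V = U - (\<Union>n\<in>I. K n)"
    and K: "\<And>n. n \<in> I \<Longrightarrow> closed (K n)" "\<And>n. n \<in> I \<Longrightarrow> T n \<subseteq> K n" "\<And>n. n \<in> I \<Longrightarrow> K n \<subseteq> B n"
    and BD: "\<And>n. n \<in> I \<Longrightarrow> open (B n)" "\<And>n. n \<in> I \<Longrightarrow> open (D n)" "\<And>n. n \<in> I \<Longrightarrow> B n \<subseteq> D n" "\<And>n. n \<in> I \<Longrightarrow> D n \<subseteq> U"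
    and dis: "disjoint_family_on D I"
    and w: "weak_grad V u g" and fin: "L2on V u < \<infinity>" "L2on V g < \<infinity>" and C: "1 \<le> C"
    and loc: "\<And>n. n \<in> I \<Longrightarrow> \<exists>\<psi> h. hole_bounds C (B n) (D n) (K n) u g \<psi> h"
  shows "\<exists>v h. extension_bounds V U I T (\<lambda>n. D n - K n) (1 + C) u g v h"
proof -
  obtain \<psi> h where hb: "\<And>n. n \<in> I \<Longrightarrow> hole_bounds C (B n) (D n) (K n) u g (\<psi> n) (h n)"
    using loc by metis
  have wB: "weak_grad (B n) (\<psi> n) (h n)" and eqB: "\<And>x. x \<in> B n - K n \<Longrightarrow> \<psi> n x = u x"
    and L2h: "L2on (B n) (h n) \<le> ennreal C * L2on (D n - K n) g"
    and th: "\<And>q. 1 \<le> q \<Longrightarrow> powr_int q (B n) (\<psi> n) \<le>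
        ennreal (C powr q) * powr_int q (B n - K n) u"
    and inf: "\<And>a. 0 \<le> a \<Longrightarrow> AE x in lborel. x \<in> B n - K n \<longrightarrow> \<bar>u x\<bar> \<le> a \<Longrightarrow> AE x in lborel. x \<in> B n \<longrightarrow> \<bar>\<psi> n x\<bar> \<le> C * a"
    if "n \<in> I" for n using hb[OF that] unfolding hole_bounds_def by blast+
  note wm[measurable] = weak_gradD(2,3)[OF w]
  have KB: "K n \<in> sets borel" "B n \<in> sets borel" "D n \<in> sets borel" if "n \<in> I" for n
    using K(1)[OF that] BD[OF that] by auto
  have VB[measurable]: "V \<in> sets borel" using weak_gradD(1)[OF w] by simp
  have uniq: "m = n" if "m \<in> I" "n \<in> I" "x \<in> D m" "x \<in> D n" for m n x
    using dis that unfolding disjoint_family_on_def by blast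
  have KD: "K n \<subseteq> D n" if "n \<in> I" for n using K(3) BD(3) that by blast
  have inV: "D n - K n \<subseteq> V" if n: "n \<in> I" for n
    using uniq[OF n] KD BD(4)[OF n] unfolding V by blast
  have BV: "B n - K n \<subseteq> V" "B n \<inter> V = B n - K n" if n: "n \<in> I" for n
    using inV[OF n] BD(3)[OF n] n unfolding V by blast+
  \<comment> \<open>At most one summand is non-zero because the closed holes are disjoint; writing
    it as a sum with indicators makes Borel measurability immediate.\<close>
  define v where "v x = (if x \<in> V then u x else (\<Sum>n\<in>I. indicator (K n) x * \<psi> n x))" for x
  define H where "H x = (if x \<in> V then g x else (\<Sum>n\<in>I. indicator (K n) x *\<^sub>R h n x))" for x
  have vB: "v x = \<psi> n x" and HB: "x \<notin> V \<Longrightarrow> H x = h n x" if n: "n \<in> I" and x: "x \<in> B n" for n x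
  proof -
    have nV: "x \<in> K n" if "x \<notin> V"
    proof -
      have "x \<in> U" "x \<in> D n" using x BD(3,4)[OF n] by auto
      then obtain m where "m \<in> I" "x \<in> K m" using \<open>x \<notin> V\<close> unfolding V by blast
      then show ?thesis using uniq[OF _ n, of m x] KD \<open>x \<in> D n\<close> by blast
    qed
    have ind: "x \<in> K m \<longleftrightarrow> m = n" if "x \<notin> V" "m \<in> I" for m
      using nV[OF that(1)] uniq[OF that(2) n, of x] KD[OF that(2)] KD[OF n] by blast
    show "v x = \<psi> n x"
    proof (cases "x \<in> V")
      case True
      then have "x \<in> B n - K n" using BV(2)[OF n] x by blast
      then show ?thesis using eqB[OF n] True by (simp add: v_def)
    next
      case False
      have "(\<Sum>m\<in>I. indicator (K m) x * \<psi> m x) = (\<Sum>m\<in>I. if m = n then \<psi> n x else 0)"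
        using ind[OF False] by (intro sum.cong) (auto simp: indicator_def)
      then show ?thesis using False I n by (simp add: v_def)
    qed
    show "H x = h n x" if nx: "x \<notin> V"
    proof -
      have "(\<Sum>m\<in>I. indicator (K m) x *\<^sub>R h m x) = (\<Sum>m\<in>I. if m = n then h n x else 0)"
        using ind[OF nx] by (intro sum.cong) (auto simp: indicator_def)
      then show ?thesis using nx I n by (simp add: H_def)
    qed
  qed
  have vm[measurable]: "v \<in> borel_measurable borel"
  proof -
    have "(\<lambda>x. \<Sum>n\<in>I. indicator (K n) x * \<psi> n x) \<in> borel_measurable borel"
      by (intro borel_measurable_sum borel_measurable_times borel_measurable_indicator KB) (use weak_gradD(2)[OF wB] in auto)
    then show ?thesis unfolding v_def by measurable
  qed
  have Hm[measurable]: "H \<in> borel_measurable borel"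
  proof -
    have "(\<lambda>x. \<Sum>n\<in>I. indicator (K n) x *\<^sub>R h n x) \<in> borel_measurable borel"
      by (intro borel_measurable_sum borel_measurable_scaleR borel_measurable_indicator KB) (use weak_gradD(3)[OF wB] in auto)
    then show ?thesis unfolding H_def by measurable
  qed
  have HAE: "AE x in lborel. x \<in> B n \<longrightarrow> H x = h n x" if n: "n \<in> I" for n
  proof -
    have op: "open (B n - K n)" using BD(1)[OF n] K(1)[OF n] by (rule open_Diff)
    have "AE x in lborel. x \<in> B n - K n \<longrightarrow> g x = h n x"
    proof (rule weak_grad_unique_AE)
      show "weak_grad (B n - K n) u g" by (rule weak_grad_subset[OF w op BV(1)[OF n]])
      show "weak_grad (B n - K n) (\<psi> n) (h n)" by (rule weak_grad_subset[OF wB[OF n] op]) auto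
      show "AE x in lborel. x \<in> B n - K n \<longrightarrow> u x = \<psi> n x" using eqB[OF n] by auto
    qed
    then show ?thesis
    proof eventually_elim
      case (elim x)
      then show ?case using HB[OF n, of x] BV(2)[OF n] by (cases "x \<in> V") (auto simp: H_def)
    qed
  qed
  have wU: "weak_grad U v H"
  proof (rule weak_grad_local[OF U vm Hm])
    fix x assume x: "x \<in> U"
    show "\<exists>N. x \<in> N \<and> weak_grad N v H"
    proof (cases "x \<in> V")
      case True
      have "weak_grad V v H" by (rule weak_grad_cong_AE[OF w vm Hm]) (simp add: v_def H_def)
      then show ?thesis using True by blast
    next
      case False
      then obtain n where n: "n \<in> I" "x \<in> B n" using x K(3) unfolding V by blast
      have "weak_grad (B n) v H"
        by (rule weak_grad_cong_AE[OF wB[OF n(1)] vm Hm])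
          (use HAE[OF n(1)] in \<open>eventually_elim; use vB[OF n(1)] in auto\<close>)
      then show ?thesis using n(2) by blast
    qed
  qed
  have L2H: "L2on S H \<le> ennreal C * L2on (D n - K n) g" if n: "n \<in> I" and S: "S \<subseteq> B n" for n S
  proof -
    have "L2on S H \<le> L2on (B n) H" by (rule L2on_mono) (use S in auto)
    also have "\<dots> = L2on (B n) (h n)" by (rule L2on_cong_AE[OF HAE[OF n]])
    also have "\<dots> \<le> ennreal C * L2on (D n - K n) g" by (rule L2h[OF n])
    finally show ?thesis .
  qed
  have thv: "powr_int q S v \<le> ennreal (C powr q) * powr_int q (D n - K n) u"
    if n: "n \<in> I" and S: "S \<subseteq> B n" and q: "1 \<le> q" for n S q
  proof -
    have "powr_int q S v \<le> powr_int q (B n) (\<psi> n)"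
      unfolding theta_int_def by (rule nn_integral_mono) (use S vB[OF n] in \<open>auto simp: indicator_def\<close>)
    also have "\<dots> \<le> ennreal (C powr q) * powr_int q (B n - K n) u" by (rule th[OF n q])
    also have "\<dots> \<le> ennreal (C powr q) * powr_int q (D n - K n) u"
      unfolding theta_int_def
      by (intro mult_left_mono nn_integral_mono) (use BD(3)[OF n] in \<open>auto simp: indicator_def\<close>)
    finally show ?thesis .
  qed
  have split: "L2on U F \<le> L2on V F + (\<Sum>n\<in>I. L2on (K n) F)" if [measurable]: "F \<in> borel_measurable borel"
    for F :: "'a \<Rightarrow> 'c::euclidean_space"
  proof -
    have "L2on U F \<le> L2on (V \<union> (\<Union>n\<in>I. K n)) F" by (rule L2on_mono) (auto simp: V)
    also have "\<dots> \<le> L2on V F + L2on (\<Union>n\<in>I. K n) F" by (rule L2on_Un) (use I KB in auto)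
    also have "\<dots> \<le> L2on V F + (\<Sum>n\<in>I. L2on (K n) F)" by (intro add_left_mono L2on_UN_le I that KB)
    finally show ?thesis .
  qed
  have HV: "L2on V H = L2on V g" "L2on V v = L2on V u" by (rule L2on_cong, simp add: H_def v_def)+
  have glob: "L2on U H \<le> ennreal (1 + C) * L2on V g"
  proof -
    have "L2on U H \<le> L2on V g + (\<Sum>n\<in>I. L2on (K n) H)" using split[OF Hm] unfolding HV .
    also have "\<dots> \<le> L2on V g + (\<Sum>n\<in>I. ennreal C * L2on (D n - K n) g)"
      by (intro add_left_mono sum_mono L2H K(3))
    also have "\<dots> = L2on V g + ennreal C * (\<Sum>n\<in>I. L2on (D n - K n) g)" by (simp add: sum_distrib_left)
    also have "\<dots> \<le> L2on V g + ennreal C * L2on V g"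
    proof (intro add_left_mono mult_left_mono L2on_disjoint_sum_le)
      show "disjoint_family_on (\<lambda>n. D n - K n) I" using dis unfolding disjoint_family_on_def by blast
    qed (use I KB inV in auto)
    also have "\<dots> = ennreal (1 + C) * L2on V g" using C by (simp add: ennreal_plus distrib_right)
    finally show ?thesis .
  qed
  have finv: "L2on U v < \<infinity>"
  proof -
    have "L2on (K n) v < \<infinity>" if n: "n \<in> I" for n
    proof -
      have "L2on (K n) v \<le> ennreal (C powr 2) * L2on (D n - K n) u"
        using thv[OF n K(3)[OF n], of 2] by (simp add: theta_int_powr_2)
      also have "L2on (D n - K n) u \<le> L2on V u" by (rule L2on_mono) (use inV[OF n] in auto)
      finally have "L2on (K n) v \<le> ennreal (C powr 2) * L2on V u" by (simp add: mult_left_mono)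
      then show ?thesis by (rule le_less_trans) (use fin(1) in \<open>simp add: ennreal_mult_less_top\<close>)
    qed
    then have "L2on V u + (\<Sum>n\<in>I. L2on (K n) v) < \<infinity>" using fin(1) I by simp
    then show ?thesis using split[OF vm] unfolding HV by (rule le_less_trans[rotated])
  qed
  have finH: "L2on U H < \<infinity>" using glob by (rule le_less_trans) (use fin(2) in \<open>simp add: ennreal_mult_less_top\<close>)
  have TB: "T n \<subseteq> B n" if "n \<in> I" for n using K(2,3) that by blast
  have "extension_bounds V U I T (\<lambda>n. D n - K n) (1 + C) u g v H"
    unfolding extension_bounds_def
  proof (intro conjI ballI allI impI)
    fix n assume n: "n \<in> I"
    show "L2on (T n) H \<le> ennreal (1 + C) * L2on (D n - K n) g"
      by (rule order_trans[OF L2H[OF n TB[OF n]]]) (use C in \<open>intro mult_right_mono ennreal_leI; simp\<close>)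
    show "powr_int q (T n) v \<le> ennreal ((1 + C) powr q) * powr_int q (D n - K n) u"
      if "1 \<le> q" for q
      by (rule order_trans[OF thv[OF n TB[OF n] that]])
        (use C that in \<open>intro mult_right_mono ennreal_leI powr_mono2; simp\<close>)
    fix a :: real assume a: "0 \<le> a" "AE x in lborel. x \<in> D n - K n \<longrightarrow> \<bar>u x\<bar> \<le> a"
    have "AE x in lborel. x \<in> B n - K n \<longrightarrow> \<bar>u x\<bar> \<le> a" using a(2) by eventually_elim (use BD(3)[OF n] in auto)
    from inf[OF n a(1) this] show "AE x in lborel. x \<in> T n \<longrightarrow> \<bar>v x\<bar> \<le> (1 + C) * a"
    proof eventually_elim
      case (elim x)
      show ?case
      proof
        assume "x \<in> T n"
        then have x: "x \<in> B n" using TB[OF n] by auto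
        then have "\<bar>v x\<bar> \<le> C * a" using elim vB[OF n x] by simp
        also have "\<dots> \<le> (1 + C) * a" using a(1) by (intro mult_right_mono) auto
        finally show "\<bar>v x\<bar> \<le> (1 + C) * a" .
      qed
    qed
  qed (use w fin wU finv finH glob in \<open>auto simp: v_def\<close>)
  then show ?thesis by blast
qed

section \<open>The extension operators on perforated domains\<close>

theorem lemma4p1:
  fixes \<Omega> :: "(real^3) set"
    and \<alpha> \<epsilon>\<^sub>0 \<delta>\<^sub>0 \<delta>\<^sub>1 \<delta>\<^sub>2 :: real
    and N :: "real \<Rightarrow> nat"
    and x :: "nat \<Rightarrow> real \<Rightarrow> real^3"
    and T0 :: "nat \<Rightarrow> (real^3) set"
  defines "T \<equiv> hole x \<alpha> T0"
    and "\<Omega>p \<equiv> perforated \<Omega> N x \<alpha> T0"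
    and "B \<equiv> (\<lambda>n \<epsilon>. ball (x n \<epsilon>) (2 * \<delta>\<^sub>0 * \<epsilon> powr \<alpha>))"
  assumes "bounded \<Omega>" and "C2_domain \<Omega>"
    and "\<alpha> \<ge> 1" and "\<epsilon>\<^sub>0 > 0" and "\<delta>\<^sub>0 > 0" and "\<delta>\<^sub>1 > 0" and "\<delta>\<^sub>2 > 0"
    and "uniformly_C2_domains {1..} T0"
    and "\<And>\<epsilon> n. 0 < \<epsilon> \<Longrightarrow> \<epsilon> < \<epsilon>\<^sub>0 \<Longrightarrow> n \<in> {1..N \<epsilon>} \<Longrightarrow>
           T n \<epsilon> \<subseteq> ball (x n \<epsilon>) (\<delta>\<^sub>0 * \<epsilon> powr \<alpha>) \<and>
           ball (x n \<epsilon>) (\<delta>\<^sub>0 * \<epsilon> powr \<alpha>) \<subseteq> B n \<epsilon> \<and>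
           B n \<epsilon> \<subseteq> ball (x n \<epsilon>) (\<delta>\<^sub>1 * \<epsilon>) \<and>
           ball (x n \<epsilon>) (\<delta>\<^sub>1 * \<epsilon>) \<subseteq> ball (x n \<epsilon>) (\<delta>\<^sub>2 * \<epsilon>) \<and>
           ball (x n \<epsilon>) (\<delta>\<^sub>2 * \<epsilon>) \<subseteq> \<Omega>"
    and "\<And>\<epsilon>. 0 < \<epsilon> \<Longrightarrow> \<epsilon> < \<epsilon>\<^sub>0 \<Longrightarrow>
           disjoint_family_on (\<lambda>n. ball (x n \<epsilon>) (\<delta>\<^sub>2 * \<epsilon>)) {1..N \<epsilon>}"
    and "\<And>\<epsilon>. 0 < \<epsilon> \<Longrightarrow> \<epsilon> < \<epsilon>\<^sub>0 \<Longrightarrow> connected (\<Omega>p \<epsilon>)"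
  shows "\<exists>C::real. C > 0 \<and> (\<forall>\<epsilon>. 0 < \<epsilon> \<and> \<epsilon> < \<epsilon>\<^sub>0 \<longrightarrow>
    (\<exists>E. extension_operator (\<Omega>p \<epsilon>) \<Omega> (W12 (\<Omega>p \<epsilon>)) (W12 \<Omega>) E \<and>
      (\<forall>\<phi>\<in>W12 (\<Omega>p \<epsilon>).
        (\<forall>n\<in>{1..N \<epsilon>}.
          Lq_norm 2 (T n \<epsilon>) (wgrad \<Omega> (E \<phi>))
            \<le> ennreal C * Lq_norm 2 (B n \<epsilon> - T n \<epsilon>) (wgrad (\<Omega>p \<epsilon>) \<phi>)) \<and>
        Lq_norm 2 \<Omega> (wgrad \<Omega> (E \<phi>)) \<le> ennreal C * Lq_norm 2 (\<Omega>p \<epsilon>) (wgrad (\<Omega>p \<epsilon>) \<phi>) \<and>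
        (\<forall>n\<in>{1..N \<epsilon>}. \<forall>q::ereal. 1 \<le> q \<longrightarrow>
          Lq_norm q (T n \<epsilon>) (E \<phi>) \<le> ennreal C * Lq_norm q (B n \<epsilon> - T n \<epsilon>) \<phi>))) \<and>
    (\<exists>E. extension_operator (\<Omega>p \<epsilon>) \<Omega> (W12_nonneg (\<Omega>p \<epsilon>)) (W12_nonneg \<Omega>) E \<and>
      (\<forall>\<phi>\<in>W12_nonneg (\<Omega>p \<epsilon>).
        (\<forall>n\<in>{1..N \<epsilon>}.
          Lq_norm 2 (T n \<epsilon>) (wgrad \<Omega> (E \<phi>))
            \<le> ennreal C * Lq_norm 2 (B n \<epsilon> - T n \<epsilon>) (wgrad (\<Omega>p \<epsilon>) \<phi>)) \<and>
        Lq_norm 2 \<Omega> (wgrad \<Omega> (E \<phi>)) \<le> ennreal C * Lq_norm 2 (\<Omega>p \<epsilon>) (wgrad (\<Omega>p \<epsilon>) \<phi>) \<and>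
        (\<forall>n\<in>{1..N \<epsilon>}. \<forall>q::ereal. 1 \<le> q \<longrightarrow>
          Lq_norm q (T n \<epsilon>) (E \<phi>) \<le> ennreal C * Lq_norm q (B n \<epsilon> - T n \<epsilon>) \<phi>))))"
proof -
  have d: "\<delta>\<^sub>0 > 0" and C2: "uniformly_C2_domains {1..} T0" and \<Omega>op: "open \<Omega>"
    using assms(5,8,11) by (auto simp: C2_domain_def)
  have geo: "T n \<epsilon> \<subseteq> ball (x n \<epsilon>) (\<delta>\<^sub>0 * \<epsilon> powr \<alpha>)" "B n \<epsilon> \<subseteq> ball (x n \<epsilon>) (\<delta>\<^sub>2 * \<epsilon>)" "B n \<epsilon> \<subseteq> \<Omega>"
    if "0 < \<epsilon>" "\<epsilon> < \<epsilon>\<^sub>0" "n \<in> {1..N \<epsilon>}" for \<epsilon> n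
    using assms(12)[OF that] by blast+
  obtain r0 M where r0: "0 < r0"
    and charts: "\<And>n p. n \<in> {1..} \<Longrightarrow> p \<in> frontier (T0 n) \<Longrightarrow>
      \<exists>Q \<gamma>. graph_chart (T0 n) p r0 Q \<gamma> \<and> Ck_bounded_on 2 M (ball 0 r0) \<gamma>"
    using C2 unfolding uniformly_C2_domains_def by blast
  have T0op: "open (T0 n)" if "n \<in> {1..}" for n
    using C2 that unfolding uniformly_C2_domains_def C2_domain_def by blast
  \<comment> \<open>Charts may be shrunk, and a size of at most half of
    \<open>\<delta>\<^sub>0\<close> keeps the chart balls about boundary points within radius 3/2
    \<open>\<delta>\<^sub>0\<close>.\<close>
  define r where "r = min r0 (\<delta>\<^sub>0 / 2)"
  define L where "L = 1 + 2 * \<bar>M\<bar>"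
  have r: "0 < r" "r \<le> \<delta>\<^sub>0 / 2" "r \<le> r0" and L: "1 \<le> L" using r0 d by (auto simp: r_def L_def)
  have patches: "\<exists>m G G'. graph_patch (T0 n) p r L m G G'" if n: "n \<in> {1..}" and p: "p \<in> frontier (T0 n)" for n p
  proof -
    obtain Q \<gamma> where "graph_chart (T0 n) p r0 Q \<gamma>" "Ck_bounded_on 2 M (ball 0 r0) \<gamma>" using charts[OF n p] by blast
    then show ?thesis unfolding L_def by (rule chart_graph_patch[OF T0op[OF n] p _ _ r(1,3)])
  qed
  obtain C :: real where C1: "1 \<le> C" and C: "\<And>T \<phi> g a s. 0 < s \<Longrightarrow> open T \<Longrightarrow> T \<subseteq> ball 0 \<delta>\<^sub>0 \<Longrightarrow>
    (\<And>p. p \<in> frontier T \<Longrightarrow> \<exists>n G G'. graph_patch T p r L n G G') \<Longrightarrow>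
    connected (ball a (3/2 * \<delta>\<^sub>0 * s) - closure ((\<lambda>y. a + s *\<^sub>R y) ` T)) \<Longrightarrow>
    weak_grad (ball a (2 * \<delta>\<^sub>0 * s) - closure ((\<lambda>y. a + s *\<^sub>R y) ` T)) \<phi> g \<Longrightarrow>
    L2on (ball a (2 * \<delta>\<^sub>0 * s) - closure ((\<lambda>y. a + s *\<^sub>R y) ` T)) \<phi> < \<infinity> \<Longrightarrow>
    L2on (ball a (2 * \<delta>\<^sub>0 * s) - closure ((\<lambda>y. a + s *\<^sub>R y) ` T)) g < \<infinity> \<Longrightarrow>
    \<exists>\<psi> h. hole_bounds C (ball a (3/2 * \<delta>\<^sub>0 * s)) (ball a (2 * \<delta>\<^sub>0 * s)) (closure ((\<lambda>y. a + s *\<^sub>R y) ` T)) \<phi> g \<psi> h"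
    by (rule scaled_hole_extension[OF d r(1,2) L]) blast
  show ?thesis
  \<comment> \<open>The constant after gluing. It serves both operators, since passing to absolute
    values increases none of the norms.\<close>
  proof (intro exI[of _ "1 + C"] conjI allI impI; (elim conjE)?)
    show "0 < 1 + C" using C1 by simp
    fix \<epsilon> assume \<epsilon>: "0 < \<epsilon>" "\<epsilon> < \<epsilon>\<^sub>0"
    define s where "s = \<epsilon> powr \<alpha>"
    define I where "I = {1..N \<epsilon>}"
    define V where "V = \<Omega>p \<epsilon>"
    define K where "K n = closure (T n \<epsilon>)" for n
    define W where "W n = ball (x n \<epsilon>) (3/2 * \<delta>\<^sub>0 * s)" for n
    define D where "D n = B n \<epsilon>" for n
    have s: "0 < s" using \<epsilon> by (simp add: s_def)
    have Teq: "T n \<epsilon> = (\<lambda>y. x n \<epsilon> + s *\<^sub>R y) ` T0 n" for n by (simp add: T_def hole_def s_def)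
    have Deq: "D n = ball (x n \<epsilon>) (2 * \<delta>\<^sub>0 * s)" for n by (simp add: D_def B_def s_def)
    have Veq: "V = \<Omega> - (\<Union>n\<in>I. K n)" by (simp add: V_def \<Omega>p_def perforated_def K_def I_def T_def)
    have I: "finite I" by (simp add: I_def)
    have Top: "open (T n \<epsilon>)" if "n \<in> I" for n
      unfolding Teq by (rule open_affinity) (use that T0op s in \<open>auto simp: I_def\<close>)
    have T0d: "T0 n \<subseteq> ball 0 \<delta>\<^sub>0" if n: "n \<in> I" for n
    proof
      fix y assume "y \<in> T0 n"
      then have "x n \<epsilon> + s *\<^sub>R y \<in> ball (x n \<epsilon>) (\<delta>\<^sub>0 * s)"
        using geo(1)[OF \<epsilon>] n unfolding Teq I_def s_def[symmetric] by blast
      then have "s * norm y < s * \<delta>\<^sub>0" using s by (simp add: dist_norm mult.commute)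
      then show "y \<in> ball 0 \<delta>\<^sub>0" using s by simp
    qed
    have Kc: "closed (K n)" "T n \<epsilon> \<subseteq> K n" for n by (auto simp: K_def closure_subset)
    have Kcb: "K n \<subseteq> cball (x n \<epsilon>) (\<delta>\<^sub>0 * s)" if n: "n \<in> I" for n
      unfolding K_def using geo(1)[OF \<epsilon>, of n] n
      by (intro closure_minimal) (auto simp: I_def s_def)
    have rad: "\<delta>\<^sub>0 * s < 3/2 * \<delta>\<^sub>0 * s" "3/2 * \<delta>\<^sub>0 * s \<le> 2 * \<delta>\<^sub>0 * s" using d s by auto
    have KW: "K n \<subseteq> W n" if "n \<in> I" for n
      using Kcb[OF that] rad(1) unfolding W_def by auto
    have WD: "W n \<subseteq> D n" for n unfolding W_def Deq by (rule subset_ball[OF rad(2)])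
    have DO: "D n \<subseteq> \<Omega>" if "n \<in> I" for n using geo(3)[OF \<epsilon>] that by (simp add: D_def I_def)
    have opWD: "open (W n)" "open (D n)" for n by (simp_all add: W_def Deq)
    have dis: "disjoint_family_on D I"
    proof -
      have "D n \<subseteq> ball (x n \<epsilon>) (\<delta>\<^sub>2 * \<epsilon>)" if "n \<in> I" for n using geo(2)[OF \<epsilon>] that by (simp add: D_def I_def)
      then show ?thesis using assms(13)[OF \<epsilon>] unfolding disjoint_family_on_def I_def by blast
    qed
    have Vop: "open V" unfolding Veq using \<Omega>op Kc(1) I by (intro open_Diff closed_UN) auto
    have Vcon: "connected V" unfolding V_def by (rule assms(14)[OF \<epsilon>])
    have VO: "V \<subseteq> \<Omega>" unfolding Veq by blast
    \<comment> \<open>Disjointness of the larger balls keeps every other hole out of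
      \<open>D n\<close>, so that inside it removing all holes amounts to removing the n-th
      alone.\<close>
    have DK: "D n \<inter> V = D n - K n" if n: "n \<in> I" for n
    proof -
      have "m = n" if "m \<in> I" "y \<in> K m" "y \<in> D n" for m y
        using dis KW[OF that(1)] WD[of m] that n unfolding disjoint_family_on_def by blast
      then show ?thesis using DO[OF n] n unfolding Veq by blast
    qed
    have DKV: "D n - K n \<subseteq> V" if "n \<in> I" for n using DK[OF that] by blast
    have Wcon: "connected (W n - K n)" if n: "n \<in> I" for n
      unfolding W_def
    proof (rule connected_ball_Diff[OF _ Vcon Vop Kc(1) Kcb[OF n] rad(1)])
      show "V \<inter> ball (x n \<epsilon>) (3/2 * \<delta>\<^sub>0 * s) = ball (x n \<epsilon>) (3/2 * \<delta>\<^sub>0 * s) - K n"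
        using DK[OF n] WD[of n] unfolding W_def by blast
    qed simp
    have ex: "\<exists>v h. extension_bounds V \<Omega> I (\<lambda>n. T n \<epsilon>) (\<lambda>n. D n - K n) (1 + C) u g v h"
      if w: "weak_grad V u g" and fin: "L2on V u < \<infinity>" "L2on V g < \<infinity>" for u g
    proof (rule perforated_extension[OF I \<Omega>op Veq Kc(1) Kc(2) KW opWD(1) opWD(2) WD DO dis w fin C1])
      fix n assume n: "n \<in> I"
      have n1: "n \<in> {1..}" using n by (simp add: I_def)
      have "weak_grad (D n - K n) u g"
        by (rule weak_grad_subset[OF w _ DKV[OF n]]) (use opWD(2) Kc(1) in \<open>auto intro: open_Diff\<close>)
      moreover have "L2on (D n - K n) u \<le> L2on V u" "L2on (D n - K n) g \<le> L2on V g"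
        by (rule L2on_mono; use DKV[OF n] in auto)+
      then have "L2on (D n - K n) u < \<infinity>" "L2on (D n - K n) g < \<infinity>" using fin by (auto intro: le_less_trans)
      ultimately show "\<exists>\<psi> h. hole_bounds C (W n) (D n) (K n) u g \<psi> h"
        using C[OF s T0op[OF n1] T0d[OF n] patches[OF n1], of "x n \<epsilon>" u g] Wcon[OF n]
        unfolding W_def Deq K_def Teq by blast
    qed
    \<comment> \<open>Formulated through representatives u and v, so that it is invariant under
      changes on null sets in both arguments, as \<open>operator_by_choice\<close> requires.\<close>
    define P where "P \<phi> \<psi> \<longleftrightarrow> (\<exists>u g v h. extension_bounds V \<Omega> I (\<lambda>n. T n \<epsilon>) (\<lambda>n. D n - K n) (1 + C) u g v h \<and>
      (AE y in lborel. y \<in> V \<longrightarrow> \<phi> y = u y) \<and> (AE y in lborel. y \<in> \<Omega> \<longrightarrow> \<psi> y = v y))" for \<phi> \<psi>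
    have VL: "V \<in> sets lebesgue" "\<Omega> \<in> sets lebesgue" using Vop \<Omega>op by auto
    have Pinv: "P \<phi>' \<psi>'" if "P \<phi> \<psi>" and eq: "AE y in lborel. y \<in> V \<longrightarrow> \<phi> y = \<phi>' y" "AE y in lborel. y \<in> \<Omega> \<longrightarrow> \<psi> y = \<psi>' y"
      for \<phi> \<phi>' \<psi> \<psi>'
    proof -
      obtain u g v h where e: "extension_bounds V \<Omega> I (\<lambda>n. T n \<epsilon>) (\<lambda>n. D n - K n) (1 + C) u g v h"
        and 1: "AE y in lborel. y \<in> V \<longrightarrow> \<phi> y = u y" and 2: "AE y in lborel. y \<in> \<Omega> \<longrightarrow> \<psi> y = v y"
        using \<open>P \<phi> \<psi>\<close> unfolding P_def by blast
      have "AE y in lborel. y \<in> V \<longrightarrow> \<phi>' y = u y" using eq(1) 1 by eventually_elim auto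
      moreover have "AE y in lborel. y \<in> \<Omega> \<longrightarrow> \<psi>' y = v y" using eq(2) 2 by eventually_elim auto
      ultimately show ?thesis using e unfolding P_def by blast
    qed
    have Pext: "AE y in lborel. y \<in> V \<longrightarrow> \<psi> y = \<phi> y" if P: "P \<phi> \<psi>" for \<phi> \<psi>
    proof -
      obtain u g v h where e: "extension_bounds V \<Omega> I (\<lambda>n. T n \<epsilon>) (\<lambda>n. D n - K n) (1 + C) u g v h"
        and 1: "AE y in lborel. y \<in> V \<longrightarrow> \<phi> y = u y" and 2: "AE y in lborel. y \<in> \<Omega> \<longrightarrow> \<psi> y = v y"
        using P unfolding P_def by blast
      have "AE y in lborel. y \<in> V \<longrightarrow> v y = u y" using e unfolding extension_bounds_def by blast
      then show ?thesis using 1 2 by eventually_elim (use VO in auto)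
    qed
    have PW: "\<psi> \<in> W12 \<Omega>" if "P \<phi> \<psi>" for \<phi> \<psi>
      using that weak_grad_imp_W12 unfolding P_def extension_bounds_def by blast
    have PB: "(\<forall>n\<in>{1..N \<epsilon>}.
          Lq_norm 2 (T n \<epsilon>) (wgrad \<Omega> \<psi>) \<le> ennreal (1 + C) * Lq_norm 2 (B n \<epsilon> - T n \<epsilon>) (wgrad V \<phi>)) \<and>
        Lq_norm 2 \<Omega> (wgrad \<Omega> \<psi>) \<le> ennreal (1 + C) * Lq_norm 2 V (wgrad V \<phi>) \<and>
        (\<forall>n\<in>{1..N \<epsilon>}. \<forall>q::ereal. 1 \<le> q \<longrightarrow>
          Lq_norm q (T n \<epsilon>) \<psi> \<le> ennreal (1 + C) * Lq_norm q (B n \<epsilon> - T n \<epsilon>) \<phi>)"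
      if P: "P \<phi> \<psi>" for \<phi> \<psi>
    proof -
      obtain u g v h where e: "extension_bounds V \<Omega> I (\<lambda>n. T n \<epsilon>) (\<lambda>n. D n - K n) (1 + C) u g v h"
        and 1: "AE y in lborel. y \<in> V \<longrightarrow> \<phi> y = u y" and 2: "AE y in lborel. y \<in> \<Omega> \<longrightarrow> \<psi> y = v y"
        using P unfolding P_def by blast
      have C2: "1 \<le> 1 + C" using C1 by simp
      have TL: "T n \<epsilon> \<in> sets lebesgue" if "n \<in> I" for n using Top[OF that] by simp
      have TO: "T n \<epsilon> \<subseteq> \<Omega>" if "n \<in> I" for n using Kc(2)[of n] KW[OF that] WD[of n] DO[OF that] by blast
      have AL: "D n - K n \<in> sets lebesgue" "D n - K n \<subseteq> B n \<epsilon> - T n \<epsilon>" for n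
        using opWD(2)[of n] Kc[of n] by (auto simp: D_def)
      have BL: "B n \<epsilon> - T n \<epsilon> \<in> sets lebesgue" if "n \<in> I" for n
      proof -
        have "B n \<epsilon> \<in> sets lebesgue" by (simp add: B_def)
        then show ?thesis using TL[OF that] by (rule sets.Diff)
      qed
      show ?thesis unfolding I_def[symmetric]
      proof (intro conjI ballI allI impI)
        show "Lq_norm 2 \<Omega> (wgrad \<Omega> \<psi>) \<le> ennreal (1 + C) * Lq_norm 2 V (wgrad V \<phi>)"
          by (rule extension_bounds_wgrad(1)[OF e C2 1 2])
        fix n assume n: "n \<in> I"
        show "Lq_norm 2 (T n \<epsilon>) (wgrad \<Omega> \<psi>) \<le> ennreal (1 + C) * Lq_norm 2 (B n \<epsilon> - T n \<epsilon>) (wgrad V \<phi>)"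
          using extension_bounds_wgrad(2)[where A' = "\<lambda>n. B n \<epsilon> - T n \<epsilon>", OF e C2 1 2 n] TL[OF n] TO[OF n] DKV[OF n] AL[of n] BL[OF n]
          by blast
        show "Lq_norm q (T n \<epsilon>) \<psi> \<le> ennreal (1 + C) * Lq_norm q (B n \<epsilon> - T n \<epsilon>) \<phi>" if "1 \<le> q" for q
          using extension_bounds_Lq[where A' = "\<lambda>n. B n \<epsilon> - T n \<epsilon>", OF e C2 n that _ _ _ _ _ _ 1 2]
            TL[OF n] TO[OF n] DKV[OF n] AL[of n] BL[OF n] by blast
      qed
    qed
    have P_ex: "\<exists>\<psi>. P \<phi> \<psi>" if \<phi>: "\<phi> \<in> W12 V" for \<phi>
    proof -
      obtain u g where ug: "weak_grad V u g" "L2on V u < \<infinity>" "L2on V g < \<infinity>" "AE y in lborel. y \<in> V \<longrightarrow> \<phi> y = u y"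
        using W12_imp_weak_grad[OF Vop \<phi>] by blast
      then obtain v h where e: "extension_bounds V \<Omega> I (\<lambda>n. T n \<epsilon>) (\<lambda>n. D n - K n) (1 + C) u g v h"
        using ex by blast
      have "P \<phi> v" unfolding P_def
        by (rule exI[of _ u], rule exI[of _ g], rule exI[of _ v], rule exI[of _ h]) (use e ug(4) in simp)
      then show ?thesis by blast
    qed
    have P_ex_nonneg: "\<exists>\<psi>. P \<phi> \<psi> \<and> (AE y in lborel. y \<in> \<Omega> \<longrightarrow> 0 \<le> \<psi> y)" if "\<phi> \<in> W12_nonneg V" for \<phi>
    proof -
      have \<phi>: "\<phi> \<in> W12 V" "AE y in lborel. y \<in> V \<longrightarrow> 0 \<le> \<phi> y"
        using that by (auto simp: W12_nonneg_def AE_lebesgue_on[OF VL(1)])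
      obtain u g where ug: "weak_grad V u g" "L2on V u < \<infinity>" "L2on V g < \<infinity>" "AE y in lborel. y \<in> V \<longrightarrow> \<phi> y = u y"
        using W12_imp_weak_grad[OF Vop \<phi>(1)] by blast
      then obtain v h where e: "extension_bounds V \<Omega> I (\<lambda>n. T n \<epsilon>) (\<lambda>n. D n - K n) (1 + C) u g v h"
        using ex by blast
      have "AE y in lborel. y \<in> V \<longrightarrow> 0 \<le> u y" using \<phi>(2) ug(4) by eventually_elim auto
      from extension_bounds_abs[OF e this] ug(4) have "P \<phi> (\<lambda>y. \<bar>v y\<bar>)"
        unfolding P_def by (intro exI conjI) auto
      then show ?thesis by (intro exI[of _ "\<lambda>y. \<bar>v y\<bar>"]) auto
    qed
    obtain E where E: "extension_operator V \<Omega> (W12 V) (W12 \<Omega>) E" "\<And>\<phi>. \<phi> \<in> W12 V \<Longrightarrow> P \<phi> (E \<phi>)"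
    proof (rule operator_by_choice[of "W12 V" P V \<Omega> "W12 \<Omega>"])
      show "P \<phi>' \<psi>" if "AE y in lborel. y \<in> V \<longrightarrow> \<phi> y = \<phi>' y" "P \<phi> \<psi>" for \<phi> \<phi>' \<psi>
        by (rule Pinv[OF that(2,1)]) simp
      show "P \<phi> \<psi>'" if "AE y in lborel. y \<in> \<Omega> \<longrightarrow> \<psi> y = \<psi>' y" "P \<phi> \<psi>" for \<phi> \<psi> \<psi>'
        by (rule Pinv[OF that(2) _ that(1)]) simp
    qed (use P_ex Pext PW VL in blast)+
    show "\<exists>E. extension_operator (\<Omega>p \<epsilon>) \<Omega> (W12 (\<Omega>p \<epsilon>)) (W12 \<Omega>) E \<and>
      (\<forall>\<phi>\<in>W12 (\<Omega>p \<epsilon>).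
        (\<forall>n\<in>{1..N \<epsilon>}.
          Lq_norm 2 (T n \<epsilon>) (wgrad \<Omega> (E \<phi>))
            \<le> ennreal (1 + C) * Lq_norm 2 (B n \<epsilon> - T n \<epsilon>) (wgrad (\<Omega>p \<epsilon>) \<phi>)) \<and>
        Lq_norm 2 \<Omega> (wgrad \<Omega> (E \<phi>)) \<le> ennreal (1 + C) * Lq_norm 2 (\<Omega>p \<epsilon>) (wgrad (\<Omega>p \<epsilon>) \<phi>) \<and>
        (\<forall>n\<in>{1..N \<epsilon>}. \<forall>q::ereal. 1 \<le> q \<longrightarrow>
          Lq_norm q (T n \<epsilon>) (E \<phi>) \<le> ennreal (1 + C) * Lq_norm q (B n \<epsilon> - T n \<epsilon>) \<phi>))"
      unfolding V_def[symmetric] by (intro exI[of _ E] conjI ballI E(1) PB[OF E(2)])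
    define P' where "P' \<phi> \<psi> \<longleftrightarrow> P \<phi> \<psi> \<and> (AE y in lborel. y \<in> \<Omega> \<longrightarrow> 0 \<le> \<psi> y)" for \<phi> \<psi>
    obtain F where F: "extension_operator V \<Omega> (W12_nonneg V) (W12_nonneg \<Omega>) F" "\<And>\<phi>. \<phi> \<in> W12_nonneg V \<Longrightarrow> P' \<phi> (F \<phi>)"
    proof (rule operator_by_choice[of "W12_nonneg V" P' V \<Omega> "W12_nonneg \<Omega>"])
      show "\<exists>\<psi>. P' \<phi> \<psi>" if "\<phi> \<in> W12_nonneg V" for \<phi> using P_ex_nonneg[OF that] unfolding P'_def .
      show "P' \<phi>' \<psi>" if "AE y in lborel. y \<in> V \<longrightarrow> \<phi> y = \<phi>' y" "P' \<phi> \<psi>" for \<phi> \<phi>' \<psi>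
        using Pinv[OF _ that(1), of \<psi> \<psi>] that(2) unfolding P'_def by simp
      show "P' \<phi> \<psi>'" if eq: "AE y in lborel. y \<in> \<Omega> \<longrightarrow> \<psi> y = \<psi>' y" and "P' \<phi> \<psi>" for \<phi> \<psi> \<psi>'
      proof -
        have P: "P \<phi> \<psi>" and nn: "AE y in lborel. y \<in> \<Omega> \<longrightarrow> 0 \<le> \<psi> y" using \<open>P' \<phi> \<psi>\<close> unfolding P'_def by auto
        have "P \<phi> \<psi>'" by (rule Pinv[OF P _ eq]) simp
        moreover have "AE y in lborel. y \<in> \<Omega> \<longrightarrow> 0 \<le> \<psi>' y" using nn eq by eventually_elim auto
        ultimately show ?thesis unfolding P'_def by blast
      qed
      show "\<psi> \<in> W12_nonneg \<Omega>" if "P' \<phi> \<psi>" for \<phi> \<psi>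
        using that PW unfolding P'_def W12_nonneg_def AE_lebesgue_on[OF VL(2)] by blast
      show "AE y in lborel. y \<in> V \<longrightarrow> \<psi> y = \<phi> y" if "P' \<phi> \<psi>" for \<phi> \<psi>
        using that Pext unfolding P'_def by blast
    qed (use VL in blast)+
    have PF: "P \<phi> (F \<phi>)" if "\<phi> \<in> W12_nonneg V" for \<phi> using F(2)[OF that] unfolding P'_def by blast
    show "\<exists>E. extension_operator (\<Omega>p \<epsilon>) \<Omega> (W12_nonneg (\<Omega>p \<epsilon>)) (W12_nonneg \<Omega>) E \<and>
      (\<forall>\<phi>\<in>W12_nonneg (\<Omega>p \<epsilon>).
        (\<forall>n\<in>{1..N \<epsilon>}.
          Lq_norm 2 (T n \<epsilon>) (wgrad \<Omega> (E \<phi>))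
            \<le> ennreal (1 + C) * Lq_norm 2 (B n \<epsilon> - T n \<epsilon>) (wgrad (\<Omega>p \<epsilon>) \<phi>)) \<and>
        Lq_norm 2 \<Omega> (wgrad \<Omega> (E \<phi>)) \<le> ennreal (1 + C) * Lq_norm 2 (\<Omega>p \<epsilon>) (wgrad (\<Omega>p \<epsilon>) \<phi>) \<and>
        (\<forall>n\<in>{1..N \<epsilon>}. \<forall>q::ereal. 1 \<le> q \<longrightarrow>
          Lq_norm q (T n \<epsilon>) (E \<phi>) \<le> ennreal (1 + C) * Lq_norm q (B n \<epsilon> - T n \<epsilon>) \<phi>))"
      unfolding V_def[symmetric] by (intro exI[of _ F] conjI ballI F(1) PB[OF PF])
  qed
qed

end
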